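(* For every positive integer $n$, the virtual cactus group $vC_n$ is virtually special compact; that is, $vC_n$ has a finite index subgroup that is isomorphic to the fundamental group of a compact special cube complex.
   Context: **Virtual cactus group.** Let $[n]=\{1,\dots,n\}$ and $[i,j]=\{i,i+1,\dots,j\}$ for $i<j$. Let $w_{ij}\in S_n$ be the permutation that reverses the interval $[i,j]$ and fixes all elements outside it. The cactus group $C_n$ is generated by $\{s_{ij}\mid 1\le i<j\le n\}$ with relations, for all $i<j$, $k<l$: (1) $s_{ij}^2=1$; (2) $s_{ij}s_{kl}=s_{kl}s_{ij}$ if $[i,j]\cap[k,l]=\varnothing$; (3) $s_{ij}s_{kl}=s_{w_{ij}(l)\,w_{ij}(k)}s_{ij}$ if $[k,l]\subset[i,j]$. The virtual cactus group $vC_n$ is the quotient of the free product $C_n*S_n$ by the relations $ws_{ij}w^{-1}=s_{w(i)w(j)}$ for all $1\le i<j\le n$ and all $w\in S_n$ such that $w(i+k)=w(i)+k$ for $k=0,\dots,j-i$. **Special cube complexes.** A cube complex is a space obtained from a collection of cubes $[-1,1]^k$ of various dimensions $k$ by gluing cubes along faces via isometries. A midcube of a $k$-cube is the set of its points where one fixed coordinate is $0$. Take the disjoint union of all midcubes of a cube complex $X$ and glue them according to the gluings in $X$; a hyperplane is the image in $X$ of a connected component of the resulting space. A 1-cube is dual to the midcube containing its midpoint, and dual to the hyperplane containing that midcube. The link of a 0-cube $v$ has as vertices the directed 1-cubes originating from $v$, and a finite set of vertices spans a simplex if the corresponding directed 1-cubes span the corner of a cube. A complex is flag if every finite clique spans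 a simplex. $X$ is nonpositively curved (NPC) if every link is a flag simplicial complex. Given an oriented 1-cube $\vec\epsilon$ dual to a hyperplane $H$, orient the opposite 1-cube in each 2-cube containing it in the same direction, and continue to all 1-cubes dual to $H$; $H$ is two-sided if each dual 1-cube receives a unique orientation. Hyperplanes $H_1,H_2$ intersect if they have dual 1-cubes $\epsilon_1\neq\epsilon_2$, respectively, that meet at a 0-cube and form a corner of a 2-cube. They osculate if they have oriented dual 1-cubes $\vec\epsilon_1\ne\vec\epsilon_2$, respectively, originating from the same 0-cube but not forming a corner of a 2-cube. They inter-osculate if they both intersect and osculate. A hyperplane self-intersects (self-osculates) if it intersects (osculates with) itself. A cube complex is special if it is NPC, all hyperplanes are two-sided, no hyperplane self-intersects, no hyperplane self-osculates, and no two hyperplanes inter-osculate. *)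

theory Defs
  imports "HOL-Analysis.Analysis" "HOL-Algebra.Sym_Groups"
begin

section \<open>Presented groups, free products, and the virtual cactus group\<close>

definition equiv_closure :: "('a \<times> 'a) set \<Rightarrow> ('a \<times> 'a) set" where
  "equiv_closure r = (r \<union> r\<inverse>)\<^sup>*"

definition word_cong :: "'a set \<Rightarrow> ('a list \<times> 'a list) set \<Rightarrow> ('a list \<times> 'a list) set" where
  "word_cong A R = equiv_closure
     {(u @ l @ v, u @ r @ v) | u l r v. u \<in> lists A \<and> v \<in> lists A \<and> (l, r) \<in> R}"

definition presented_monoid :: "'a set \<Rightarrow> ('a list \<times> 'a list) set \<Rightarrow> 'a list set monoid" where
  "presented_monoid A R =
    \<lparr> carrier = lists A // word_cong A R,
      mult = (\<lambda>X Y. \<Union>x\<in>X. \<Union>y\<in>Y. word_cong A R `` {x @ y}),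
      one = word_cong A R `` {[]} \<rparr>"

text \<open>The letter \<open>(s, True)\<close> stands for the generator \<open>s\<close> and \<open>(s, False)\<close> for its inverse.\<close>

definition presented_group ::
    "'g set \<Rightarrow> (('g \<times> bool) list \<times> ('g \<times> bool) list) set \<Rightarrow> ('g \<times> bool) list set monoid" where
  "presented_group S R =
     presented_monoid (S \<times> UNIV) (R \<union> {([(s, b), (s, \<not> b)], []) | s b. s \<in> S})"

definition presented_gen ::
    "'g set \<Rightarrow> (('g \<times> bool) list \<times> ('g \<times> bool) list) set \<Rightarrow> 'g \<Rightarrow> ('g \<times> bool) list set" where
  "presented_gen S R s =
     word_cong (S \<times> UNIV) (R \<union> {([(s, b), (s, \<not> b)], []) | s b. s \<in> S}) `` {[(s, True)]}"

definition free_product_rels ::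
    "('a, 'c) monoid_scheme \<Rightarrow> ('b, 'd) monoid_scheme \<Rightarrow> (('a + 'b) list \<times> ('a + 'b) list) set" where
  "free_product_rels G H =
     {([Inl x, Inl y], [Inl (x \<otimes>\<^bsub>G\<^esub> y)]) | x y. x \<in> carrier G \<and> y \<in> carrier G} \<union>
     {([Inr x, Inr y], [Inr (x \<otimes>\<^bsub>H\<^esub> y)]) | x y. x \<in> carrier H \<and> y \<in> carrier H} \<union>
     {([Inl \<one>\<^bsub>G\<^esub>], []), ([Inr \<one>\<^bsub>H\<^esub>], [])}"

definition free_product ::
    "('a, 'c) monoid_scheme \<Rightarrow> ('b, 'd) monoid_scheme \<Rightarrow> ('a + 'b) list set monoid" where
  "free_product G H = presented_monoid (carrier G <+> carrier H) (free_product_rels G H)"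

definition free_product_inl ::
    "('a, 'c) monoid_scheme \<Rightarrow> ('b, 'd) monoid_scheme \<Rightarrow> 'a \<Rightarrow> ('a + 'b) list set" where
  "free_product_inl G H x = word_cong (carrier G <+> carrier H) (free_product_rels G H) `` {[Inl x]}"

definition free_product_inr ::
    "('a, 'c) monoid_scheme \<Rightarrow> ('b, 'd) monoid_scheme \<Rightarrow> 'b \<Rightarrow> ('a + 'b) list set" where
  "free_product_inr G H y = word_cong (carrier G <+> carrier H) (free_product_rels G H) `` {[Inr y]}"

definition normal_closure :: "('a, 'c) monoid_scheme \<Rightarrow> 'a set \<Rightarrow> 'a set" where
  "normal_closure G R =
     generate G {g \<otimes>\<^bsub>G\<^esub> r \<otimes>\<^bsub>G\<^esub> inv\<^bsub>G\<^esub> g | g r. g \<in> carrier G \<and> r \<in> R}"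

definition interval_reversal :: "nat \<Rightarrow> nat \<Rightarrow> nat \<Rightarrow> nat" where
  "interval_reversal i j k = (if i \<le> k \<and> k \<le> j then i + j - k else k)"

definition cactus_gens :: "nat \<Rightarrow> (nat \<times> nat) set" where
  "cactus_gens n = {(i, j). 1 \<le> i \<and> i < j \<and> j \<le> n}"

definition cactus_letter :: "nat \<Rightarrow> nat \<Rightarrow> (nat \<times> nat) \<times> bool" where
  "cactus_letter i j = ((i, j), True)"

definition cactus_rels :: "nat \<Rightarrow> (((nat \<times> nat) \<times> bool) list \<times> ((nat \<times> nat) \<times> bool) list) set" where
  "cactus_rels n =
     {([cactus_letter i j, cactus_letter i j], []) | i j. (i, j) \<in> cactus_gens n} \<union>
     {([cactus_letter i j, cactus_letter k l], [cactus_letter k l, cactus_letter i j]) | i j k l.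
        (i, j) \<in> cactus_gens n \<and> (k, l) \<in> cactus_gens n \<and> {i..j} \<inter> {k..l} = {}} \<union>
     {([cactus_letter i j, cactus_letter k l],
       [cactus_letter (interval_reversal i j l) (interval_reversal i j k), cactus_letter i j]) | i j k l.
        (i, j) \<in> cactus_gens n \<and> (k, l) \<in> cactus_gens n \<and> {k..l} \<subseteq> {i..j}}"

definition cactus_group :: "nat \<Rightarrow> ((nat \<times> nat) \<times> bool) list set monoid" where
  "cactus_group n = presented_group (cactus_gens n) (cactus_rels n)"

definition cactus_s :: "nat \<Rightarrow> nat \<Rightarrow> nat \<Rightarrow> ((nat \<times> nat) \<times> bool) list set" where
  "cactus_s n i j = presented_gen (cactus_gens n) (cactus_rels n) (i, j)"

type_synonym cactus_free_elem = "(((nat \<times> nat) \<times> bool) list set + (nat \<Rightarrow> nat)) list set"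

definition cactus_free_sym :: "nat \<Rightarrow> cactus_free_elem monoid" where
  "cactus_free_sym n = free_product (cactus_group n) (sym_group n)"

text \<open>The relation \<open>w s\<^bsub>ij\<^esub> w\<^sup>-\<^sup>1 = s\<^bsub>w(i)w(j)\<^esub>\<close> enters as the relator
  \<open>(w s\<^bsub>ij\<^esub> w\<^sup>-\<^sup>1) s\<^bsub>w(i)w(j)\<^esub>\<^sup>-\<^sup>1\<close>.\<close>

definition virtual_cactus_relators :: "nat \<Rightarrow> cactus_free_elem set" where
  "virtual_cactus_relators n =
     (let F = cactus_free_sym n;
          \<sigma> = (\<lambda>i j. free_product_inl (cactus_group n) (sym_group n) (cactus_s n i j));
          \<tau> = free_product_inr (cactus_group n) (sym_group n)
      in {(\<tau> w \<otimes>\<^bsub>F\<^esub> \<sigma> i j \<otimes>\<^bsub>F\<^esub> inv\<^bsub>F\<^esub> (\<tau> w)) \<otimes>\<^bsub>F\<^esub> inv\<^bsub>F\<^esub> (\<sigma> (w i) (w j)) | w i j.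
            1 \<le> i \<and> i < j \<and> j \<le> n \<and> w \<in> carrier (sym_group n) \<and>
            (\<forall>k\<le>j - i. w (i + k) = w i + k)})"

definition virtual_cactus_group :: "nat \<Rightarrow> cactus_free_elem set monoid" where
  "virtual_cactus_group n =
     cactus_free_sym n Mod normal_closure (cactus_free_sym n) (virtual_cactus_relators n)"

section \<open>Quotient spaces and the fundamental group\<close>

definition quotient_topology :: "'a topology \<Rightarrow> ('a \<times> 'a) set \<Rightarrow> 'a set topology" where
  "quotient_topology T R = topology (\<lambda>U. U \<subseteq> topspace T // R \<and> openin T (\<Union>U))"

definition path_concat :: "(real \<Rightarrow> 'a) \<Rightarrow> (real \<Rightarrow> 'a) \<Rightarrow> real \<Rightarrow> 'a" where
  "path_concat p q = (\<lambda>t. if t \<le> 1/2 then p (2 * t) else q (2 * t - 1))"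

definition loops_at :: "'a topology \<Rightarrow> 'a \<Rightarrow> (real \<Rightarrow> 'a) set" where
  "loops_at T x = {p. pathin T p \<and> p 0 = x \<and> p 1 = x}"

definition loop_homotopy :: "'a topology \<Rightarrow> 'a \<Rightarrow> ((real \<Rightarrow> 'a) \<times> (real \<Rightarrow> 'a)) set" where
  "loop_homotopy T x =
     {(p, q). homotopic_with (\<lambda>r. r 0 = x \<and> r 1 = x) (top_of_set {0..1}) T p q}"

definition fundamental_group :: "'a topology \<Rightarrow> 'a \<Rightarrow> (real \<Rightarrow> 'a) set monoid" where
  "fundamental_group T x =
    \<lparr> carrier = loops_at T x // loop_homotopy T x,
      mult = (\<lambda>P Q. \<Union>p\<in>P. \<Union>q\<in>Q. loop_homotopy T x `` {path_concat p q}),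
      one = loop_homotopy T x `` {\<lambda>_. x} \<rparr>"

section \<open>Cube complexes\<close>

definition std_cube :: "nat \<Rightarrow> (nat \<Rightarrow> real) set" where
  "std_cube k = {x \<in> topspace (Euclidean_space k). \<forall>i<k. -1 \<le> x i \<and> x i \<le> 1}"

definition cube_topology :: "nat \<Rightarrow> (nat \<Rightarrow> real) topology" where
  "cube_topology k = subtopology (Euclidean_space k) (std_cube k)"

definition cube_face :: "nat \<Rightarrow> (nat \<Rightarrow> real) set \<Rightarrow> bool" where
  "cube_face k F \<longleftrightarrow>
     (\<exists>J \<sigma>. J \<subseteq> {..<k} \<and> (\<forall>i\<in>J. \<sigma> i \<in> {-1, 1}) \<and> F = {x \<in> std_cube k. \<forall>i\<in>J. x i = \<sigma> i})"

definition cube_vertices :: "nat \<Rightarrow> (nat \<Rightarrow> real) set" where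
  "cube_vertices k = {x \<in> std_cube k. \<forall>i<k. x i \<in> {-1, 1}}"

definition cube_isometry :: "nat \<Rightarrow> nat \<Rightarrow> ((nat \<Rightarrow> real) \<Rightarrow> nat \<Rightarrow> real) \<Rightarrow> bool" where
  "cube_isometry m k f \<longleftrightarrow> f ` std_cube m \<subseteq> std_cube k \<and>
     (\<forall>x\<in>std_cube m. \<forall>y\<in>std_cube m.
        L2_set (\<lambda>i. f x i - f y i) {..<k} = L2_set (\<lambda>i. x i - y i) {..<m})"

text \<open>A triple \<open>(d, f, c)\<close> in \<open>gluings\<close> glues the cube \<open>d\<close> along the isometry \<open>f\<close> onto a face of
  the cube \<open>c\<close>. The collection of cubes lists every cell of the complex exactly once: each face of
  each cube (the cube itself included) is the image of exactly one gluing. In particular no face is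
  glued to itself by a nontrivial isometry, while different faces of one cube may be glued to each
  other. The maps are fixed to be \<open>undefined\<close> outside the cube so that uniqueness makes sense.\<close>

record 'c cube_data =
  cubes :: "'c set"
  dimn :: "'c \<Rightarrow> nat"
  gluings :: "('c \<times> ((nat \<Rightarrow> real) \<Rightarrow> (nat \<Rightarrow> real)) \<times> 'c) set"

definition cube_complex :: "'c cube_data \<Rightarrow> bool" where
  "cube_complex X \<longleftrightarrow>
     (\<forall>d f c. (d, f, c) \<in> gluings X \<longrightarrow>
        d \<in> cubes X \<and> c \<in> cubes X \<and> f \<in> extensional (std_cube (dimn X d)) \<and>
        cube_isometry (dimn X d) (dimn X c) f \<and>
        cube_face (dimn X c) (f ` std_cube (dimn X d))) \<and>
     (\<forall>c\<in>cubes X. \<forall>F. cube_face (dimn X c) F \<longrightarrow>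
        (\<exists>!(d, f). (d, f, c) \<in> gluings X \<and> f ` std_cube (dimn X d) = F)) \<and>
     (\<forall>c\<in>cubes X. (c, restrict id (std_cube (dimn X c)), c) \<in> gluings X) \<and>
     (\<forall>d f c g b. (d, f, c) \<in> gluings X \<and> (c, g, b) \<in> gluings X \<longrightarrow>
        (d, compose (std_cube (dimn X d)) g f, b) \<in> gluings X)"

definition glue_rel :: "'c cube_data \<Rightarrow> (('c \<times> (nat \<Rightarrow> real)) \<times> ('c \<times> (nat \<Rightarrow> real))) set" where
  "glue_rel X = equiv_closure
     {((d, x), (c, f x)) | d f c x. (d, f, c) \<in> gluings X \<and> x \<in> std_cube (dimn X d)}"

definition realization :: "'c cube_data \<Rightarrow> ('c \<times> (nat \<Rightarrow> real)) set topology" where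
  "realization X =
     quotient_topology (sum_topology (\<lambda>c. cube_topology (dimn X c)) (cubes X)) (glue_rel X)"

subsection \<open>Directed 1-cubes, links and nonpositive curvature\<close>

text \<open>A directed 1-cube is a pair \<open>(e, p)\<close> of a 1-cube \<open>e\<close> and the endpoint \<open>p\<close> of
  \<open>[-1, 1]\<close> at which it starts. Thus a loop \<open>e\<close> yields two different directed 1-cubes originating
  from the same 0-cube.\<close>

definition directed_edges :: "'c cube_data \<Rightarrow> ('c \<times> (nat \<Rightarrow> real)) set" where
  "directed_edges X = {(e, p). e \<in> cubes X \<and> dimn X e = 1 \<and> p \<in> cube_vertices 1}"

definition antipode :: "(nat \<Rightarrow> real) \<Rightarrow> nat \<Rightarrow> real" where
  "antipode p = (\<lambda>i. - p i)"

definition zero_cubes :: "'c cube_data \<Rightarrow> 'c set" where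
  "zero_cubes X = {v \<in> cubes X. dimn X v = 0}"

definition corners_at :: "'c cube_data \<Rightarrow> 'c \<Rightarrow> ('c \<times> (nat \<Rightarrow> real)) set" where
  "corners_at X v = {(c, u). c \<in> cubes X \<and> u \<in> cube_vertices (dimn X c) \<and>
     (\<exists>f. (v, f, c) \<in> gluings X \<and> f ` std_cube (dimn X v) = {u})}"

definition edges_from :: "'c cube_data \<Rightarrow> 'c \<Rightarrow> ('c \<times> (nat \<Rightarrow> real)) set" where
  "edges_from X v = directed_edges X \<inter> corners_at X v"

text \<open>The directed 1-cubes that span the corner of the cube \<open>c\<close> at its vertex \<open>u\<close>.\<close>

definition corner_edges :: "'c cube_data \<Rightarrow> 'c \<times> (nat \<Rightarrow> real) \<Rightarrow> ('c \<times> (nat \<Rightarrow> real)) set" where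
  "corner_edges X cu =
     {(e, p) \<in> directed_edges X. \<exists>f. (e, f, fst cu) \<in> gluings X \<and> f p = snd cu}"

definition link_simplices :: "'c cube_data \<Rightarrow> 'c \<Rightarrow> ('c \<times> (nat \<Rightarrow> real)) set set" where
  "link_simplices X v = corner_edges X ` corners_at X v"

text \<open>A corner of a \<open>k\<close>-cube contributes a simplex with \<open>k\<close> vertices to the link. For the link to
  be a simplicial complex, these vertices must be distinct and different corners must not
  contribute simplices with the same vertex set (for instance, two squares glued along their
  boundaries are excluded).\<close>

definition link_simplicial :: "'c cube_data \<Rightarrow> 'c \<Rightarrow> bool" where
  "link_simplicial X v \<longleftrightarrow>
     (\<forall>(c, u)\<in>corners_at X v. card (corner_edges X (c, u)) = dimn X c) \<and>
     inj_on (corner_edges X) (corners_at X v)"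

definition link_flag :: "'c cube_data \<Rightarrow> 'c \<Rightarrow> bool" where
  "link_flag X v \<longleftrightarrow>
     (\<forall>S. finite S \<and> S \<subseteq> edges_from X v \<and>
          (\<forall>a\<in>S. \<forall>b\<in>S. a \<noteq> b \<longrightarrow> {a, b} \<in> link_simplices X v) \<longrightarrow>
        S \<in> link_simplices X v)"

definition nonpositively_curved :: "'c cube_data \<Rightarrow> bool" where
  "nonpositively_curved X \<longleftrightarrow> (\<forall>v\<in>zero_cubes X. link_simplicial X v \<and> link_flag X v)"

subsection \<open>Hyperplanes\<close>

definition midcube :: "nat \<Rightarrow> nat \<Rightarrow> (nat \<Rightarrow> real) set" where
  "midcube k i = {x \<in> std_cube k. x i = 0}"

definition midcubes :: "'c cube_data \<Rightarrow> ('c \<times> nat) set" where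
  "midcubes X = {(c, i). c \<in> cubes X \<and> i < dimn X c}"

definition midcube_glue_rel ::
    "'c cube_data \<Rightarrow> ((('c \<times> nat) \<times> (nat \<Rightarrow> real)) \<times> (('c \<times> nat) \<times> (nat \<Rightarrow> real))) set" where
  "midcube_glue_rel X = equiv_closure
     {(((d, j), x), ((c, i), f x)) | d j f c i x.
        (d, f, c) \<in> gluings X \<and> (d, j) \<in> midcubes X \<and> (c, i) \<in> midcubes X \<and>
        f ` midcube (dimn X d) j \<subseteq> midcube (dimn X c) i \<and> x \<in> midcube (dimn X d) j}"

definition midcube_space :: "'c cube_data \<Rightarrow> (('c \<times> nat) \<times> (nat \<Rightarrow> real)) set topology" where
  "midcube_space X = quotient_topology
     (sum_topology (\<lambda>(c, i). subtopology (cube_topology (dimn X c)) (midcube (dimn X c) i))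
        (midcubes X))
     (midcube_glue_rel X)"

definition image_in_complex ::
    "'c cube_data \<Rightarrow> (('c \<times> nat) \<times> (nat \<Rightarrow> real)) set set \<Rightarrow> ('c \<times> (nat \<Rightarrow> real)) set set" where
  "image_in_complex X K = {glue_rel X `` {(c, x)} | c i x. ((c, i), x) \<in> \<Union>K}"

definition hyperplanes :: "'c cube_data \<Rightarrow> ('c \<times> (nat \<Rightarrow> real)) set set set" where
  "hyperplanes X = image_in_complex X ` connected_components_of (midcube_space X)"

text \<open>The midcube containing the midpoint of a 1-cube consists of just that midpoint.\<close>

definition dual_edge :: "'c cube_data \<Rightarrow> ('c \<times> (nat \<Rightarrow> real)) set set \<Rightarrow> 'c \<Rightarrow> bool" where
  "dual_edge X H e \<longleftrightarrow> e \<in> cubes X \<and> dimn X e = 1 \<and> glue_rel X `` {(e, \<lambda>_. 0)} \<in> H"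

text \<open>Opposite 1-cubes of a 2-cube, oriented in the same direction.\<close>

definition opposite_in_square ::
    "'c cube_data \<Rightarrow> (('c \<times> (nat \<Rightarrow> real)) \<times> ('c \<times> (nat \<Rightarrow> real))) set" where
  "opposite_in_square X = {((e, p), (e', p')).
     (e, p) \<in> directed_edges X \<and> (e', p') \<in> directed_edges X \<and>
     (\<exists>c f f'. dimn X c = 2 \<and> (e, f, c) \<in> gluings X \<and> (e', f', c) \<in> gluings X \<and>
        f ` std_cube 1 \<inter> f' ` std_cube 1 = {} \<and>
        (\<forall>i. f (antipode p) i - f p i = f' (antipode p') i - f' p' i))}"

definition two_sided :: "'c cube_data \<Rightarrow> ('c \<times> (nat \<Rightarrow> real)) set set \<Rightarrow> bool" where
  "two_sided X H \<longleftrightarrow>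
     (\<forall>e p e'. (e, p) \<in> directed_edges X \<and> dual_edge X H e \<and> dual_edge X H e' \<longrightarrow>
        (\<exists>!p'. p' \<in> cube_vertices 1 \<and> ((e, p), (e', p')) \<in> equiv_closure (opposite_in_square X)))"

definition forms_square_corner ::
    "'c cube_data \<Rightarrow> 'c \<times> (nat \<Rightarrow> real) \<Rightarrow> 'c \<times> (nat \<Rightarrow> real) \<Rightarrow> bool" where
  "forms_square_corner X a b \<longleftrightarrow>
     (\<exists>c\<in>cubes X. \<exists>u\<in>cube_vertices 2. dimn X c = 2 \<and> corner_edges X (c, u) = {a, b})"

definition hyperplanes_intersect ::
    "'c cube_data \<Rightarrow> ('c \<times> (nat \<Rightarrow> real)) set set \<Rightarrow> ('c \<times> (nat \<Rightarrow> real)) set set \<Rightarrow> bool" where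
  "hyperplanes_intersect X H1 H2 \<longleftrightarrow>
     (\<exists>e1 p1 e2 p2. \<exists>v\<in>zero_cubes X. dual_edge X H1 e1 \<and> dual_edge X H2 e2 \<and> e1 \<noteq> e2 \<and>
        (e1, p1) \<in> edges_from X v \<and> (e2, p2) \<in> edges_from X v \<and>
        forms_square_corner X (e1, p1) (e2, p2))"

text \<open>The orientations of the two 1-cubes are arbitrary, so that for \<open>H1 = H2\<close> both the direct and
  the indirect form of self-osculation count; a 1-cube whose endpoints coincide osculates with
  itself.\<close>

definition hyperplanes_osculate ::
    "'c cube_data \<Rightarrow> ('c \<times> (nat \<Rightarrow> real)) set set \<Rightarrow> ('c \<times> (nat \<Rightarrow> real)) set set \<Rightarrow> bool" where
  "hyperplanes_osculate X H1 H2 \<longleftrightarrow>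
     (\<exists>a b. \<exists>v\<in>zero_cubes X. dual_edge X H1 (fst a) \<and> dual_edge X H2 (fst b) \<and> a \<noteq> b \<and>
        a \<in> edges_from X v \<and> b \<in> edges_from X v \<and> \<not> forms_square_corner X a b)"

definition special_cube_complex :: "'c cube_data \<Rightarrow> bool" where
  "special_cube_complex X \<longleftrightarrow>
     cube_complex X \<and> nonpositively_curved X \<and>
     (\<forall>H\<in>hyperplanes X. two_sided X H) \<and>
     (\<forall>H\<in>hyperplanes X. \<not> hyperplanes_intersect X H H) \<and>
     (\<forall>H\<in>hyperplanes X. \<not> hyperplanes_osculate X H H) \<and>
     (\<forall>H1\<in>hyperplanes X. \<forall>H2\<in>hyperplanes X. H1 \<noteq> H2 \<longrightarrow>
        \<not> (hyperplanes_intersect X H1 H2 \<and> hyperplanes_osculate X H1 H2))"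

section \<open>Virtually special compact groups\<close>

text \<open>A compact cube complex has finitely many cubes, so indexing the cubes by natural numbers is
  no restriction. Path-connectedness makes the fundamental group independent of the base point.\<close>

definition virtually_special_compact :: "('a, 'm) monoid_scheme \<Rightarrow> bool" where
  "virtually_special_compact G \<longleftrightarrow>
     (\<exists>H (X :: nat cube_data) x.
        subgroup H G \<and> finite (rcosets\<^bsub>G\<^esub> H) \<and>
        special_cube_complex X \<and>
        compact_space (realization X) \<and> path_connected_space (realization X) \<and>
        x \<in> topspace (realization X) \<and>
        G\<lparr>carrier := H\<rparr> \<cong> fundamental_group (realization X) x)"

end

theory Submission
  imports Defs "HOL-Algebra.Bij"
begin

text \<open>For a list \<open>a\<close> of distinct points let \<open>s\<^sub>a\<close> be the conjugate of \<open>s\<^sub>1\<^sub>k\<close> by a permutation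
  carrying \<open>1, \<dots>, k\<close> to \<open>a\<close>, and let \<open>t\<^sub>a\<close> be \<open>s\<^sub>a\<close> times the permutation that reverses \<open>a\<close>. The
  virtual cactus group is the semidirect product of the group generated by the \<open>t\<^sub>a\<close> with the symmetric
  group, and the \<open>t\<^sub>a\<close> satisfy the relations \<open>t\<^sub>a t\<^bsub>rev a\<^esub> = 1\<close>, \<open>t\<^sub>a t\<^sub>b = t\<^sub>b t\<^sub>a\<close> for disjoint lists,
  and \<open>t\<^sub>a t\<^bsub>rev b\<^esub> = t\<^sub>b t\<^bsub>a'\<^esub>\<close> if \<open>b\<close> is a segment of \<open>a\<close> and \<open>a'\<close> is \<open>a\<close> with this segment reversed.
  These have the shape of a flip around a square in which each of the two edges changes the name of the other.
  Attaching to every set of points the permutation that the reversals induce on it gives finitely many states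
  through which the names can be followed; together with the parities of the flips they are the vertices of a
  finite cube complex in which the name of an edge, pulled back to the start, is constant along its hyperplane
  and determines, with the traces of the state, which hyperplanes cross. So the complex is special.
  The product of the \<open>t\<^sub>a\<close> along an edge path is a homotopy invariant. Conversely the group acts on the
  homotopy classes of edge paths framed by a permutation, which shows that this product determines the class.
  Hence the fundamental group is the subgroup of the products along closed edge paths, and this
  subgroup has finite index because there are finitely many states and permutations.\<close>

section \<open>Flip systems and their cube complexes\<close>

text \<open>Specialness requires data that are constant along each of two hyperplanes and together
  decide whether these cross. Following names needs only one permutation for the set of points of
  each axis; those recorded for all other sets serve the labels. A flip crossing an axis moves the
  trace of its list on a subset \<open>S\<close> of its points by the very permutation recorded for
  \<open>S\<close>, so the pulled back trace stays. Contiguity of a smaller list is harder, since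
  its own label must take part: the smaller list is collapsed to one of its points in two ways,
  which is why sets differing in one point are compared. The marks keep the vertices of a cube
  distinct and give edges an orientation that parallelism preserves. For the topology the
  realization is exchanged for a set of functions on vertices, whose charts are the open stars of
  vertices. Approximation by edge paths and lifting are then local in a star and are made global by
  bisection of the unit interval. That the product along a path determines its class is not visible
  from relations; it needs an action. Generators are named by intervals and edges by lists, and the
  framing translates between them.\<close>

lemma fold_commute_past:
  assumes inv: "\<And>i z. i \<in> S \<Longrightarrow> P z \<Longrightarrow> P (f i z)"
    and comm: "\<And>i j z. i \<in> S \<Longrightarrow> j \<in> S \<Longrightarrow> P z \<Longrightarrow> f i (f j z) = f j (f i z)"
  shows "set l \<subseteq> S \<Longrightarrow> i \<in> S \<Longrightarrow> P z \<Longrightarrow> fold f l (f i z) = f i (fold f l z)"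
proof (induction l arbitrary: z)
  case (Cons a l)
  then have "fold f l (f a (f i z)) = fold f l (f i (f a z))"
    using comm[of a i z] by simp
  then show ?case
    using Cons inv[of a z] by simp
qed simp

lemma fold_invariant:
  assumes inv: "\<And>i z. i \<in> S \<Longrightarrow> P z \<Longrightarrow> P (f i z)"
  shows "set l \<subseteq> S \<Longrightarrow> P z \<Longrightarrow> P (fold f l z)"
  by (induction l arbitrary: z) (auto simp: inv)

text \<open>Induction on the length: the first letter \<open>i\<close> has an even count and so
  occurs again. It moves past the letters in between and cancels. \<open>P\<close> confines
  commutation and involution to the points where they hold.\<close>

lemma fold_even_count:
  assumes inv: "\<And>i z. i \<in> S \<Longrightarrow> P z \<Longrightarrow> P (f i z)"
    and invol: "\<And>i z. i \<in> S \<Longrightarrow> P z \<Longrightarrow> f i (f i z) = z"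
    and comm: "\<And>i j z. i \<in> S \<Longrightarrow> j \<in> S \<Longrightarrow> P z \<Longrightarrow> f i (f j z) = f j (f i z)"
  shows "set l \<subseteq> S \<Longrightarrow> P z \<Longrightarrow> (\<And>i. even (count_list l i)) \<Longrightarrow> fold f l z = z"
proof (induction "length l" arbitrary: l z rule: less_induct)
  case less
  show ?case
  proof (cases l)
    case (Cons i r)
    have "odd (count_list r i)"
      using less.prems(3)[of i] Cons by simp
    then have "i \<in> set r"
      by (metis count_list_0_iff even_zero)
    then obtain a b where r: "r = a @ i # b"
      by (meson split_list)
    have sub: "i \<in> S" "set a \<subseteq> S" "set b \<subseteq> S"
      using less.prems(1) Cons r by auto
    have "fold f l z = fold f b (f i (fold f a (f i z)))"
      by (simp add: Cons r)
    also have "\<dots> = fold f b (f i (f i (fold f a z)))"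
      using fold_commute_past[of S P f a i z] sub less.prems inv comm by simp
    also have "\<dots> = fold f (a @ b) z"
      using invol[OF sub(1) fold_invariant[of S P f a z]] sub less.prems inv by simp
    also have "\<dots> = z"
    proof (rule less.hyps)
      show "even (count_list (a @ b) j)" for j
        using less.prems(3)[of j] Cons r by (auto split: if_splits)
    qed (use less.prems Cons r in auto)
    finally show ?thesis .
  qed simp
qed

text \<open>The words \<open>l' @ rev l\<close> and \<open>rev l @ l\<close> have even counts. So
  \<open>rev l\<close> takes the result of \<open>l'\<close> back to \<open>z\<close>, and
  \<open>l\<close> leads from \<open>z\<close> to this result again.\<close>

lemma fold_parity_cong:
  assumes inv: "\<And>i z. i \<in> S \<Longrightarrow> P z \<Longrightarrow> P (f i z)"
    and invol: "\<And>i z. i \<in> S \<Longrightarrow> P z \<Longrightarrow> f i (f i z) = z"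
    and comm: "\<And>i j z. i \<in> S \<Longrightarrow> j \<in> S \<Longrightarrow> P z \<Longrightarrow> f i (f j z) = f j (f i z)"
    and l: "set l \<subseteq> S" "set l' \<subseteq> S" and z: "P z"
    and par: "\<And>i. even (count_list l i) \<longleftrightarrow> even (count_list l' i)"
  shows "fold f l z = fold f l' z"
proof -
  let ?y = "fold f l' z"
  have Py: "P ?y"
    using fold_invariant[of S P f l' z] inv l z by blast
  have "fold f (rev l) ?y = z"
    using fold_even_count[of S P f "l' @ rev l" z, OF inv invol comm] l z par by simp
  moreover have "fold f l (fold f (rev l) ?y) = ?y"
    using fold_even_count[of S P f "rev l @ l" ?y, OF inv invol comm] l Py by simp
  ultimately show ?thesis by simp
qed

text \<open>Any order serves, since the flips to which it is applied commute.\<close>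

definition enum_set :: "'a set \<Rightarrow> 'a list" where
  "enum_set D = (SOME l. distinct l \<and> set l = D)"

lemma enum_set: "finite D \<Longrightarrow> distinct (enum_set D) \<and> set (enum_set D) = D"
  unfolding enum_set_def by (rule someI_ex) (metis finite_distinct_list)

lemma even_count_enum_set: "finite D \<Longrightarrow> even (count_list (enum_set D) i) \<longleftrightarrow> i \<notin> D"
proof -
  have "distinct l \<Longrightarrow> count_list l i = (if i \<in> set l then 1 else 0)" for l
    by (induction l) auto
  then show "finite D \<Longrightarrow> even (count_list (enum_set D) i) \<longleftrightarrow> i \<notin> D"
    using enum_set[of D] by simp
qed

text \<open>The vertices of a cube complex, with an edge from \<open>v\<close> to \<open>flip i v\<close> for every axis \<open>i\<close>; pairwise
  orthogonal axes at \<open>v\<close> span a cube. The mark \<open>mk v\<close> is the set of axes flipped an odd number of times,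
  which distinguishes the vertices of a cube.\<close>

locale flip_system =
  fixes V :: "'v set" and I :: "'i set" and flip :: "'i \<Rightarrow> 'v \<Rightarrow> 'v"
    and mk :: "'v \<Rightarrow> 'i set" and ort :: "'v \<Rightarrow> 'i \<Rightarrow> 'i \<Rightarrow> bool"
  assumes finite_V: "finite V" and finite_I: "finite I"
    and flip_in: "\<And>i v. i \<in> I \<Longrightarrow> v \<in> V \<Longrightarrow> flip i v \<in> V"
    and flip_flip: "\<And>i v. i \<in> I \<Longrightarrow> v \<in> V \<Longrightarrow> flip i (flip i v) = v"
    and mk_flip: "\<And>i v. i \<in> I \<Longrightarrow> v \<in> V \<Longrightarrow> mk (flip i v) = sym_diff (mk v) {i}"
    and mk_sub: "\<And>v. v \<in> V \<Longrightarrow> mk v \<subseteq> I"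
    and ort_sym: "\<And>v i j. ort v i j \<Longrightarrow> ort v j i"
    and ort_irrefl: "\<And>v i. \<not> ort v i i"
    and ort_comm: "\<And>v i j. v \<in> V \<Longrightarrow> i \<in> I \<Longrightarrow> j \<in> I \<Longrightarrow> ort v i j
      \<Longrightarrow> flip i (flip j v) = flip j (flip i v)"
    and ort_flip: "\<And>v i j. v \<in> V \<Longrightarrow> i \<in> I \<Longrightarrow> j \<in> I \<Longrightarrow> ort v i j \<Longrightarrow> ort (flip i v) i j"
    and ort_flip_other: "\<And>v i j k. v \<in> V \<Longrightarrow> i \<in> I \<Longrightarrow> j \<in> I \<Longrightarrow> k \<in> I \<Longrightarrow>
      ort v i j \<Longrightarrow> ort v i k \<Longrightarrow> ort v j k \<Longrightarrow> ort (flip k v) i j"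
begin

definition clique :: "'v \<Rightarrow> 'i set \<Rightarrow> bool" where
  "clique v S \<longleftrightarrow> S \<subseteq> I \<and> (\<forall>i\<in>S. \<forall>j\<in>S. i \<noteq> j \<longrightarrow> ort v i j)"

lemma clique_sub: "clique v S \<Longrightarrow> S \<subseteq> I" and clique_finite: "clique v S \<Longrightarrow> finite S"
  using finite_I by (auto simp: clique_def intro: finite_subset)

lemma clique_mono: "clique v S \<Longrightarrow> D \<subseteq> S \<Longrightarrow> clique v D"
  by (auto simp: clique_def)

lemma clique_empty [simp]: "clique v {}"
  by (simp add: clique_def)

lemma clique_single [simp]: "clique v {i} \<longleftrightarrow> i \<in> I"
  by (simp add: clique_def)

lemma clique_pair: "i \<noteq> j \<Longrightarrow> clique v {i, j} \<longleftrightarrow> i \<in> I \<and> j \<in> I \<and> ort v i j"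
  using ort_sym by (auto simp: clique_def)

text \<open>This is what \<open>ort_flip\<close> and \<open>ort_flip_other\<close> are made for:
  axes that span a cube at one of its vertices span one at the neighbouring vertices, hence at all
  of them.\<close>

lemma clique_flip:
  assumes "v \<in> V" "clique v S" "i \<in> S" shows "clique (flip i v) S"
  unfolding clique_def
proof (intro conjI ballI impI)
  fix j k assume jk: "j \<in> S" "k \<in> S" "j \<noteq> k"
  show "ort (flip i v) j k"
    using assms jk ort_flip ort_flip_other ort_sym unfolding clique_def
    by (metis subsetD)
qed (use assms in \<open>auto simp: clique_def\<close>)

abbreviation walk :: "'i list \<Rightarrow> 'v \<Rightarrow> 'v" where
  "walk \<equiv> fold flip"

lemma walk_in: "set l \<subseteq> I \<Longrightarrow> v \<in> V \<Longrightarrow> walk l v \<in> V"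
  by (induction l arbitrary: v) (auto simp: flip_in)

lemma walk_clique: "set l \<subseteq> S \<Longrightarrow> v \<in> V \<Longrightarrow> clique v S \<Longrightarrow> clique (walk l v) S"
proof (induction l arbitrary: v)
  case (Cons i l)
  then show ?case
    using clique_flip[of v S i] flip_in[of i v] clique_sub by auto
qed simp

lemma walk_mk: "set l \<subseteq> I \<Longrightarrow> v \<in> V \<Longrightarrow> mk (walk l v) = {i. (i \<in> mk v) \<noteq> odd (count_list l i)}"
  by (induction l arbitrary: v) (auto simp: mk_flip flip_in)

text \<open>Inside the cube spanned by \<open>S\<close> the flips are commuting involutions, and
  being a clique survives each of them, so it can be part of the invariant of the fold.\<close>

lemma walk_parity:
  assumes v: "v \<in> V" "clique v S" and "set l \<subseteq> S" "set l' \<subseteq> S"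
    and par: "\<And>i. even (count_list l i) \<longleftrightarrow> even (count_list l' i)"
  shows "walk l v = walk l' v"
proof (rule fold_parity_cong[where P = "\<lambda>z. z \<in> V \<and> clique z S" and S = S])
  show "flip i (flip j z) = flip j (flip i z)" if "i \<in> S" "j \<in> S" "z \<in> V \<and> clique z S" for i j z
    using that ort_comm[of z i j] clique_sub by (cases "i = j") (auto simp: clique_def)
  show "flip i (flip i z) = z" if "i \<in> S" "z \<in> V \<and> clique z S" for i z
    using that flip_flip clique_sub by blast
  show "flip i z \<in> V \<and> clique (flip i z) S" if "i \<in> S" "z \<in> V \<and> clique z S" for i z
    using that flip_in clique_flip clique_sub by blast
qed (use assms in auto)

definition flips :: "'i set \<Rightarrow> 'v \<Rightarrow> 'v" where
  "flips D = walk (enum_set D)"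

lemma walk_eq_flips:
  assumes v: "v \<in> V" "clique v S" and l: "set l \<subseteq> S" and D: "D = {i. odd (count_list l i)}"
  shows "walk l v = flips D v" and "D \<subseteq> S"
proof -
  show sub: "D \<subseteq> S"
    using l D by (auto, metis count_list_0_iff even_zero subsetD)
  then have fin: "finite D"
    using clique_finite[OF v(2)] finite_subset by blast
  show "walk l v = flips D v"
    unfolding flips_def
    using walk_parity[OF v l] enum_set[OF fin] sub even_count_enum_set[OF fin] D by blast
qed

lemma flips_in: "D \<subseteq> I \<Longrightarrow> v \<in> V \<Longrightarrow> flips D v \<in> V"
  unfolding flips_def using walk_in enum_set[of D] finite_I finite_subset by metis

lemma mk_flips: "D \<subseteq> I \<Longrightarrow> v \<in> V \<Longrightarrow> mk (flips D v) = sym_diff (mk v) D"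
  unfolding flips_def
  using walk_mk[of "enum_set D" v] enum_set[of D] even_count_enum_set[of D] finite_subset[OF _ finite_I]
  by auto

lemma clique_flips: "D \<subseteq> S \<Longrightarrow> v \<in> V \<Longrightarrow> clique v S \<Longrightarrow> clique (flips D v) S"
  unfolding flips_def using walk_clique enum_set[of D] clique_finite finite_subset by metis

lemma flips_empty [simp]: "flips {} v = v"
proof -
  have "enum_set {} = ([] :: 'i list)"
    using enum_set[of "{} :: 'i set"] by simp
  then show ?thesis by (simp add: flips_def)
qed

lemma flips_single [simp]: "flips {i} v = flip i v"
proof -
  have "distinct (enum_set {i}) \<and> set (enum_set {i}) = {i}"
    using enum_set[of "{i}"] by simp
  then have "enum_set {i} = [i]"
    by (cases "enum_set {i}" rule: remdups_adj.cases) auto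
  then show ?thesis by (simp add: flips_def)
qed

lemma flips_flips:
  assumes "v \<in> V" "clique v S" "D \<subseteq> S" "E \<subseteq> S"
  shows "flips D (flips E v) = flips (sym_diff D E) v"
proof -
  have fin: "finite D" "finite E"
    using assms clique_finite finite_subset by blast+
  have "flips D (flips E v) = walk (enum_set E @ enum_set D) v"
    by (simp add: flips_def)
  also have "\<dots> = flips (sym_diff D E) v"
    by (rule walk_eq_flips(1)[OF assms(1,2)])
      (use enum_set[OF fin(1)] enum_set[OF fin(2)] assms even_count_enum_set[OF fin(1)]
        even_count_enum_set[OF fin(2)] in auto)
  finally show ?thesis .
qed

lemma flips_flip:
  assumes "v \<in> V" "clique v S" "D \<subseteq> S" "i \<in> S"
  shows "flips (sym_diff D {i}) (flip i v) = flips D v"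
proof -
  have "flips (sym_diff D {i}) (flips {i} v) = flips (sym_diff (sym_diff D {i}) {i}) v"
    by (rule flips_flips) (use assms in auto)
  moreover have "sym_diff (sym_diff D {i}) {i} = D"
    by blast
  ultimately show ?thesis by simp
qed

text \<open>Vertices of a common cube. The marks leave only one candidate for the set of axes
  between them.\<close>

definition joined :: "'v \<Rightarrow> 'v \<Rightarrow> bool" where
  "joined v w \<longleftrightarrow> clique v (sym_diff (mk v) (mk w)) \<and> flips (sym_diff (mk v) (mk w)) v = w"

text \<open>A point with coordinates \<open>y\<close> in a cube at \<open>v\<close> is encoded by its multiaffine weights at the
  vertices of the cube. This makes the realization a subset of a function space, and \<open>odds\<close> recovers
  the coordinates seen from any vertex of the cube.\<close>

definition weight :: "'v \<Rightarrow> ('i \<Rightarrow> real) \<Rightarrow> 'v \<Rightarrow> real" where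
  "weight v y w = (if joined v w
     then (\<Prod>i\<in>I. if i \<in> sym_diff (mk v) (mk w) then y i else 1 - y i) else 0)"

definition coords :: "'v \<Rightarrow> ('i \<Rightarrow> real) set" where
  "coords v = {y. (\<forall>i. 0 \<le> y i \<and> y i \<le> 1) \<and> clique v {i. y i \<noteq> 0}}"

definition model :: "('v \<Rightarrow> real) set" where
  "model = {weight v y | v y. v \<in> V \<and> y \<in> coords v}"

definition odds :: "('v \<Rightarrow> real) \<Rightarrow> 'v \<Rightarrow> 'i \<Rightarrow> real" where
  "odds f v i = (if i \<in> I then f (flip i v) / (f v + f (flip i v)) else 0)"

lemma joined_refl [simp]: "joined v v"
  by (simp add: joined_def)

lemma joined_flips:
  assumes "v \<in> V" "clique v D" shows "joined v (flips D v)"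
proof -
  have "sym_diff (mk v) (mk (flips D v)) = D"
    using mk_flips[OF clique_sub[OF assms(2)] assms(1)] by blast
  then show ?thesis using assms by (simp add: joined_def)
qed

lemma joined_flip: "v \<in> V \<Longrightarrow> i \<in> I \<Longrightarrow> joined v (flip i v)"
  using joined_flips[of v "{i}"] by simp

lemma joined_in: "joined v w \<Longrightarrow> v \<in> V \<Longrightarrow> w \<in> V"
  by (metis joined_def flips_in clique_sub)

lemma coords_bounds: "y \<in> coords v \<Longrightarrow> 0 \<le> y i" "y \<in> coords v \<Longrightarrow> y i \<le> 1"
  and coords_clique: "y \<in> coords v \<Longrightarrow> clique v {i. y i \<noteq> 0}"
  by (auto simp: coords_def)

lemma weight_nonneg: "y \<in> coords v \<Longrightarrow> 0 \<le> weight v y w"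
  by (auto simp: weight_def coords_def intro!: prod_nonneg)

lemma weight_nonzero_sub:
  assumes "weight v y w \<noteq> 0" "v \<in> V"
  shows "joined v w" and "sym_diff (mk v) (mk w) \<subseteq> {i. y i \<noteq> 0}"
    and "\<And>i. i \<in> I \<Longrightarrow> i \<notin> sym_diff (mk v) (mk w) \<Longrightarrow> y i \<noteq> 1"
proof -
  show j: "joined v w"
    using assms by (auto simp: weight_def split: if_splits)
  then have nz: "\<forall>i\<in>I. (if i \<in> sym_diff (mk v) (mk w) then y i else 1 - y i) \<noteq> 0"
    using assms finite_I by (simp add: weight_def)
  have "sym_diff (mk v) (mk w) \<subseteq> I"
    using j clique_sub by (auto simp: joined_def)
  with nz show "sym_diff (mk v) (mk w) \<subseteq> {i. y i \<noteq> 0}"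
    by (metis (mono_tags, lifting) mem_Collect_eq subsetD subsetI)
  show "y i \<noteq> 1" if "i \<in> I" "i \<notin> sym_diff (mk v) (mk w)" for i
    using nz that by auto
qed

lemma joined_rebase:
  assumes "v \<in> V" "clique v S" "i \<in> S" "sym_diff (mk v) (mk w) \<subseteq> S" "w \<in> V"
  shows "joined (flip i v) w \<longleftrightarrow> joined v w"
proof -
  have i: "i \<in> I"
    using assms clique_sub by auto
  have eq: "sym_diff (mk (flip i v)) (mk w) = sym_diff (sym_diff (mk v) (mk w)) {i}"
    using mk_flip[OF i assms(1)] by blast
  have c1: "clique (flip i v) S"
    using clique_flip assms by blast
  have c2: "clique (flip i v) (sym_diff (sym_diff (mk v) (mk w)) {i})"
    by (rule clique_mono[OF c1]) (use assms in auto)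
  have c3: "clique v (sym_diff (mk v) (mk w))"
    using clique_mono assms by blast
  show ?thesis
    unfolding joined_def eq using c2 c3 flips_flip[OF assms(1,2,4,3)] by simp
qed

text \<open>Seen from the neighbour, the mark difference gains or loses \<open>i\<close>, so the
  factor at \<open>i\<close> exchanges \<open>y i\<close> with \<open>1 - y i\<close> while all
  other factors stay. This change of charts underlies every comparison of weights at different
  vertices.\<close>

lemma weight_rebase:
  assumes v: "v \<in> V" and S: "clique v S" "{j. y j \<noteq> 0} \<subseteq> S" and i: "i \<in> S"
  shows "weight v y = weight (flip i v) (y(i := 1 - y i))"
proof
  fix w
  let ?u = "flip i v" and ?y' = "y(i := 1 - y i)"
  let ?D = "sym_diff (mk v) (mk w)" and ?D' = "sym_diff (mk ?u) (mk w)"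
  have iI: "i \<in> I"
    using i S clique_sub by blast
  have eq: "?D' = sym_diff ?D {i}"
    using mk_flip[OF iI v] by blast
  have pr: "(\<Prod>j\<in>I. if j \<in> ?D then y j else 1 - y j) = (\<Prod>j\<in>I. if j \<in> ?D' then ?y' j else 1 - ?y' j)"
    by (rule prod.cong) (auto simp: eq)
  \<comment> \<open>If the mark difference leaves \<open>S\<close>, both weights vanish, because
    both supports lie in \<open>S\<close>. Inside \<open>S\<close> it does not matter from which of
    the two vertices \<open>joined\<close> is tested.\<close>
  consider (out) "\<not> (?D \<subseteq> S)" | (V) "w \<notin> V" | (ok) "?D \<subseteq> S" "w \<in> V" by blast
  then show "weight v y w = weight ?u ?y' w"
  proof cases
    case out
    have "weight v y w = 0"
      using weight_nonzero_sub(2)[of v y w] v out S by blast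
    moreover have "weight ?u ?y' w = 0"
    proof (rule ccontr)
      assume a: "weight ?u ?y' w \<noteq> 0"
      then have "?D' \<subseteq> {j. ?y' j \<noteq> 0}"
        using weight_nonzero_sub(2)[of ?u ?y' w] flip_in[OF iI v] by blast
      then have "?D' \<subseteq> S"
        using S i by (auto split: if_splits)
      then show False using out eq i by auto
    qed
    ultimately show ?thesis by simp
  next
    case V
    then have "\<not> joined v w" "\<not> joined ?u w"
      using joined_in v flip_in[OF iI v] by blast+
    then show ?thesis by (simp add: weight_def)
  next
    case ok
    show ?thesis
      unfolding weight_def pr using joined_rebase[OF v S(1) i ok] by simp
  qed
qed

lemma coords_rebase:
  assumes v: "v \<in> V" and y: "y \<in> coords v" and S: "clique v S" "{j. y j \<noteq> 0} \<subseteq> S" "i \<in> S"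
  shows "y(i := 1 - y i) \<in> coords (flip i v)"
proof -
  have "clique (flip i v) {j. (y(i := 1 - y i)) j \<noteq> 0}"
    by (rule clique_mono[OF clique_flip[OF v S(1,3)]]) (use S in \<open>auto split: if_splits\<close>)
  then show ?thesis using y by (auto simp: coords_def)
qed

lemma model_nonneg: "f \<in> model \<Longrightarrow> 0 \<le> f v"
  by (auto simp: model_def weight_nonneg)

lemma model_outside: "f \<in> model \<Longrightarrow> v \<notin> V \<Longrightarrow> f v = 0"
  by (auto simp: model_def weight_def dest: joined_in)

lemma weight_base: "weight v y v = (\<Prod>i\<in>I. 1 - y i)"
  by (simp add: weight_def)

text \<open>Induction on the number of marks in which \<open>u\<close> and \<open>v\<close> differ:
  rebasing along one of these axes brings the base vertex closer. Once it has arrived, a nonzero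
  weight at the base forces every coordinate below 1.\<close>

lemma model_chart_ex:
  assumes "v \<in> V" "u \<in> V" "y \<in> coords u" "weight u y v \<noteq> 0"
  shows "\<exists>y'\<in>coords v. (\<forall>i. y' i < 1) \<and> weight u y = weight v y'"
  using assms
proof (induction "card (sym_diff (mk u) (mk v))" arbitrary: u y rule: less_induct)
  case less
  let ?D = "sym_diff (mk u) (mk v)"
  note nz = weight_nonzero_sub[OF less.prems(4) less.prems(2)]
  show ?case
  proof (cases "?D = {}")
    case True
    then have "u = v"
      using nz(1) by (auto simp: joined_def)
    moreover have "y i < 1" for i
    proof (cases "i \<in> I")
      case i: True
      with nz(3)[of i] True have "y i \<noteq> 1" by blast
      then show ?thesis using coords_bounds(2)[OF less.prems(3), of i] by simp
    next
      case False
      then have "y i = 0"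
        using coords_clique[OF less.prems(3)] clique_sub by blast
      then show ?thesis by simp
    qed
    ultimately show ?thesis using less.prems by blast
  next
    case False
    then obtain i where i: "i \<in> ?D" by blast
    let ?S = "{j. y j \<noteq> 0}"
    have S: "clique u ?S" and iS: "i \<in> ?S" and iI: "i \<in> I"
      using coords_clique[OF less.prems(3)] nz(2) i clique_sub by blast+
    have eq: "weight u y = weight (flip i u) (y(i := 1 - y i))"
      using weight_rebase[OF less.prems(2) S _ iS] by blast
    have D: "sym_diff (mk (flip i u)) (mk v) = ?D - {i}"
      using mk_flip[OF iI less.prems(2)] i by blast
    have "finite ?D"
      using mk_sub less.prems finite_I by (meson Diff_subset Un_least finite_subset subset_trans)
    then have "card (sym_diff (mk (flip i u)) (mk v)) < card ?D"
      unfolding D using i by (intro psubset_card_mono) auto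
    then show ?thesis
      using less.hyps[of "flip i u" "y(i := 1 - y i)"] less.prems flip_in[OF iI]
        coords_rebase[OF less.prems(2,3) S _ iS] eq by auto
  qed
qed

text \<open>The weights at \<open>v\<close> and at \<open>flip i v\<close> are
  \<open>1 - y i\<close> and \<open>y i\<close> times the same product \<open>?P\<close> over the
  other axes. Since all coordinates are below 1, \<open>?P\<close> is positive and drops out of the
  quotient.\<close>

lemma odds_weight:
  assumes v: "v \<in> V" and y: "y \<in> coords v" "\<forall>i. y i < 1"
  shows "odds (weight v y) v = y"
proof
  fix i
  show "odds (weight v y) v i = y i"
  proof (cases "i \<in> I")
    case True
    let ?P = "\<Prod>j\<in>I - {i}. 1 - y j"
    have P: "?P > 0"
      using y by (intro prod_pos) auto
    have D: "sym_diff (mk v) (mk (flip i v)) = {i}"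
      using mk_flip[OF True v] by blast
    have "weight v y v = (1 - y i) * ?P"
      unfolding weight_base using True finite_I by (simp add: prod.remove)
    moreover have "weight v y (flip i v) = y i * ?P"
      unfolding weight_def D using joined_flip[OF v True] True finite_I
      by (simp add: prod.remove[of I i] cong: prod.cong) (auto intro!: prod.cong)
    ultimately have "weight v y v + weight v y (flip i v) = ?P" "weight v y (flip i v) = y i * ?P"
      by (auto simp: algebra_simps)
    then show ?thesis
      using P True by (simp add: odds_def)
  next
    case False
    then have "y i = 0"
      using coords_clique[OF y(1)] clique_sub by blast
    then show ?thesis using False by (simp add: odds_def)
  qed
qed

text \<open>A nonzero value at \<open>v\<close> means that the point lies in the open star of
  \<open>v\<close>; there \<open>odds\<close> gives the coordinates of a chart.\<close>

lemma model_chart: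
  assumes f: "f \<in> model" and v: "f v \<noteq> 0"
  shows "v \<in> V" and "odds f v \<in> coords v" and "odds f v i < 1" and "weight v (odds f v) = f"
proof -
  show vV: "v \<in> V"
    using model_outside f v by blast
  obtain y where "y \<in> coords v" "\<forall>i. y i < 1" "f = weight v y"
    using f v model_chart_ex[OF vV] unfolding model_def by blast
  then show "odds f v \<in> coords v" "odds f v i < 1" "weight v (odds f v) = f"
    using odds_weight[OF vV] by auto
qed

lemma model_support:
  assumes f: "f \<in> model" and "f v \<noteq> 0" "f w \<noteq> 0"
  shows "joined v w" and "sym_diff (mk v) (mk w) \<subseteq> {i. odds f v i \<noteq> 0}"
    and "clique v {i. odds f v i \<noteq> 0}"
  using weight_nonzero_sub(1,2)[of v "odds f v" w] model_chart[OF f assms(2)] assms(3) coords_clique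
  by auto

text \<open>Coordinates in the support are nonzero and all coordinates are below 1, so no factor of
  the weight vanishes, whichever of these axes are flipped.\<close>

lemma model_support_flips:
  assumes f: "f \<in> model" and "f v \<noteq> 0" "D \<subseteq> {i. odds f v i \<noteq> 0}"
  shows "f (flips D v) \<noteq> 0"
proof -
  note c = model_chart[OF f assms(2)]
  have cD: "clique v D"
    using clique_mono coords_clique c(2) assms(3) by blast
  have D: "sym_diff (mk v) (mk (flips D v)) = D"
    using mk_flips[OF clique_sub[OF cD] c(1)] by blast
  have "weight v (odds f v) (flips D v) \<noteq> 0"
    unfolding weight_def D using joined_flips[OF c(1) cD] finite_I assms(3) less_imp_neq[OF c(3)]
    by auto
  then show ?thesis using c(4) by simp
qed

end

section \<open>Edge paths\<close>

text \<open>The straight-line homotopy in the convex domain, pushed forward by \<open>h\<close>. For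
  an interval it gives the unit, inverse and subdivision laws of paths, for a square the homotopies
  across 2-cells.\<close>

lemma homotopic_paths_convex_image:
  fixes h :: "'a::real_normed_vector \<Rightarrow> 'b::topological_space"
  assumes "convex S" "continuous_on S h" "h ` S \<subseteq> T" "path a" "path b"
    "path_image a \<subseteq> S" "path_image b \<subseteq> S" "pathstart a = pathstart b" "pathfinish a = pathfinish b"
  shows "homotopic_paths T (h \<circ> a) (h \<circ> b)"
proof (rule homotopic_paths_continuous_image)
  show "homotopic_paths S a b"
  proof (rule homotopic_paths_linear)
    show "closed_segment (a t) (b t) \<subseteq> S" if "t \<in> {0..1}" for t
    proof -
      have "a t \<in> S" "b t \<in> S"
        using that assms by (auto simp: path_image_def)
      then show ?thesis
        using closed_segment_subset assms(1) by blast
    qed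
  qed (use assms in auto)
qed (use assms in auto)

definition path_between :: "'a::topological_space set \<Rightarrow> 'a \<Rightarrow> 'a \<Rightarrow> (real \<Rightarrow> 'a) \<Rightarrow> bool" where
  "path_between T x y p \<longleftrightarrow> path p \<and> path_image p \<subseteq> T \<and> pathstart p = x \<and> pathfinish p = y"

lemma path_between_join:
  "path_between T x y p \<Longrightarrow> path_between T y z q \<Longrightarrow> path_between T x z (p +++ q)"
  by (auto simp: path_between_def subset_path_image_join)

lemma path_between_const [simp]: "path_between T x y (\<lambda>_. z) \<longleftrightarrow> z \<in> T \<and> x = z \<and> y = z"
  by (auto simp: path_between_def path_def path_image_def pathstart_def pathfinish_def)

lemma path_between_refl: "path_between T x y p \<Longrightarrow> homotopic_paths T p p"
  by (simp add: path_between_def)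

lemma homotopic_join_cong:
  assumes "homotopic_paths T p p'" "homotopic_paths T q q'"
    and "path_between T x y p" "path_between T y z q"
  shows "homotopic_paths T (p +++ q) (p' +++ q')"
  using assms by (auto simp: path_between_def intro: homotopic_paths_join)

lemma homotopic_join_assoc:
  assumes "path_between T x y p" "path_between T y z q" "path_between T z w r"
  shows "homotopic_paths T ((p +++ q) +++ r) (p +++ (q +++ r))"
  using assms by (auto simp: path_between_def intro!: homotopic_paths_sym[OF homotopic_paths_assoc])

lemma homotopic_reparam:
  assumes "path_between T x y p" "path a" "path b" "path_image a \<subseteq> {0..1}" "path_image b \<subseteq> {0..1}"
    "pathstart a = pathstart b" "pathfinish a = pathfinish b"
  shows "homotopic_paths T (p \<circ> a) (p \<circ> b)"
  by (rule homotopic_paths_convex_image[of "{0..1::real}"])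
    (use assms in \<open>auto simp: path_between_def path_def path_image_def\<close>)

lemma path_id: "path (id :: real \<Rightarrow> real)" "path_image (id :: real \<Rightarrow> real) = {0..1}"
  "pathstart (id :: real \<Rightarrow> real) = 0" "pathfinish (id :: real \<Rightarrow> real) = 1"
  by (auto simp: path_def path_image_def pathstart_def pathfinish_def)

lemma path_const_real: "path (\<lambda>_. c :: real)" "path_image (\<lambda>_. c :: real) = {c}"
  "pathstart (\<lambda>_. c :: real) = c" "pathfinish (\<lambda>_. c :: real) = c"
  by (auto simp: path_def path_image_def pathstart_def pathfinish_def)

lemma homotopic_join_const_right:
  assumes "path_between T x y p" shows "homotopic_paths T (p +++ (\<lambda>_. y)) p"
proof -
  have "homotopic_paths T (p \<circ> (id +++ (\<lambda>_. 1))) (p \<circ> id)"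
    by (rule homotopic_reparam[OF assms])
      (simp_all add: path_id path_const_real subset_path_image_join)
  moreover have "p 1 = y"
    using assms by (auto simp: path_between_def pathfinish_def)
  ultimately show ?thesis
    unfolding path_compose_join by (simp add: o_def)
qed

lemma homotopic_join_const_left:
  assumes "path_between T x y p" shows "homotopic_paths T ((\<lambda>_. x) +++ p) p"
proof -
  have "homotopic_paths T (p \<circ> ((\<lambda>_. 0) +++ id)) (p \<circ> id)"
    by (rule homotopic_reparam[OF assms])
      (simp_all add: path_id path_const_real subset_path_image_join)
  moreover have "p 0 = x"
    using assms by (auto simp: path_between_def pathstart_def)
  ultimately show ?thesis
    unfolding path_compose_join by (simp add: o_def)
qed

lemma homotopic_join_reverse:
  assumes "path_between T x y p" shows "homotopic_paths T (p +++ reversepath p) (\<lambda>_. x)"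
proof -
  have "homotopic_paths T (p \<circ> (id +++ reversepath id)) (p \<circ> (\<lambda>_. 0))"
    by (rule homotopic_reparam[OF assms])
      (simp_all add: path_id path_const_real subset_path_image_join)
  moreover have "p 0 = x"
    using assms by (auto simp: path_between_def pathstart_def)
  moreover have "p \<circ> reversepath id = reversepath p"
    by (auto simp: reversepath_def)
  ultimately show ?thesis
    unfolding path_compose_join by (simp add: o_def)
qed

lemma path_between_reverse: "path_between T x y p \<Longrightarrow> path_between T y x (reversepath p)"
  by (simp add: path_between_def)

definition piece :: "real \<Rightarrow> real \<Rightarrow> (real \<Rightarrow> 'a) \<Rightarrow> real \<Rightarrow> 'a" where
  "piece a b p = (\<lambda>t. p (a + t * (b - a)))"

lemma affine_in_interval: "a \<le> b \<Longrightarrow> 0 \<le> t \<Longrightarrow> t \<le> 1 \<Longrightarrow> a + t * (b - a) \<in> {a..b::real}"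
  using mult_left_le_one_le[of "b - a" t] mult_nonneg_nonneg[of t "b - a"] by auto

lemma piece_between:
  assumes "path_between T x y p" "0 \<le> a" "a \<le> b" "b \<le> 1"
  shows "path_between T (p a) (p b) (piece a b p)"
proof -
  have sub: "(\<lambda>t. a + t * (b - a)) ` {0..1} \<subseteq> {0..1}"
    using affine_in_interval[of a b] assms by fastforce
  have "continuous_on {0..1} (p \<circ> (\<lambda>t. a + t * (b - a)))"
    by (rule continuous_on_compose[OF _ continuous_on_subset[OF _ sub]])
      (use assms in \<open>auto simp: path_between_def path_def intro!: continuous_intros\<close>)
  then show ?thesis
    using assms sub unfolding path_between_def piece_def
    by (auto simp: path_def path_image_def pathstart_def pathfinish_def o_def)
qed

lemma piece_join:
  assumes "path_between T x y p" "0 \<le> a" "a \<le> b" "b \<le> c" "c \<le> 1"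
  shows "homotopic_paths T (piece a b p +++ piece b c p) (piece a c p)"
proof -
  let ?l = "\<lambda>a b t::real. a + t * (b - a)"
  have l: "path (?l a b)" "pathstart (?l a b) = a" "pathfinish (?l a b) = b" for a b
    by (auto simp: path_def pathstart_def pathfinish_def intro!: continuous_intros)
  have im: "path_image (?l a b) \<subseteq> {0..1}" if "0 \<le> a" "a \<le> b" "b \<le> 1" for a b
    using affine_in_interval[of a b] that by (fastforce simp: path_image_def)
  have "homotopic_paths T (p \<circ> (?l a b +++ ?l b c)) (p \<circ> ?l a c)"
    by (rule homotopic_reparam[OF assms(1)])
      (use assms im[of a b] im[of b c] im[of a c] in \<open>simp_all add: l subset_path_image_join\<close>)
  then show ?thesis
    unfolding path_compose_join by (simp add: piece_def o_def)
qed

text \<open>The two ways around the boundary are homotopic in the convex square. A side on which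
  \<open>h\<close> is constant turns this into a statement about triangles, which is how it is used
  for rays.\<close>

lemma homotopic_square:
  fixes h :: "real \<times> real \<Rightarrow> 'b::topological_space"
  assumes h: "continuous_on ({0..1} \<times> {0..1}) h" "h ` ({0..1} \<times> {0..1}) \<subseteq> T"
  shows "homotopic_paths T ((\<lambda>s. h (s, 0)) +++ (\<lambda>t. h (1, t))) ((\<lambda>t. h (0, t)) +++ (\<lambda>s. h (s, 1)))"
proof -
  let ?a = "(\<lambda>s. (s, 0)) +++ (\<lambda>t. (1, t)) :: real \<Rightarrow> real \<times> real"
  let ?b = "(\<lambda>t. (0, t)) +++ (\<lambda>s. (s, 1)) :: real \<Rightarrow> real \<times> real"
  have "homotopic_paths T (h \<circ> ?a) (h \<circ> ?b)"
  proof (rule homotopic_paths_convex_image[OF _ h])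
    show "convex ({0..1::real} \<times> {0..1::real})"
      by (simp add: convex_Times)
    have "path (\<lambda>s::real. (s, c::real))" "path (\<lambda>t::real. (c::real, t))" for c
      by (auto intro!: continuous_intros simp: path_def)
    then show "path ?a" "path ?b"
      by (auto intro!: path_join_imp simp: pathstart_def pathfinish_def)
    show "path_image ?a \<subseteq> {0..1} \<times> {0..1}" "path_image ?b \<subseteq> {0..1} \<times> {0..1}"
      by (rule subset_path_image_join; force simp: path_image_def)+
  qed (auto simp: pathstart_def pathfinish_def joinpaths_def)
  then show ?thesis
    unfolding path_compose_join by (simp add: o_def)
qed

context flip_system begin

lemma continuous_on_weight:
  assumes "\<And>i. i \<in> I \<Longrightarrow> continuous_on X (\<lambda>x. y x i)"
  shows "continuous_on X (\<lambda>x. weight v (y x))"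
proof (rule continuous_on_coordinatewise_then_product)
  fix w
  have "continuous_on X (\<lambda>x. \<Prod>i\<in>I. if i \<in> sym_diff (mk v) (mk w) then y x i else 1 - y x i)"
  proof (rule continuous_on_prod)
    fix i assume "i \<in> I"
    then show "continuous_on X (\<lambda>x. if i \<in> sym_diff (mk v) (mk w) then y x i else 1 - y x i)"
      using assms by (cases "i \<in> sym_diff (mk v) (mk w)") (auto intro!: continuous_intros)
  qed
  then show "continuous_on X (\<lambda>x. weight v (y x) w)"
    by (cases "joined v w") (auto simp: weight_def)
qed

lemma continuous_on_eval: "continuous_on X p \<Longrightarrow> continuous_on X (\<lambda>x. p x w)"
  by (rule continuous_on_product_then_coordinatewise)

lemma continuous_on_odds:
  assumes "continuous_on X p" "\<And>x. x \<in> X \<Longrightarrow> p x \<in> model \<and> p x u \<noteq> 0"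
  shows "continuous_on X (\<lambda>x. odds (p x) u i)"
proof (cases "i \<in> I")
  case True
  have "p x u + p x (flip i u) \<noteq> 0" if "x \<in> X" for x
    using assms(2)[OF that] model_nonneg[of "p x" u] model_nonneg[of "p x" "flip i u"] by linarith
  moreover have "continuous_on X (\<lambda>x. p x w)" for w
    by (rule continuous_on_eval[OF assms(1)])
  ultimately show ?thesis
    using True unfolding odds_def by (simp add: continuous_on_divide continuous_on_add)
qed (simp add: odds_def)

abbreviation vertex :: "'v \<Rightarrow> 'v \<Rightarrow> real" where
  "vertex v \<equiv> weight v (\<lambda>_. 0)"

definition edge :: "'v \<Rightarrow> 'i \<Rightarrow> real \<Rightarrow> 'v \<Rightarrow> real" where
  "edge v i = (\<lambda>t. weight v (\<lambda>j. if j = i then t else 0))"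

text \<open>The straight segment from the vertex to \<open>f\<close> in the chart on the open star
  of \<open>v\<close>.\<close>

definition ray :: "'v \<Rightarrow> ('v \<Rightarrow> real) \<Rightarrow> real \<Rightarrow> 'v \<Rightarrow> real" where
  "ray v f = (\<lambda>t. weight v (\<lambda>i. t * odds f v i))"

fun edge_path :: "'v \<Rightarrow> 'i list \<Rightarrow> real \<Rightarrow> 'v \<Rightarrow> real" where
  "edge_path v [] = (\<lambda>_. vertex v)"
| "edge_path v (i # l) = edge v i +++ edge_path (flip i v) l"

lemma weight_in_model: "v \<in> V \<Longrightarrow> y \<in> coords v \<Longrightarrow> weight v y \<in> model"
  by (auto simp: model_def)

lemma vertex_in_model: "v \<in> V \<Longrightarrow> vertex v \<in> model"
  by (auto simp: weight_in_model coords_def)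

lemma vertex_apply: "v \<in> V \<Longrightarrow> vertex v w = (if w = v then 1 else 0)"
proof -
  assume v: "v \<in> V"
  have "vertex v w = 0" if "w \<noteq> v"
  proof (rule ccontr)
    assume "vertex v w \<noteq> 0"
    from weight_nonzero_sub[OF this v] have "joined v w" "sym_diff (mk v) (mk w) = {}"
      by auto
    then show False using that by (auto simp: joined_def)
  qed
  then show ?thesis by (auto simp: weight_base)
qed

lemma rebase_single:
  assumes v: "v \<in> V" "i \<in> I"
  shows "weight (flip i v) (\<lambda>j. if j = i then t else 0) = weight v (\<lambda>j. if j = i then 1 - t else 0)"
proof -
  let ?y = "\<lambda>j. if j = i then 1 - t else 0"
  have "weight v ?y = weight (flip i v) (?y(i := 1 - ?y i))"
    by (rule weight_rebase[of v "{i}"]) (use v in auto)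
  also have "?y(i := 1 - ?y i) = (\<lambda>j. if j = i then t else 0)"
    by auto
  finally show ?thesis by (rule sym)
qed

lemma continuous_on_if_const:
  "continuous_on X (\<lambda>t. if b then f t else g t)" if "continuous_on X f" "continuous_on X g"
  using that by (cases b) auto

lemma edge_between:
  assumes v: "v \<in> V" "i \<in> I"
  shows "path_between model (vertex v) (vertex (flip i v)) (edge v i)"
proof -
  have "weight v (\<lambda>j. if j = i then t else 0) \<in> model" if "0 \<le> t" "t \<le> 1" for t
    using that v by (intro weight_in_model) (auto simp: coords_def clique_def split: if_splits)
  then have "path_image (edge v i) \<subseteq> model"
    by (auto simp: edge_def path_image_def)
  moreover have "pathfinish (edge v i) = vertex (flip i v)"
    using rebase_single[OF v, of 0, unfolded diff_0_right if_cancel]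
    by (simp add: edge_def pathfinish_def)
  moreover have "pathstart (edge v i) = vertex v"
    by (simp add: edge_def pathstart_def)
  moreover have "path (edge v i)"
    unfolding edge_def path_def
    by (rule continuous_on_weight, rule continuous_on_if_const) (auto intro: continuous_intros)
  ultimately show ?thesis
    by (simp add: path_between_def)
qed

lemma edge_reverse:
  assumes v: "v \<in> V" "i \<in> I"
  shows "edge (flip i v) i = reversepath (edge v i)"
  using rebase_single[OF v] by (auto simp: edge_def reversepath_def)

lemma edge_path_between:
  "v \<in> V \<Longrightarrow> set l \<subseteq> I \<Longrightarrow> path_between model (vertex v) (vertex (walk l v)) (edge_path v l)"
  by (induction l arbitrary: v)
    (auto simp: vertex_in_model flip_in intro!: path_between_join edge_between)

lemma edge_path_append:
  assumes "v \<in> V" "set l \<subseteq> I" "set k \<subseteq> I"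
  shows "homotopic_paths model (edge_path v (l @ k)) (edge_path v l +++ edge_path (walk l v) k)"
  using assms
proof (induction l arbitrary: v)
  case Nil
  then show ?case
    using homotopic_paths_sym[OF homotopic_join_const_left[OF edge_path_between[of v k]]] by simp
next
  case (Cons i l)
  then have i: "i \<in> I" "flip i v \<in> V" "set l \<subseteq> I" by (auto simp: flip_in)
  note b = edge_between[OF Cons.prems(1) i(1)] edge_path_between[OF i(2,3)]
  have "homotopic_paths model (edge v i +++ edge_path (flip i v) (l @ k))
     (edge v i +++ (edge_path (flip i v) l +++ edge_path (walk l (flip i v)) k))"
    using homotopic_join_cong[OF path_between_refl[OF b(1)] Cons.IH[OF i(2,3)] b(1)]
      edge_path_between[OF i(2), of "l @ k"] i Cons.prems by simp
  also have "homotopic_paths model \<dots>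
      ((edge v i +++ edge_path (flip i v) l) +++ edge_path (walk l (flip i v)) k)"
    by (rule homotopic_paths_sym[OF homotopic_join_assoc[OF b edge_path_between]])
      (use walk_in i Cons.prems in auto)
  finally show ?case by simp
qed

lemma edge_backtrack:
  assumes "v \<in> V" "i \<in> I"
  shows "homotopic_paths model (edge v i +++ edge (flip i v) i) (\<lambda>_. vertex v)"
  unfolding edge_reverse[OF assms] by (rule homotopic_join_reverse[OF edge_between[OF assms]])

text \<open>\<open>h\<close> parametrizes the 2-cell by its coordinates at \<open>v\<close>. The two
  sides at \<open>v\<close> are edges outright; the far sides become edges after rebasing along
  \<open>i\<close> or \<open>j\<close>.\<close>

lemma edge_square:
  assumes v: "v \<in> V" and ij: "i \<in> I" "j \<in> I" and o: "ort v i j"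
  shows "homotopic_paths model (edge v i +++ edge (flip i v) j) (edge v j +++ edge (flip j v) i)"
proof -
  have ne: "i \<noteq> j" using o ort_irrefl by blast
  have cl: "clique v {i, j}" using ne ij o by (simp add: clique_pair)
  define y where "y = (\<lambda>z::real \<times> real. \<lambda>k. if k = i then fst z else if k = j then snd z else 0)"
  define h where "h z = weight v (y z)" for z
  have y: "y z \<in> coords v" if "z \<in> {0..1} \<times> {0..1}" for z
    using that by (auto simp: coords_def y_def intro!: clique_mono[OF cl])
  have "continuous_on ({0..1} \<times> {0..1}) h"
    unfolding h_def
  proof (rule continuous_on_weight)
    fix k show "continuous_on ({0..1} \<times> {0..1}) (\<lambda>x. y x k)"
      unfolding y_def by (cases "k = i"; cases "k = j") (auto intro!: continuous_intros)
  qed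
  moreover have "h ` ({0..1} \<times> {0..1}) \<subseteq> model"
    using y v by (auto simp: h_def weight_in_model)
  ultimately have *: "homotopic_paths model ((\<lambda>s. h (s, 0)) +++ (\<lambda>t. h (1, t)))
      ((\<lambda>t. h (0, t)) +++ (\<lambda>s. h (s, 1)))"
    by (rule homotopic_square)
  have sub: "{k. y z k \<noteq> 0} \<subseteq> {i, j}" for z
    by (auto simp: y_def)
  have "y (s, 0) = (\<lambda>k. if k = i then s else 0)" "y (0, t) = (\<lambda>k. if k = j then t else 0)" for s t
    using ne by (auto simp: y_def)
  then have "(\<lambda>s. h (s, 0)) = edge v i" "(\<lambda>t. h (0, t)) = edge v j"
    by (simp_all add: h_def edge_def)
  moreover have "(y (1, t))(i := 1 - y (1, t) i) = (\<lambda>k. if k = j then t else 0)" for t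
    using ne by (auto simp: y_def)
  then have "(\<lambda>t. h (1, t)) = edge (flip i v) j"
    using weight_rebase[OF v cl sub, of i] by (simp add: h_def edge_def)
  moreover have "(y (s, 1))(j := 1 - y (s, 1) j) = (\<lambda>k. if k = i then s else 0)" for s
    using ne by (auto simp: y_def)
  then have "(\<lambda>s. h (s, 1)) = edge (flip j v) i"
    using weight_rebase[OF v cl sub, of j] by (simp add: h_def edge_def)
  ultimately show ?thesis
    using * by simp
qed

end

lemma path_between_in: "path_between T x y p \<Longrightarrow> 0 \<le> t \<Longrightarrow> t \<le> 1 \<Longrightarrow> p t \<in> T"
  by (auto simp: path_between_def path_image_def)

section \<open>Homotopy of paths to edge paths\<close>

context flip_system begin

lemma model_support_nonempty:
  assumes "f \<in> model" obtains v where "f v \<noteq> 0"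
proof -
  obtain v y where v: "v \<in> V" and y: "y \<in> coords v" and f: "f = weight v y"
    using assms by (auto simp: model_def)
  \<comment> \<open>Flipping exactly the coordinates that equal 1 leads to a vertex where each
    factor of the weight is either 1 or a nonzero \<open>1 - y i\<close>.\<close>
  let ?D = "{i. y i = 1}"
  have c: "clique v ?D"
    by (rule clique_mono[OF coords_clique[OF y]]) auto
  have D: "sym_diff (mk v) (mk (flips ?D v)) = ?D"
    using mk_flips[OF clique_sub[OF c] v] by blast
  have "weight v y (flips ?D v) \<noteq> 0"
    unfolding weight_def D using joined_flips[OF v c] finite_I by auto
  then show ?thesis using that f by blast
qed

lemma coords_scale:
  assumes "y \<in> coords v" "0 \<le> t" "t \<le> 1" shows "(\<lambda>i. t * y i) \<in> coords v"
  unfolding coords_def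
proof (intro CollectI conjI allI)
  show "clique v {i. t * y i \<noteq> 0}"
    by (rule clique_mono[OF coords_clique[OF assms(1)]]) auto
  show "0 \<le> t * y i" "t * y i \<le> 1" for i
    using coords_bounds[OF assms(1), of i] assms by (auto simp: mult_le_one)
qed

lemma odds_flip:
  assumes f: "f \<in> model" and v: "f v \<noteq> 0" and i: "odds f v i \<noteq> 0"
  shows "f (flip i v) \<noteq> 0" and "odds f (flip i v) = (odds f v)(i := 1 - odds f v i)"
proof -
  note c = model_chart[OF f v]
  let ?S = "{j. odds f v j \<noteq> 0}" and ?y = "(odds f v)(i := 1 - odds f v i)"
  have S: "clique v ?S" "i \<in> ?S" and iI: "i \<in> I"
    using coords_clique[OF c(2)] i clique_sub by auto
  show "f (flip i v) \<noteq> 0"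
    using model_support_flips[OF f v, of "{i}"] i by simp
  have "odds (weight (flip i v) ?y) (flip i v) = ?y"
  proof (rule odds_weight)
    show "?y \<in> coords (flip i v)"
      by (rule coords_rebase[OF c(1,2) S(1) _ S(2)]) simp
    have "0 < odds f v i"
      using coords_bounds(1)[OF c(2), of i] i by simp
    then show "\<forall>j. ?y j < 1"
      using c(3) by simp
  qed (use flip_in iI c in auto)
  moreover have "weight (flip i v) ?y = f"
    using weight_rebase[OF c(1) S(1) _ S(2)] c(4) by simp
  ultimately show "odds f (flip i v) = ?y" by simp
qed

lemma ray_between:
  assumes f: "f \<in> model" and v: "f v \<noteq> 0"
  shows "path_between model (vertex v) f (ray v f)"
proof -
  note c = model_chart[OF f v]
  have "path_image (ray v f) \<subseteq> model"
    using weight_in_model[OF c(1) coords_scale[OF c(2)]] by (auto simp: ray_def path_image_def)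
  moreover have "path (ray v f)"
    unfolding path_def ray_def by (rule continuous_on_weight) (auto intro!: continuous_intros)
  ultimately show ?thesis
    using c(4) by (simp add: path_between_def pathstart_def pathfinish_def ray_def)
qed

lemma ray_triangle:
  assumes f: "f \<in> model" and v: "f v \<noteq> 0" and i: "odds f v i \<noteq> 0"
  shows "homotopic_paths model (ray v f) (edge v i +++ ray (flip i v) f)"
proof -
  note c = model_chart[OF f v]
  let ?S = "{j. odds f v j \<noteq> 0}"
  have S: "clique v ?S" "i \<in> ?S" and iI: "i \<in> I"
    using coords_clique[OF c(2)] i clique_sub by auto
  \<comment> \<open>The square is mapped onto the triangle with corners \<open>v\<close>,
    \<open>flip i v\<close> and \<open>f\<close> in the chart at \<open>v\<close>: the side with
    \<open>snd z = 0\<close> is the edge, those with \<open>fst z = 0\<close> and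
    \<open>fst z = 1\<close> are the two rays, and the side with \<open>snd z = 1\<close> collapses
    to \<open>f\<close>.\<close>
  define y where "y = (\<lambda>z::real \<times> real. \<lambda>k.
    if k = i then (1 - snd z) * fst z + snd z * odds f v i else snd z * odds f v k)"
  define h where "h z = weight v (y z)" for z
  have sub: "{k. y z k \<noteq> 0} \<subseteq> ?S" for z
    using i by (auto simp: y_def)
  have bnd: "0 \<le> odds f v k" "odds f v k \<le> 1" for k
    using coords_bounds[OF c(2)] by auto
  have y: "y z \<in> coords v" if z: "z \<in> {0..1} \<times> {0..1}" for z
  proof -
    obtain s t where st: "z = (s, t)" "0 \<le> s" "s \<le> 1" "0 \<le> t" "t \<le> 1"
      using z by auto
    have "(1 - t) * s + t * odds f v i \<le> (1 - t) * 1 + t * 1"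
      using st bnd by (intro add_mono mult_left_mono) auto
    then have "0 \<le> y z k" "y z k \<le> 1" for k
      using st bnd by (auto simp: y_def mult_le_one)
    then show ?thesis
      using clique_mono[OF S(1) sub] by (simp add: coords_def)
  qed
  have "continuous_on ({0..1} \<times> {0..1}) h"
    unfolding h_def
  proof (rule continuous_on_weight)
    fix k show "continuous_on ({0..1} \<times> {0..1}) (\<lambda>x. y x k)"
      unfolding y_def by (cases "k = i") (auto intro!: continuous_intros)
  qed
  moreover have "h ` ({0..1} \<times> {0..1}) \<subseteq> model"
    using y c(1) by (auto simp: h_def weight_in_model)
  ultimately have *: "homotopic_paths model ((\<lambda>s. h (s, 0)) +++ (\<lambda>t. h (1, t)))
      ((\<lambda>t. h (0, t)) +++ (\<lambda>s. h (s, 1)))"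
    by (rule homotopic_square)
  have "y (s, 0) = (\<lambda>k. if k = i then s else 0)" "y (0, t) = (\<lambda>k. t * odds f v k)"
     "y (s, 1) = odds f v" for s t
    by (auto simp: y_def)
  then have "(\<lambda>s. h (s, 0)) = edge v i" "(\<lambda>t. h (0, t)) = ray v f" "(\<lambda>s. h (s, 1)) = (\<lambda>_. f)"
    using c(4) by (simp_all add: h_def edge_def ray_def)
  moreover have "(y (1, t))(i := 1 - y (1, t) i) = (\<lambda>k. t * odds f (flip i v) k)" for t
    by (auto simp: y_def odds_flip(2)[OF assms] algebra_simps)
  then have "(\<lambda>t. h (1, t)) = ray (flip i v) f"
    using weight_rebase[OF c(1) S(1) sub S(2)] by (simp add: h_def ray_def)
  ultimately have "homotopic_paths model (edge v i +++ ray (flip i v) f) (ray v f +++ (\<lambda>_. f))"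
    using * by simp
  moreover have "homotopic_paths model (ray v f +++ (\<lambda>_. f)) (ray v f)"
    by (rule homotopic_join_const_right[OF ray_between[OF f v]])
  ultimately show ?thesis
    using homotopic_paths_sym homotopic_paths_trans by blast
qed

text \<open>One triangle per letter. As the coordinate in question lies strictly between 0 and 1, it
  stays nonzero after the flip, so the remaining letters are still in the support.\<close>

lemma ray_walk:
  assumes "f \<in> model" "f v \<noteq> 0" "set l \<subseteq> {i. odds f v i \<noteq> 0}"
  shows "f (walk l v) \<noteq> 0 \<and> homotopic_paths model (ray v f) (edge_path v l +++ ray (walk l v) f)"
  using assms
proof (induction l arbitrary: v)
  case Nil
  then show ?case
    using homotopic_paths_sym[OF homotopic_join_const_left[OF ray_between[of f v]]] by simp
next
  case (Cons i l)
  note c = model_chart[OF Cons.prems(1,2)]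
  have i: "odds f v i \<noteq> 0" "i \<in> I"
    using Cons.prems(3) by (auto simp: odds_def split: if_splits)
  have lI: "set l \<subseteq> I"
    using Cons.prems(3) by (auto simp: odds_def split: if_splits)
  note o = odds_flip[OF Cons.prems(1,2) i(1)]
  have "set l \<subseteq> {j. odds f (flip i v) j \<noteq> 0}"
    using Cons.prems(3) c(3)[of i] by (auto simp: o(2))
  note IH = Cons.IH[OF Cons.prems(1) o(1) this]
  let ?u = "flip i v"
  have u: "?u \<in> V" using c(1) i flip_in by blast
  note b = edge_between[OF c(1) i(2)] edge_path_between[OF u lI] ray_between[OF Cons.prems(1), of "walk l ?u"]
  have "homotopic_paths model (ray v f) (edge v i +++ ray ?u f)"
    by (rule ray_triangle[OF Cons.prems(1,2) i(1)])
  also have "homotopic_paths model \<dots> (edge v i +++ (edge_path ?u l +++ ray (walk l ?u) f))"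
    using IH homotopic_join_cong[OF path_between_refl[OF b(1)] _ b(1) ray_between[OF Cons.prems(1) o(1)]]
    by blast
  also have "homotopic_paths model \<dots> ((edge v i +++ edge_path ?u l) +++ ray (walk l ?u) f)"
    using homotopic_paths_sym[OF homotopic_join_assoc[OF b]] IH by blast
  finally show ?case using IH by simp
qed

lemma ray_change:
  assumes f: "f \<in> model" "f v \<noteq> 0" "f w \<noteq> 0"
  obtains l where "set l \<subseteq> I" "walk l v = w"
    "homotopic_paths model (ray v f) (edge_path v l +++ ray w f)"
proof -
  note s = model_support[OF assms]
  let ?D = "sym_diff (mk v) (mk w)"
  have e: "set (enum_set ?D) = ?D"
    using enum_set s(1) clique_finite unfolding joined_def by blast
  have w: "walk (enum_set ?D) v = w"
    using s(1) by (simp add: joined_def flips_def)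
  have "?D \<subseteq> I"
    using s(1) clique_sub unfolding joined_def by blast
  moreover have "homotopic_paths model (ray v f) (edge_path v (enum_set ?D) +++ ray w f)"
    using ray_walk[OF f(1,2), of "enum_set ?D"] s(2) unfolding e w by blast
  ultimately show ?thesis
    using that[OF _ w] e by blast
qed

text \<open>While the path stays in the open star of \<open>u\<close>, its coordinates there vary
  continuously. Scaling them by \<open>s\<close> gives a square whose side at \<open>s = 0\<close>
  is constant at the vertex and whose side at \<open>s = 1\<close> is the path.\<close>

lemma ray_contract:
  assumes p: "path_between model x y p" and u: "\<And>t. 0 \<le> t \<Longrightarrow> t \<le> 1 \<Longrightarrow> p t u \<noteq> 0"
  shows "homotopic_paths model (ray u x +++ p) (ray u y)"
proof -
  have m: "p t \<in> model" if "0 \<le> t" "t \<le> 1" for t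
    using p that by (auto simp: path_between_def path_image_def)
  note c = model_chart[OF m u]
  have xy: "p 0 = x" "p 1 = y"
    using p by (auto simp: path_between_def pathstart_def pathfinish_def)
  have uV: "u \<in> V" using c(1)[of 0] by simp
  define h where "h z = weight u (\<lambda>i. fst z * odds (p (snd z)) u i)" for z
  have cp: "continuous_on {0..1} p"
    using p by (simp add: path_between_def path_def)
  have "continuous_on {0..1} (\<lambda>t. odds (p t) u i)" for i
    by (rule continuous_on_odds[OF cp]) (use m u in auto)
  then have "continuous_on ({0..1} \<times> {0..1}) (\<lambda>z. odds (p (snd z)) u i)" for i
    by (rule continuous_on_compose2[of _ "\<lambda>t. odds (p t) u i" _ snd]) (auto intro!: continuous_intros)
  then have "continuous_on ({0..1} \<times> {0..1}) h"
    unfolding h_def by (intro continuous_on_weight continuous_intros)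
  moreover have "h ` ({0..1} \<times> {0..1}) \<subseteq> model"
    using weight_in_model[OF uV coords_scale[OF c(2)]] by (auto simp: h_def)
  ultimately have *: "homotopic_paths model ((\<lambda>s. h (s, 0)) +++ (\<lambda>t. h (1, t)))
      ((\<lambda>t. h (0, t)) +++ (\<lambda>s. h (s, 1)))"
    by (rule homotopic_square)
  have "(\<lambda>s. h (s, 0)) = ray u x" "(\<lambda>s. h (s, 1)) = ray u y" "(\<lambda>t. h (0, t)) = (\<lambda>_. vertex u)"
    using xy by (simp_all add: h_def ray_def)
  with * have 1: "homotopic_paths model (ray u x +++ (\<lambda>t. h (1, t))) ((\<lambda>_. vertex u) +++ ray u y)"
    by simp
  have 2: "homotopic_paths model p (\<lambda>t. h (1, t))"
    by (rule homotopic_paths_eq) (use p c(4) in \<open>auto simp: path_between_def h_def\<close>)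
  have rx: "path_between model (vertex u) x (ray u x)"
    using ray_between[OF m[of 0] u[of 0]] xy by simp
  have "homotopic_paths model (ray u x +++ p) (ray u x +++ (\<lambda>t. h (1, t)))"
    by (rule homotopic_join_cong[OF path_between_refl[OF rx] 2 rx p])
  moreover have "homotopic_paths model ((\<lambda>_. vertex u) +++ ray u y) (ray u y)"
    by (rule homotopic_join_const_left) (use ray_between[OF m[of 1] u[of 1]] xy in simp)
  ultimately show ?thesis
    using 1 homotopic_paths_trans by blast
qed

text \<open>The property that is glued along a subdivision of the path; the rays lead from the end points to
  vertices of the cubes that contain them.\<close>

definition edgelike :: "(real \<Rightarrow> 'v \<Rightarrow> real) \<Rightarrow> real \<Rightarrow> real \<Rightarrow> bool" where
  "edgelike p a b \<longleftrightarrow> (\<forall>v w. p a v \<noteq> 0 \<longrightarrow> p b w \<noteq> 0 \<longrightarrow>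
     (\<exists>l. set l \<subseteq> I \<and> walk l v = w \<and>
       homotopic_paths model (ray v (p a) +++ piece a b p) (edge_path v l +++ ray w (p b))))"

lemma edgelikeD:
  assumes "edgelike p a b" "p a v \<noteq> 0" "p b w \<noteq> 0"
  shows "\<exists>l. set l \<subseteq> I \<and> walk l v = w \<and>
       homotopic_paths model (ray v (p a) +++ piece a b p) (edge_path v l +++ ray w (p b))"
  using assms by (simp add: edgelike_def)

text \<open>\<open>edgelike\<close> quantifies over the vertices at both ends, so one vertex
  \<open>u\<close> of the support at time \<open>b\<close> can be chosen for both halves. The ray
  from \<open>u\<close> ends the first half and begins the second, and the two edge words are
  appended.\<close>

lemma edgelike_trans:
  assumes p: "path_between model x y p" and abc: "0 \<le> a" "a \<le> b" "b \<le> c" "c \<le> 1"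
    and 1: "edgelike p a b" and 2: "edgelike p b c"
  shows "edgelike p a c"
  unfolding edgelike_def
proof (intro allI impI)
  fix v w assume v: "p a v \<noteq> 0" and w: "p c w \<noteq> 0"
  have m: "p t \<in> model" if "0 \<le> t" "t \<le> 1" for t
    using p that by (auto simp: path_between_def path_image_def)
  have ma: "p a \<in> model" and mb: "p b \<in> model" and mc: "p c \<in> model"
    using m abc by auto
  obtain u where u: "p b u \<noteq> 0"
    using model_support_nonempty mb by blast
  obtain l where l: "set l \<subseteq> I" "walk l v = u"
      "homotopic_paths model (ray v (p a) +++ piece a b p) (edge_path v l +++ ray u (p b))"
    using edgelikeD[OF 1 v u] by blast
  obtain k where k: "set k \<subseteq> I" "walk k u = w"
      "homotopic_paths model (ray u (p b) +++ piece b c p) (edge_path u k +++ ray w (p c))"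
    using edgelikeD[OF 2 u w] by blast
  have vV: "v \<in> V" and uV: "u \<in> V"
    using model_chart(1) ma mb v u by auto
  note ra = ray_between[OF ma v] and rb = ray_between[OF mb u] and rc = ray_between[OF mc w]
  have el: "path_between model (vertex v) (vertex u) (edge_path v l)"
    and ek: "path_between model (vertex u) (vertex w) (edge_path u k)"
    using edge_path_between[OF vV l(1)] edge_path_between[OF uV k(1)] l k by auto
  have pab: "path_between model (p a) (p b) (piece a b p)" and pbc: "path_between model (p b) (p c) (piece b c p)"
    using piece_between[OF p] abc by auto
  have pac: "path_between model (p a) (p c) (piece a c p)"
    using piece_between[OF p] abc by auto
  have "homotopic_paths model (ray v (p a) +++ piece a c p) (ray v (p a) +++ (piece a b p +++ piece b c p))"
    by (rule homotopic_join_cong[OF path_between_refl[OF ra] homotopic_paths_sym[OF piece_join[OF p abc]] ra pac])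
  also have "homotopic_paths model \<dots> ((ray v (p a) +++ piece a b p) +++ piece b c p)"
    by (rule homotopic_paths_sym[OF homotopic_join_assoc[OF ra pab pbc]])
  also have "homotopic_paths model \<dots> ((edge_path v l +++ ray u (p b)) +++ piece b c p)"
    by (rule homotopic_join_cong[OF l(3) path_between_refl[OF pbc] path_between_join[OF ra pab] pbc])
  also have "homotopic_paths model \<dots> (edge_path v l +++ (ray u (p b) +++ piece b c p))"
    by (rule homotopic_join_assoc[OF el rb pbc])
  also have "homotopic_paths model \<dots> (edge_path v l +++ (edge_path u k +++ ray w (p c)))"
    by (rule homotopic_join_cong[OF path_between_refl[OF el] k(3) el path_between_join[OF rb pbc]])
  also have "homotopic_paths model \<dots> ((edge_path v l +++ edge_path u k) +++ ray w (p c))"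
    by (rule homotopic_paths_sym[OF homotopic_join_assoc[OF el ek rc]])
  also have "homotopic_paths model \<dots> (edge_path v (l @ k) +++ ray w (p c))"
    by (rule homotopic_join_cong[OF _ path_between_refl[OF rc] path_between_join[OF el ek] rc])
      (use homotopic_paths_sym[OF edge_path_append[OF vV l(1) k(1)]] l(2) in simp)
  finally show "\<exists>l. set l \<subseteq> I \<and> walk l v = w \<and>
       homotopic_paths model (ray v (p a) +++ piece a c p) (edge_path v l +++ ray w (p c))"
    using l k by (intro exI[of _ "l @ k"]) auto
qed

text \<open>The whole piece lies in the open star of \<open>u\<close>: edges lead from
  \<open>v\<close> to \<open>u\<close>, the piece is absorbed into a ray at \<open>u\<close>, and
  edges lead on from \<open>u\<close> to \<open>w\<close>.\<close>

lemma edgelike_local: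
  assumes p: "path_between model x y p" and ab: "0 \<le> a" "a \<le> b" "b \<le> 1"
    and u: "\<And>t. a \<le> t \<Longrightarrow> t \<le> b \<Longrightarrow> p t u \<noteq> 0"
  shows "edgelike p a b"
  unfolding edgelike_def
proof (intro allI impI)
  fix v w assume v: "p a v \<noteq> 0" and w: "p b w \<noteq> 0"
  have ma: "p a \<in> model" and mb: "p b \<in> model"
    using path_between_in[OF p] ab by auto
  have ua: "p a u \<noteq> 0" and ub: "p b u \<noteq> 0"
    using u ab by auto
  obtain l where l: "set l \<subseteq> I" "walk l v = u"
      "homotopic_paths model (ray v (p a)) (edge_path v l +++ ray u (p a))"
    using ray_change[OF ma v ua] by blast
  obtain k where k: "set k \<subseteq> I" "walk k u = w"
      "homotopic_paths model (ray u (p b)) (edge_path u k +++ ray w (p b))"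
    using ray_change[OF mb ub w] by blast
  have vV: "v \<in> V" and uV: "u \<in> V"
    using model_chart(1) ma mb v ub by auto
  note ra = ray_between[OF ma v] and rua = ray_between[OF ma ua] and rub = ray_between[OF mb ub]
    and rw = ray_between[OF mb w]
  have el: "path_between model (vertex v) (vertex u) (edge_path v l)"
    and ek: "path_between model (vertex u) (vertex w) (edge_path u k)"
    using edge_path_between[OF vV l(1)] edge_path_between[OF uV k(1)] l k by auto
  have pab: "path_between model (p a) (p b) (piece a b p)"
    using piece_between[OF p] ab by auto
  have con: "homotopic_paths model (ray u (p a) +++ piece a b p) (ray u (p b))"
  proof (rule ray_contract[OF pab])
    show "piece a b p t u \<noteq> 0" if "0 \<le> t" "t \<le> 1" for t
      unfolding piece_def by (rule u) (use affine_in_interval[OF ab(2) that] in auto)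
  qed
  have "homotopic_paths model (ray v (p a) +++ piece a b p) ((edge_path v l +++ ray u (p a)) +++ piece a b p)"
    by (rule homotopic_join_cong[OF l(3) path_between_refl[OF pab] ra pab])
  also have "homotopic_paths model \<dots> (edge_path v l +++ (ray u (p a) +++ piece a b p))"
    by (rule homotopic_join_assoc[OF el rua pab])
  also have "homotopic_paths model \<dots> (edge_path v l +++ ray u (p b))"
    by (rule homotopic_join_cong[OF path_between_refl[OF el] con el path_between_join[OF rua pab]])
  also have "homotopic_paths model \<dots> (edge_path v l +++ (edge_path u k +++ ray w (p b)))"
    by (rule homotopic_join_cong[OF path_between_refl[OF el] k(3) el rub])
  also have "homotopic_paths model \<dots> ((edge_path v l +++ edge_path u k) +++ ray w (p b))"
    by (rule homotopic_paths_sym[OF homotopic_join_assoc[OF el ek rw]])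
  also have "homotopic_paths model \<dots> (edge_path v (l @ k) +++ ray w (p b))"
    by (rule homotopic_join_cong[OF _ path_between_refl[OF rw] path_between_join[OF el ek] rw])
      (use homotopic_paths_sym[OF edge_path_append[OF vV l(1) k(1)]] l(2) in simp)
  finally show "\<exists>l. set l \<subseteq> I \<and> walk l v = w \<and>
       homotopic_paths model (ray v (p a) +++ piece a b p) (edge_path v l +++ ray w (p b))"
    using l k by (intro exI[of _ "l @ k"]) auto
qed

lemma nonzero_nearby:
  assumes "continuous_on X p" "x \<in> X" "p x u \<noteq> 0"
  obtains d where "d > 0" "\<And>t. t \<in> X \<Longrightarrow> dist t x < d \<Longrightarrow> p t u \<noteq> (0::real)"
proof -
  have "continuous_on X (\<lambda>t. p t u)"
    by (rule continuous_on_eval[OF assms(1)])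
  then obtain d where d: "d > 0" "\<forall>t\<in>X. dist t x < d \<longrightarrow> dist (p t u) (p x u) < \<bar>p x u\<bar>"
    using assms(2,3) unfolding continuous_on_iff by (metis zero_less_abs_iff)
  show ?thesis
    by (rule that[OF d(1)]) (use d(2) in \<open>auto simp: dist_real_def\<close>)
qed

text \<open>The rays at both ends are constant because the path starts and ends in vertices, so the
  property \<open>edgelike\<close> for the whole interval is the claim up to constant paths.\<close>

theorem path_homotopic_edge_path:
  assumes p: "path_between model (vertex v) (vertex w) p" and vw: "v \<in> V" "w \<in> V"
  obtains l where "set l \<subseteq> I" "walk l v = w" "homotopic_paths model p (edge_path v l)"
proof -
  have cp: "continuous_on {0..1} p" and p01: "p 0 = vertex v" "p 1 = vertex w"
    using p by (auto simp: path_between_def path_def pathstart_def pathfinish_def)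
  \<comment> \<open>Bisection takes the place of a Lebesgue number. Its local condition ranges over
    all real intervals around a point, so the property is guarded to concern only those inside the
    unit interval.\<close>
  have "0 \<le> (0::real) \<longrightarrow> (0::real) \<le> 1 \<longrightarrow> (1::real) \<le> 1 \<longrightarrow> edgelike p 0 1"
  proof (rule Bolzano[where P = "\<lambda>a b. 0 \<le> a \<longrightarrow> a \<le> b \<longrightarrow> b \<le> 1 \<longrightarrow> edgelike p a b"])
    fix x :: real assume x: "0 \<le> x" "x \<le> 1"
    have "p x \<in> model" using path_between_in[OF p] x by simp
    then obtain u where u: "p x u \<noteq> 0" using model_support_nonempty by blast
    obtain d where d: "d > 0" "\<And>t. t \<in> {0..1} \<Longrightarrow> dist t x < d \<Longrightarrow> p t u \<noteq> 0"
      using nonzero_nearby[OF cp _ u] x by auto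
    show "\<exists>d>0. \<forall>a b. a \<le> x \<and> x \<le> b \<and> b - a < d \<longrightarrow> 0 \<le> a \<longrightarrow> a \<le> b \<longrightarrow> b \<le> 1 \<longrightarrow> edgelike p a b"
    proof (intro exI[of _ d] conjI d(1) allI impI)
      fix a b assume ab: "a \<le> x \<and> x \<le> b \<and> b - a < d" "0 \<le> a" "a \<le> b" "b \<le> 1"
      show "edgelike p a b"
      proof (rule edgelike_local[OF p ab(2-4) d(2)])
        fix t assume t: "a \<le> t" "t \<le> b"
        then show "t \<in> {0..1}"
          using ab by simp
        show "dist t x < d"
          using t ab by (simp add: dist_real_def abs_less_iff)
      qed
    qed
  next
    fix a b c :: real
    assume "0 \<le> a \<longrightarrow> a \<le> b \<longrightarrow> b \<le> 1 \<longrightarrow> edgelike p a b"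
      "0 \<le> b \<longrightarrow> b \<le> c \<longrightarrow> c \<le> 1 \<longrightarrow> edgelike p b c" "a \<le> b" "b \<le> c"
    then show "0 \<le> a \<longrightarrow> a \<le> c \<longrightarrow> c \<le> 1 \<longrightarrow> edgelike p a c"
      using edgelike_trans[OF p, of a b c] by linarith
  qed simp
  then have "edgelike p 0 1" by simp
  then obtain l where l: "set l \<subseteq> I" "walk l v = w"
      "homotopic_paths model (ray v (vertex v) +++ piece 0 1 p) (edge_path v l +++ ray w (vertex w))"
    using edgelikeD[of p 0 1 v w] unfolding p01 by (auto simp: vertex_apply vw)
  have ray: "ray v (vertex v) = (\<lambda>_. vertex v)" if "v \<in> V" for v
  proof -
    have "odds (vertex v) v = (\<lambda>_. 0)"
      by (rule odds_weight[OF that]) (auto simp: coords_def)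
    then show ?thesis by (simp add: ray_def)
  qed
  have "piece 0 1 p = p" by (simp add: piece_def)
  then have "homotopic_paths model ((\<lambda>_. vertex v) +++ p) (edge_path v l +++ (\<lambda>_. vertex w))"
    using l(3) ray vw by simp
  moreover have "homotopic_paths model p ((\<lambda>_. vertex v) +++ p)"
    by (rule homotopic_paths_sym[OF homotopic_join_const_left[OF p]])
  moreover have "homotopic_paths model (edge_path v l +++ (\<lambda>_. vertex w)) (edge_path v l)"
    by (rule homotopic_join_const_right) (use edge_path_between[OF vw(1) l(1)] l(2) in simp)
  ultimately show ?thesis
    using that[OF l(1,2)] homotopic_paths_trans by blast
qed

end

section \<open>Local systems and their holonomy\<close>

text \<open>A covering with fibre \<open>F\<close>, given by its monodromy along edges: moves are
  invertible and agree around squares. In the application the fibre is the group itself, so that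
  following a loop yields its holonomy.\<close>

locale flip_local_system = flip_system V I flip mk ort
  for V :: "'v set" and I :: "'i set" and flip :: "'i \<Rightarrow> 'v \<Rightarrow> 'v"
    and mk :: "'v \<Rightarrow> 'i set" and ort :: "'v \<Rightarrow> 'i \<Rightarrow> 'i \<Rightarrow> bool" +
  fixes F :: "'g set" and st :: "'i \<Rightarrow> 'v \<Rightarrow> 'g \<Rightarrow> 'g"
  assumes st_in: "\<And>i v x. i \<in> I \<Longrightarrow> v \<in> V \<Longrightarrow> x \<in> F \<Longrightarrow> st i v x \<in> F"
    and st_st: "\<And>i v x. i \<in> I \<Longrightarrow> v \<in> V \<Longrightarrow> x \<in> F \<Longrightarrow> st i (flip i v) (st i v x) = x"
    and st_comm: "\<And>i j v x. i \<in> I \<Longrightarrow> j \<in> I \<Longrightarrow> v \<in> V \<Longrightarrow> x \<in> F \<Longrightarrow> ort v i j \<Longrightarrow>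
      st i (flip j v) (st j v x) = st j (flip i v) (st i v x)"
begin

text \<open>Fibre point and vertex move together, so that the parity lemma for folds covers
  transport as well.\<close>

definition step :: "'i \<Rightarrow> 'g \<times> 'v \<Rightarrow> 'g \<times> 'v" where
  "step i z = (st i (snd z) (fst z), flip i (snd z))"

definition along :: "'v \<Rightarrow> 'i list \<Rightarrow> 'g \<Rightarrow> 'g" where
  "along v l x = fst (fold step l (x, v))"

lemma along_Nil [simp]: "along v [] x = x"
  and along_Cons [simp]: "along v (i # l) x = along (flip i v) l (st i v x)"
  by (simp_all add: along_def step_def)

lemma along_append: "along v (l @ k) x = along (walk l v) k (along v l x)"
  by (induction l arbitrary: v x) auto

lemma along_in: "set l \<subseteq> I \<Longrightarrow> v \<in> V \<Longrightarrow> x \<in> F \<Longrightarrow> along v l x \<in> F"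
  by (induction l arbitrary: v x) (auto simp: st_in flip_in)

lemma along_parity:
  assumes v: "v \<in> V" "clique v S" and l: "set l \<subseteq> S" "set l' \<subseteq> S" and x: "x \<in> F"
    and par: "\<And>i. even (count_list l i) \<longleftrightarrow> even (count_list l' i)"
  shows "along v l x = along v l' x"
proof -
  have "fold step l (x, v) = fold step l' (x, v)"
  proof (rule fold_parity_cong[where P = "\<lambda>z. fst z \<in> F \<and> snd z \<in> V \<and> clique (snd z) S" and S = S])
    fix i j z assume i: "i \<in> S" and z: "fst z \<in> F \<and> snd z \<in> V \<and> clique (snd z) S"
    then have iI: "i \<in> I" using clique_sub by blast
    show "fst (step i z) \<in> F \<and> snd (step i z) \<in> V \<and> clique (snd (step i z)) S"
      using i z iI by (simp add: step_def st_in flip_in clique_flip)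
    show "step i (step i z) = z"
      using z iI by (simp add: step_def st_st flip_flip prod_eq_iff)
    assume j: "j \<in> S"
    then have jI: "j \<in> I" using z clique_sub by blast
    show "step i (step j z) = step j (step i z)"
    proof (cases "i = j")
      case False
      then have "ort (snd z) i j"
        using i j z by (simp add: clique_def)
      then show ?thesis
        using st_comm[OF iI jI, of "snd z" "fst z"] ort_comm[OF _ iI jI, of "snd z"] z
        by (simp add: step_def)
    qed simp
  qed (use assms in auto)
  then show ?thesis by (simp add: along_def)
qed

text \<open>Meant for two vertices of one cube, where \<open>along_parity\<close> makes the chosen
  order of the axes immaterial.\<close>

definition transport :: "'v \<Rightarrow> 'v \<Rightarrow> 'g \<Rightarrow> 'g" where
  "transport v w = along v (enum_set (sym_diff (mk v) (mk w)))"

lemma support_enum: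
  assumes f: "f \<in> model" "f v \<noteq> 0" "f w \<noteq> 0"
  defines "l \<equiv> enum_set (sym_diff (mk v) (mk w))"
  shows "set l = sym_diff (mk v) (mk w)" "set l \<subseteq> {i. odds f v i \<noteq> 0}" "set l \<subseteq> I" "walk l v = w"
    "\<And>i. even (count_list l i) \<longleftrightarrow> i \<notin> sym_diff (mk v) (mk w)"
proof -
  note s = model_support[OF f]
  have fin: "finite (sym_diff (mk v) (mk w))"
    using s(1) clique_finite unfolding joined_def by blast
  show e: "set l = sym_diff (mk v) (mk w)"
    unfolding l_def using enum_set[OF fin] by blast
  show "set l \<subseteq> {i. odds f v i \<noteq> 0}" using s(2) e by simp
  show "set l \<subseteq> I" using s(1) clique_sub e unfolding joined_def by blast
  show "walk l v = w" unfolding l_def using s(1) by (simp add: joined_def flips_def)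
  show "even (count_list l i) \<longleftrightarrow> i \<notin> sym_diff (mk v) (mk w)" for i
    unfolding l_def by (rule even_count_enum_set[OF fin])
qed

lemma transport_in:
  assumes "f \<in> model" "f v \<noteq> 0" "f w \<noteq> 0" "x \<in> F"
  shows "transport v w x \<in> F"
  unfolding transport_def
  using along_in[OF support_enum(3)[OF assms(1-3)] model_chart(1)[OF assms(1,2)] assms(4)] .

lemma transport_flip:
  assumes f: "f \<in> model" "f u \<noteq> 0" "f v \<noteq> 0" "f (flip i v) \<noteq> 0" and i: "i \<in> I" and y: "y \<in> F"
  shows "transport u (flip i v) y = st i v (transport u v y)"
proof -
  let ?S = "{i. odds f u i \<noteq> 0}"
  note c = model_chart[OF f(1,2)] and cv = model_chart[OF f(1,3)]
  note e = support_enum[OF f(1,2,3)] and e' = support_enum[OF f(1,2,4)]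
  let ?l = "enum_set (sym_diff (mk u) (mk v))" and ?l' = "enum_set (sym_diff (mk u) (mk (flip i v)))"
  have D: "sym_diff (mk u) (mk (flip i v)) = sym_diff (sym_diff (mk u) (mk v)) {i}"
    using mk_flip[OF i cv(1)] by blast
  have "i \<in> ?S"
    using e(1,2) e'(1,2) D by blast
  then have "along u ?l' y = along u (?l @ [i]) y"
    using e(2) e'(2) e(5) e'(5) D
    by (intro along_parity[OF c(1) coords_clique[OF c(2)] _ _ y]) auto
  then show ?thesis
    by (simp add: transport_def along_append e(4))
qed

lemma transport_inverse:
  assumes f: "f \<in> model" "f u \<noteq> 0" "f v \<noteq> 0" and y: "y \<in> F"
  shows "transport u v (transport v u y) = y"
proof -
  let ?l = "enum_set (sym_diff (mk v) (mk u))" and ?l' = "enum_set (sym_diff (mk u) (mk v))"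
  note c = model_chart[OF f(1,3)]
  note e = support_enum[OF f(1,3,2)] and e' = support_enum[OF f(1,2,3)]
  have "along v (?l @ ?l') y = along v [] y"
    using e e' by (intro along_parity[OF c(1) coords_clique[OF c(2)] _ _ y]) auto
  then show ?thesis
    by (simp add: transport_def along_append e(4))
qed

text \<open>A flat section is a lift of the path to the covering with fibre \<open>F\<close>, written in the charts
  given by the vertices whose open star contains the current point.\<close>

definition flat :: "(real \<Rightarrow> 'v \<Rightarrow> real) \<Rightarrow> real \<Rightarrow> real \<Rightarrow> (real \<Rightarrow> 'v \<Rightarrow> 'g) \<Rightarrow> bool" where
  "flat p a b \<phi> \<longleftrightarrow>
     (\<forall>t v. a \<le> t \<longrightarrow> t \<le> b \<longrightarrow> p t v \<noteq> 0 \<longrightarrow> \<phi> t v \<in> F) \<and>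
     (\<forall>t v i. a \<le> t \<longrightarrow> t \<le> b \<longrightarrow> i \<in> I \<longrightarrow> p t v \<noteq> 0 \<longrightarrow> p t (flip i v) \<noteq> 0 \<longrightarrow>
        \<phi> t (flip i v) = st i v (\<phi> t v)) \<and>
     (\<forall>s t v. a \<le> s \<longrightarrow> s \<le> t \<longrightarrow> t \<le> b \<longrightarrow> (\<forall>r. s \<le> r \<longrightarrow> r \<le> t \<longrightarrow> p r v \<noteq> 0) \<longrightarrow> \<phi> s v = \<phi> t v)"

lemma flatD:
  assumes "flat p a b \<phi>"
  shows "a \<le> t \<Longrightarrow> t \<le> b \<Longrightarrow> p t v \<noteq> 0 \<Longrightarrow> \<phi> t v \<in> F"
    and "a \<le> t \<Longrightarrow> t \<le> b \<Longrightarrow> i \<in> I \<Longrightarrow> p t v \<noteq> 0 \<Longrightarrow> p t (flip i v) \<noteq> 0 \<Longrightarrow>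
        \<phi> t (flip i v) = st i v (\<phi> t v)"
    and "a \<le> s \<Longrightarrow> s \<le> t \<Longrightarrow> t \<le> b \<Longrightarrow> (\<And>r. s \<le> r \<Longrightarrow> r \<le> t \<Longrightarrow> p r v \<noteq> 0) \<Longrightarrow> \<phi> s v = \<phi> t v"
  using assms by (auto simp: flat_def)

lemma flat_mono: "flat p a b \<phi> \<Longrightarrow> a \<le> a' \<Longrightarrow> b' \<le> b \<Longrightarrow> flat p a' b' \<phi>"
  unfolding flat_def by (meson order_trans)

lemma flat_along:
  assumes \<phi>: "flat p a b \<phi>" and t: "a \<le> t" "t \<le> b" and m: "p t \<in> model"
  shows "p t v \<noteq> 0 \<Longrightarrow> set l \<subseteq> {i. odds (p t) v i \<noteq> 0} \<Longrightarrow> \<phi> t (walk l v) = along v l (\<phi> t v)"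
proof (induction l arbitrary: v)
  case (Cons i l)
  have i: "odds (p t) v i \<noteq> 0" "i \<in> I"
    using Cons.prems(2) by (auto simp: odds_def split: if_splits)
  note o = odds_flip[OF m Cons.prems(1) i(1)]
  have "set l \<subseteq> {j. odds (p t) (flip i v) j \<noteq> 0}"
    using Cons.prems(2) model_chart(3)[OF m Cons.prems(1), of i] by (auto simp: o(2))
  from Cons.IH[OF o(1) this] show ?case
    using flatD(2)[OF \<phi> t i(2) Cons.prems(1) o(1)] by simp
qed simp

lemma flat_transport:
  assumes "flat p a b \<phi>" "a \<le> t" "t \<le> b" and m: "p t \<in> model" "p t v \<noteq> 0" "p t w \<noteq> 0"
  shows "\<phi> t w = transport v w (\<phi> t v)"
  using flat_along[OF assms(1-5) support_enum(2)[OF m]] support_enum(4)[OF m]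
  by (simp add: transport_def)

text \<open>A value at the centre \<open>u\<close> of an open star spreads by transport to every
  vertex whose star contains the current point; inside cubes transport is independent of the
  route.\<close>

lemma flat_local:
  assumes m: "\<And>t. a \<le> t \<Longrightarrow> t \<le> b \<Longrightarrow> p t \<in> model" and u: "\<And>t. a \<le> t \<Longrightarrow> t \<le> b \<Longrightarrow> p t u \<noteq> 0"
    and y: "y \<in> F"
  shows "flat p a b (\<lambda>t v. transport u v y)"
  unfolding flat_def using transport_in[OF m u _ y] transport_flip[OF m u _ _ _ y] by blast

lemma flat_join:
  assumes \<phi>: "flat p a b \<phi>" and \<psi>: "flat p b c \<psi>" and abc: "a \<le> b" "b \<le> c"
    and eq: "\<And>v. p b v \<noteq> 0 \<Longrightarrow> \<phi> b v = \<psi> b v"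
  shows "flat p a c (\<lambda>t. if t \<le> b then \<phi> t else \<psi> t)"
  unfolding flat_def
proof (intro conjI allI impI)
  fix t v i assume t: "a \<le> t" "t \<le> c" "p t v \<noteq> 0"
  show "(if t \<le> b then \<phi> t else \<psi> t) v \<in> F"
    using flatD(1)[OF \<phi>] flatD(1)[OF \<psi>] t by auto
  assume i: "i \<in> I" "p t (flip i v) \<noteq> 0"
  show "(if t \<le> b then \<phi> t else \<psi> t) (flip i v) = st i v ((if t \<le> b then \<phi> t else \<psi> t) v)"
    using flatD(2)[OF \<phi>] flatD(2)[OF \<psi>] t i by auto
next
  fix s t v assume st: "a \<le> s" "s \<le> t" "t \<le> c" and p: "\<forall>r. s \<le> r \<longrightarrow> r \<le> t \<longrightarrow> p r v \<noteq> 0"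
  consider "t \<le> b" | "b < s" | "s \<le> b" "b < t" by linarith
  then show "(if s \<le> b then \<phi> s else \<psi> s) v = (if t \<le> b then \<phi> t else \<psi> t) v"
  proof cases
    case 1 then show ?thesis using flatD(3)[OF \<phi>, of s t v] st p by simp
  next
    case 2 then show ?thesis using flatD(3)[OF \<psi>, of s t v] st p by simp
  next
    case 3
    then have "\<phi> s v = \<phi> b v" "\<psi> b v = \<psi> t v"
      using flatD(3)[OF \<phi>, of s b v] flatD(3)[OF \<psi>, of b t v] st p by simp_all
    then show ?thesis using 3 eq[of v] p by simp
  qed
qed

text \<open>The claim is bisected for every start vertex and start value at once, so that the second
  half can be started with the value in which the first half ends.\<close>

lemma flat_exists:
  assumes p: "continuous_on {0..1} p" and m: "\<And>t. 0 \<le> t \<Longrightarrow> t \<le> 1 \<Longrightarrow> p t \<in> model"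
    and v: "p 0 v \<noteq> 0" and y: "y \<in> F"
  obtains \<phi> where "flat p 0 1 \<phi>" "\<phi> 0 v = y"
proof -
  have "0 \<le> (0::real) \<longrightarrow> (0::real) \<le> 1 \<longrightarrow> (1::real) \<le> 1 \<longrightarrow>
      (\<forall>v. \<forall>y\<in>F. p 0 v \<noteq> 0 \<longrightarrow> (\<exists>\<phi>. flat p 0 1 \<phi> \<and> \<phi> 0 v = y))"
  proof (rule Bolzano[where P = "\<lambda>a b. 0 \<le> a \<longrightarrow> a \<le> b \<longrightarrow> b \<le> 1 \<longrightarrow>
      (\<forall>v. \<forall>y\<in>F. p a v \<noteq> 0 \<longrightarrow> (\<exists>\<phi>. flat p a b \<phi> \<and> \<phi> a v = y))"])
    fix x :: real assume x: "0 \<le> x" "x \<le> 1"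
    obtain u where u: "p x u \<noteq> 0" using model_support_nonempty m x by blast
    obtain d where d: "d > 0" "\<And>t. t \<in> {0..1} \<Longrightarrow> dist t x < d \<Longrightarrow> p t u \<noteq> 0"
      using nonzero_nearby[OF p _ u] x by auto
    show "\<exists>d>0. \<forall>a b. a \<le> x \<and> x \<le> b \<and> b - a < d \<longrightarrow> 0 \<le> a \<longrightarrow> a \<le> b \<longrightarrow> b \<le> 1 \<longrightarrow>
      (\<forall>v. \<forall>y\<in>F. p a v \<noteq> 0 \<longrightarrow> (\<exists>\<phi>. flat p a b \<phi> \<and> \<phi> a v = y))"
    proof (intro exI[of _ d] conjI d(1) allI impI ballI)
      fix a b v y assume ab: "a \<le> x \<and> x \<le> b \<and> b - a < d" "0 \<le> a" "a \<le> b" "b \<le> 1"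
        and y: "y \<in> F" and v: "p a v \<noteq> 0"
      have u: "p t u \<noteq> 0" if "a \<le> t" "t \<le> b" for t
        by (rule d(2)) (use ab that in \<open>auto simp: dist_real_def abs_less_iff\<close>)
      have m': "p t \<in> model" if "a \<le> t" "t \<le> b" for t
        by (rule m) (use ab that in auto)
      have a: "a \<le> a" "a \<le> b" using ab by auto
      have "flat p a b (\<lambda>t w. transport u w (transport v u y))"
        by (rule flat_local[OF m' u transport_in[OF m'[OF a] v u[OF a] y]])
      then show "\<exists>\<phi>. flat p a b \<phi> \<and> \<phi> a v = y"
        using transport_inverse[OF m'[OF a] u[OF a] v y] by blast
    qed
  next
    fix a b c :: real assume abc: "a \<le> b" "b \<le> c"
      and 1: "0 \<le> a \<longrightarrow> a \<le> b \<longrightarrow> b \<le> 1 \<longrightarrow>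
        (\<forall>v. \<forall>y\<in>F. p a v \<noteq> 0 \<longrightarrow> (\<exists>\<phi>. flat p a b \<phi> \<and> \<phi> a v = y))"
      and 2: "0 \<le> b \<longrightarrow> b \<le> c \<longrightarrow> c \<le> 1 \<longrightarrow>
        (\<forall>v. \<forall>y\<in>F. p b v \<noteq> 0 \<longrightarrow> (\<exists>\<phi>. flat p b c \<phi> \<and> \<phi> b v = y))"
    show "0 \<le> a \<longrightarrow> a \<le> c \<longrightarrow> c \<le> 1 \<longrightarrow>
        (\<forall>v. \<forall>y\<in>F. p a v \<noteq> 0 \<longrightarrow> (\<exists>\<phi>. flat p a c \<phi> \<and> \<phi> a v = y))"
    proof (intro allI impI ballI)
      fix v y assume ac: "0 \<le> a" "a \<le> c" "c \<le> 1" and v: "p a v \<noteq> 0" and y: "y \<in> F"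
      obtain \<phi> where \<phi>: "flat p a b \<phi>" "\<phi> a v = y"
        using 1 ac abc v y by fastforce
      have mb: "p b \<in> model" using m ac abc by simp
      obtain u where u: "p b u \<noteq> 0" using model_support_nonempty mb by blast
      have "\<phi> b u \<in> F"
        using flatD(1)[OF \<phi>(1) abc(1) _ u] by simp
      then obtain \<psi> where \<psi>: "flat p b c \<psi>" "\<psi> b u = \<phi> b u"
        using 2 ac abc u by fastforce
      \<comment> \<open>The sections were matched at the single vertex \<open>u\<close>; being flat,
        they then agree at all vertices of the support at time \<open>b\<close>, which is what
        \<open>flat_join\<close> demands.\<close>
      have "\<phi> b v = \<psi> b v" if "p b v \<noteq> 0" for v
        using flat_transport[OF \<phi>(1) abc(1) _ mb u that] flat_transport[OF \<psi>(1) _ abc(2) mb u that] \<psi>(2)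
        by simp
      from flat_join[OF \<phi>(1) \<psi>(1) abc this] show "\<exists>\<phi>. flat p a c \<phi> \<and> \<phi> a v = y"
        using \<phi>(2) abc by (intro exI[of _ "\<lambda>t. if t \<le> b then \<phi> t else \<psi> t"]) simp
    qed
  qed simp
  then show ?thesis using that v y by auto
qed

text \<open>During a short time one open star contains all nearby paths of the family, so the rule
  \<open>r\<close> from start values to end values is common to them. For a constant family this is
  uniqueness of lifts; for a homotopy it says that the end of the lift is locally constant.\<close>

lemma flat_stable:
  fixes h :: "real \<times> real \<Rightarrow> 'v \<Rightarrow> real"
  assumes h: "continuous_on ({0..1} \<times> {0..1}) h" "\<And>s t. s \<in> {0..1} \<Longrightarrow> t \<in> {0..1} \<Longrightarrow> h (s, t) \<in> model"
    and s: "s \<in> {0..1}" and vw: "h (s, 0) v \<noteq> 0" "h (s, 1) w \<noteq> 0"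
  shows "\<exists>r. \<exists>d>0. \<forall>s'\<in>{0..1}. \<bar>s' - s\<bar> < d \<longrightarrow>
    (\<forall>\<phi>. flat (\<lambda>t. h (s', t)) 0 1 \<phi> \<longrightarrow> \<phi> 1 w = r (\<phi> 0 v))"
proof -
  define R where "R a b \<longleftrightarrow> (\<forall>v w. h (s, a) v \<noteq> 0 \<longrightarrow> h (s, b) w \<noteq> 0 \<longrightarrow> (\<exists>r. \<exists>d>0.
      \<forall>s'\<in>{0..1}. \<bar>s' - s\<bar> < d \<longrightarrow> (\<forall>\<phi>. flat (\<lambda>t. h (s', t)) a b \<phi> \<longrightarrow> \<phi> b w = r (\<phi> a v))))" for a b
  have ch: "continuous_on {0..1} (\<lambda>s. h (s, t))" if "t \<in> {0..1}" for t
    by (rule continuous_on_compose2[OF h(1)]) (use that in \<open>auto intro!: continuous_intros\<close>)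
  have "0 \<le> (0::real) \<longrightarrow> (0::real) \<le> 1 \<longrightarrow> (1::real) \<le> 1 \<longrightarrow> R 0 1"
  proof (rule Bolzano[where P = "\<lambda>a b. 0 \<le> a \<longrightarrow> a \<le> b \<longrightarrow> b \<le> 1 \<longrightarrow> R a b"])
    fix x :: real assume x: "0 \<le> x" "x \<le> 1"
    obtain u where u: "h (s, x) u \<noteq> 0" using model_support_nonempty h(2)[of s x] s x by auto
    obtain d where d: "d > 0" "\<And>z. z \<in> {0..1} \<times> {0..1} \<Longrightarrow> dist z (s, x) < d \<Longrightarrow> h z u \<noteq> 0"
      using nonzero_nearby[OF h(1) _ u] x s by auto
    show "\<exists>d>0. \<forall>a b. a \<le> x \<and> x \<le> b \<and> b - a < d \<longrightarrow> 0 \<le> a \<longrightarrow> a \<le> b \<longrightarrow> b \<le> 1 \<longrightarrow> R a b"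
    \<comment> \<open>Half of the radius is for the time and half for the parameter of the family;
      together the point stays within \<open>d\<close> of \<open>(s, x)\<close>.\<close>
    proof (intro exI[of _ "d / 2"] conjI allI impI)
      fix a b assume ab: "a \<le> x \<and> x \<le> b \<and> b - a < d / 2" "0 \<le> a" "a \<le> b" "b \<le> 1"
      show "R a b"
        unfolding R_def
      proof (intro allI impI)
        fix v w assume v: "h (s, a) v \<noteq> 0" and w: "h (s, b) w \<noteq> 0"
        obtain d1 where d1: "d1 > 0" "\<And>s'. s' \<in> {0..1} \<Longrightarrow> dist s' s < d1 \<Longrightarrow> h (s', a) v \<noteq> 0"
          using nonzero_nearby[OF ch[of a] s v] ab by auto
        obtain d2 where d2: "d2 > 0" "\<And>s'. s' \<in> {0..1} \<Longrightarrow> dist s' s < d2 \<Longrightarrow> h (s', b) w \<noteq> 0"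
          using nonzero_nearby[OF ch[of b] s w] ab by auto
        have "\<phi> b w = transport u w (transport v u (\<phi> a v))"
          if s': "s' \<in> {0..1}" "\<bar>s' - s\<bar> < min (d / 2) (min d1 d2)" and \<phi>: "flat (\<lambda>t. h (s', t)) a b \<phi>" for s' \<phi>
        proof -
          have u': "h (s', t) u \<noteq> 0" if t: "a \<le> t" "t \<le> b" for t
          proof (rule d(2))
            have "dist (s', t) (s, x) \<le> \<bar>s' - s\<bar> + \<bar>t - x\<bar>"
              using dist_Pair_Pair[of s' t s x] sqrt_sum_squares_le_sum_abs[of "s' - s" "t - x"]
              by (simp add: dist_real_def)
            also have "\<bar>t - x\<bar> < d / 2"
              unfolding abs_less_iff using t conjunct1[OF ab(1)] conjunct2[OF ab(1)] by linarith
            finally show "dist (s', t) (s, x) < d" using s' by simp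
          qed (use s' t ab in auto)
          have v': "h (s', a) v \<noteq> 0" and w': "h (s', b) w \<noteq> 0"
            using d1(2) d2(2) s' by (simp_all add: dist_real_def)
          have m: "h (s', a) \<in> model" "h (s', b) \<in> model"
            using h(2) s' ab by auto
          have "\<phi> a u = transport v u (\<phi> a v)" "\<phi> b w = transport u w (\<phi> b u)"
            using flat_transport[OF \<phi> _ ab(3) m(1) v' u'[of a]] flat_transport[OF \<phi> ab(3) _ m(2) u'[of b] w'] ab(3)
            by simp_all
          moreover have "\<phi> a u = \<phi> b u"
            by (rule flatD(3)[OF \<phi>]) (use ab(3) u' in auto)
          ultimately show ?thesis by simp
        qed
        then show "\<exists>r. \<exists>d>0. \<forall>s'\<in>{0..1}. \<bar>s' - s\<bar> < d \<longrightarrow>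
            (\<forall>\<phi>. flat (\<lambda>t. h (s', t)) a b \<phi> \<longrightarrow> \<phi> b w = r (\<phi> a v))"
          using d(1) d1(1) d2(1)
          by (intro exI[of _ "\<lambda>x. transport u w (transport v u x)"] exI[of _ "min (d / 2) (min d1 d2)"]) auto
      qed
    qed (use d(1) in simp)
  next
    fix a b c :: real assume abc: "a \<le> b" "b \<le> c"
      and 1: "0 \<le> a \<longrightarrow> a \<le> b \<longrightarrow> b \<le> 1 \<longrightarrow> R a b" and 2: "0 \<le> b \<longrightarrow> b \<le> c \<longrightarrow> c \<le> 1 \<longrightarrow> R b c"
    show "0 \<le> a \<longrightarrow> a \<le> c \<longrightarrow> c \<le> 1 \<longrightarrow> R a c"
    proof (intro impI)
      assume ac: "0 \<le> a" "a \<le> c" "c \<le> 1"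
      have R: "R a b" "R b c" using 1 2 ac abc by auto
      show "R a c"
        unfolding R_def
      proof (intro allI impI)
        fix v w assume v: "h (s, a) v \<noteq> 0" and w: "h (s, c) w \<noteq> 0"
        obtain u where u: "h (s, b) u \<noteq> 0" using model_support_nonempty h(2)[of s b] s ac abc by auto
        obtain r d where r: "d > 0" "\<forall>s'\<in>{0..1}. \<bar>s' - s\<bar> < d \<longrightarrow>
            (\<forall>\<phi>. flat (\<lambda>t. h (s', t)) a b \<phi> \<longrightarrow> \<phi> b u = r (\<phi> a v))"
          using R(1)[unfolded R_def, rule_format, OF v u] by blast
        obtain r' d' where r': "d' > 0" "\<forall>s'\<in>{0..1}. \<bar>s' - s\<bar> < d' \<longrightarrow>
            (\<forall>\<phi>. flat (\<lambda>t. h (s', t)) b c \<phi> \<longrightarrow> \<phi> c w = r' (\<phi> b u))"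
          using R(2)[unfolded R_def, rule_format, OF u w] by blast
        have "\<phi> c w = r' (r (\<phi> a v))"
          if "s' \<in> {0..1}" "\<bar>s' - s\<bar> < min d d'" and \<phi>: "flat (\<lambda>t. h (s', t)) a c \<phi>" for s' \<phi>
          using r(2) r'(2) that flat_mono[OF \<phi>, of a b] flat_mono[OF \<phi>, of b c] abc by simp
        then show "\<exists>r. \<exists>d>0. \<forall>s'\<in>{0..1}. \<bar>s' - s\<bar> < d \<longrightarrow>
            (\<forall>\<phi>. flat (\<lambda>t. h (s', t)) a c \<phi> \<longrightarrow> \<phi> c w = r (\<phi> a v))"
          using r(1) r'(1) by (intro exI[of _ "\<lambda>x. r' (r x)"] exI[of _ "min d d'"]) auto
      qed
    qed
  qed simp
  then show ?thesis using vw by (simp add: R_def)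
qed

definition lift_end :: "(real \<Rightarrow> 'v \<Rightarrow> real) \<Rightarrow> 'v \<Rightarrow> 'v \<Rightarrow> 'g \<Rightarrow> 'g" where
  "lift_end p v w x = (SOME z. \<exists>\<phi>. flat p 0 1 \<phi> \<and> \<phi> 0 v = x \<and> \<phi> 1 w = z)"

text \<open>That the choice in \<open>lift_end\<close> is unique is \<open>flat_stable\<close> for
  the family that repeats the one path \<open>p\<close>.\<close>

lemma lift_end_eq:
  assumes p: "path_between model x y p" and vw: "x v \<noteq> 0" "y w \<noteq> 0" and \<phi>: "flat p 0 1 \<phi>"
  shows "lift_end p v w (\<phi> 0 v) = \<phi> 1 w"
proof -
  have cp: "continuous_on {0..1} p" and p01: "p 0 = x" "p 1 = y"
    using p by (auto simp: path_between_def path_def pathstart_def pathfinish_def)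
  have "continuous_on ({0..1} \<times> {0..1::real}) (\<lambda>z. p (snd z))"
    by (rule continuous_on_compose2[OF cp]) (auto intro!: continuous_intros)
  then have "\<exists>r. \<exists>d>0. \<forall>s'\<in>{0..1::real}. \<bar>s' - 0\<bar> < d \<longrightarrow>
      (\<forall>\<psi>. flat (\<lambda>t. p (snd (s', t))) 0 1 \<psi> \<longrightarrow> \<psi> 1 w = r (\<psi> 0 v))"
    by (rule flat_stable) (use path_between_in[OF p] vw p01 in auto)
  then obtain r d where d: "d > 0" "\<forall>s'\<in>{0..1::real}. \<bar>s' - 0\<bar> < d \<longrightarrow>
      (\<forall>\<psi>. flat (\<lambda>t. p (snd (s', t))) 0 1 \<psi> \<longrightarrow> \<psi> 1 w = r (\<psi> 0 v))"
    by blast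
  have r: "\<And>\<psi>. flat p 0 1 \<psi> \<Longrightarrow> \<psi> 1 w = r (\<psi> 0 v)"
    using d(2)[rule_format, of 0] d(1) by simp
  show ?thesis
    unfolding lift_end_def by (rule some_equality) (use \<phi> r in metis)+
qed

text \<open>All paths of the homotopy share their end points, so \<open>v\<close> and
  \<open>w\<close> serve for each of them. The end of the lift is locally constant in the parameter,
  hence constant by bisection.\<close>

lemma lift_end_homotopic:
  assumes pq: "homotopic_paths model p q" and p: "path_between model x y p"
    and vw: "x v \<noteq> 0" "y w \<noteq> 0" and z: "z \<in> F"
  shows "lift_end p v w z = lift_end q v w z"
proof -
  obtain h where h: "continuous_on ({0..1} \<times> {0..1}) h" "h \<in> ({0..1} \<times> {0..1}) \<rightarrow> model"
      "\<forall>t\<in>{0..1}. h (0, t) = p t" "\<forall>t\<in>{0..1}. h (1, t) = q t"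
      "\<forall>s\<in>{0..1::real}. pathstart (h \<circ> Pair s) = pathstart p \<and> pathfinish (h \<circ> Pair s) = pathfinish p"
    using pq[unfolded homotopic_paths] by auto
  have hm: "h (s, t) \<in> model" if "s \<in> {0..1}" "t \<in> {0..1}" for s t
    using h(2) that by auto
  have h01: "h (s, 0) = x" "h (s, 1) = y" if "s \<in> {0..1}" for s
    using h(5) that p by (auto simp: pathstart_def pathfinish_def path_between_def)
  define P where "P s = (\<lambda>t. h (s, t))" for s
  have Pc: "continuous_on {0..1} (P s)" if "s \<in> {0..1}" for s
    unfolding P_def by (rule continuous_on_compose2[OF h(1)]) (use that in \<open>auto intro!: continuous_intros\<close>)
  have Pb: "path_between model x y (P s)" if "s \<in> {0..1}" for s
    using Pc[OF that] hm[OF that] h01[OF that]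
    by (auto simp: path_between_def path_def path_image_def pathstart_def pathfinish_def P_def)
  have fl: "\<exists>\<phi>. flat (P s) 0 1 \<phi> \<and> \<phi> 0 v = z" if "s \<in> {0..1}" for s
    using flat_exists[OF Pc[OF that] path_between_in[OF Pb[OF that]], of v z] vw z h01[OF that]
    by (auto simp: P_def)
  define L where "L s = lift_end (P s) v w z" for s
  have "0 \<le> (0::real) \<longrightarrow> (0::real) \<le> 1 \<longrightarrow> (1::real) \<le> 1 \<longrightarrow> L 0 = L 1"
  proof (rule Bolzano[where P = "\<lambda>a b. 0 \<le> a \<longrightarrow> a \<le> b \<longrightarrow> b \<le> 1 \<longrightarrow> L a = L b"])
    fix s :: real assume s: "0 \<le> s" "s \<le> 1"
    obtain r d where r: "d > 0" "\<forall>s'\<in>{0..1}. \<bar>s' - s\<bar> < d \<longrightarrow>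
        (\<forall>\<phi>. flat (\<lambda>t. h (s', t)) 0 1 \<phi> \<longrightarrow> \<phi> 1 w = r (\<phi> 0 v))"
      using flat_stable[OF h(1) hm, of s v w] s h01[of s] vw by auto
    have "L s' = r z" if s': "s' \<in> {0..1}" "\<bar>s' - s\<bar> < d" for s'
    proof -
      obtain \<phi> where \<phi>: "flat (P s') 0 1 \<phi>" "\<phi> 0 v = z" using fl s' by blast
      then have "\<phi> 1 w = r z" using r(2) s' by (auto simp: P_def)
      then show ?thesis
        using lift_end_eq[OF Pb[OF s'(1)] vw \<phi>(1)] \<phi>(2) by (simp add: L_def)
    qed
    then have "L a = L b" if "a \<le> s \<and> s \<le> b \<and> b - a < d" "0 \<le> a" "a \<le> b" "b \<le> 1" for a b
      using that by simp
    then show "\<exists>d>0. \<forall>a b. a \<le> s \<and> s \<le> b \<and> b - a < d \<longrightarrow> 0 \<le> a \<longrightarrow> a \<le> b \<longrightarrow> b \<le> 1 \<longrightarrow> L a = L b"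
      using r(1) by blast
  qed auto
  then have "L 0 = L 1" by simp
  moreover have "flat (P 0) 0 1 \<phi> = flat p 0 1 \<phi>" "flat (P 1) 0 1 \<phi> = flat q 0 1 \<phi>" for \<phi>
    using h(3,4) unfolding flat_def P_def by auto
  then have "L 0 = lift_end p v w z" "L 1 = lift_end q v w z"
    by (simp_all add: L_def lift_end_def)
  ultimately show ?thesis by simp
qed

lemma lift_end_join:
  assumes p: "path_between model x y p" and q: "path_between model y z q"
    and vuw: "x v \<noteq> 0" "y u \<noteq> 0" "z w \<noteq> 0" and g: "g \<in> F"
  shows "lift_end (p +++ q) v w g = lift_end q u w (lift_end p v u g)"
proof -
  have cp: "continuous_on {0..1} p" "continuous_on {0..1} q"
    and p01: "p 0 = x" "p 1 = y" "q 0 = y" "q 1 = z"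
    using p q by (auto simp: path_between_def path_def pathstart_def pathfinish_def)
  obtain \<phi> where \<phi>: "flat p 0 1 \<phi>" "\<phi> 0 v = g"
    using flat_exists[OF cp(1) path_between_in[OF p] _ g] vuw p01 by metis
  have "\<phi> 1 u \<in> F" using flatD(1)[OF \<phi>(1), of 1 u] vuw p01 by simp
  then obtain \<psi> where \<psi>: "flat q 0 1 \<psi>" "\<psi> 0 u = \<phi> 1 u"
    using flat_exists[OF cp(2) path_between_in[OF q]] vuw p01 by metis
  have my: "y \<in> model" using path_between_in[OF q, of 0] p01 by simp
  have eq: "\<phi> 1 v = \<psi> 0 v" if "y v \<noteq> 0" for v
    using flat_transport[OF \<phi>(1), of 1 u v] flat_transport[OF \<psi>(1), of 0 u v] \<psi>(2) my vuw that p01 by simp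
  let ?j = "p +++ q"
  have 1: "flat ?j 0 (1/2) (\<lambda>t. \<phi> (2 * t))"
    unfolding flat_def
  proof (intro conjI allI impI)
    fix t v i assume t: "0 \<le> t" "t \<le> 1/2" "?j t v \<noteq> 0"
    then have t': "0 \<le> 2 * t" "2 * t \<le> 1" "p (2 * t) v \<noteq> 0" by (auto simp: joinpaths_def)
    show "\<phi> (2 * t) v \<in> F" by (rule flatD(1)[OF \<phi>(1) t'])
    assume i: "i \<in> I" "?j t (flip i v) \<noteq> 0"
    then show "\<phi> (2 * t) (flip i v) = st i v (\<phi> (2 * t) v)"
      using flatD(2)[OF \<phi>(1) t'(1,2) i(1) t'(3)] t by (simp add: joinpaths_def)
  next
    fix s t v assume a: "0 \<le> s" "s \<le> t" "t \<le> 1/2" "\<forall>r. s \<le> r \<longrightarrow> r \<le> t \<longrightarrow> ?j r v \<noteq> 0"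
    have "p r v \<noteq> 0" if "2 * s \<le> r" "r \<le> 2 * t" for r
      using a(3) a(4)[rule_format, of "r / 2"] that by (simp add: joinpaths_def)
    then show "\<phi> (2 * s) v = \<phi> (2 * t) v"
      using flatD(3)[OF \<phi>(1), of "2 * s" "2 * t" v] a by simp
  qed
  have jr: "?j t = q (2 * t - 1)" if "1/2 \<le> t" for t
  proof (cases "t = 1/2")
    case True show ?thesis unfolding True by (simp add: joinpaths_def p01)
  qed (use that in \<open>simp add: joinpaths_def\<close>)
  have 2: "flat ?j (1/2) 1 (\<lambda>t. \<psi> (2 * t - 1))"
    unfolding flat_def
  proof (intro conjI allI impI)
    fix t v i assume t: "1/2 \<le> t" "t \<le> 1" "?j t v \<noteq> 0"
    then have t': "0 \<le> 2 * t - 1" "2 * t - 1 \<le> 1" "q (2 * t - 1) v \<noteq> 0" by (auto simp: jr)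
    show "\<psi> (2 * t - 1) v \<in> F" by (rule flatD(1)[OF \<psi>(1) t'])
    assume i: "i \<in> I" "?j t (flip i v) \<noteq> 0"
    then show "\<psi> (2 * t - 1) (flip i v) = st i v (\<psi> (2 * t - 1) v)"
      using flatD(2)[OF \<psi>(1) t'(1,2) i(1) t'(3)] t by (simp add: jr)
  next
    fix s t v assume a: "1/2 \<le> s" "s \<le> t" "t \<le> 1" "\<forall>r. s \<le> r \<longrightarrow> r \<le> t \<longrightarrow> ?j r v \<noteq> 0"
    have "q r v \<noteq> 0" if "2 * s - 1 \<le> r" "r \<le> 2 * t - 1" for r
    proof -
      have "2 * ((r + 1) / 2) - 1 = r"
        by (simp add: field_simps)
      then show ?thesis
        using a(1) a(4)[rule_format, of "(r + 1) / 2"] that jr[of "(r + 1) / 2"] by auto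
    qed
    then show "\<psi> (2 * s - 1) v = \<psi> (2 * t - 1) v"
      using flatD(3)[OF \<psi>(1), of "2 * s - 1" "2 * t - 1" v] a by simp
  qed
  have "flat ?j 0 1 (\<lambda>t. if t \<le> 1/2 then \<phi> (2 * t) else \<psi> (2 * t - 1))"
    by (rule flat_join[OF 1 2]) (use eq jr[of "1/2"] p01 in auto)
  from lift_end_eq[OF path_between_join[OF p q] vuw(1,3) this]
  have "lift_end ?j v w g = \<psi> 1 w" using \<phi>(2) by simp
  moreover have "lift_end p v u g = \<phi> 1 u" using lift_end_eq[OF p vuw(1,2) \<phi>(1)] \<phi>(2) by simp
  moreover have "lift_end q u w (\<phi> 1 u) = \<psi> 1 w" using lift_end_eq[OF q vuw(2,3) \<psi>(1)] \<psi>(2) by simp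
  ultimately show ?thesis by simp
qed

text \<open>Along an edge only its two end vertices have nonzero weight, so a section constant in
  time can be written down. The marks show that no axis other than \<open>i\<close> joins these
  vertices, which is all that flatness has to check.\<close>

lemma lift_end_edge:
  assumes v: "v \<in> V" "i \<in> I" and g: "g \<in> F"
  shows "lift_end (edge v i) v (flip i v) g = st i v g"
proof -
  define \<phi> where "\<phi> t w = (if w = v then g else st i v g)" for t :: real and w
  have irr: "flip j u \<noteq> u" if "j \<in> I" "u \<in> V" for j u
  proof
    assume "flip j u = u"
    then have "sym_diff (mk u) {j} = mk u"
      using mk_flip[OF that] by simp
    then show False by blast
  qed
  have ne: "flip i v \<noteq> v"
    by (rule irr[OF v(2,1)])
  have sup: "w = v \<or> w = flip i v" if "edge v i t w \<noteq> 0" for t w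
  proof -
    have nz: "weight v (\<lambda>j. if j = i then t else 0) w \<noteq> 0" using that by (simp add: edge_def)
    from weight_nonzero_sub[OF this v(1)]
    have "joined v w" and D: "sym_diff (mk v) (mk w) \<subseteq> {i}" by (auto split: if_splits)
    then have w: "flips (sym_diff (mk v) (mk w)) v = w" by (simp add: joined_def)
    from D consider "sym_diff (mk v) (mk w) = {}" | "sym_diff (mk v) (mk w) = {i}" by blast
    then show ?thesis
      by cases (use w in \<open>simp_all only: flips_empty flips_single simp_thms\<close>)
  qed
  have inj: "j = i" if "flip j u = flip i u" "j \<in> I" "u \<in> V" for j u
  proof -
    have "sym_diff (mk u) {j} = sym_diff (mk u) {i}"
      using mk_flip[OF that(2,3)] mk_flip[OF v(2) that(3)] that(1) by simp
    then show ?thesis by blast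
  qed
  have "flat (edge v i) 0 1 \<phi>"
    unfolding flat_def
  proof (intro conjI allI impI)
    fix t w j assume w: "edge v i t w \<noteq> 0"
    show "\<phi> t w \<in> F" using g v st_in by (simp add: \<phi>_def)
    assume j: "j \<in> I" "edge v i t (flip j w) \<noteq> 0"
    consider "w = v" | "w = flip i v" using sup[OF w] by blast
    then show "\<phi> t (flip j w) = st j w (\<phi> t w)"
    proof cases
      case 1
      then have "flip j v = flip i v" using sup[OF j(2)] irr[OF j(1) v(1)] by blast
      then have "j = i" by (rule inj[OF _ j(1) v(1)])
      then show ?thesis using 1 ne by (simp add: \<phi>_def)
    next
      case 2
      have iV: "flip i v \<in> V" using flip_in v by blast
      have "flip j (flip i v) = v" using sup[OF j(2)] irr[OF j(1) iV] unfolding 2 by simp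
      then have "flip j (flip i v) = flip i (flip i v)" using flip_flip[OF v(2,1)] by simp
      then have "j = i" by (rule inj[OF _ j(1) iV])
      then show ?thesis using 2 ne st_st flip_flip g v by (simp add: \<phi>_def)
    qed
  qed (simp add: \<phi>_def)
  from lift_end_eq[OF edge_between[OF v] _ _ this, of v "flip i v"] show ?thesis
    using v ne by (simp add: \<phi>_def vertex_apply flip_in)
qed

lemma lift_end_edge_path:
  "v \<in> V \<Longrightarrow> set l \<subseteq> I \<Longrightarrow> g \<in> F \<Longrightarrow> lift_end (edge_path v l) v (walk l v) g = along v l g"
proof (induction l arbitrary: v g)
  case Nil
  have "flat (\<lambda>_. vertex v) 0 1 (\<lambda>t w. transport v w g)"
    by (rule flat_local) (use Nil in \<open>auto simp: vertex_in_model vertex_apply\<close>)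
  from lift_end_eq[OF _ _ _ this, of "vertex v" "vertex v" v v] Nil
  have "lift_end (\<lambda>_. vertex v) v v (transport v v g) = transport v v g"
    by (simp add: vertex_apply vertex_in_model)
  moreover have "enum_set {} = ([] :: 'i list)"
    using enum_set[of "{} :: 'i set"] by simp
  then have "transport v v g = g"
    by (simp add: transport_def)
  ultimately show ?case by simp
next
  case (Cons i l)
  then have i: "i \<in> I" "set l \<subseteq> I" "flip i v \<in> V" by (auto simp: flip_in)
  have w: "walk l (flip i v) \<in> V" using walk_in i by blast
  have "lift_end (edge v i +++ edge_path (flip i v) l) v (walk l (flip i v)) g =
      lift_end (edge_path (flip i v) l) (flip i v) (walk l (flip i v)) (lift_end (edge v i) v (flip i v) g)"
    by (rule lift_end_join[OF edge_between[OF Cons.prems(1) i(1)] edge_path_between[OF i(3,2)]])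
      (use Cons.prems i w in \<open>auto simp: vertex_apply\<close>)
  then show ?case
    using lift_end_edge[OF Cons.prems(1) i(1) Cons.prems(3)] Cons.IH[OF i(3,2)] st_in i Cons.prems by simp
qed

text \<open>\<open>along\<close> is the end of the lift over an edge path, and that end depends only
  on the homotopy class. This is the invariance of the product along edge paths.\<close>

theorem edge_path_homotopic_along:
  assumes v: "v \<in> V" "set l \<subseteq> I" "set k \<subseteq> I" "g \<in> F"
    and hom: "homotopic_paths model (edge_path v l) (edge_path v k)"
  shows "walk l v = walk k v" and "along v l g = along v k g"
proof -
  have w: "walk l v \<in> V" "walk k v \<in> V" using walk_in v by auto
  have "vertex (walk l v) = vertex (walk k v)"
    using homotopic_paths_imp_pathfinish[OF hom] edge_path_between[OF v(1,2)] edge_path_between[OF v(1,3)]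
    by (simp add: path_between_def)
  then have "vertex (walk k v) (walk l v) \<noteq> 0"
    using w by (metis vertex_apply zero_neq_one)
  then show eq: "walk l v = walk k v"
    using w by (simp add: vertex_apply split: if_splits)
  have "lift_end (edge_path v l) v (walk l v) g = lift_end (edge_path v k) v (walk l v) g"
    by (rule lift_end_homotopic[OF hom edge_path_between[OF v(1,2)]])
      (use v w in \<open>auto simp: vertex_apply\<close>)
  then show "along v l g = along v k g"
    using lift_end_edge_path[OF v(1,2,4)] lift_end_edge_path[OF v(1,3,4)] eq by simp
qed

end

section \<open>The cubing of a flip system\<close>

lemma std_cube_iff: "x \<in> std_cube k \<longleftrightarrow> (\<forall>i\<ge>k. x i = 0) \<and> (\<forall>i<k. -1 \<le> x i \<and> x i \<le> 1)"
  by (auto simp: std_cube_def topspace_Euclidean_space)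

definition pos :: "'a set \<Rightarrow> 'a \<Rightarrow> nat" where
  "pos S = (SOME f. bij_betw f S {..<card S})"

definition axis_at :: "'a set \<Rightarrow> nat \<Rightarrow> 'a" where
  "axis_at S = inv_into S (pos S)"

lemma bij_pos: "finite S \<Longrightarrow> bij_betw (pos S) S {..<card S}"
  unfolding pos_def by (rule someI_ex[of "\<lambda>f. bij_betw f S {..<card S}"])
    (use ex_bij_betw_finite_nat[of S] in \<open>simp add: atLeast0LessThan\<close>)

lemma pos_less: "finite S \<Longrightarrow> i \<in> S \<Longrightarrow> pos S i < card S"
  and axis_pos: "finite S \<Longrightarrow> i \<in> S \<Longrightarrow> axis_at S (pos S i) = i"
  and axis_in: "finite S \<Longrightarrow> k < card S \<Longrightarrow> axis_at S k \<in> S"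
  and pos_axis: "finite S \<Longrightarrow> k < card S \<Longrightarrow> pos S (axis_at S k) = k"
proof -
  assume fin: "finite S"
  note b = bij_pos[OF fin]
  have inv: "bij_betw (axis_at S) {..<card S} S"
    unfolding axis_at_def by (rule bij_betw_inv_into[OF b])
  show "i \<in> S \<Longrightarrow> pos S i < card S" using bij_betw_apply[OF b] by blast
  show "i \<in> S \<Longrightarrow> axis_at S (pos S i) = i"
    unfolding axis_at_def by (rule bij_betw_inv_into_left[OF b])
  show "k < card S \<Longrightarrow> axis_at S k \<in> S" using bij_betw_apply[OF inv] by blast
  show "k < card S \<Longrightarrow> pos S (axis_at S k) = k"
    unfolding axis_at_def by (rule bij_betw_inv_into_right[OF b]) simp
qed

lemma pos_single [simp]: "pos {i} i = 0"
  using pos_less[of "{i}" i] by simp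

lemma axis_single [simp]: "axis_at {i} 0 = i"
  using axis_pos[of "{i}" i] by simp

lemma pos_inj: "finite S \<Longrightarrow> i \<in> S \<Longrightarrow> j \<in> S \<Longrightarrow> pos S i = pos S j \<longleftrightarrow> i = j"
  by (rule inj_on_eq_iff[OF bij_betw_imp_inj_on[OF bij_pos]])

lemma sum_pos: "finite S \<Longrightarrow> (\<Sum>k<card S. g k) = (\<Sum>i\<in>S. g (pos S i))"
  using sum.reindex_bij_betw[OF bij_pos, of S g] by simp

lemma std_cube_eqI:
  assumes "finite S" "x \<in> std_cube (card S)" "y \<in> std_cube (card S)" "\<And>i. i \<in> S \<Longrightarrow> x (pos S i) = y (pos S i)"
  shows "x = y"
proof
  fix k
  show "x k = y k"
  proof (cases "k < card S")
    case True
    then show ?thesis using assms(4)[OF axis_in[OF assms(1)]] pos_axis[OF assms(1)] by simp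
  next
    case False
    then show ?thesis using assms(2,3) by (simp add: std_cube_iff)
  qed
qed

definition cube_point :: "'a set \<Rightarrow> ('a \<Rightarrow> real) \<Rightarrow> nat \<Rightarrow> real" where
  "cube_point S z = (\<lambda>k. if k < card S then z (axis_at S k) else 0)"

lemma cube_point_pos [simp]: "finite S \<Longrightarrow> i \<in> S \<Longrightarrow> cube_point S z (pos S i) = z i"
  by (simp add: cube_point_def pos_less axis_pos)

lemma cube_point_in:
  "finite S \<Longrightarrow> (\<And>i. i \<in> S \<Longrightarrow> -1 \<le> z i \<and> z i \<le> 1) \<Longrightarrow> cube_point S z \<in> std_cube (card S)"
  by (auto simp: std_cube_iff cube_point_def axis_in)

context flip_system begin

definition cells :: "('v \<times> 'i set) set" where
  "cells = {(q, S). q \<in> V \<and> clique q S \<and> mk q \<inter> S = {}}"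

definition code :: "'v \<times> 'i set \<Rightarrow> nat" where
  "code = to_nat_on cells"

definition decode :: "nat \<Rightarrow> 'v \<times> 'i set" where
  "decode = from_nat_into cells"

text \<open>The axes of \<open>c\<close> that lie in the mark of the lowest vertex of
  \<open>d\<close> are those held at +1 on the face. Flipping them leads from the lowest vertex of
  \<open>c\<close> to that of \<open>d\<close>.\<close>

definition face :: "'v \<times> 'i set \<Rightarrow> 'v \<times> 'i set \<Rightarrow> bool" where
  "face d c \<longleftrightarrow> snd d \<subseteq> snd c \<and> flips (mk (fst d) \<inter> snd c) (fst c) = fst d"

definition sg :: "'v \<Rightarrow> 'i \<Rightarrow> real" where
  "sg v i = (if i \<in> mk v then 1 else -1)"

definition face_map :: "'v \<times> 'i set \<Rightarrow> 'v \<times> 'i set \<Rightarrow> (nat \<Rightarrow> real) \<Rightarrow> nat \<Rightarrow> real" where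
  "face_map d c = (\<lambda>x\<in>std_cube (card (snd d)).
     cube_point (snd c) (\<lambda>i. if i \<in> snd d then x (pos (snd d) i) else sg (fst d) i))"

text \<open>The cubes are pairs of a lowest vertex and a clique of axes; all of them carry coordinates
  indexed by the axes, so that the gluing maps are coordinate inclusions.\<close>

definition cubing :: "nat cube_data" where
  "cubing = \<lparr>cubes = code ` cells, dimn = (\<lambda>c. card (snd (decode c))),
     gluings = {(code d, face_map d c, code c) | d c. d \<in> cells \<and> c \<in> cells \<and> face d c}\<rparr>"

lemma finite_cells: "finite cells"
proof (rule finite_subset)
  show "cells \<subseteq> V \<times> Pow I"
    using clique_sub by (auto simp: cells_def)
qed (simp add: finite_V finite_I)

lemma decode_code [simp]: "c \<in> cells \<Longrightarrow> decode (code c) = c"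
  unfolding code_def decode_def by (simp add: countable_finite finite_cells)

lemma code_inject: "c \<in> cells \<Longrightarrow> d \<in> cells \<Longrightarrow> code c = code d \<longleftrightarrow> c = d"
  by (metis decode_code)

lemma cubes_cubing: "cubes cubing = code ` cells"
  by (simp add: cubing_def)

lemma dimn_cubing [simp]: "c \<in> cells \<Longrightarrow> dimn cubing (code c) = card (snd c)"
  by (simp add: cubing_def)

lemma gluings_cubing: "(d', f, c') \<in> gluings cubing \<longleftrightarrow>
    (\<exists>d\<in>cells. \<exists>c\<in>cells. face d c \<and> d' = code d \<and> c' = code c \<and> f = face_map d c)"
  by (auto simp: cubing_def)

lemma cells_D:
  assumes "c \<in> cells"
  shows "fst c \<in> V" "clique (fst c) (snd c)" "mk (fst c) \<inter> snd c = {}" "finite (snd c)" "snd c \<subseteq> I"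
proof -
  show c: "fst c \<in> V" "clique (fst c) (snd c)" "mk (fst c) \<inter> snd c = {}"
    using assms by (auto simp: cells_def)
  show "finite (snd c)" "snd c \<subseteq> I"
    by (rule clique_finite[OF c(2)]) (rule clique_sub[OF c(2)])
qed

lemma cell_bottom:
  assumes "v \<in> V" "clique v S" shows "(flips (mk v \<inter> S) v, S) \<in> cells"
proof -
  have sub: "mk v \<inter> S \<subseteq> I" "mk v \<inter> S \<subseteq> S"
    using clique_sub[OF assms(2)] by auto
  have "flips (mk v \<inter> S) v \<in> V"
    by (rule flips_in[OF sub(1) assms(1)])
  moreover have "clique (flips (mk v \<inter> S) v) S"
    by (rule clique_flips[OF sub(2) assms])
  moreover have "mk (flips (mk v \<inter> S) v) \<inter> S = {}"
    unfolding mk_flips[OF sub(1) assms(1)] by blast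
  ultimately show ?thesis by (simp add: cells_def)
qed

lemma face_mk:
  assumes "d \<in> cells" "c \<in> cells" "face d c"
  shows "mk (fst d) \<inter> snd c \<subseteq> snd c - snd d" and "mk (fst d) = mk (fst c) \<union> (mk (fst d) \<inter> snd c)"
proof -
  show "mk (fst d) \<inter> snd c \<subseteq> snd c - snd d"
    using cells_D(3)[OF assms(1)] by blast
  have "mk (fst d) = sym_diff (mk (fst c)) (mk (fst d) \<inter> snd c)"
  proof -
    have "mk (fst d) \<inter> snd c \<subseteq> I" using cells_D(5)[OF assms(2)] by blast
    from mk_flips[OF this cells_D(1)[OF assms(2)]] show ?thesis
      using assms(3) by (simp add: face_def)
  qed
  then show "mk (fst d) = mk (fst c) \<union> (mk (fst d) \<inter> snd c)"
    using cells_D(3)[OF assms(2)] by blast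
qed

lemma face_refl: "c \<in> cells \<Longrightarrow> face c c"
  using cells_D(3)[of c] by (simp add: face_def)

lemma face_trans:
  assumes d: "d \<in> cells" and c: "c \<in> cells" and b: "b \<in> cells" and "face d c" "face c b"
  shows "face d b" and "\<And>i. i \<in> snd b - snd c \<Longrightarrow> i \<in> mk (fst d) \<longleftrightarrow> i \<in> mk (fst c)"
proof -
  let ?D = "mk (fst d) \<inter> snd c" and ?C = "mk (fst c) \<inter> snd b"
  have sub: "snd d \<subseteq> snd c" "snd c \<subseteq> snd b"
    using assms by (auto simp: face_def)
  note m = face_mk(2)[OF d c assms(4)] and m' = face_mk(2)[OF c b assms(5)]
  show "i \<in> mk (fst d) \<longleftrightarrow> i \<in> mk (fst c)" if "i \<in> snd b - snd c" for i
    using m that by blast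
  have "flips ?C (fst b) = fst c" "flips ?D (fst c) = fst d"
    using assms(4,5) by (auto simp: face_def)
  then have "fst d = flips ?D (flips ?C (fst b))"
    by simp
  also have "\<dots> = flips (sym_diff ?D ?C) (fst b)"
    by (rule flips_flips[OF cells_D(1,2)[OF b]]) (use sub in auto)
  also have "sym_diff ?D ?C = mk (fst d) \<inter> snd b"
    using m cells_D(3)[OF c] sub by blast
  finally have "flips (mk (fst d) \<inter> snd b) (fst b) = fst d" by (rule sym)
  then show "face d b" using sub by (simp add: face_def)
qed

lemma face_map_in:
  assumes "c \<in> cells" "d \<in> cells" "face d c" "x \<in> std_cube (card (snd d))"
  shows "face_map d c x \<in> std_cube (card (snd c))"
proof -
  have "-1 \<le> x k \<and> x k \<le> 1" for k
    using assms(4) by (cases "k < card (snd d)") (auto simp: std_cube_iff)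
  then show ?thesis
    unfolding face_map_def using assms(4)
    by (auto intro!: cube_point_in cells_D[OF assms(1)] simp: sg_def)
qed

lemma face_map_pos:
  assumes "c \<in> cells" "x \<in> std_cube (card (snd d))" "i \<in> snd c"
  shows "face_map d c x (pos (snd c) i) = (if i \<in> snd d then x (pos (snd d) i) else sg (fst d) i)"
  using assms cells_D(4)[OF assms(1)] by (simp add: face_map_def)

lemma face_map_image:
  assumes c: "c \<in> cells" and d: "d \<in> cells" and f: "face d c"
  shows "face_map d c ` std_cube (card (snd d)) =
    {x \<in> std_cube (card (snd c)). \<forall>i\<in>snd c - snd d. x (pos (snd c) i) = sg (fst d) i}" (is "_ = ?R")
proof
  show "face_map d c ` std_cube (card (snd d)) \<subseteq> ?R"
    using face_map_in[OF assms] face_map_pos[OF c, of _ d] by auto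
  show "?R \<subseteq> face_map d c ` std_cube (card (snd d))"
  proof
    fix x assume x: "x \<in> ?R"
    let ?y = "cube_point (snd d) (\<lambda>i. x (pos (snd c) i))"
    have fin: "finite (snd d)" "finite (snd c)" using cells_D c d by auto
    have sub: "snd d \<subseteq> snd c" using f by (simp add: face_def)
    have "-1 \<le> x k \<and> x k \<le> 1" for k
      using x by (cases "k < card (snd c)") (auto simp: std_cube_iff)
    then have y: "?y \<in> std_cube (card (snd d))"
      by (intro cube_point_in fin) auto
    have "face_map d c ?y = x"
    proof (rule std_cube_eqI[OF fin(2) face_map_in[OF assms y]])
      show "x \<in> std_cube (card (snd c))" using x by simp
      show "face_map d c ?y (pos (snd c) i) = x (pos (snd c) i)" if "i \<in> snd c" for i
        using face_map_pos[OF c y that] x that fin by auto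
    qed
    then show "x \<in> face_map d c ` std_cube (card (snd d))" using y by (metis image_eqI)
  qed
qed

lemma face_map_isometry:
  assumes c: "c \<in> cells" and d: "d \<in> cells" and f: "face d c"
  shows "cube_isometry (card (snd d)) (card (snd c)) (face_map d c)"
  unfolding cube_isometry_def
proof (intro conjI ballI)
  show "face_map d c ` std_cube (card (snd d)) \<subseteq> std_cube (card (snd c))"
    using face_map_in[OF assms] by blast
  fix x y assume xy: "x \<in> std_cube (card (snd d))" "y \<in> std_cube (card (snd d))"
  have fin: "finite (snd d)" "finite (snd c)" using cells_D c d by auto
  have sub: "snd d \<subseteq> snd c" using f by (simp add: face_def)
  let ?g = "\<lambda>i. (x (pos (snd d) i) - y (pos (snd d) i))\<^sup>2"
  have "(\<Sum>k<card (snd c). (face_map d c x k - face_map d c y k)\<^sup>2) =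
      (\<Sum>i\<in>snd c. if i \<in> snd d then ?g i else 0)"
    unfolding sum_pos[OF fin(2)]
    by (rule sum.cong) (auto simp: face_map_pos[OF c xy(1)] face_map_pos[OF c xy(2)])
  also have "\<dots> = (\<Sum>i\<in>snd d. ?g i)"
    using fin sub by (simp add: sum.If_cases Int_absorb1)
  also have "\<dots> = (\<Sum>k<card (snd d). (x k - y k)\<^sup>2)"
    unfolding sum_pos[OF fin(1)] ..
  finally show "L2_set (\<lambda>i. face_map d c x i - face_map d c y i) {..<card (snd c)} =
      L2_set (\<lambda>i. x i - y i) {..<card (snd d)}"
    by (simp add: L2_set_def)
qed

lemma face_map_face:
  assumes c: "c \<in> cells" and d: "d \<in> cells" and f: "face d c"
  shows "cube_face (card (snd c)) (face_map d c ` std_cube (card (snd d)))"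
proof -
  have fin: "finite (snd c)" using cells_D c by auto
  let ?J = "pos (snd c) ` (snd c - snd d)" and ?s = "\<lambda>k. sg (fst d) (axis_at (snd c) k)"
  have "?J \<subseteq> {..<card (snd c)}" using pos_less[OF fin] by auto
  moreover have "\<forall>k\<in>?J. ?s k \<in> {-1, 1}" by (simp add: sg_def)
  moreover have "face_map d c ` std_cube (card (snd d)) = {x \<in> std_cube (card (snd c)). \<forall>k\<in>?J. x k = ?s k}"
    unfolding face_map_image[OF assms] using axis_pos[OF fin] by auto
  ultimately show ?thesis
    unfolding cube_face_def by (intro exI[of _ ?J] exI[of _ ?s] conjI)
qed

lemma face_exists:
  assumes c: "c \<in> cells" and F: "cube_face (card (snd c)) F"
  obtains d where "d \<in> cells" "face d c" "face_map d c ` std_cube (card (snd d)) = F"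
proof -
  let ?S = "snd c"
  have fin: "finite ?S" using cells_D c by auto
  obtain J \<sigma> where J: "J \<subseteq> {..<card ?S}" "\<forall>i\<in>J. \<sigma> i \<in> {-1, 1}"
    and F: "F = {x \<in> std_cube (card ?S). \<forall>i\<in>J. x i = \<sigma> i}"
    using F unfolding cube_face_def by blast
  \<comment> \<open>The free axes are those whose coordinate is outside \<open>J\<close>. Of the
    fixed ones, those held at +1 must be flipped to reach the lowest vertex of the face.\<close>
  let ?S' = "{i \<in> ?S. pos ?S i \<notin> J}" and ?D = "{i \<in> ?S. pos ?S i \<in> J \<and> \<sigma> (pos ?S i) = 1}"
  define d where "d = (flips ?D (fst c), ?S')"
  have mk: "mk (flips ?D (fst c)) = sym_diff (mk (fst c)) ?D"
    by (rule mk_flips) (use cells_D[OF c] in auto)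
  have cl: "clique (flips ?D (fst c)) ?S"
    by (rule clique_flips) (use cells_D[OF c] in auto)
  have int: "mk (flips ?D (fst c)) \<inter> ?S = ?D"
    unfolding mk using cells_D(3)[OF c] by blast
  have "?D \<subseteq> I" using cells_D(5)[OF c] by auto
  then have "flips ?D (fst c) \<in> V" by (rule flips_in[OF _ cells_D(1)[OF c]])
  moreover have "clique (flips ?D (fst c)) ?S'"
    by (rule clique_mono[OF cl]) auto
  moreover have "mk (flips ?D (fst c)) \<inter> ?S' = {}"
    using int by blast
  ultimately have d: "d \<in> cells" by (simp add: cells_def d_def)
  have f: "face d c" unfolding face_def d_def fst_conv snd_conv int by auto
  have "(\<forall>i\<in>J. x i = \<sigma> i) \<longleftrightarrow> (\<forall>i\<in>?S - ?S'. x (pos ?S i) = sg (fst d) i)" for x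
  proof -
    have sg: "sg (fst d) i = \<sigma> (pos ?S i)" if "i \<in> ?S - ?S'" for i
    proof -
      have "i \<in> mk (fst d) \<longleftrightarrow> i \<in> ?D" using that int by (auto simp: d_def)
      then show ?thesis using that J(2) by (auto simp: sg_def)
    qed
    have J': "pos ?S ` (?S - ?S') = J"
      using J(1) pos_axis[OF fin] axis_in[OF fin] by (force simp: image_iff)
    have "(\<forall>i\<in>J. x i = \<sigma> i) \<longleftrightarrow> (\<forall>i\<in>?S - ?S'. x (pos ?S i) = \<sigma> (pos ?S i))"
      by (subst J'[symmetric], rule ball_simps(9))
    then show ?thesis using sg by (metis (no_types, lifting))
  qed
  then have "face_map d c ` std_cube (card (snd d)) = F"
    unfolding face_map_image[OF c d f] F by (simp add: d_def)
  then show ?thesis using that d f by blast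
qed

lemma face_unique:
  assumes c: "c \<in> cells" and d: "d \<in> cells" "face d c" and e: "e \<in> cells" "face e c"
    and eq: "face_map d c ` std_cube (card (snd d)) = face_map e c ` std_cube (card (snd e))"
  shows "d = e"
proof -
  let ?S = "snd c"
  have fin: "finite ?S" using cells_D c by auto
  have key: "snd e' \<subseteq> snd d' \<and> (\<forall>i\<in>?S - snd d'. i \<in> mk (fst d') \<longleftrightarrow> i \<in> mk (fst e'))"
    if d': "d' \<in> cells" "face d' c" and e': "e' \<in> cells" "face e' c"
      and eq: "face_map d' c ` std_cube (card (snd d')) = face_map e' c ` std_cube (card (snd e'))" for d' e'
  proof -
    \<comment> \<open>The centre of the face of \<open>e'\<close>. Its zero coordinates cannot be
      fixed on the face of \<open>d'\<close>, where fixed coordinates are -1 or 1, and its other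
      coordinates display the signs of \<open>e'\<close>.\<close>
    let ?x = "cube_point ?S (\<lambda>i. if i \<in> snd e' then 0 else sg (fst e') i)"
    have "?x \<in> std_cube (card ?S)" by (rule cube_point_in[OF fin]) (auto simp: sg_def)
    then have "?x \<in> face_map e' c ` std_cube (card (snd e'))"
      unfolding face_map_image[OF c e'] using fin by auto
    then have "\<forall>i\<in>?S - snd d'. ?x (pos ?S i) = sg (fst d') i"
      unfolding eq[symmetric] face_map_image[OF c d'] by blast
    then have x: "\<forall>i\<in>?S - snd d'. (if i \<in> snd e' then 0 else sg (fst e') i) = sg (fst d') i"
      using fin by simp
    have "snd e' \<subseteq> snd d'"
      using x e'(2) by (force simp: face_def sg_def split: if_splits)
    moreover have "\<forall>i\<in>?S - snd d'. i \<in> mk (fst d') \<longleftrightarrow> i \<in> mk (fst e')"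
      using x by (auto simp: sg_def split: if_splits)
    ultimately show ?thesis by blast
  qed
  have S: "snd d = snd e" using key[OF d e eq] key[OF e d eq[symmetric]] by blast
  have "mk (fst d) \<inter> ?S = mk (fst e) \<inter> ?S"
    using key[OF d e eq] S cells_D(3)[OF d(1)] cells_D(3)[OF e(1)] by blast
  then have "fst d = fst e" using d(2) e(2) by (simp add: face_def)
  then show ?thesis using S by (simp add: prod_eq_iff)
qed

lemma face_map_self: "c \<in> cells \<Longrightarrow> face_map c c = restrict id (std_cube (card (snd c)))"
proof
  fix x assume c: "c \<in> cells"
  show "face_map c c x = restrict id (std_cube (card (snd c))) x"
  proof (cases "x \<in> std_cube (card (snd c))")
    case True
    have "face_map c c x = x"
      by (rule std_cube_eqI[OF cells_D(4)[OF c] face_map_in[OF c c face_refl[OF c] True] True])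
        (simp add: face_map_pos[OF c True])
    then show ?thesis using True by simp
  next
    case False
    then show ?thesis by (simp add: face_map_def)
  qed
qed

lemma face_map_compose:
  assumes d: "d \<in> cells" and c: "c \<in> cells" and b: "b \<in> cells" and dc: "face d c" and cb: "face c b"
  shows "compose (std_cube (card (snd d))) (face_map c b) (face_map d c) = face_map d b"
proof
  fix x
  show "compose (std_cube (card (snd d))) (face_map c b) (face_map d c) x = face_map d b x"
  proof (cases "x \<in> std_cube (card (snd d))")
    case True
    note y = face_map_in[OF c d dc True]
    note t = face_trans[OF d c b dc cb]
    have sub: "snd d \<subseteq> snd c" "snd c \<subseteq> snd b" using dc cb by (auto simp: face_def)
    have "face_map c b (face_map d c x) = face_map d b x"
    proof (rule std_cube_eqI[OF cells_D(4)[OF b] face_map_in[OF b c cb y] face_map_in[OF b d t(1) True]])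
      fix i assume i: "i \<in> snd b"
      show "face_map c b (face_map d c x) (pos (snd b) i) = face_map d b x (pos (snd b) i)"
        unfolding face_map_pos[OF b y i] face_map_pos[OF b True i]
        using face_map_pos[OF c True, of i] sub t(2)[of i] i by (auto simp: sg_def)
    qed
    then show ?thesis using True by (simp add: compose_eq)
  next
    case False
    then show ?thesis by (simp add: compose_def face_map_def)
  qed
qed

theorem cube_complex_cubing: "cube_complex cubing"
  unfolding cube_complex_def
proof (intro conjI allI impI ballI)
  fix d' f c' assume "(d', f, c') \<in> gluings cubing"
  then obtain d c where g: "d \<in> cells" "c \<in> cells" "face d c" "d' = code d" "c' = code c" "f = face_map d c"
    unfolding gluings_cubing by blast
  show "d' \<in> cubes cubing" "c' \<in> cubes cubing" using g by (auto simp: cubes_cubing)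
  show "f \<in> extensional (std_cube (dimn cubing d'))" using g by (simp add: face_map_def)
  show "cube_isometry (dimn cubing d') (dimn cubing c') f" using g face_map_isometry by simp
  show "cube_face (dimn cubing c') (f ` std_cube (dimn cubing d'))" using g face_map_face by simp
next
  fix c' F assume c': "c' \<in> cubes cubing" and F: "cube_face (dimn cubing c') F"
  then obtain c where c: "c \<in> cells" "c' = code c" by (auto simp: cubes_cubing)
  obtain d where d: "d \<in> cells" "face d c" "face_map d c ` std_cube (card (snd d)) = F"
    by (rule face_exists[OF c(1), of F]) (use F c in auto)
  show "\<exists>!(d, f). (d, f, c') \<in> gluings cubing \<and> f ` std_cube (dimn cubing d) = F"
  proof (rule ex1I[of _ "(code d, face_map d c)"])
    show "case (code d, face_map d c) of (d, f) \<Rightarrow> (d, f, c') \<in> gluings cubing \<and> f ` std_cube (dimn cubing d) = F"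
      using d c by (auto simp: gluings_cubing)
    fix z assume "case z of (d, f) \<Rightarrow> (d, f, c') \<in> gluings cubing \<and> f ` std_cube (dimn cubing d) = F"
    then obtain e c2 where e: "e \<in> cells" "c2 \<in> cells" "face e c2" "c' = code c2" "z = (code e, face_map e c2)"
      "face_map e c2 ` std_cube (dimn cubing (code e)) = F"
      by (auto simp: gluings_cubing)
    have "c2 = c" using e c code_inject by auto
    then have "e = d" using face_unique[OF c(1) e(1) _ d(1,2)] e d(3) by simp
    then show "z = (code d, face_map d c)" using e \<open>c2 = c\<close> by simp
  qed
next
  fix c' assume "c' \<in> cubes cubing"
  then obtain c where c: "c \<in> cells" "c' = code c" by (auto simp: cubes_cubing)
  then show "(c', restrict id (std_cube (dimn cubing c')), c') \<in> gluings cubing"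
    unfolding gluings_cubing
    by (intro bexI[of _ c] conjI) (simp_all add: face_refl face_map_self)
next
  fix d' f c' g b' assume a: "(d', f, c') \<in> gluings cubing \<and> (c', g, b') \<in> gluings cubing"
  obtain d c where 1: "d \<in> cells" "c \<in> cells" "face d c" "d' = code d" "c' = code c" "f = face_map d c"
    using conjunct1[OF a] unfolding gluings_cubing by blast
  obtain c2 b where 2: "c2 \<in> cells" "b \<in> cells" "face c2 b" "c' = code c2" "b' = code b" "g = face_map c2 b"
    using conjunct2[OF a] unfolding gluings_cubing by blast
  have "code c2 = code c" using 1(5) 2(4) by simp
  then have c2: "c2 = c" using code_inject[OF 2(1) 1(2)] by simp
  note cb = 2(3)[unfolded c2]
  show "(d', compose (std_cube (dimn cubing d')) g f, b') \<in> gluings cubing"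
    unfolding gluings_cubing
  proof (intro bexI conjI)
    show "face d b" by (rule face_trans(1)[OF 1(1,2) 2(2) 1(3) cb])
    show "compose (std_cube (dimn cubing d')) g f = face_map d b"
      using face_map_compose[OF 1(1,2) 2(2) 1(3) cb] 1(1,4,6) 2(6) c2 by simp
  qed (use 1 2 in auto)
qed

end

lemma cube_vertices_iff: "x \<in> cube_vertices k \<longleftrightarrow> (\<forall>i\<ge>k. x i = 0) \<and> (\<forall>i<k. x i = -1 \<or> x i = 1)"
  by (auto simp: cube_vertices_def std_cube_iff)

context flip_system begin

section \<open>Corners, directed edges and links of the cubing\<close>

definition lowest :: "'v \<Rightarrow> 'i set \<Rightarrow> 'v" where
  "lowest v S = flips (mk v \<inter> S) v"

text \<open>A vertex of a cube is named by the vertex of the complex to which it is glued and by the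
  axes of the cube. A directed edge is the case of a single axis, so links and directed edges share
  one naming.\<close>

definition corner :: "'v \<Rightarrow> 'i set \<Rightarrow> nat \<times> (nat \<Rightarrow> real)" where
  "corner v S = (code (lowest v S, S), cube_point S (sg v))"

abbreviation dedge :: "'v \<Rightarrow> 'i \<Rightarrow> nat \<times> (nat \<Rightarrow> real)" where
  "dedge v i \<equiv> corner v {i}"

lemma lowest_cell: "v \<in> V \<Longrightarrow> clique v S \<Longrightarrow> (lowest v S, S) \<in> cells"
  unfolding lowest_def by (rule cell_bottom)

lemma vertex_cell: "v \<in> V \<Longrightarrow> (v, {}) \<in> cells"
  by (simp add: cells_def)

lemma flips_cancel: "v \<in> V \<Longrightarrow> clique v S \<Longrightarrow> D \<subseteq> S \<Longrightarrow> flips D (flips D v) = v"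
  using flips_flips[of v S D D] by simp

lemma face_vertex_lowest:
  assumes v: "v \<in> V" and S: "clique v S" shows "face (v, {}) (lowest v S, S)"
  using flips_cancel[OF v S, of "mk v \<inter> S"] by (simp add: face_def lowest_def)

lemma face_vertex:
  assumes v: "v \<in> V" and c: "c \<in> cells" and f: "face (v, {}) c"
  shows "clique v (snd c)" and "fst c = lowest v (snd c)"
proof -
  note C = cells_D[OF c]
  have e: "flips (mk v \<inter> snd c) (fst c) = v"
    using f by (simp add: face_def)
  show cl: "clique v (snd c)"
    using clique_flips[of "mk v \<inter> snd c" "snd c" "fst c"] C e by simp
  have "flips (mk v \<inter> snd c) (flips (mk v \<inter> snd c) (fst c)) = fst c"
    by (rule flips_cancel[OF C(1,2)]) simp
  then show "fst c = lowest v (snd c)"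
    unfolding lowest_def e by (rule sym)
qed

lemma cube_point_vertex: "finite S \<Longrightarrow> cube_point S (sg v) \<in> cube_vertices (card S)"
  by (auto simp: cube_vertices_iff cube_point_def sg_def)

lemma vertex_face_image:
  assumes v: "v \<in> V" and c: "c \<in> cells" and f: "face (v, {}) c"
  shows "face_map (v, {}) c ` std_cube 0 = {cube_point (snd c) (sg v)}"
proof -
  have fin: "finite (snd c)" using cells_D[OF c] by simp
  have "face_map (v, {}) c ` std_cube 0 =
      {x \<in> std_cube (card (snd c)). \<forall>i\<in>snd c. x (pos (snd c) i) = sg v i}"
    using face_map_image[OF c vertex_cell[OF v] f] by simp
  also have "\<dots> = {cube_point (snd c) (sg v)}"
  proof -
    have "cube_point (snd c) (sg v) \<in> std_cube (card (snd c))"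
      by (rule cube_point_in[OF fin]) (auto simp: sg_def)
    then show ?thesis
      using std_cube_eqI[OF fin] fin by auto
  qed
  finally show ?thesis .
qed

lemma corners_at_cubing:
  assumes v: "v \<in> V"
  shows "corners_at cubing (code (v, {})) = {corner v S | S. clique v S}"
proof (intro equalityI subsetI)
  fix cu assume "cu \<in> corners_at cubing (code (v, {}))"
  then obtain c u f where cu: "cu = (code c, u)" "c \<in> cells" "(code (v, {}), f, code c) \<in> gluings cubing"
      "f ` std_cube (dimn cubing (code (v, {}))) = {u}"
    by (auto simp: corners_at_def cubes_cubing)
  obtain d c' where d: "d \<in> cells" "c' \<in> cells" "face d c'" "code (v, {}) = code d" "code c = code c'" "f = face_map d c'"
    using cu(3) unfolding gluings_cubing by blast
  have "d = (v, {})" "c' = c"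
    using d code_inject[OF vertex_cell[OF v] d(1)] code_inject[OF cu(2) d(2)] by auto
  then have f: "face (v, {}) c" "f = face_map (v, {}) c"
    using d by auto
  have "u = cube_point (snd c) (sg v)"
    using cu(4) vertex_face_image[OF v cu(2) f(1)] vertex_cell[OF v] by (simp add: f(2))
  moreover have "code c = code (lowest v (snd c), snd c)"
    using face_vertex(2)[OF v cu(2) f(1)] by (metis prod.collapse)
  ultimately show "cu \<in> {corner v S | S. clique v S}"
    using face_vertex(1)[OF v cu(2) f(1)] cu(1) unfolding corner_def by blast
next
  fix cu assume "cu \<in> {corner v S | S. clique v S}"
  then obtain S where S: "clique v S" and cu: "cu = corner v S" by blast
  let ?c = "(lowest v S, S)"
  have c: "?c \<in> cells" and f: "face (v, {}) ?c"
    using lowest_cell[OF v S] face_vertex_lowest[OF v S] by auto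
  have "(code (v, {}), face_map (v, {}) ?c, code ?c) \<in> gluings cubing"
    unfolding gluings_cubing using c f vertex_cell[OF v] by blast
  then show "cu \<in> corners_at cubing (code (v, {}))"
    using vertex_face_image[OF v c f] vertex_cell[OF v] c cube_point_vertex[OF clique_finite[OF S]]
    unfolding corners_at_def cu corner_def by (auto simp: cubes_cubing)
qed

lemma sg_eq_iff: "sg v i = sg w i \<longleftrightarrow> (i \<in> mk v \<longleftrightarrow> i \<in> mk w)"
  by (simp add: sg_def)

text \<open>The signs at the corner give the mark of \<open>v\<close> within \<open>S\<close>, and
  flipping these axes leads back from the lowest vertex to \<open>v\<close>.\<close>

lemma corner_inject:
  assumes v: "v \<in> V" "w \<in> V" and S: "clique v S" "clique w R" and eq: "corner v S = corner w R"
  shows "S = R" and "v = w"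
proof -
  have c: "code (lowest v S, S) = code (lowest w R, R)" and p: "cube_point S (sg v) = cube_point R (sg w)"
    using eq by (auto simp: corner_def)
  have e: "(lowest v S, S) = (lowest w R, R)"
    using c unfolding code_inject[OF lowest_cell[OF v(1) S(1)] lowest_cell[OF v(2) S(2)]] .
  show R: "S = R" using arg_cong[OF e, of snd] by simp
  have l: "lowest v S = lowest w R" using arg_cong[OF e, of fst] by simp
  have "sg v i = sg w i" if "i \<in> S" for i
    using fun_cong[OF p, of "pos S i"] that clique_finite[OF S(1)] R by simp
  then have "mk v \<inter> S = mk w \<inter> S"
    unfolding sg_eq_iff by blast
  then have m: "mk v \<inter> S = mk w \<inter> R" using R by simp
  have "flips (mk v \<inter> S) (lowest v S) = v"
    unfolding lowest_def by (rule flips_cancel[OF v(1) S(1)]) simp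
  moreover have "flips (mk w \<inter> R) (lowest w R) = w"
    unfolding lowest_def by (rule flips_cancel[OF v(2) S(2)]) simp
  ultimately show "v = w" unfolding m l by (rule trans[OF sym])
qed

lemma dedge_inject:
  assumes "v \<in> V" "w \<in> V" "i \<in> I" "j \<in> I" "dedge v i = dedge w j"
  shows "i = j" "v = w"
  using corner_inject[of v w "{i}" "{j}"] assms by auto

lemma lowest_single: "lowest v {i} = (if i \<in> mk v then flip i v else v)"
  by (cases "i \<in> mk v") (auto simp: lowest_def Int_insert_right)

lemma directed_edges_cubing: "directed_edges cubing = {dedge v i | v i. v \<in> V \<and> i \<in> I}"
proof (intro equalityI subsetI)
  fix ep assume "ep \<in> directed_edges cubing"
  then obtain c p where c: "ep = (code c, p)" "c \<in> cells" "card (snd c) = 1" "p \<in> cube_vertices 1"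
    by (auto simp: directed_edges_def cubes_cubing)
  then obtain i where i: "snd c = {i}" by (meson card_1_singletonE)
  note C = cells_D[OF c(2)]
  have iI: "i \<in> I" "i \<notin> mk (fst c)" using C i by auto
  define v where "v = (if p 0 = 1 then flip i (fst c) else fst c)"
  have vV: "v \<in> V" using C iI flip_in by (auto simp: v_def)
  have mv: "i \<in> mk v \<longleftrightarrow> p 0 = 1"
    using mk_flip[OF iI(1) C(1)] iI by (auto simp: v_def)
  have "lowest v {i} = fst c"
    unfolding lowest_single mv using flip_flip[OF iI(1) C(1)] by (auto simp: v_def)
  moreover have "p = cube_point {i} (sg v)"
  proof
    fix k show "p k = cube_point {i} (sg v) k"
      using c(4) mv by (cases "k = 0") (auto simp: cube_vertices_iff cube_point_def sg_def)
  qed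
  ultimately have "ep = dedge v i"
    using c(1) i unfolding corner_def by (metis prod.collapse)
  then show "ep \<in> {dedge v i | v i. v \<in> V \<and> i \<in> I}" using vV iI by blast
next
  fix ep assume "ep \<in> {dedge v i | v i. v \<in> V \<and> i \<in> I}"
  then obtain v i where v: "v \<in> V" "i \<in> I" and ep: "ep = dedge v i" by blast
  have "(lowest v {i}, {i}) \<in> cells" by (rule lowest_cell) (use v in auto)
  then show "ep \<in> directed_edges cubing"
    using cube_point_vertex[of "{i}" v] unfolding ep corner_def
    by (auto simp: directed_edges_def cubes_cubing)
qed

lemma edges_from_cubing:
  assumes v: "v \<in> V" shows "edges_from cubing (code (v, {})) = dedge v ` I"
proof (intro equalityI subsetI)
  fix a assume "a \<in> edges_from cubing (code (v, {}))"
  then have "a \<in> directed_edges cubing" "a \<in> corners_at cubing (code (v, {}))"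
    by (auto simp: edges_from_def)
  then obtain w i S where a: "a = dedge w i" "w \<in> V" "i \<in> I" "a = corner v S" "clique v S"
    unfolding directed_edges_cubing corners_at_cubing[OF v] by blast
  then have "w = v" using corner_inject(2)[of w v "{i}" S] v by simp
  then show "a \<in> dedge v ` I" using a by blast
next
  fix a assume "a \<in> dedge v ` I"
  then show "a \<in> edges_from cubing (code (v, {}))"
    unfolding edges_from_def directed_edges_cubing corners_at_cubing[OF v] using v by auto
qed

lemma face_dedge:
  assumes v: "v \<in> V" and S: "clique v S" and i: "i \<in> S"
  shows "face (lowest v {i}, {i}) (lowest v S, S)"
    and "face_map (lowest v {i}, {i}) (lowest v S, S) (cube_point {i} (sg v)) = cube_point S (sg v)"
proof -
  have iI: "i \<in> I" using clique_sub[OF S] i by blast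
  have fin: "finite S" by (rule clique_finite[OF S])
  have mk: "mk (lowest v {i}) = mk v - {i}"
    using mk_flip[OF iI v] by (auto simp: lowest_single)
  have "flips (mk v \<inter> S - {i}) (flips (mk v \<inter> S) v) = flips (sym_diff (mk v \<inter> S - {i}) (mk v \<inter> S)) v"
    by (rule flips_flips[OF v S]) auto
  also have "sym_diff (mk v \<inter> S - {i}) (mk v \<inter> S) = mk v \<inter> {i}"
    using i by blast
  finally show f: "face (lowest v {i}, {i}) (lowest v S, S)"
    using i mk by (simp add: face_def lowest_def Int_Diff Diff_Int_distrib2 Int_commute)
  have c: "(lowest v S, S) \<in> cells" "(lowest v {i}, {i}) \<in> cells"
    using lowest_cell[OF v S] lowest_cell[OF v, of "{i}"] iI by auto
  have p: "cube_point {i} (sg v) \<in> std_cube (card (snd (lowest v {i}, {i})))"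
    using cube_point_in[of "{i}" "sg v"] by (simp add: sg_def)
  show "face_map (lowest v {i}, {i}) (lowest v S, S) (cube_point {i} (sg v)) = cube_point S (sg v)"
  proof (rule std_cube_eqI[OF fin])
    show "face_map (lowest v {i}, {i}) (lowest v S, S) (cube_point {i} (sg v)) \<in> std_cube (card S)"
      using face_map_in[OF c f p] by simp
    show "cube_point S (sg v) \<in> std_cube (card S)"
      by (rule cube_point_in[OF fin]) (simp add: sg_def)
    fix j assume j: "j \<in> S"
    show "face_map (lowest v {i}, {i}) (lowest v S, S) (cube_point {i} (sg v)) (pos S j) = cube_point S (sg v) (pos S j)"
      using face_map_pos[OF c(1) p, of j] j fin cube_point_pos[of "{i}" i "sg v"] mk by (auto simp: sg_def)
  qed
qed

text \<open>The inclusion from left to right has content: an edge glued into the cube and starting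
  at this corner has the marks of \<open>v\<close> within \<open>S\<close>. Going through the lowest
  vertex of the cube, its own lowest vertex is that of \<open>dedge v i\<close>.\<close>

lemma corner_edges_cubing:
  assumes v: "v \<in> V" and S: "clique v S"
  shows "corner_edges cubing (corner v S) = dedge v ` S"
proof (intro equalityI subsetI)
  let ?c = "(lowest v S, S)"
  have fin: "finite S" by (rule clique_finite[OF S])
  note c = lowest_cell[OF v S]
  fix a assume "a \<in> corner_edges cubing (corner v S)"
  then obtain e p f where a: "a = (e, p)" "a \<in> directed_edges cubing" "(e, f, code ?c) \<in> gluings cubing"
      "f p = cube_point S (sg v)"
    by (auto simp: corner_edges_def corner_def)
  from a(2) obtain w i where w: "w \<in> V" "i \<in> I" "a = dedge w i" unfolding directed_edges_cubing by blast
  let ?d = "(lowest w {i}, {i})"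
  have d: "?d \<in> cells" by (rule lowest_cell[OF w(1)]) (use w in simp)
  have ep: "e = code ?d" "p = cube_point {i} (sg w)" using w(3) a(1) by (auto simp: corner_def)
  obtain d' c' where "d' \<in> cells" "c' \<in> cells" "face d' c'" "e = code d'" "code ?c = code c'" "f = face_map d' c'"
    using a(3) unfolding gluings_cubing by blast
  then have f: "face ?d ?c" "f = face_map ?d ?c"
    using code_inject[OF d] code_inject[OF c] ep by auto
  have i: "i \<in> S" using f by (simp add: face_def)
  have p: "p \<in> std_cube (card (snd ?d))"
    using cube_point_in[of "{i}" "sg w"] ep by (simp add: sg_def)
  have val: "(if j = i then sg w i else sg (lowest w {i}) j) = sg v j" if "j \<in> S" for j
    using face_map_pos[OF c p, of j] that a(4) f(2) fin ep(2) cube_point_pos[of "{i}" i "sg w"] by (auto split: if_splits)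
  have mkl: "mk (lowest w {i}) = mk w - {i}"
    using mk_flip[OF w(2,1)] by (auto simp: lowest_single)
  have "sg w j = sg v j" if "j \<in> S" for j
    using val[OF that] mkl by (auto simp: sg_def split: if_splits)
  then have mkS: "mk w \<inter> S = mk v \<inter> S"
    unfolding sg_eq_iff by blast
  have cl: "clique (lowest v S) S" by (rule cells_D(2)[OF c, simplified])
  have "lowest w {i} = flips (mk v \<inter> S - {i}) (lowest v S)"
    using f(1) mkl mkS by (auto simp: face_def Int_Diff Diff_Int_distrib2)
  also have "\<dots> = flips (sym_diff (mk v \<inter> S - {i}) (mk v \<inter> S)) v"
    unfolding lowest_def by (rule flips_flips[OF v S]) auto
  also have "sym_diff (mk v \<inter> S - {i}) (mk v \<inter> S) = mk v \<inter> {i}"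
    using i by blast
  finally have "lowest w {i} = lowest v {i}" by (simp add: lowest_def)
  moreover have "cube_point {i} (sg w) = cube_point {i} (sg v)"
    using val[OF i] by (auto simp: cube_point_def)
  ultimately have "a = dedge v i" using w(3) by (simp add: corner_def)
  then show "a \<in> dedge v ` S" using i by blast
next
  fix a assume "a \<in> dedge v ` S"
  then obtain i where i: "i \<in> S" "a = dedge v i" by blast
  have iI: "i \<in> I" using clique_sub[OF S] i by blast
  have "(code (lowest v {i}, {i}), face_map (lowest v {i}, {i}) (lowest v S, S), code (lowest v S, S)) \<in> gluings cubing"
    unfolding gluings_cubing using face_dedge(1)[OF v S i(1)] lowest_cell[OF v S] lowest_cell[OF v, of "{i}"] iI by auto
  moreover have "a \<in> directed_edges cubing"
    unfolding directed_edges_cubing using i v iI by blast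
  ultimately show "a \<in> corner_edges cubing (corner v S)"
    using face_dedge(2)[OF v S i(1)] unfolding corner_edges_def i(2) corner_def by auto
qed

lemma zero_cubes_cubing: "zero_cubes cubing = (\<lambda>v. code (v, {})) ` V"
proof -
  have "c \<in> cells \<and> card (snd c) = 0 \<longleftrightarrow> (\<exists>v\<in>V. c = (v, {}))" for c
    using cells_D[of c] vertex_cell by (cases c) auto
  then show ?thesis
    unfolding zero_cubes_def cubes_cubing by (auto simp: image_iff) (metis dimn_cubing snd_conv card.empty)+
qed

lemma inj_dedge: "v \<in> V \<Longrightarrow> inj_on (dedge v) I"
  by (rule inj_onI) (metis dedge_inject(1))

lemma link_simplices_cubing:
  assumes "v \<in> V" shows "link_simplices cubing (code (v, {})) = {dedge v ` S | S. clique v S}"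
  unfolding link_simplices_def corners_at_cubing[OF assms]
  using corner_edges_cubing[OF assms] by (auto simp: image_iff) metis

text \<open>The link at \<open>v\<close> is the clique complex of the graph \<open>ort v\<close> on
  the axes, and clique complexes are flag. Injectivity of \<open>dedge v\<close> makes it
  simplicial.\<close>

theorem nonpositively_curved_cubing: "nonpositively_curved cubing"
  unfolding nonpositively_curved_def
proof (intro ballI conjI)
  fix z assume "z \<in> zero_cubes cubing"
  then obtain v where v: "v \<in> V" "z = code (v, {})" by (auto simp: zero_cubes_cubing)
  note inj = inj_dedge[OF v(1)]
  show "link_simplicial cubing z"
    unfolding link_simplicial_def v(2) corners_at_cubing[OF v(1)]
  proof (intro conjI ballI)
    fix cu assume "cu \<in> {corner v S | S. clique v S}"
    then obtain S where S: "clique v S" "cu = corner v S" by blast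
    have "card (dedge v ` S) = card S"
      by (rule card_image[OF inj_on_subset[OF inj clique_sub[OF S(1)]]])
    then show "case cu of (c, u) \<Rightarrow> card (corner_edges cubing (c, u)) = dimn cubing c"
      using corner_edges_cubing[OF v(1) S(1)] lowest_cell[OF v(1) S(1)] unfolding S(2) corner_def by simp
  next
    show "inj_on (corner_edges cubing) {corner v S | S. clique v S}"
    proof (rule inj_onI)
      fix a b assume "a \<in> {corner v S | S. clique v S}" "b \<in> {corner v S | S. clique v S}"
        and eq: "corner_edges cubing a = corner_edges cubing b"
      then obtain S R where S: "clique v S" "a = corner v S" and R: "clique v R" "b = corner v R" by blast
      have "dedge v ` S = dedge v ` R"
        using eq corner_edges_cubing[OF v(1) S(1)] corner_edges_cubing[OF v(1) R(1)] S R by simp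
      then have "S = R"
        using inj_on_image_eq_iff[OF inj clique_sub[OF S(1)] clique_sub[OF R(1)]] by simp
      then show "a = b" using S R by simp
    qed
  qed
  show "link_flag cubing z"
    unfolding link_flag_def v(2) edges_from_cubing[OF v(1)] link_simplices_cubing[OF v(1)]
  proof (intro allI impI)
    fix A assume A: "finite A \<and> A \<subseteq> dedge v ` I \<and>
      (\<forall>a\<in>A. \<forall>b\<in>A. a \<noteq> b \<longrightarrow> {a, b} \<in> {dedge v ` S | S. clique v S})"
    then obtain S where S: "S \<subseteq> I" "A = dedge v ` S" by (meson subset_imageE)
    have "clique v S"
      unfolding clique_def
    proof (intro conjI S(1) ballI impI)
      fix i j assume ij: "i \<in> S" "j \<in> S" "i \<noteq> j"
      then have "dedge v i \<noteq> dedge v j" using inj S(1) by (meson inj_on_eq_iff subsetD)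
      then obtain R where R: "{dedge v i, dedge v j} = dedge v ` R" "clique v R"
        using A ij S(2) by blast
      have "dedge v ` {i, j} = dedge v ` R" using R(1) by simp
      then have "{i, j} = R"
        using inj_on_image_eq_iff[OF inj _ clique_sub[OF R(2)], of "{i, j}"] ij S(1) by auto
      then show "ort v i j" using R(2) ij by (auto simp: clique_def)
    qed
    then show "A \<in> {dedge v ` S | S. clique v S}" using S(2) by blast
  qed
qed

lemma forms_square_corner_cubing:
  assumes v: "v \<in> V" and ij: "i \<in> I" "j \<in> I" "i \<noteq> j"
  shows "forms_square_corner cubing (dedge v i) (dedge v j) \<longleftrightarrow> ort v i j"
proof
  assume "ort v i j"
  then have S: "clique v {i, j}" using ij by (simp add: clique_pair)
  have "corner_edges cubing (corner v {i, j}) = {dedge v i, dedge v j}"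
    using corner_edges_cubing[OF v S] by simp
  moreover have "card {i, j} = 2" using ij by simp
  ultimately show "forms_square_corner cubing (dedge v i) (dedge v j)"
    using lowest_cell[OF v S] cube_point_vertex[of "{i, j}" v]
    unfolding forms_square_corner_def corner_def cubes_cubing
    by (intro bexI[of _ "code (lowest v {i, j}, {i, j})"] bexI[of _ "cube_point {i, j} (sg v)"]) auto
next
  assume "forms_square_corner cubing (dedge v i) (dedge v j)"
  then obtain c u where c: "c \<in> cells" "u \<in> cube_vertices 2" "card (snd c) = 2"
    and e: "corner_edges cubing (code c, u) = {dedge v i, dedge v j}"
    unfolding forms_square_corner_def cubes_cubing by auto
  note C = cells_D[OF c(1)]
  \<comment> \<open>Flipping the axes with coordinate +1 at \<open>u\<close> recovers the vertex
    \<open>w\<close> of the complex at this corner, so the known description of corners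
    applies.\<close>
  let ?D = "{k \<in> snd c. u (pos (snd c) k) = 1}"
  define w where "w = flips ?D (fst c)"
  have DI: "?D \<subseteq> I" "?D \<subseteq> snd c" using C by auto
  have w: "w \<in> V" unfolding w_def by (rule flips_in[OF DI(1) C(1)])
  have cl: "clique w (snd c)" unfolding w_def by (rule clique_flips[OF DI(2) C(1,2)])
  have mkw: "mk w \<inter> snd c = ?D"
    unfolding w_def mk_flips[OF DI(1) C(1)] using C(3) by blast
  have "lowest w (snd c) = fst c"
    using flips_cancel[OF C(1,2) DI(2)] unfolding lowest_def mkw unfolding w_def .
  moreover have "u = cube_point (snd c) (sg w)"
  proof (rule std_cube_eqI[OF C(4)])
    show "u \<in> std_cube (card (snd c))" using c by (simp add: cube_vertices_def)
    show "cube_point (snd c) (sg w) \<in> std_cube (card (snd c))"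
      by (rule cube_point_in[OF C(4)]) (simp add: sg_def)
    fix k assume k: "k \<in> snd c"
    have "k \<in> mk w \<longleftrightarrow> u (pos (snd c) k) = 1" using mkw k by blast
    moreover have "u (pos (snd c) k) = -1 \<or> u (pos (snd c) k) = 1"
      using c pos_less[OF C(4) k] by (auto simp: cube_vertices_iff)
    ultimately show "u (pos (snd c) k) = cube_point (snd c) (sg w) (pos (snd c) k)"
      using k C(4) by (auto simp: sg_def)
  qed
  ultimately have "(code c, u) = corner w (snd c)" by (simp add: corner_def)
  then have eq: "dedge w ` snd c = {dedge v i, dedge v j}" using e corner_edges_cubing[OF w cl] by simp
  have "dedge v i \<in> dedge w ` snd c" unfolding eq by simp
  then obtain k where k: "dedge v i = dedge w k" "k \<in> snd c" by (rule imageE)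
  have kI: "k \<in> I" using C(5) k(2) by (rule subsetD)
  have wv: "w = v" by (rule dedge_inject(2)[OF v w ij(1) kI k(1), symmetric])
  have "dedge v ` snd c = dedge v ` {i, j}" using eq wv by simp
  then have "snd c = {i, j}"
    using inj_on_image_eq_iff[OF inj_dedge[OF v] C(5), of "{i, j}"] ij by simp
  then show "ort v i j" using cl wv ij by (simp add: clique_pair)
qed

end

section \<open>Equivalence closures, quotient topologies and sums of spaces\<close>

lemma equiv_equiv_closure: "equiv UNIV (equiv_closure r)"
  unfolding equiv_closure_def equiv_def
  by (auto simp: refl_rtrancl trans_rtrancl intro!: sym_rtrancl sym_Un_converse)

lemma equiv_closure_invariant:
  assumes "(a, b) \<in> equiv_closure r" "\<And>a b. (a, b) \<in> r \<Longrightarrow> f a = f b"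
  shows "f a = f b"
  using assms(1) unfolding equiv_closure_def
  by (induction rule: rtrancl_induct) (auto dest: assms(2))

lemma equiv_closure_base: "(a, b) \<in> r \<Longrightarrow> (a, b) \<in> equiv_closure r"
  by (auto simp: equiv_closure_def)

lemma equiv_closure_refl: "(a, a) \<in> equiv_closure r"
  by (simp add: equiv_closure_def)

lemma equiv_closure_sym: "(a, b) \<in> equiv_closure r \<Longrightarrow> (b, a) \<in> equiv_closure r"
  by (meson equiv_equiv_closure equivE symE)

lemma equiv_closure_trans:
  "(a, b) \<in> equiv_closure r \<Longrightarrow> (b, c) \<in> equiv_closure r \<Longrightarrow> (a, c) \<in> equiv_closure r"
  by (meson equiv_equiv_closure equivE transE)

text \<open>\<open>topology\<close> inverts \<open>openin\<close> only on families that are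
  topologies. For intersections this rests on the disjointness of classes: a class met by both
  unions belongs to both families.\<close>

lemma openin_quotient_topology:
  assumes R: "equiv UNIV R"
  shows "openin (quotient_topology T R) U \<longleftrightarrow> U \<subseteq> topspace T // R \<and> openin T (\<Union>U)"
proof -
  have "istopology (\<lambda>U. U \<subseteq> topspace T // R \<and> openin T (\<Union>U))"
    unfolding istopology_def
  proof (intro conjI allI impI)
    fix U W assume U: "U \<subseteq> topspace T // R \<and> openin T (\<Union>U)" and W: "W \<subseteq> topspace T // R \<and> openin T (\<Union>W)"
    have disj: "A = B" if "A \<in> U" "B \<in> W" "x \<in> A" "x \<in> B" for A B x
    proof -
      have "A \<in> UNIV // R" "B \<in> UNIV // R"
        using U W that by (auto simp: quotient_def)
      then show ?thesis using quotient_disj[OF R] that by blast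
    qed
    have "\<Union>(U \<inter> W) = \<Union>U \<inter> \<Union>W"
      using disj by blast
    then show "openin T (\<Union>(U \<inter> W))" using U W by auto
    show "U \<inter> W \<subseteq> topspace T // R" using U by auto
  next
    fix \<K> assume K: "\<forall>K\<in>\<K>. K \<subseteq> topspace T // R \<and> openin T (\<Union>K)"
    then show "\<Union>\<K> \<subseteq> topspace T // R" by blast
    have "\<Union>(\<Union>\<K>) = (\<Union>K\<in>\<K>. \<Union>K)" by blast
    then show "openin T (\<Union>(\<Union>\<K>))" using K by auto
  qed
  then show ?thesis
    unfolding quotient_topology_def by (simp add: topology_inverse')
qed

lemma topspace_quotient_topology:
  assumes R: "equiv UNIV R" and sat: "\<And>x y. x \<in> topspace T \<Longrightarrow> (x, y) \<in> R \<Longrightarrow> y \<in> topspace T"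
  shows "topspace (quotient_topology T R) = topspace T // R" and "\<Union>(topspace T // R) = topspace T"
proof -
  show U: "\<Union>(topspace T // R) = topspace T"
    using sat equiv_class_self[OF R] by (fastforce simp: quotient_def)
  have "openin (quotient_topology T R) (topspace T // R)"
    unfolding openin_quotient_topology[OF R] U by simp
  then show "topspace (quotient_topology T R) = topspace T // R"
    unfolding topspace_def openin_quotient_topology[OF R] by blast
qed

text \<open>Used for functions invariant under the relation, for which every representative gives
  the same value.\<close>

definition descend :: "('a \<Rightarrow> 'b) \<Rightarrow> 'a set \<Rightarrow> 'b" where
  "descend g C = g (SOME x. x \<in> C)"

lemma descend_class:
  assumes R: "equiv UNIV R" and inv: "\<And>x y. (x, y) \<in> R \<Longrightarrow> g x = g y"
  shows "descend g (R `` {x}) = g x"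
proof -
  have "(SOME y. y \<in> R `` {x}) \<in> R `` {x}"
    by (rule someI[of _ x]) (rule equiv_class_self[OF R], simp)
  then show ?thesis unfolding descend_def using inv by auto
qed

lemma continuous_map_descend:
  assumes R: "equiv UNIV R" and inv: "\<And>x y. (x, y) \<in> R \<Longrightarrow> g x = g y"
    and sat: "\<And>x y. x \<in> topspace T \<Longrightarrow> (x, y) \<in> R \<Longrightarrow> y \<in> topspace T"
    and g: "continuous_map T Y g"
  shows "continuous_map (quotient_topology T R) Y (descend g)"
proof -
  have ts: "topspace (quotient_topology T R) = topspace T // R"
    by (rule topspace_quotient_topology(1)[OF R sat])
  have dc: "descend g (R `` {x}) = g x" for x
    by (rule descend_class[OF R inv])
  show ?thesis
    unfolding continuous_map_def ts
  proof (intro conjI allI impI)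
  show "descend g \<in> topspace T // R \<rightarrow> topspace Y"
    using g dc by (auto simp: quotient_def continuous_map_def)
  fix W assume W: "openin Y W"
  have "\<Union>{C \<in> topspace T // R. descend g C \<in> W} = {x \<in> topspace T. g x \<in> W}"
  proof (intro equalityI subsetI)
    fix x assume "x \<in> \<Union>{C \<in> topspace T // R. descend g C \<in> W}"
    then obtain y where y: "y \<in> topspace T" "(y, x) \<in> R" "descend g (R `` {y}) \<in> W"
      by (auto simp: quotient_def)
    then show "x \<in> {x \<in> topspace T. g x \<in> W}"
      using dc[of y] inv[OF y(2)] sat[OF y(1,2)] by simp
  next
    fix x assume x: "x \<in> {x \<in> topspace T. g x \<in> W}"
    then have "R `` {x} \<in> {C \<in> topspace T // R. descend g C \<in> W}"
      using dc[of x] by (simp add: quotientI)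
    moreover have "x \<in> R `` {x}" by (rule equiv_class_self[OF R]) simp
    ultimately show "x \<in> \<Union>{C \<in> topspace T // R. descend g C \<in> W}" by blast
  qed
  then show "openin (quotient_topology T R) {C \<in> topspace T // R. descend g C \<in> W}"
    unfolding openin_quotient_topology[OF R] using openin_continuous_map_preimage[OF g W] by auto
  qed
qed

lemma compact_space_quotient_topology:
  assumes R: "equiv UNIV R" and sat: "\<And>x y. x \<in> topspace T \<Longrightarrow> (x, y) \<in> R \<Longrightarrow> y \<in> topspace T"
    and T: "compact_space T"
  shows "compact_space (quotient_topology T R)"
proof -
  have ts: "topspace (quotient_topology T R) = topspace T // R"
    by (rule topspace_quotient_topology(1)[OF R sat])
  have "continuous_map T (quotient_topology T R) (\<lambda>x. R `` {x})"
    unfolding continuous_map_def ts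
  proof (intro conjI allI impI)
    show "(\<lambda>x. R `` {x}) \<in> topspace T \<rightarrow> topspace T // R"
      by (simp add: quotientI)
    fix U assume "openin (quotient_topology T R) U"
    then have U: "U \<subseteq> topspace T // R" "openin T (\<Union>U)"
      unfolding openin_quotient_topology[OF R] by auto
    have "{x \<in> topspace T. R `` {x} \<in> U} = \<Union>U"
    proof (intro equalityI subsetI)
      fix x assume "x \<in> {x \<in> topspace T. R `` {x} \<in> U}"
      then show "x \<in> \<Union>U" using equiv_class_self[OF R, of x] by blast
    next
      fix x assume "x \<in> \<Union>U"
      then obtain y where y: "R `` {y} \<in> U" "y \<in> topspace T" "(y, x) \<in> R"
        using U(1) by (auto simp: quotient_def)
      then have "R `` {x} = R `` {y}" using equiv_class_eq[OF R] by metis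
      then show "x \<in> {x \<in> topspace T. R `` {x} \<in> U}" using y sat by simp
    qed
    then show "openin T {x \<in> topspace T. R `` {x} \<in> U}" using U(2) by simp
  qed
  from image_compactin[OF _ this, of "topspace T"] T
  have "compactin (quotient_topology T R) ((\<lambda>x. R `` {x}) ` topspace T)"
    by (simp add: compact_space_def)
  moreover have "(\<lambda>x. R `` {x}) ` topspace T = topspace T // R"
    by (auto simp: quotient_def)
  ultimately show ?thesis by (simp add: compact_space_def ts)
qed

lemma cube_topology_eq: "cube_topology k = top_of_set (std_cube k)"
proof -
  have "std_cube k \<subseteq> {x. \<forall>i\<ge>k. x i = 0}" by (auto simp: std_cube_iff)
  then have "{x. \<forall>i\<ge>k. x i = 0} \<inter> std_cube k = std_cube k" by blast
  then show ?thesis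
    by (simp add: cube_topology_def Euclidean_space_def subtopology_subtopology euclidean_product_topology)
qed

lemma compact_std_cube: "compact_space (cube_topology k)"
proof -
  have "std_cube k = PiE UNIV (\<lambda>i. if i < k then {-1..1} else {0})"
    by (force simp: std_cube_iff PiE_def Pi_def split: if_splits)
  moreover have "compactin (product_topology (\<lambda>i. euclideanreal) UNIV) (PiE UNIV (\<lambda>i. if i < k then {-1..1} else {0}))"
    unfolding compactin_PiE by auto
  ultimately show ?thesis
    unfolding cube_topology_eq by (simp add: euclidean_product_topology compact_space_subtopology)
qed

lemma continuous_map_sum_topology:
  assumes "\<And>i. i \<in> I \<Longrightarrow> continuous_map (X i) Y (\<lambda>x. g (i, x))"
  shows "continuous_map (sum_topology X I) Y g"
  unfolding continuous_map_def topspace_sum_topology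
proof (intro conjI allI impI)
  show "g \<in> Sigma I (topspace \<circ> X) \<rightarrow> topspace Y"
    using assms by (fastforce simp: continuous_map_def Pi_iff)
  fix U assume U: "openin Y U"
  show "openin (sum_topology X I) {x \<in> Sigma I (topspace \<circ> X). g x \<in> U}"
    unfolding openin_sum_topology
  proof (intro conjI ballI)
    fix i assume i: "i \<in> I"
    have "{x. (i, x) \<in> {x \<in> Sigma I (topspace \<circ> X). g x \<in> U}} = {x \<in> topspace (X i). g (i, x) \<in> U}"
      using i by auto
    then show "openin (X i) {x. (i, x) \<in> {x \<in> Sigma I (topspace \<circ> X). g x \<in> U}}"
      using openin_continuous_map_preimage[OF assms[OF i] U] by simp
  qed auto
qed

lemma compact_space_sum_topology:
  assumes fin: "finite I" and X: "\<And>i. i \<in> I \<Longrightarrow> compact_space (X i)"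
  shows "compact_space (sum_topology X I)"
proof -
  have "compactin (sum_topology X I) (\<Union>i\<in>I. Pair i ` topspace (X i))"
  proof (rule compactin_Union)
    show "finite ((\<lambda>i. Pair i ` topspace (X i)) ` I)" using fin by simp
    fix A assume "A \<in> (\<lambda>i. Pair i ` topspace (X i)) ` I"
    then obtain i where i: "i \<in> I" "A = Pair i ` topspace (X i)" by blast
    show "compactin (sum_topology X I) A"
      unfolding i(2) using image_compactin[OF _ continuous_map_component_injection[OF i(1)]] X[OF i(1)]
      by (simp add: compact_space_def)
  qed
  moreover have "(\<Union>i\<in>I. Pair i ` topspace (X i)) = topspace (sum_topology X I)" by auto
  ultimately show ?thesis by (simp add: compact_space_def)
qed

section \<open>The realization is homeomorphic to the model\<close>

context flip_system begin

definition cell_coord :: "'i set \<Rightarrow> (nat \<Rightarrow> real) \<Rightarrow> 'i \<Rightarrow> real" where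
  "cell_coord S x i = (if i \<in> S then (1 + x (pos S i)) / 2 else 0)"

definition cell_point :: "nat \<times> (nat \<Rightarrow> real) \<Rightarrow> 'v \<Rightarrow> real" where
  "cell_point cx = weight (fst (decode (fst cx))) (cell_coord (snd (decode (fst cx))) (snd cx))"

lemma cell_point: "c \<in> cells \<Longrightarrow> cell_point (code c, x) = weight (fst c) (cell_coord (snd c) x)"
  by (simp add: cell_point_def)

definition points :: "(nat \<times> (nat \<Rightarrow> real)) set" where
  "points = {(c, x). c \<in> cubes cubing \<and> x \<in> std_cube (dimn cubing c)}"

lemma weight_rebase_set:
  assumes v: "v \<in> V" and S: "clique v S" "{j. y j \<noteq> 0} \<subseteq> S" and D: "D \<subseteq> S"
  shows "weight v y = weight (flips D v) (\<lambda>i. if i \<in> D then 1 - y i else y i)"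
proof -
  have "finite D" using D clique_finite[OF S(1)] finite_subset by blast
  then show ?thesis using D
  proof (induction D)
    case (insert i D)
    let ?y = "\<lambda>i. if i \<in> D then 1 - y i else y i"
    have i: "i \<in> S" "D \<subseteq> S" using insert.prems by auto
    have u: "flips D v \<in> V" by (rule flips_in[OF subset_trans[OF i(2) clique_sub[OF S(1)]] v])
    have cu: "clique (flips D v) S" by (rule clique_flips[OF i(2) v S(1)])
    have sub: "{j. ?y j \<noteq> 0} \<subseteq> S" using S(2) i(2) by (auto split: if_splits)
    have "flip i (flips D v) = flips (sym_diff {i} D) v"
      using flips_flips[OF v S(1), of "{i}" D] i by simp
    also have "sym_diff {i} D = insert i D" using insert.hyps(2) by blast
    finally have f: "flip i (flips D v) = flips (insert i D) v" .
    have "?y(i := 1 - ?y i) = (\<lambda>j. if j \<in> insert i D then 1 - y j else y j)"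
      using insert.hyps(2) by auto
    then show ?case
      using insert.IH[OF i(2)] weight_rebase[OF u cu sub i(1)] f by simp
  qed simp
qed

lemma cell_coord_in:
  assumes c: "c \<in> cells" and x: "x \<in> std_cube (card (snd c))"
  shows "cell_coord (snd c) x \<in> coords (fst c)"
proof -
  have k: "-1 \<le> x k \<and> x k \<le> 1" for k
    using x by (cases "k < card (snd c)") (auto simp: std_cube_iff)
  have "0 \<le> cell_coord (snd c) x i \<and> cell_coord (snd c) x i \<le> 1" for i
    using k[of "pos (snd c) i"] by (simp add: cell_coord_def)
  moreover have "clique (fst c) {i. cell_coord (snd c) x i \<noteq> 0}"
    by (rule clique_mono[OF cells_D(2)[OF c]]) (auto simp: cell_coord_def)
  ultimately show ?thesis by (simp add: coords_def)
qed

text \<open>Passing from the lowest vertex of \<open>c\<close> to that of \<open>d\<close> rebases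
  the axes held at +1; their coordinate 1 turns into 0, so only the axes of \<open>d\<close>
  remain.\<close>

lemma cell_point_face:
  assumes d: "d \<in> cells" and c: "c \<in> cells" and f: "face d c" and x: "x \<in> std_cube (card (snd d))"
  shows "cell_point (code c, face_map d c x) = cell_point (code d, x)"
proof -
  let ?y = "cell_coord (snd c) (face_map d c x)" and ?D = "mk (fst d) \<inter> snd c"
  note C = cells_D[OF c]
  have sub: "snd d \<subseteq> snd c" and fl: "flips ?D (fst c) = fst d" using f by (auto simp: face_def)
  have "weight (fst c) ?y = weight (flips ?D (fst c)) (\<lambda>i. if i \<in> ?D then 1 - ?y i else ?y i)"
    by (rule weight_rebase_set[OF C(1,2)]) (auto simp: cell_coord_def)
  moreover have "(if i \<in> ?D then 1 - ?y i else ?y i) = cell_coord (snd d) x i" for i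
  proof (cases "i \<in> snd c")
    case True
    then show ?thesis
      using face_map_pos[OF c x True] cells_D(3)[OF d] sub by (auto simp: cell_coord_def sg_def)
  next
    case False then show ?thesis using sub by (auto simp: cell_coord_def)
  qed
  ultimately show ?thesis
    unfolding cell_point[OF c] cell_point[OF d] fl by simp
qed

lemma glue_base: "((d', x), (c', y)) \<in>
    {((d, x), (c, f x)) | d f c x. (d, f, c) \<in> gluings cubing \<and> x \<in> std_cube (dimn cubing d)} \<longleftrightarrow>
    (\<exists>d\<in>cells. \<exists>c\<in>cells. face d c \<and> x \<in> std_cube (card (snd d)) \<and> d' = code d \<and> c' = code c \<and> y = face_map d c x)"
  (is "?L \<longleftrightarrow> ?R")
proof
  assume ?L
  then obtain f where f: "(d', f, c') \<in> gluings cubing" "x \<in> std_cube (dimn cubing d')" "y = f x"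
    by blast
  then show ?R unfolding gluings_cubing by (metis dimn_cubing)
next
  assume ?R
  then obtain d c where "d \<in> cells" "c \<in> cells" "face d c" "x \<in> std_cube (card (snd d))"
      "d' = code d" "c' = code c" "y = face_map d c x" by blast
  then have "(d', face_map d c, c') \<in> gluings cubing" "x \<in> std_cube (dimn cubing d')" "y = face_map d c x"
    unfolding gluings_cubing by auto
  then show ?L by blast
qed

lemma glue_rel_cell_point: "(a, b) \<in> glue_rel cubing \<Longrightarrow> cell_point a = cell_point b"
proof (unfold glue_rel_def, erule equiv_closure_invariant)
  fix a b assume "(a, b) \<in> {((d, x), (c, f x)) | d f c x. (d, f, c) \<in> gluings cubing \<and> x \<in> std_cube (dimn cubing d)}"
  then show "cell_point a = cell_point b"
    using cell_point_face by (cases a; cases b) (auto simp only: glue_base)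
qed

lemma glue_rel_points: "(a, b) \<in> glue_rel cubing \<Longrightarrow> a \<in> points \<longleftrightarrow> b \<in> points"
proof (unfold glue_rel_def, erule equiv_closure_invariant)
  fix a b assume ab: "(a, b) \<in> {((d, x), (c, f x)) | d f c x. (d, f, c) \<in> gluings cubing \<and> x \<in> std_cube (dimn cubing d)}"
  obtain d' x where a: "a = (d', x)" by (cases a)
  obtain c' y where b: "b = (c', y)" by (cases b)
  obtain d c where "d \<in> cells" "c \<in> cells" "face d c" "x \<in> std_cube (card (snd d))" "d' = code d" "c' = code c"
      "y = face_map d c x"
    using ab unfolding a b glue_base by blast
  then show "a \<in> points \<longleftrightarrow> b \<in> points"
    unfolding a b using face_map_in by (auto simp: points_def cubes_cubing)
qed

lemma glue_rel_equiv: "equiv UNIV (glue_rel cubing)"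
  unfolding glue_rel_def by (rule equiv_equiv_closure)

text \<open>Fixing the coordinates that equal -1 or 1 gives the smallest face containing the point,
  and in that face the point is interior.\<close>

lemma interior_face:
  assumes c: "c \<in> cells" and x: "x \<in> std_cube (card (snd c))"
  obtains d z where "d \<in> cells" "z \<in> std_cube (card (snd d))" "((code d, z), (code c, x)) \<in> glue_rel cubing"
    "face d c" "x = face_map d c z" "\<And>i. i \<in> snd d \<Longrightarrow> \<bar>z (pos (snd d) i)\<bar> < 1"
proof -
  let ?J = "{k \<in> {..<card (snd c)}. x k = -1 \<or> x k = 1}"
  let ?F = "{w \<in> std_cube (card (snd c)). \<forall>k\<in>?J. w k = x k}"
  note fin = cells_D(4)[OF c]
  have F: "cube_face (card (snd c)) ?F"
    unfolding cube_face_def by (intro exI[of _ ?J] exI[of _ x]) auto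
  obtain d where d: "d \<in> cells" "face d c" "face_map d c ` std_cube (card (snd d)) = ?F"
    by (rule face_exists[OF c F])
  have "x \<in> ?F" using x by simp
  then obtain z where z: "z \<in> std_cube (card (snd d))" "x = face_map d c z"
    unfolding d(3)[symmetric] by (elim imageE)
  have "((code d, z), (code c, x)) \<in> glue_rel cubing"
    unfolding glue_rel_def
    by (rule equiv_closure_base, unfold glue_base) (use d c z in blast)
  moreover have "\<bar>z (pos (snd d) i)\<bar> < 1" if i: "i \<in> snd d" for i
  proof (rule ccontr)
    assume n: "\<not> \<bar>z (pos (snd d) i)\<bar> < 1"
    have ic: "i \<in> snd c" using d(2) i by (auto simp: face_def)
    have zi: "z (pos (snd d) i) = x (pos (snd c) i)"
      using face_map_pos[OF c z(1) ic] i z(2) by simp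
    have "-1 \<le> x (pos (snd c) i) \<and> x (pos (snd c) i) \<le> 1"
      using x pos_less[OF fin ic] by (simp add: std_cube_iff)
    then have J: "pos (snd c) i \<in> ?J"
      using n zi pos_less[OF fin ic] by auto
    \<comment> \<open>The centre of the face would share the coordinate -1 or 1 in question, but a
      free axis has coordinate 0 there.\<close>
    let ?w = "cube_point (snd d) (\<lambda>_. 0)"
    have w: "?w \<in> std_cube (card (snd d))"
      by (rule cube_point_in[OF cells_D(4)[OF d(1)]]) auto
    then have "face_map d c ?w \<in> ?F" using d(3) by blast
    then have "face_map d c ?w (pos (snd c) i) = x (pos (snd c) i)" using J by blast
    moreover have "face_map d c ?w (pos (snd c) i) = 0"
      using face_map_pos[OF c w ic] i cells_D(4)[OF d(1)] by simp
    ultimately show False using J by auto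
  qed
  ultimately show ?thesis using that[OF d(1) z(1) _ d(2) z(2)] by blast
qed

lemma odds_support_walk:
  assumes f: "f \<in> model" shows "f v \<noteq> 0 \<Longrightarrow> set l \<subseteq> {i. odds f v i \<noteq> 0} \<Longrightarrow>
    {i. odds f (walk l v) i \<noteq> 0} = {i. odds f v i \<noteq> 0}"
proof (induction l arbitrary: v)
  case (Cons i l)
  have i: "odds f v i \<noteq> 0" using Cons.prems by simp
  note o = odds_flip[OF f Cons.prems(1) i]
  have eq: "{j. odds f (flip i v) j \<noteq> 0} = {j. odds f v j \<noteq> 0}"
    using i less_imp_neq[OF model_chart(3)[OF f Cons.prems(1), of i]] by (auto simp: o(2))
  show ?case using Cons.IH[OF o(1)] Cons.prems(2) eq by simp
qed simp

lemma odds_support_eq: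
  assumes f: "f \<in> model" "f v \<noteq> 0" "f w \<noteq> 0"
  shows "{i. odds f w i \<noteq> 0} = {i. odds f v i \<noteq> 0}"
proof -
  note s = model_support[OF f]
  let ?D = "sym_diff (mk v) (mk w)"
  have e: "set (enum_set ?D) = ?D"
    using enum_set s(1) clique_finite unfolding joined_def by blast
  have w: "walk (enum_set ?D) v = w"
    using s(1) by (simp add: joined_def flips_def)
  have "set (enum_set ?D) \<subseteq> {i. odds f v i \<noteq> 0}" using s(2) unfolding e .
  from odds_support_walk[OF f(1,2) this] show ?thesis unfolding w .
qed

text \<open>For an interior point the support of the coordinates is the full set of axes of its
  cell, and the support is the same in every chart. The two lowest vertices can differ only in marks
  of these axes, yet neither has any of them.\<close>

lemma interior_unique:
  assumes d: "d \<in> cells" "z \<in> std_cube (card (snd d))" "\<And>i. i \<in> snd d \<Longrightarrow> \<bar>z (pos (snd d) i)\<bar> < 1"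
    and e: "e \<in> cells" "w \<in> std_cube (card (snd e))" "\<And>i. i \<in> snd e \<Longrightarrow> \<bar>w (pos (snd e) i)\<bar> < 1"
    and eq: "cell_point (code d, z) = cell_point (code e, w)"
  shows "d = e" and "z = w"
proof -
  have key: "cell_point (code d, z) \<in> model \<and> cell_point (code d, z) (fst d) \<noteq> 0 \<and>
      odds (cell_point (code d, z)) (fst d) = cell_coord (snd d) z \<and> {i. cell_coord (snd d) z i \<noteq> 0} = snd d"
    if d: "d \<in> cells" "z \<in> std_cube (card (snd d))" "\<And>i. i \<in> snd d \<Longrightarrow> \<bar>z (pos (snd d) i)\<bar> < 1" for d z
  proof -
    note D = cells_D[OF d(1)]
    note y = cell_coord_in[OF d(1,2)]
    have lt: "\<forall>i. cell_coord (snd d) z i < 1"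
    proof
      fix i show "cell_coord (snd d) z i < 1"
        using d(3)[of i] by (cases "i \<in> snd d") (auto simp: cell_coord_def)
    qed
    have "{i. cell_coord (snd d) z i \<noteq> 0} = snd d"
    proof (intro equalityI subsetI CollectI)
      fix i assume i: "i \<in> snd d"
      then show "cell_coord (snd d) z i \<noteq> 0" using d(3)[OF i] by (auto simp: cell_coord_def)
    qed (auto simp: cell_coord_def split: if_splits)
    moreover have "weight (fst d) (cell_coord (snd d) z) (fst d) \<noteq> 0"
      unfolding weight_base using lt finite_I by (simp add: less_imp_neq)
    ultimately show ?thesis
      unfolding cell_point[OF d(1)] using odds_weight[OF D(1) y lt] weight_in_model[OF D(1) y] by simp
  qed
  let ?f = "cell_point (code d, z)"
  note kd = key[OF d] and ke = key[OF e, folded eq]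
  have S: "snd d = snd e"
    using odds_support_eq[of ?f "fst d" "fst e"] kd ke by metis
  have j: "joined (fst d) (fst e)" and sub: "sym_diff (mk (fst d)) (mk (fst e)) \<subseteq> snd d"
    using model_support(1,2)[of ?f "fst d" "fst e"] kd ke by auto
  have E: "sym_diff (mk (fst d)) (mk (fst e)) = {}"
    using sub cells_D(3)[OF d(1)] cells_D(3)[OF e(1)] S by blast
  have v: "fst d = fst e" using j unfolding joined_def E by simp
  then show "d = e" using S by (simp add: prod_eq_iff)
  have "cell_coord (snd d) z = cell_coord (snd e) w" using kd ke v by metis
  then have co: "cell_coord (snd d) z = cell_coord (snd d) w" using S by simp
  show "z = w"
  proof (rule std_cube_eqI[OF cells_D(4)[OF d(1)] d(2)])
    show "w \<in> std_cube (card (snd d))" using e(2) S by simp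
    show "z (pos (snd d) i) = w (pos (snd d) i)" if "i \<in> snd d" for i
      using fun_cong[OF co, of i] that by (simp add: cell_coord_def)
  qed
qed

text \<open>Both points are glued to interior points of faces, and on interior points
  \<open>cell_point\<close> is injective. So equality in the model is exactly gluing.\<close>

lemma cell_point_eq_glue:
  assumes a: "a \<in> points" and b: "b \<in> points" and eq: "cell_point a = cell_point b"
  shows "(a, b) \<in> glue_rel cubing"
proof -
  obtain c x where a: "a = (code c, x)" "c \<in> cells" "x \<in> std_cube (card (snd c))"
    using a by (auto simp: points_def cubes_cubing)
  obtain c' x' where b: "b = (code c', x')" "c' \<in> cells" "x' \<in> std_cube (card (snd c'))"
    using b by (auto simp: points_def cubes_cubing)
  obtain d z where d: "d \<in> cells" "z \<in> std_cube (card (snd d))" "((code d, z), a) \<in> glue_rel cubing"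
    "\<And>i. i \<in> snd d \<Longrightarrow> \<bar>z (pos (snd d) i)\<bar> < 1"
    using interior_face[OF a(2,3)] unfolding a(1) by metis
  obtain e w where e: "e \<in> cells" "w \<in> std_cube (card (snd e))" "((code e, w), b) \<in> glue_rel cubing"
    "\<And>i. i \<in> snd e \<Longrightarrow> \<bar>w (pos (snd e) i)\<bar> < 1"
    using interior_face[OF b(2,3)] unfolding b(1) by metis
  have "cell_point (code d, z) = cell_point (code e, w)"
    using glue_rel_cell_point[OF d(3)] glue_rel_cell_point[OF e(3)] eq by simp
  then have de: "d = e" "z = w" using interior_unique[OF d(1,2,4) e(1,2,4)] by auto
  show ?thesis
    using equiv_closure_trans[OF equiv_closure_sym[OF d(3)[unfolded glue_rel_def]]
        e(3)[unfolded glue_rel_def, folded de]]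
    unfolding glue_rel_def .
qed

abbreviation cell_sum :: "(nat \<times> (nat \<Rightarrow> real)) topology" where
  "cell_sum \<equiv> sum_topology (\<lambda>c. cube_topology (dimn cubing c)) (cubes cubing)"

lemma topspace_cell_sum: "topspace cell_sum = points"
  by (auto simp: points_def cube_topology_eq)

lemma topspace_realization: "topspace (realization cubing) = points // glue_rel cubing"
  unfolding realization_def
  using topspace_quotient_topology(1)[OF glue_rel_equiv, of cell_sum] glue_rel_points
  unfolding topspace_cell_sum by blast

lemma compact_realization: "compact_space (realization cubing)"
  unfolding realization_def
proof (rule compact_space_quotient_topology[OF glue_rel_equiv])
  show "y \<in> topspace cell_sum" if "x \<in> topspace cell_sum" "(x, y) \<in> glue_rel cubing" for x y
    using glue_rel_points that unfolding topspace_cell_sum by blast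
  show "compact_space cell_sum"
    by (rule compact_space_sum_topology) (auto simp: cubes_cubing finite_cells compact_std_cube)
qed

lemma cell_point_in_model: "a \<in> points \<Longrightarrow> cell_point a \<in> model"
  using cell_coord_in weight_in_model cells_D(1) by (auto simp: points_def cubes_cubing cell_point)

lemma cell_point_surj:
  assumes "f \<in> model" obtains a where "a \<in> points" "cell_point a = f"
proof -
  obtain v y where v: "v \<in> V" "y \<in> coords v" "f = weight v y"
    using assms by (auto simp: model_def)
  let ?S = "{i. y i \<noteq> 0}" and ?c = "(lowest v {i. y i \<noteq> 0}, {i. y i \<noteq> 0})"
  let ?D = "mk v \<inter> ?S"
  have S: "clique v ?S" by (rule coords_clique[OF v(2)])
  have fin: "finite ?S" by (rule clique_finite[OF S])
  have c: "?c \<in> cells" by (rule lowest_cell[OF v(1) S])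
  let ?z = "\<lambda>i. if i \<in> ?D then 1 - y i else y i"
  have z: "0 \<le> ?z i \<and> ?z i \<le> 1" for i
    using coords_bounds[OF v(2), of i] by simp
  let ?x = "cube_point ?S (\<lambda>i. 2 * ?z i - 1)"
  have "-1 \<le> 2 * ?z i - 1 \<and> 2 * ?z i - 1 \<le> 1" for i
    using z[of i] by linarith
  then have x: "?x \<in> std_cube (card ?S)"
    by (rule cube_point_in[OF fin])
  have "f = weight (flips ?D v) ?z"
    unfolding v(3) by (rule weight_rebase_set[OF v(1) S]) auto
  moreover have "?z = cell_coord ?S ?x"
    using fin by (auto simp: cell_coord_def)
  ultimately have "cell_point (code ?c, ?x) = f"
    unfolding cell_point[OF c] by (simp add: lowest_def)
  moreover have "(code ?c, ?x) \<in> points"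
    using c x by (auto simp: points_def cubes_cubing)
  ultimately show ?thesis using that by blast
qed

lemma continuous_cell_point: "continuous_map cell_sum (top_of_set model) cell_point"
proof (rule continuous_map_sum_topology)
  fix c' assume "c' \<in> cubes cubing"
  then obtain c where c: "c \<in> cells" "c' = code c" by (auto simp: cubes_cubing)
  have "continuous_on (std_cube (card (snd c))) (\<lambda>x. weight (fst c) (cell_coord (snd c) x))"
  proof (rule continuous_on_weight)
    fix i
    have "continuous_on (std_cube (card (snd c))) (\<lambda>x. x (pos (snd c) i))"
      by (rule continuous_on_product_then_coordinatewise) (rule continuous_on_id)
    then show "continuous_on (std_cube (card (snd c))) (\<lambda>x. cell_coord (snd c) x i)"
      unfolding cell_coord_def by (cases "i \<in> snd c") (auto intro!: continuous_intros)
  qed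
  moreover have "weight (fst c) (cell_coord (snd c) x) \<in> model" if "x \<in> std_cube (card (snd c))" for x
    by (rule weight_in_model[OF cells_D(1)[OF c(1)] cell_coord_in[OF c(1) that]])
  ultimately show "continuous_map (cube_topology (dimn cubing c')) (top_of_set model) (\<lambda>x. cell_point (c', x))"
    using c by (auto simp: cube_topology_eq cell_point continuous_map_in_subtopology)
qed

definition to_model :: "(nat \<times> (nat \<Rightarrow> real)) set \<Rightarrow> 'v \<Rightarrow> real" where
  "to_model = descend cell_point"

lemma to_model_class: "to_model (glue_rel cubing `` {a}) = cell_point a"
  unfolding to_model_def by (rule descend_class[OF glue_rel_equiv glue_rel_cell_point])

text \<open>A continuous bijection from a compact space to a Hausdorff space; continuity of the
  inverse comes for free.\<close>

theorem homeomorphic_realization: "homeomorphic_map (realization cubing) (top_of_set model) to_model"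
proof (rule continuous_imp_homeomorphic_map)
  show "continuous_map (realization cubing) (top_of_set model) to_model"
    unfolding realization_def to_model_def
  proof (rule continuous_map_descend[OF glue_rel_equiv glue_rel_cell_point _ continuous_cell_point])
    show "y \<in> topspace cell_sum" if "x \<in> topspace cell_sum" "(x, y) \<in> glue_rel cubing" for x y
      using glue_rel_points that unfolding topspace_cell_sum by blast
  qed
  show "compact_space (realization cubing)" by (rule compact_realization)
  have "Hausdorff_space (euclidean :: ('v \<Rightarrow> real) topology)"
    unfolding euclidean_product_topology[symmetric] by (simp add: Hausdorff_space_product_topology)
  then show "Hausdorff_space (top_of_set model)" by (rule Hausdorff_space_subtopology)
  show "to_model ` topspace (realization cubing) = topspace (top_of_set model)"
  proof (intro equalityI subsetI)
    fix f assume "f \<in> to_model ` topspace (realization cubing)"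
    then show "f \<in> topspace (top_of_set model)"
      unfolding topspace_realization quotient_def using to_model_class cell_point_in_model by auto
  next
    fix f assume "f \<in> topspace (top_of_set model)"
    then obtain a where a: "a \<in> points" "cell_point a = f" using cell_point_surj[of f] by auto
    then show "f \<in> to_model ` topspace (realization cubing)"
      unfolding topspace_realization using to_model_class[of a] quotientI[OF a(1), of "glue_rel cubing"]
      by (metis image_eqI)
  qed
  show "inj_on to_model (topspace (realization cubing))"
  proof (rule inj_onI)
    fix A B assume "A \<in> topspace (realization cubing)" "B \<in> topspace (realization cubing)"
      and eq: "to_model A = to_model B"
    then obtain a b where a: "a \<in> points" "A = glue_rel cubing `` {a}" and b: "b \<in> points" "B = glue_rel cubing `` {b}"
      unfolding topspace_realization by (auto elim!: quotientE)
    have "(a, b) \<in> glue_rel cubing"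
      by (rule cell_point_eq_glue[OF a(1) b(1)]) (use eq a b to_model_class in simp)
    then show "A = B" using a b equiv_class_eq[OF glue_rel_equiv] by simp
  qed
qed

section \<open>Hyperplanes\<close>

text \<open>The edges with axis \<open>i\<close> at \<open>v\<close> and \<open>w\<close> coincide or are opposite in a square. So the classes of \<open>par i\<close>
  are the hyperplanes dual to edges with axis \<open>i\<close>.\<close>

definition par_step :: "'i \<Rightarrow> ('v \<times> 'v) set" where
  "par_step i = {(v, w). v \<in> V \<and> (w = flip i v \<or> (\<exists>j\<in>I. ort v i j \<and> w = flip j v))}"

abbreviation par :: "'i \<Rightarrow> ('v \<times> 'v) set" where
  "par i \<equiv> equiv_closure (par_step i)"

lemma par_step_sym: "i \<in> I \<Longrightarrow> (v, w) \<in> par_step i \<Longrightarrow> (w, v) \<in> par_step i"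
proof -
  assume i: "i \<in> I" and vw: "(v, w) \<in> par_step i"
  then have v: "v \<in> V" by (simp add: par_step_def)
  from vw consider "w = flip i v" | j where "j \<in> I" "ort v i j" "w = flip j v"
    unfolding par_step_def by blast
  then show ?thesis
  proof cases
    case 1
    then show ?thesis using flip_flip[OF i v] flip_in[OF i v] by (simp add: par_step_def)
  next
    case (2 j)
    have "ort (flip j v) i j"
      by (rule ort_sym[OF ort_flip[OF v 2(1) i ort_sym[OF 2(2)]]])
    then have o: "ort w i j" using 2(3) by simp
    have w: "v = flip j w" "w \<in> V"
      unfolding 2(3) using flip_flip[OF 2(1) v] flip_in[OF 2(1) v] by auto
    show ?thesis unfolding par_step_def using 2(1) o w by fast
  qed
qed

lemma par_eq_rtrancl: "i \<in> I \<Longrightarrow> par i = (par_step i)\<^sup>*"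
proof -
  assume "i \<in> I"
  then have "par_step i \<union> (par_step i)\<inverse> = par_step i" using par_step_sym by blast
  then show ?thesis by (simp add: equiv_closure_def)
qed

lemma par_walk:
  "v \<in> V \<Longrightarrow> clique v S \<Longrightarrow> i \<in> S \<Longrightarrow> set l \<subseteq> S \<Longrightarrow> (v, walk l v) \<in> par i"
proof (induction l arbitrary: v)
  case Nil then show ?case by (simp add: equiv_closure_refl)
next
  case (Cons j l)
  have j: "j \<in> S" "j \<in> I" using Cons.prems clique_sub by auto
  have "(v, flip j v) \<in> par_step i"
  proof (cases "j = i")
    case False
    then have "ort v i j" using Cons.prems(2,3) j(1) by (simp add: clique_def)
    then show ?thesis using Cons.prems(1) j(2) by (auto simp: par_step_def)
  qed (use Cons.prems(1) in \<open>simp add: par_step_def\<close>)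
  then have "(v, flip j v) \<in> par i" by (rule equiv_closure_base)
  moreover have "(flip j v, walk l (flip j v)) \<in> par i"
    by (rule Cons.IH) (use Cons.prems j flip_in clique_flip in auto)
  ultimately show ?case using equiv_closure_trans by simp
qed

lemma par_flips: "v \<in> V \<Longrightarrow> clique v S \<Longrightarrow> i \<in> S \<Longrightarrow> D \<subseteq> S \<Longrightarrow> (v, flips D v) \<in> par i"
  unfolding flips_def using par_walk[of v S i "enum_set D"] enum_set[of D] clique_finite finite_subset by metis

lemma lowest_flip:
  assumes "v \<in> V" "clique v S" "i \<in> S" shows "lowest (flip i v) S = lowest v S"
proof -
  have iI: "i \<in> I" using assms clique_sub by blast
  have "mk (flip i v) \<inter> S = sym_diff (mk v \<inter> S) {i}"
    unfolding mk_flip[OF iI assms(1)] using assms(3) by blast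
  then show ?thesis
    unfolding lowest_def using flips_flip[OF assms(1,2) _ assms(3), of "mk v \<inter> S"] by simp
qed

lemma mk_lowest_single: "v \<in> V \<Longrightarrow> i \<in> I \<Longrightarrow> mk (lowest v {i}) = mk v - {i}"
  using mk_flip by (auto simp: lowest_single)

text \<open>In the square spanned by \<open>i\<close> and \<open>j\<close> the two edges lie on
  different sides of the axis \<open>j\<close>, hence are disjoint. Both run from
  \<open>sg v i\<close> to its negative in the coordinate of \<open>i\<close>.\<close>

lemma opposite_flip:
  assumes v: "v \<in> V" and ij: "i \<in> I" "j \<in> I" and o: "ort v i j"
  shows "(dedge v i, dedge (flip j v) i) \<in> opposite_in_square cubing"
proof -
  have ne: "i \<noteq> j" using o ort_irrefl by blast
  let ?S = "{i, j}" and ?w = "flip j v"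
  have S: "clique v ?S" using o ij ne by (simp add: clique_pair)
  have w: "?w \<in> V" using flip_in ij v by blast
  have Sw: "clique ?w ?S" by (rule clique_flip[OF v S]) simp
  have low: "lowest ?w ?S = lowest v ?S" by (rule lowest_flip[OF v S]) simp
  let ?c = "(lowest v ?S, ?S)" and ?d = "(lowest v {i}, {i})" and ?d' = "(lowest ?w {i}, {i})"
  have c: "?c \<in> cells" by (rule lowest_cell[OF v S])
  have d: "?d \<in> cells" "?d' \<in> cells" using lowest_cell[of _ "{i}"] v w ij by auto
  have f: "face ?d ?c" using face_dedge(1)[OF v S, of i] by simp
  have f': "face ?d' ?c" using face_dedge(1)[OF w Sw, of i] by (simp add: low)
  let ?p = "cube_point {i} (sg v)"
  have sgi: "sg ?w i = sg v i"
    using mk_flip[OF ij(2) v] ne by (auto simp: sg_def)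
  have p': "cube_point {i} (sg ?w) = ?p"
    using sgi by (auto simp: cube_point_def)
  have pi: "?p 0 = sg v i"
    using cube_point_pos[of "{i}" i "sg v"] by simp
  have p: "?p \<in> std_cube (card (snd (q, {i})))" "antipode ?p \<in> std_cube (card (snd (q, {i})))" for q :: 'v
    using cube_point_in[of "{i}" "sg v"] cube_point_in[of "{i}" "\<lambda>k. - sg v k"]
    by (auto simp: sg_def std_cube_iff antipode_def cube_point_def)
  have diff: "face_map (q, {i}) ?c (antipode ?p) k - face_map (q, {i}) ?c ?p k =
      (if k = pos ?S i then - 2 * sg v i else 0)" if "(q, {i}) \<in> cells" "face (q, {i}) ?c" for q k
  proof (cases "k < card ?S")
    case True
    then obtain m where m: "m \<in> ?S" "k = pos ?S m"
      using axis_in[of ?S k] pos_axis[of ?S k] by (metis finite.emptyI finite.insertI)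
    have "m = i \<longleftrightarrow> k = pos ?S i" using pos_inj[of ?S m i] m by simp
    then show ?thesis
      using face_map_pos[OF c p(1), of m] face_map_pos[OF c p(2), of m] m pi
      by (auto simp: antipode_def)
  next
    case False
    then have "k \<noteq> pos ?S i" using pos_less[of ?S i] by auto
    moreover have "face_map (q, {i}) ?c (antipode ?p) \<in> std_cube (card ?S)" "face_map (q, {i}) ?c ?p \<in> std_cube (card ?S)"
      using face_map_in[OF c that p(1)] face_map_in[OF c that p(2)] by simp_all
    ultimately show ?thesis using False by (simp add: std_cube_iff)
  qed
  have "face_map ?d ?c ` std_cube 1 \<inter> face_map ?d' ?c ` std_cube 1 = {}"
  proof -
    have "sg (lowest v {i}) j \<noteq> sg (lowest ?w {i}) j"
      using mk_flip[OF ij(2) v] ne unfolding sg_eq_iff mk_lowest_single[OF v ij(1)] mk_lowest_single[OF w ij(1)] by auto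
    then show ?thesis
      using face_map_image[OF c d(1) f] face_map_image[OF c d(2) f'] ne by auto
  qed
  moreover have "(code ?d, face_map ?d ?c, code ?c) \<in> gluings cubing" "(code ?d', face_map ?d' ?c, code ?c) \<in> gluings cubing"
    unfolding gluings_cubing using c d f f' by blast+
  moreover have "dimn cubing (code ?c) = 2" using dimn_cubing[OF c] ne by simp
  moreover have "\<forall>k. face_map ?d ?c (antipode ?p) k - face_map ?d ?c ?p k =
      face_map ?d' ?c (antipode ?p) k - face_map ?d' ?c ?p k"
    using diff d f f' by simp
  moreover have "dedge v i \<in> directed_edges cubing" "dedge ?w i \<in> directed_edges cubing"
    unfolding directed_edges_cubing using v w ij by auto
  ultimately show ?thesis
    unfolding opposite_in_square_def corner_def p' by blast
qed

text \<open>The displacement of a directed edge is nonzero only in the coordinate of its axis, and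
  there it is minus twice the starting end. Equal displacements therefore have equal starting ends;
  this is the source of two-sidedness.\<close>

lemma opposite_same_end:
  assumes "(a, b) \<in> opposite_in_square cubing" shows "snd a = snd b"
proof -
  obtain e p where a: "a = (e, p)" by (cases a)
  obtain e' p' where b: "b = (e', p')" by (cases b)
  have o: "a \<in> directed_edges cubing \<and> b \<in> directed_edges cubing \<and>
     (\<exists>c f f'. (e, f, c) \<in> gluings cubing \<and> (e', f', c) \<in> gluings cubing \<and>
        (\<forall>k. f (antipode p) k - f p k = f' (antipode p') k - f' p' k))"
    using assms unfolding a b opposite_in_square_def mem_Collect_eq prod.case by metis
  then obtain c f f' where c: "(e, f, c) \<in> gluings cubing" "(e', f', c) \<in> gluings cubing"
    and eq': "\<forall>k. f (antipode p) k - f p k = f' (antipode p') k - f' p' k"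
    by metis
  note eq = spec[OF eq'] and ab = a b conjunct1[OF o] conjunct1[OF conjunct2[OF o]]
  obtain v i where v: "v \<in> V" "i \<in> I" "a = dedge v i" using ab(3) unfolding directed_edges_cubing by blast
  obtain w j where w: "w \<in> V" "j \<in> I" "b = dedge w j" using ab(4) unfolding directed_edges_cubing by blast
  obtain d c1 where d: "d \<in> cells" "c1 \<in> cells" "face d c1" "e = code d" "c = code c1" "f = face_map d c1"
    using c(1) unfolding gluings_cubing by blast
  obtain d' c2 where d': "d' \<in> cells" "c2 \<in> cells" "face d' c2" "e' = code d'" "c = code c2" "f' = face_map d' c2"
    using c(2) unfolding gluings_cubing by blast
  have cc: "c2 = c1" using code_inject[OF d'(2) d(2)] d(5) d'(5) by simp
  have "d = (lowest v {i}, {i})"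
    using code_inject[OF d(1) lowest_cell[of v "{i}"]] v ab(1) d(4) by (simp add: corner_def)
  then have sd: "snd d = {i}" by simp
  have "d' = (lowest w {j}, {j})"
    using code_inject[OF d'(1) lowest_cell[of w "{j}"]] w ab(2) d'(4) by (simp add: corner_def)
  then have sd': "snd d' = {j}" by simp
  have p: "p = cube_point {i} (sg v)" and p': "p' = cube_point {j} (sg w)"
    using v w ab by (auto simp: corner_def)
  have in_c: "i \<in> snd c1" "j \<in> snd c1" using d(3) d'(3) sd sd' cc by (auto simp: face_def)
  have p0: "p 0 = sg v i" "p' 0 = sg w j"
    using cube_point_pos[of "{i}" i "sg v"] cube_point_pos[of "{j}" j "sg w"] p p' by simp_all
  have std: "p \<in> std_cube (card (snd d))" "antipode p \<in> std_cube (card (snd d))"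
    "p' \<in> std_cube (card (snd d'))" "antipode p' \<in> std_cube (card (snd d'))"
    unfolding sd sd' p p' by (auto simp: std_cube_iff antipode_def cube_point_def sg_def)
  have ff: "f p (pos (snd c1) i) = p 0" "f (antipode p) (pos (snd c1) i) = - p 0"
    using face_map_pos[OF d(2) std(1) in_c(1)] face_map_pos[OF d(2) std(2) in_c(1)] sd d(6)
    by (simp_all add: antipode_def)
  have ff': "f' q (pos (snd c1) i) = (if i = j then q 0 else sg (fst d') i)"
    if "q \<in> std_cube (card (snd d'))" for q
    using face_map_pos[OF d'(2) that, of i] in_c(1) sd' d'(6) cc by simp
  have "- 2 * p 0 = (if i = j then - 2 * p' 0 else 0)"
    using eq[of "pos (snd c1) i"] ff ff'[OF std(3)] ff'[OF std(4)] by (auto simp: antipode_def split: if_splits)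
  then have "i = j" "p 0 = p' 0" using p0 by (auto simp: sg_def split: if_splits)
  then have "p = p'" unfolding p p' using p0 p p' by (auto simp: cube_point_def fun_eq_iff)
  then show ?thesis using ab by simp
qed

text \<open>\<open>par\<close> forgets at which end of the \<open>i\<close>-edge a vertex lies. The
  orientation carried along the squares may thus start at \<open>w\<close> or at
  \<open>flip i w\<close>.\<close>

lemma par_opposite:
  assumes i: "i \<in> I" and v: "v \<in> V" and vw: "(v, w) \<in> par i"
  shows "w \<in> V \<and> (\<exists>w'. (w' = w \<or> w' = flip i w) \<and> (dedge v i, dedge w' i) \<in> equiv_closure (opposite_in_square cubing))"
  using vw unfolding par_eq_rtrancl[OF i]
proof (induction rule: rtrancl_induct)
  case base
  show ?case by (intro conjI exI[of _ v] disjI1 v refl equiv_closure_refl)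
next
  case (step w u)
  have w: "w \<in> V" by (rule conjunct1[OF step.IH])
  obtain w' where w': "w' = w \<or> w' = flip i w"
    "(dedge v i, dedge w' i) \<in> equiv_closure (opposite_in_square cubing)"
    using conjunct2[OF step.IH] by (elim exE conjE)
  have w'V: "w' \<in> V" using w w'(1) flip_in[OF i] by blast
  from step.hyps(2) consider "u = flip i w" | j where "j \<in> I" "ort w i j" "u = flip j w"
    unfolding par_step_def by blast
  then show ?case
  proof cases
    case 1
    then have "w' = u \<or> w' = flip i u" using w'(1) flip_flip[OF i w] by auto
    moreover have "u \<in> V" using 1 flip_in[OF i w] by simp
    ultimately show ?thesis using w'(2) by (intro conjI exI[of _ w'])
  next
    case (2 j)
    have o: "ort w' i j" using w'(1) 2(2) ort_flip[OF w i 2(1,2)] by auto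
    have "(dedge v i, dedge (flip j w') i) \<in> equiv_closure (opposite_in_square cubing)"
      by (rule equiv_closure_trans[OF w'(2) equiv_closure_base[OF opposite_flip[OF w'V i 2(1) o]]])
    moreover have "flip j w' = u \<or> flip j w' = flip i u"
      using w'(1) 2(3) ort_comm[OF w i 2(1,2)] by auto
    moreover have "u \<in> V" using flip_in[OF 2(1) w] 2(3) by simp
    ultimately show ?thesis by (intro conjI exI[of _ "flip j w'"])
  qed
qed

lemma midcubes_cubing: "(c', a) \<in> midcubes cubing \<longleftrightarrow> (\<exists>c\<in>cells. c' = code c \<and> a < card (snd c))"
  by (auto simp: midcubes_def cubes_cubing)

text \<open>A discrete invariant of midcubes: the axis, and the parallelism class of the edges
  crossing the midcube. It is compatible with gluing and hence constant on connected
  components.\<close>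

definition mid_label :: "(nat \<times> nat) \<times> (nat \<Rightarrow> real) \<Rightarrow> 'i \<times> 'v set" where
  "mid_label z = (let c = decode (fst (fst z)); i = axis_at (snd c) (snd (fst z)) in (i, par i `` {fst c}))"

lemma mid_label: "c \<in> cells \<Longrightarrow> mid_label ((code c, a), x) =
    (axis_at (snd c) a, par (axis_at (snd c) a) `` {fst c})"
  by (simp add: mid_label_def Let_def)

definition mid_points :: "((nat \<times> nat) \<times> (nat \<Rightarrow> real)) set" where
  "mid_points = {((c, a), x). (c, a) \<in> midcubes cubing \<and> x \<in> midcube (dimn cubing c) a}"

lemma par_class: "(v, w) \<in> par i \<Longrightarrow> par i `` {v} = par i `` {w}"
  using equiv_class_eq[OF equiv_equiv_closure] by metis

lemma par_face:
  assumes "d \<in> cells" "c \<in> cells" "face d c" "i \<in> snd c"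
  shows "par i `` {fst d} = par i `` {fst c}"
proof -
  have "(fst c, flips (mk (fst d) \<inter> snd c) (fst c)) \<in> par i"
    by (rule par_flips[OF cells_D(1,2)[OF assms(2)] assms(4)]) simp
  then show ?thesis using par_class assms(3) unfolding face_def by metis
qed

lemma midcube_glue_invariant:
  assumes "(a, b) \<in> midcube_glue_rel cubing"
  shows "mid_label a = mid_label b" and "a \<in> mid_points \<longleftrightarrow> b \<in> mid_points"
proof -
  have base: "mid_label a = mid_label b \<and> (a \<in> mid_points \<longleftrightarrow> b \<in> mid_points)"
    if "(a, b) \<in> {(((d, j), x), ((c, i), f x)) | d j f c i x.
        (d, f, c) \<in> gluings cubing \<and> (d, j) \<in> midcubes cubing \<and> (c, i) \<in> midcubes cubing \<and>
        f ` midcube (dimn cubing d) j \<subseteq> midcube (dimn cubing c) i \<and> x \<in> midcube (dimn cubing d) j}" for a b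
  proof -
    from that obtain d' j f c' k x where ab: "a = ((d', j), x)" "b = ((c', k), f x)"
      and g: "(d', f, c') \<in> gluings cubing" and m: "(d', j) \<in> midcubes cubing" "(c', k) \<in> midcubes cubing"
        "f ` midcube (dimn cubing d') j \<subseteq> midcube (dimn cubing c') k" "x \<in> midcube (dimn cubing d') j"
      by blast
    obtain d c where d: "d \<in> cells" "c \<in> cells" "face d c" "d' = code d" "c' = code c" "f = face_map d c"
      using g unfolding gluings_cubing by blast
    have j: "j < card (snd d)" using m(1) d by (auto simp: midcubes_def)
    have k: "k < card (snd c)" using m(2) d by (auto simp: midcubes_def)
    note fin = cells_D(4)[OF d(1)] cells_D(4)[OF d(2)]
    let ?i = "axis_at (snd d) j" and ?k = "axis_at (snd c) k"
    \<comment> \<open>A point of the midcube of \<open>d\<close> whose only zero coordinate is that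
      of \<open>?i\<close>. All other coordinates of its image are -1 or 1, so the image can lie in
      the midcube of \<open>?k\<close> only for \<open>?k = ?i\<close>.\<close>
    let ?x = "cube_point (snd d) (\<lambda>i. if i = ?i then 0 else 1)"
    have x: "?x \<in> std_cube (card (snd d))" by (rule cube_point_in[OF fin(1)]) auto
    have kS: "?k \<in> snd c" by (rule axis_in[OF fin(2) k])
    have "?x \<in> midcube (dimn cubing d') j"
      using x j d by (auto simp: midcube_def cube_point_def)
    then have "face_map d c ?x k = 0"
      using m(3) d by (auto simp: midcube_def)
    then have "face_map d c ?x (pos (snd c) ?k) = 0" using pos_axis[OF fin(2) k] by simp
    then have "?k = ?i"
      using face_map_pos[OF d(2) x kS] fin(1) by (auto simp: sg_def split: if_splits)
    then have "mid_label a = mid_label b"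
      unfolding ab d(4,5) mid_label[OF d(1)] mid_label[OF d(2)] using par_face[OF d(1,2,3) kS] by simp
    moreover have "a \<in> mid_points" "b \<in> mid_points"
      using ab m by (auto simp: mid_points_def)
    ultimately show ?thesis by blast
  qed
  show "mid_label a = mid_label b"
    by (rule equiv_closure_invariant[OF assms[unfolded midcube_glue_rel_def], of mid_label]) (use base in blast)
  show "a \<in> mid_points \<longleftrightarrow> b \<in> mid_points"
    by (rule equiv_closure_invariant[OF assms[unfolded midcube_glue_rel_def], of "\<lambda>a. a \<in> mid_points"]) (use base in blast)
qed

abbreviation mid_sum :: "((nat \<times> nat) \<times> (nat \<Rightarrow> real)) topology" where
  "mid_sum \<equiv> sum_topology (\<lambda>(c, i). subtopology (cube_topology (dimn cubing c)) (midcube (dimn cubing c) i))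
        (midcubes cubing)"

lemma midcube_glue_equiv: "equiv UNIV (midcube_glue_rel cubing)"
  unfolding midcube_glue_rel_def by (rule equiv_equiv_closure)

lemma topspace_mid_sum: "topspace mid_sum = mid_points"
  by (auto simp: mid_points_def cube_topology_eq midcube_def)

text \<open>The label descends to a continuous map into a discrete space, and such a map is constant
  on a connected component.\<close>

lemma hyperplane_labels:
  assumes K: "K \<in> connected_components_of (midcube_space cubing)"
    and ab: "a \<in> \<Union>K" "b \<in> \<Union>K"
  shows "a \<in> mid_points" "mid_label a = mid_label b"
proof -
  note R = midcube_glue_equiv
  have sat: "y \<in> topspace mid_sum" if "x \<in> topspace mid_sum" "(x, y) \<in> midcube_glue_rel cubing" for x y
    using that midcube_glue_invariant(2) unfolding topspace_mid_sum by blast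
  have ts: "topspace (midcube_space cubing) = mid_points // midcube_glue_rel cubing"
    unfolding midcube_space_def using topspace_quotient_topology(1)[OF R sat] unfolding topspace_mid_sum .
  have Ksub: "K \<subseteq> mid_points // midcube_glue_rel cubing"
    using connected_components_of_subset[OF K] ts by simp
  have cont: "continuous_map (midcube_space cubing) (discrete_topology UNIV) (descend mid_label)"
    unfolding midcube_space_def
  proof (rule continuous_map_descend[OF R midcube_glue_invariant(1) sat])
    show "continuous_map mid_sum (discrete_topology UNIV) mid_label"
    proof (rule continuous_map_sum_topology)
      fix ca assume "ca \<in> midcubes cubing"
      have "(\<lambda>x. mid_label (ca, x)) = (\<lambda>x. mid_label (ca, \<lambda>_. 0))" by (simp add: mid_label_def)
      then show "continuous_map (case ca of (c, i) \<Rightarrow> subtopology (cube_topology (dimn cubing c)) (midcube (dimn cubing c) i))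
          (discrete_topology UNIV) (\<lambda>x. mid_label (ca, x))"
        by simp
    qed
  qed
  have "connectedin (discrete_topology UNIV) (descend mid_label ` K)"
    by (rule connectedin_continuous_map_image[OF cont connectedin_connected_components_of[OF K]])
  then obtain l where l: "descend mid_label ` K \<subseteq> {l}"
    by (auto simp: connectedin_discrete_topology)
  have dc: "descend mid_label (midcube_glue_rel cubing `` {x}) = mid_label x" for x
    by (rule descend_class[OF R midcube_glue_invariant(1)])
  have key: "x \<in> mid_points \<and> mid_label x = l" if x: "x \<in> \<Union>K" for x
  proof -
    obtain C where C: "C \<in> K" "x \<in> C" using x by blast
    have "C \<in> mid_points // midcube_glue_rel cubing" using C(1) Ksub by blast
    then obtain y where y: "C = midcube_glue_rel cubing `` {y}" "y \<in> mid_points" by (rule quotientE)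
    then have yx: "(y, x) \<in> midcube_glue_rel cubing" using C(2) by blast
    have "descend mid_label C = l" using l C(1) by blast
    then show ?thesis
      using dc[of y] y midcube_glue_invariant[OF yx] by simp
  qed
  show "a \<in> mid_points" "mid_label a = mid_label b" using key ab by auto
qed

text \<open>That an edge is dual to a hyperplane only says that its midpoint lies in the image in
  the complex, so the midcube has to be recovered. The midpoint is interior to the edge, so the edge
  is the face of \<open>c\<close> in which \<open>x\<close> is interior, and the zero coordinate of
  \<open>x\<close> must belong to the axis of this edge.\<close>

lemma dual_edge_label:
  assumes K: "K \<in> connected_components_of (midcube_space cubing)"
    and v: "v \<in> V" "i \<in> I" and dual: "dual_edge cubing (image_in_complex cubing K) (fst (dedge v i))"
  obtains a where "a \<in> \<Union>K" "mid_label a = (i, par i `` {v})"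
proof -
  let ?e = "(lowest v {i}, {i})"
  have e: "?e \<in> cells" by (rule lowest_cell) (use v in auto)
  have "glue_rel cubing `` {(code ?e, \<lambda>_. 0)} \<in> image_in_complex cubing K"
    using dual by (simp add: dual_edge_def corner_def)
  then obtain c' a x where eq: "glue_rel cubing `` {(code ?e, \<lambda>_. 0)} = glue_rel cubing `` {(c', x)}"
    and K': "((c', a), x) \<in> \<Union>K"
    unfolding image_in_complex_def by blast
  have mp: "((c', a), x) \<in> mid_points" by (rule hyperplane_labels(1)[OF K K' K'])
  then obtain c where c: "c \<in> cells" "c' = code c" "a < card (snd c)" "x \<in> std_cube (card (snd c))" "x a = 0"
    by (auto simp: mid_points_def midcubes_cubing midcube_def)
  note fin = cells_D(4)[OF c(1)]
  let ?j = "axis_at (snd c) a"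
  have j: "?j \<in> snd c" "x (pos (snd c) ?j) = 0" using axis_in[OF fin c(3)] pos_axis[OF fin c(3)] c(5) by auto
  have glue: "((code ?e, \<lambda>_. 0), (code c, x)) \<in> glue_rel cubing"
    using eq_equiv_class[OF eq glue_rel_equiv] c(2) by simp
  obtain d z where d: "d \<in> cells" "z \<in> std_cube (card (snd d))" "((code d, z), (code c, x)) \<in> glue_rel cubing"
    "face d c" "x = face_map d c z" "\<And>i. i \<in> snd d \<Longrightarrow> \<bar>z (pos (snd d) i)\<bar> < 1"
    using interior_face[OF c(1,4)] by metis
  have cp: "cell_point (code ?e, \<lambda>_. 0) = cell_point (code d, z)"
    using glue_rel_cell_point[OF glue] glue_rel_cell_point[OF d(3)] by simp
  have "?e = d"
    by (rule interior_unique(1)[OF e _ _ d(1,2,6) cp]) (auto simp: std_cube_iff)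
  then have sd: "snd d = {i}" "fst d = lowest v {i}" by auto
  have "?j \<in> snd d"
    using face_map_pos[OF c(1) d(2) j(1)] j(2) d(5) by (auto simp: sg_def split: if_splits)
  then have ji: "?j = i" using sd by simp
  have "(v, lowest v {i}) \<in> par i"
    unfolding lowest_def by (rule par_flips[of v "{i}"]) (use v in auto)
  then have "par i `` {v} = par i `` {fst c}"
    using par_class par_face[OF d(1) c(1) d(4), of i] j(1) ji sd by metis
  then have "mid_label ((c', a), x) = (i, par i `` {v})"
    unfolding c(2) mid_label[OF c(1)] ji by simp
  then show ?thesis using that K' by blast
qed

lemma dual_edge_parallel:
  assumes H: "H \<in> hyperplanes cubing" and v: "v \<in> V" "i \<in> I" "w \<in> V" "j \<in> I"
    and dual: "dual_edge cubing H (fst (dedge v i))" "dual_edge cubing H (fst (dedge w j))"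
  shows "i = j" and "(v, w) \<in> par i"
proof -
  obtain K where K: "K \<in> connected_components_of (midcube_space cubing)" "H = image_in_complex cubing K"
    using H unfolding hyperplanes_def by blast
  obtain a where a: "a \<in> \<Union>K" "mid_label a = (i, par i `` {v})"
    by (rule dual_edge_label[OF K(1) v(1,2) dual(1)[unfolded K(2)]])
  obtain b where b: "b \<in> \<Union>K" "mid_label b = (j, par j `` {w})"
    by (rule dual_edge_label[OF K(1) v(3,4) dual(2)[unfolded K(2)]])
  have "(i, par i `` {v}) = (j, par j `` {w})"
    using hyperplane_labels(2)[OF K(1) a(1) b(1)] unfolding a(2) b(2) .
  then have ij: "i = j" and cl: "par i `` {v} = par i `` {w}" by auto
  show "i = j" by (rule ij)
  show "(v, w) \<in> par i" by (rule eq_equiv_class[OF cl equiv_equiv_closure]) simp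
qed

lemma edge_cases:
  assumes "e \<in> cubes cubing" "dimn cubing e = 1"
  obtains v i where "v \<in> V" "i \<in> I" "e = fst (dedge v i)"
proof -
  have "(e, \<lambda>k. if k = 0 then 1 else 0) \<in> directed_edges cubing"
    using assms by (auto simp: directed_edges_def cube_vertices_iff)
  then show ?thesis using that unfolding directed_edges_cubing by (auto, metis fst_conv)
qed

text \<open>Existence: parallel vertices are connected by a chain of squares along which the
  orientation is carried. Uniqueness: the starting end never changes on the way.\<close>

lemma two_sided_cubing:
  assumes H: "H \<in> hyperplanes cubing" shows "two_sided cubing H"
  unfolding two_sided_def
proof (intro allI impI)
  fix e p e' assume a: "(e, p) \<in> directed_edges cubing \<and> dual_edge cubing H e \<and> dual_edge cubing H e'"
  then obtain v i where v: "v \<in> V" "i \<in> I" "(e, p) = dedge v i" unfolding directed_edges_cubing by blast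
  obtain w j where w: "w \<in> V" "j \<in> I" "e' = fst (dedge w j)"
    using a edge_cases[of e'] unfolding dual_edge_def by blast
  have "e = fst (dedge v i)" using v(3) by (metis fst_conv)
  then have ij: "i = j" and vw: "(v, w) \<in> par i"
    using dual_edge_parallel[OF H v(1,2) w(1,2)] a w(3) by auto
  obtain w' where w': "w' = w \<or> w' = flip i w" "(dedge v i, dedge w' i) \<in> equiv_closure (opposite_in_square cubing)"
    using par_opposite[OF v(2,1) vw] by blast
  have "lowest w' {i} = lowest w {i}"
    using w'(1) lowest_flip[of w "{i}" i] w v(2) by auto
  then have e': "dedge w' i = (e', snd (dedge w' i))"
    using w(3) ij by (simp add: corner_def)
  show "\<exists>!p'. p' \<in> cube_vertices 1 \<and> ((e, p), (e', p')) \<in> equiv_closure (opposite_in_square cubing)"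
  proof (rule ex1I[of _ "snd (dedge w' i)"])
    show "snd (dedge w' i) \<in> cube_vertices 1 \<and> ((e, p), (e', snd (dedge w' i))) \<in> equiv_closure (opposite_in_square cubing)"
      using w'(2) e' v(3) cube_point_vertex[of "{i}" w'] by (simp add: corner_def)
    fix p' assume "p' \<in> cube_vertices 1 \<and> ((e, p), (e', p')) \<in> equiv_closure (opposite_in_square cubing)"
    then have "snd (e, p) = snd (e', p')"
      using equiv_closure_invariant[of "(e, p)" "(e', p')" "opposite_in_square cubing" snd] opposite_same_end by blast
    moreover have "snd (dedge v i) = snd (dedge w' i)"
      by (rule equiv_closure_invariant[OF w'(2) opposite_same_end])
    ultimately show "p' = snd (dedge w' i)" using v(3) by (metis snd_conv)
  qed
qed

end

text \<open>Since the labels are constant along hyperplanes, \<open>lab_determines\<close> excludes inter-osculation.\<close>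

locale special_flip_system = flip_system V I flip mk ort
  for V :: "'v set" and I :: "'i set" and flip :: "'i \<Rightarrow> 'v \<Rightarrow> 'v"
    and mk :: "'v \<Rightarrow> 'i set" and ort :: "'v \<Rightarrow> 'i \<Rightarrow> 'i \<Rightarrow> bool" +
  fixes lab :: "'v \<Rightarrow> 'i \<Rightarrow> 'l"
  assumes lab_flip: "\<And>v i. v \<in> V \<Longrightarrow> i \<in> I \<Longrightarrow> lab (flip i v) i = lab v i"
    and lab_ort: "\<And>v i j. v \<in> V \<Longrightarrow> i \<in> I \<Longrightarrow> j \<in> I \<Longrightarrow> ort v i j \<Longrightarrow> lab (flip j v) i = lab v i"
    and lab_determines: "\<And>v w i j. v \<in> V \<Longrightarrow> w \<in> V \<Longrightarrow> i \<in> I \<Longrightarrow> j \<in> I \<Longrightarrow>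
      lab v i = lab w i \<Longrightarrow> lab v j = lab w j \<Longrightarrow> ort v i j \<Longrightarrow> ort w i j"
begin

lemma lab_par: "i \<in> I \<Longrightarrow> (v, w) \<in> par i \<Longrightarrow> lab v i = lab w i"
  by (erule equiv_closure_invariant[where f = "\<lambda>v. lab v i"]) (auto simp: par_step_def lab_flip lab_ort)

text \<open>Two edges at one vertex that are dual to the same hyperplane have the same axis and
  hence coincide, which excludes self-intersection and self-osculation. Axes that cross at
  \<open>v\<close> cross at every vertex with the same two labels, which excludes
  inter-osculation.\<close>

theorem special_cubing: "special_cube_complex cubing"
  unfolding special_cube_complex_def
proof (intro conjI ballI impI notI)
  show "cube_complex cubing" by (rule cube_complex_cubing)
  show "nonpositively_curved cubing" by (rule nonpositively_curved_cubing)
  fix H assume H: "H \<in> hyperplanes cubing"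
  show "two_sided cubing H" by (rule two_sided_cubing[OF H])
next
  fix H assume H: "H \<in> hyperplanes cubing" and "hyperplanes_intersect cubing H H"
  then obtain e1 p1 e2 p2 z where z: "z \<in> zero_cubes cubing" "dual_edge cubing H e1" "dual_edge cubing H e2" "e1 \<noteq> e2"
      "(e1, p1) \<in> edges_from cubing z" "(e2, p2) \<in> edges_from cubing z"
    unfolding hyperplanes_intersect_def by blast
  obtain v where v: "v \<in> V" "z = code (v, {})" using z(1) zero_cubes_cubing by blast
  obtain i j where "i \<in> I" "(e1, p1) = dedge v i" "j \<in> I" "(e2, p2) = dedge v j"
    using z(5,6) unfolding v(2) edges_from_cubing[OF v(1)] by blast
  moreover from this have "i = j"
    using dual_edge_parallel(1)[OF H v(1) _ v(1), of i j] z(2,3) by (metis fst_conv)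
  ultimately show False using z(4) by (metis fst_conv)
next
  fix H assume H: "H \<in> hyperplanes cubing" and "hyperplanes_osculate cubing H H"
  then obtain a b z where z: "z \<in> zero_cubes cubing" "dual_edge cubing H (fst a)" "dual_edge cubing H (fst b)" "a \<noteq> b"
      "a \<in> edges_from cubing z" "b \<in> edges_from cubing z"
    unfolding hyperplanes_osculate_def by blast
  obtain v where v: "v \<in> V" "z = code (v, {})" using z(1) zero_cubes_cubing by blast
  obtain i j where "i \<in> I" "a = dedge v i" "j \<in> I" "b = dedge v j"
    using z(5,6) unfolding v(2) edges_from_cubing[OF v(1)] by blast
  moreover from this have "i = j"
    using dual_edge_parallel(1)[OF H v(1) _ v(1), of i j] z(2,3) by metis
  ultimately show False using z(4) by metis
next
  fix H1 H2 assume H: "H1 \<in> hyperplanes cubing" "H2 \<in> hyperplanes cubing"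
    and "hyperplanes_intersect cubing H1 H2 \<and> hyperplanes_osculate cubing H1 H2"
  then obtain e1 p1 e2 p2 z a b y where z: "z \<in> zero_cubes cubing" "dual_edge cubing H1 e1" "dual_edge cubing H2 e2"
      "e1 \<noteq> e2" "(e1, p1) \<in> edges_from cubing z" "(e2, p2) \<in> edges_from cubing z"
      "forms_square_corner cubing (e1, p1) (e2, p2)"
    and y: "y \<in> zero_cubes cubing" "dual_edge cubing H1 (fst a)" "dual_edge cubing H2 (fst b)" "a \<noteq> b"
      "a \<in> edges_from cubing y" "b \<in> edges_from cubing y" "\<not> forms_square_corner cubing a b"
    unfolding hyperplanes_intersect_def hyperplanes_osculate_def by blast
  obtain v where v: "v \<in> V" "z = code (v, {})" using z(1) zero_cubes_cubing by blast
  obtain w where w: "w \<in> V" "y = code (w, {})" using y(1) zero_cubes_cubing by blast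
  obtain i j where i: "i \<in> I" "(e1, p1) = dedge v i" and j: "j \<in> I" "(e2, p2) = dedge v j"
    using z(5,6) unfolding v(2) edges_from_cubing[OF v(1)] by blast
  obtain i' j' where i': "i' \<in> I" "a = dedge w i'" and j': "j' \<in> I" "b = dedge w j'"
    using y(5,6) unfolding w(2) edges_from_cubing[OF w(1)] by blast
  have e: "e1 = fst (dedge v i)" "e2 = fst (dedge v j)" using i j by (metis fst_conv)+
  have ne: "i \<noteq> j" using z(4) e by auto
  note d1 = dual_edge_parallel[OF H(1) v(1) i(1) w(1) i'(1) z(2)[unfolded e] y(2)[unfolded i'(2)]]
  note d2 = dual_edge_parallel[OF H(2) v(1) j(1) w(1) j'(1) z(3)[unfolded e] y(3)[unfolded j'(2)]]
  have "ort v i j"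
    using z(7) forms_square_corner_cubing[OF v(1) i(1) j(1) ne] unfolding i(2) j(2) by simp
  then have "ort w i j"
    using lab_determines[OF v(1) w(1) i(1) j(1) lab_par[OF i(1) d1(2)] lab_par[OF j(1) d2(2)]] by simp
  then show False
    using y(7) forms_square_corner_cubing[OF w(1) i(1) j(1) ne] unfolding i'(2) j'(2) d1(1)[symmetric] d2(1)[symmetric]
    by simp
qed

end

section \<open>Presented groups\<close>

definition word_step :: "'a set \<Rightarrow> ('a list \<times> 'a list) set \<Rightarrow> ('a list \<times> 'a list) set" where
  "word_step A R = {(u @ l @ v, u @ r @ v) | u l r v. u \<in> lists A \<and> v \<in> lists A \<and> (l, r) \<in> R}"

lemma word_cong_eq: "word_cong A R = equiv_closure (word_step A R)"
  by (simp add: word_cong_def word_step_def)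

lemma word_stepI: "u \<in> lists A \<Longrightarrow> v \<in> lists A \<Longrightarrow> (l, r) \<in> R \<Longrightarrow> (u @ l @ v, u @ r @ v) \<in> word_step A R"
  unfolding word_step_def by blast

lemma word_stepE:
  assumes "(x, y) \<in> word_step A R"
  obtains u l r v where "u \<in> lists A" "v \<in> lists A" "(l, r) \<in> R" "x = u @ l @ v" "y = u @ r @ v"
  using assms unfolding word_step_def by blast

lemma equiv_closure_map:
  assumes "(a, b) \<in> equiv_closure r" "\<And>a b. (a, b) \<in> r \<Longrightarrow> (f a, f b) \<in> r'"
  shows "(f a, f b) \<in> equiv_closure r'"
  using assms(1) unfolding equiv_closure_def
  by (induction rule: rtrancl_induct) (auto dest: assms(2) intro: rtrancl_into_rtrancl)

locale presentation =
  fixes A :: "'a set" and R :: "('a list \<times> 'a list) set"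
  assumes R_lists: "\<And>l r. (l, r) \<in> R \<Longrightarrow> l \<in> lists A \<and> r \<in> lists A"
begin

abbreviation cls :: "'a list \<Rightarrow> 'a list set" where
  "cls w \<equiv> word_cong A R `` {w}"

abbreviation PM :: "'a list set monoid" where
  "PM \<equiv> presented_monoid A R"

lemma word_cong_equiv: "equiv UNIV (word_cong A R)"
  unfolding word_cong_eq by (rule equiv_equiv_closure)

lemma cls_eqI: "(x, y) \<in> word_cong A R \<Longrightarrow> cls x = cls y"
  by (rule equiv_class_eq[OF word_cong_equiv])

lemma word_cong_lists: "(x, y) \<in> word_cong A R \<Longrightarrow> x \<in> lists A \<longleftrightarrow> y \<in> lists A"
  unfolding word_cong_eq
  by (erule equiv_closure_invariant[where f = "\<lambda>x. x \<in> lists A"])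
    (auto elim!: word_stepE dest!: R_lists)

lemma word_cong_append:
  assumes "(x, x') \<in> word_cong A R" "(y, y') \<in> word_cong A R" and l: "x' \<in> lists A" "y \<in> lists A"
  shows "(x @ y, x' @ y') \<in> word_cong A R"
proof -
  have "(x @ y, x' @ y) \<in> word_cong A R"
    unfolding word_cong_eq
  proof (rule equiv_closure_map[OF assms(1)[unfolded word_cong_eq], of "\<lambda>x. x @ y"])
    fix a b assume "(a, b) \<in> word_step A R"
    then show "(a @ y, b @ y) \<in> word_step A R"
      by (rule word_stepE) (use word_stepI[of _ A "_ @ y"] l in auto)
  qed
  moreover have "(x' @ y, x' @ y') \<in> word_cong A R"
    unfolding word_cong_eq
  proof (rule equiv_closure_map[OF assms(2)[unfolded word_cong_eq], of "\<lambda>y. x' @ y"])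
    fix a b assume "(a, b) \<in> word_step A R"
    then show "(x' @ a, x' @ b) \<in> word_step A R"
    proof (rule word_stepE)
      fix u l r v assume "u \<in> lists A" "v \<in> lists A" "(l, r) \<in> R" "a = u @ l @ v" "b = u @ r @ v"
      then show ?thesis using word_stepI[of "x' @ u" A v l r R] l by simp
    qed
  qed
  ultimately show ?thesis unfolding word_cong_eq by (rule equiv_closure_trans)
qed

lemma cls_rel: "(l, r) \<in> R \<Longrightarrow> cls l = cls r"
  using word_stepI[of "[]" A "[]" l r R] by (intro cls_eqI) (auto simp: word_cong_eq intro: equiv_closure_base)

lemma carrier_PM: "carrier PM = cls ` lists A"
  by (auto simp: presented_monoid_def quotient_def)

lemma one_PM: "\<one>\<^bsub>PM\<^esub> = cls []"
  by (simp add: presented_monoid_def)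

lemma cls_in: "w \<in> lists A \<Longrightarrow> cls w \<in> carrier PM"
  by (simp add: carrier_PM)

lemma mult_PM:
  assumes "x \<in> lists A" "y \<in> lists A"
  shows "cls x \<otimes>\<^bsub>PM\<^esub> cls y = cls (x @ y)"
proof -
  have "cls (x' @ y') = cls (x @ y)" if "x' \<in> cls x" "y' \<in> cls y" for x' y'
  proof -
    have "(x @ y, x' @ y') \<in> word_cong A R"
      by (rule word_cong_append) (use that assms word_cong_lists in auto)
    then show ?thesis by (rule cls_eqI[symmetric])
  qed
  moreover have "x \<in> cls x" "y \<in> cls y"
    using equiv_class_self[OF word_cong_equiv] by auto
  ultimately show ?thesis
    unfolding presented_monoid_def monoid.simps by blast
qed

lemma monoid_PM: "monoid PM"
proof (rule monoidI)
  fix X Y Z assume "X \<in> carrier PM" "Y \<in> carrier PM" "Z \<in> carrier PM"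
  then obtain x y z where "x \<in> lists A" "y \<in> lists A" "z \<in> lists A" "X = cls x" "Y = cls y" "Z = cls z"
    unfolding carrier_PM by blast
  then show "X \<otimes>\<^bsub>PM\<^esub> Y \<otimes>\<^bsub>PM\<^esub> Z = X \<otimes>\<^bsub>PM\<^esub> (Y \<otimes>\<^bsub>PM\<^esub> Z)"
    by (simp add: mult_PM del: in_lists_conv_set)
next
  fix X Y assume "X \<in> carrier PM"
  then obtain x where x: "x \<in> lists A" "X = cls x" unfolding carrier_PM by blast
  show "\<one>\<^bsub>PM\<^esub> \<otimes>\<^bsub>PM\<^esub> X = X" "X \<otimes>\<^bsub>PM\<^esub> \<one>\<^bsub>PM\<^esub> = X"
    unfolding one_PM x(2) using mult_PM[of "[]" x] mult_PM[of x "[]"] x(1) by simp_all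
  assume "Y \<in> carrier PM"
  then obtain y where y: "y \<in> lists A" "Y = cls y" unfolding carrier_PM by blast
  show "X \<otimes>\<^bsub>PM\<^esub> Y \<in> carrier PM"
    unfolding x(2) y(2) mult_PM[OF x(1) y(1)] by (rule cls_in) (use x y in simp)
qed (simp add: one_PM cls_in)

lemma group_PM:
  assumes inv: "\<And>a. a \<in> A \<Longrightarrow> \<exists>w\<in>lists A. cls (w @ [a]) = cls []"
  shows "group PM"
proof (rule monoid.group_l_invI[OF monoid_PM])
  have ex: "\<exists>v\<in>lists A. cls (v @ w) = cls []" if "w \<in> lists A" for w
    using that
  proof (induction w)
    case (Cons a w)
    obtain u where u: "u \<in> lists A" "cls (u @ [a]) = cls []" using inv Cons.hyps by blast
    obtain v where v: "v \<in> lists A" "cls (v @ w) = cls []" using Cons.IH by blast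
    have "cls ((v @ u) @ a # w) = cls v \<otimes>\<^bsub>PM\<^esub> (cls (u @ [a]) \<otimes>\<^bsub>PM\<^esub> cls w)"
      using u(1) v(1) Cons.hyps by (simp add: mult_PM)
    also have "\<dots> = cls []"
      unfolding u(2) using v Cons.hyps by (simp add: mult_PM)
    finally show ?case using u v by (intro bexI[of _ "v @ u"]) auto
  qed (auto intro!: bexI[of _ "[]"])
  fix X assume "X \<in> carrier PM"
  then obtain w where w: "w \<in> lists A" "X = cls w" unfolding carrier_PM by blast
  obtain v where v: "v \<in> lists A" "cls (v @ w) = cls []" using ex[OF w(1)] by blast
  show "\<exists>Y\<in>carrier PM. Y \<otimes>\<^bsub>PM\<^esub> X = \<one>\<^bsub>PM\<^esub>"
    by (rule bexI[of _ "cls v"]) (simp_all only: w(2) one_PM mult_PM[OF v(1) w(1)] v(2) cls_in[OF v(1)])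
qed

definition eval_word :: "('b, 'm) monoid_scheme \<Rightarrow> ('a \<Rightarrow> 'b) \<Rightarrow> 'a list \<Rightarrow> 'b" where
  "eval_word K h w = foldr (\<lambda>a x. h a \<otimes>\<^bsub>K\<^esub> x) w \<one>\<^bsub>K\<^esub>"

lemma eval_word_in: "monoid K \<Longrightarrow> h \<in> A \<rightarrow> carrier K \<Longrightarrow> w \<in> lists A \<Longrightarrow> eval_word K h w \<in> carrier K"
  by (induction w) (auto simp: eval_word_def monoid.m_closed Pi_iff)

lemma eval_word_append:
  assumes K: "monoid K" and h: "h \<in> A \<rightarrow> carrier K"
  shows "x \<in> lists A \<Longrightarrow> y \<in> lists A \<Longrightarrow> eval_word K h (x @ y) = eval_word K h x \<otimes>\<^bsub>K\<^esub> eval_word K h y"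
proof (induction x)
  case Nil
  then show ?case using eval_word_in[OF K h, of y] K by (simp add: eval_word_def monoid.l_one)
next
  case (Cons a x)
  then have "h a \<in> carrier K" "eval_word K h x \<in> carrier K" "eval_word K h y \<in> carrier K"
    using eval_word_in[OF K h] h by auto
  then show ?case using Cons K by (simp add: eval_word_def monoid.m_assoc)
qed

lemma presented_hom:
  assumes K: "monoid K" and h: "h \<in> A \<rightarrow> carrier K"
    and rel: "\<And>l r. (l, r) \<in> R \<Longrightarrow> eval_word K h l = eval_word K h r"
  shows "\<exists>\<Theta>. \<Theta> \<in> hom PM K \<and> (\<forall>w. w \<in> lists A \<longrightarrow> \<Theta> (cls w) = eval_word K h w)"
proof -
  have inv: "eval_word K h x = eval_word K h y" if "(x, y) \<in> word_cong A R" for x y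
    using that unfolding word_cong_eq
  proof (rule equiv_closure_invariant)
    fix a b assume "(a, b) \<in> word_step A R"
    then show "eval_word K h a = eval_word K h b"
    proof (rule word_stepE)
      fix u l r v assume "u \<in> lists A" "v \<in> lists A" "(l, r) \<in> R" "a = u @ l @ v" "b = u @ r @ v"
      then show ?thesis using R_lists[of l r] rel[of l r] by (simp add: eval_word_append[OF K h])
    qed
  qed
  have v: "descend (eval_word K h) (cls w) = eval_word K h w" for w
    by (rule descend_class[OF word_cong_equiv inv])
  have "descend (eval_word K h) \<in> hom PM K"
  proof (rule homI)
    fix X assume "X \<in> carrier PM"
    then obtain x where x: "x \<in> lists A" "X = cls x" unfolding carrier_PM by blast
    show "descend (eval_word K h) X \<in> carrier K"
      unfolding x(2) v by (rule eval_word_in[OF K h x(1)])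
    fix Y assume "Y \<in> carrier PM"
    then obtain y where y: "y \<in> lists A" "Y = cls y" unfolding carrier_PM by blast
    show "descend (eval_word K h) (X \<otimes>\<^bsub>PM\<^esub> Y) =
        descend (eval_word K h) X \<otimes>\<^bsub>K\<^esub> descend (eval_word K h) Y"
      unfolding x(2) y(2) mult_PM[OF x(1) y(1)] v by (rule eval_word_append[OF K h x(1) y(1)])
  qed
  then show ?thesis using v by (intro exI[of _ "descend (eval_word K h)"]) simp
qed

end

section \<open>Generators and relations of the virtual cactus group\<close>

text \<open>The target group is arbitrary because the relations serve twice: for the virtual cactus
  group itself and for the group of bijections on which it is made to act.\<close>

definition vc_relations :: "nat \<Rightarrow> ('b, 'm) monoid_scheme \<Rightarrow> (nat \<Rightarrow> nat \<Rightarrow> 'b) \<Rightarrow> ((nat \<Rightarrow> nat) \<Rightarrow> 'b) \<Rightarrow> bool" where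
  "vc_relations n K s t \<longleftrightarrow>
     (\<forall>i j. (i, j) \<in> cactus_gens n \<longrightarrow> s i j \<in> carrier K \<and> s i j \<otimes>\<^bsub>K\<^esub> s i j = \<one>\<^bsub>K\<^esub>) \<and>
     (\<forall>i j k l. (i, j) \<in> cactus_gens n \<and> (k, l) \<in> cactus_gens n \<and> {i..j} \<inter> {k..l} = {} \<longrightarrow>
        s i j \<otimes>\<^bsub>K\<^esub> s k l = s k l \<otimes>\<^bsub>K\<^esub> s i j) \<and>
     (\<forall>i j k l. (i, j) \<in> cactus_gens n \<and> (k, l) \<in> cactus_gens n \<and> {k..l} \<subseteq> {i..j} \<longrightarrow>
        s i j \<otimes>\<^bsub>K\<^esub> s k l = s (interval_reversal i j l) (interval_reversal i j k) \<otimes>\<^bsub>K\<^esub> s i j) \<and>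
     t \<in> hom (sym_group n) K \<and>
     (\<forall>w i j. (i, j) \<in> cactus_gens n \<and> w permutes {1..n} \<and> (\<forall>k\<le>j - i. w (i + k) = w i + k) \<longrightarrow>
        t w \<otimes>\<^bsub>K\<^esub> s i j = s (w i) (w j) \<otimes>\<^bsub>K\<^esub> t w)"

lemma vc_relationsD:
  assumes "vc_relations n K s t"
  shows "\<forall>i j. (i, j) \<in> cactus_gens n \<longrightarrow> s i j \<in> carrier K \<and> s i j \<otimes>\<^bsub>K\<^esub> s i j = \<one>\<^bsub>K\<^esub>"
    and "\<forall>i j k l. (i, j) \<in> cactus_gens n \<and> (k, l) \<in> cactus_gens n \<and> {i..j} \<inter> {k..l} = {} \<longrightarrow>
        s i j \<otimes>\<^bsub>K\<^esub> s k l = s k l \<otimes>\<^bsub>K\<^esub> s i j"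
    and "\<forall>i j k l. (i, j) \<in> cactus_gens n \<and> (k, l) \<in> cactus_gens n \<and> {k..l} \<subseteq> {i..j} \<longrightarrow>
        s i j \<otimes>\<^bsub>K\<^esub> s k l = s (interval_reversal i j l) (interval_reversal i j k) \<otimes>\<^bsub>K\<^esub> s i j"
    and "t \<in> hom (sym_group n) K"
    and "\<forall>w i j. (i, j) \<in> cactus_gens n \<and> w permutes {1..n} \<and> (\<forall>k\<le>j - i. w (i + k) = w i + k) \<longrightarrow>
        t w \<otimes>\<^bsub>K\<^esub> s i j = s (w i) (w j) \<otimes>\<^bsub>K\<^esub> t w"
  using assms[unfolded vc_relations_def]
  by (rule conjunct1, rule conjunct1[OF conjunct2], rule conjunct1[OF conjunct2[OF conjunct2]],
      rule conjunct1[OF conjunct2[OF conjunct2[OF conjunct2]]], rule conjunct2[OF conjunct2[OF conjunct2[OF conjunct2]]])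

lemma interval_reversal_gens:
  assumes "(i, j) \<in> cactus_gens n" "(k, l) \<in> cactus_gens n" "{k..l} \<subseteq> {i..j}"
  shows "(interval_reversal i j l, interval_reversal i j k) \<in> cactus_gens n"
  using assms by (auto simp: cactus_gens_def interval_reversal_def)

lemma translation_gens:
  assumes "(i, j) \<in> cactus_gens n" "w permutes {1..n}" "\<forall>k\<le>j - i. w (i + k) = w i + k"
  shows "(w i, w j) \<in> cactus_gens n"
proof -
  have "w j = w i + (j - i)" using assms by (auto simp: cactus_gens_def dest: spec[of _ "j - i"])
  moreover have "w i \<in> {1..n}" "w j \<in> {1..n}"
    using permutes_in_image[OF assms(2)] assms(1) by (auto simp: cactus_gens_def)
  ultimately show ?thesis using assms(1) by (auto simp: cactus_gens_def)
qed

locale virtual_cactus =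
  fixes n :: nat
begin

abbreviation C :: "((nat \<times> nat) \<times> bool) list set monoid" where "C \<equiv> cactus_group n"
abbreviation S :: "(nat \<Rightarrow> nat) monoid" where "S \<equiv> sym_group n"
abbreviation F :: "cactus_free_elem monoid" where "F \<equiv> cactus_free_sym n"
abbreviation N :: "cactus_free_elem set" where "N \<equiv> normal_closure F (virtual_cactus_relators n)"
abbreviation VC :: "cactus_free_elem set monoid" where "VC \<equiv> virtual_cactus_group n"

definition CR :: "(((nat \<times> nat) \<times> bool) list \<times> ((nat \<times> nat) \<times> bool) list) set" where
  "CR = cactus_rels n \<union> {([(s, b), (s, \<not> b)], []) | s b. s \<in> cactus_gens n}"

sublocale C: presentation "cactus_gens n \<times> UNIV" CR
proof
  fix l r assume "(l, r) \<in> CR"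
  then show "l \<in> lists (cactus_gens n \<times> UNIV) \<and> r \<in> lists (cactus_gens n \<times> UNIV)"
    using interval_reversal_gens by (fastforce simp: CR_def cactus_rels_def cactus_letter_def)
qed

lemma C_PM: "C = C.PM"
  by (simp add: cactus_group_def presented_group_def CR_def)

lemma cactus_s_cls: "cactus_s n i j = C.cls [((i, j), True)]"
  by (simp add: cactus_s_def presented_gen_def CR_def)

lemma group_C: "group C"
  unfolding C_PM
proof (rule C.group_PM)
  fix a assume a: "a \<in> cactus_gens n \<times> (UNIV :: bool set)"
  have "([(fst a, \<not> snd a), (fst a, snd a)], []) \<in> CR"
    unfolding CR_def using a by (auto intro!: exI[of _ "fst a"] exI[of _ "\<not> snd a"])
  then have "C.cls ([(fst a, \<not> snd a)] @ [a]) = C.cls []"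
    using C.cls_rel[of "[(fst a, \<not> snd a), (fst a, snd a)]" "[]"] by simp
  then show "\<exists>w\<in>lists (cactus_gens n \<times> UNIV). C.cls (w @ [a]) = C.cls []"
    using a by (intro bexI[of _ "[(fst a, \<not> snd a)]"]) auto
qed

lemma cactus_s_in: "(i, j) \<in> cactus_gens n \<Longrightarrow> cactus_s n i j \<in> carrier C"
  unfolding cactus_s_cls C_PM by (rule C.cls_in) simp

lemma cactus_s_square:
  assumes "(i, j) \<in> cactus_gens n" shows "cactus_s n i j \<otimes>\<^bsub>C\<^esub> cactus_s n i j = \<one>\<^bsub>C\<^esub>"
proof -
  have "([cactus_letter i j, cactus_letter i j], []) \<in> CR" using assms by (auto simp: CR_def cactus_rels_def)
  from C.cls_rel[OF this] show ?thesis
    unfolding cactus_s_cls C_PM C.one_PM using assms by (simp add: C.mult_PM cactus_letter_def)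
qed

lemma cactus_s_commute:
  assumes "(i, j) \<in> cactus_gens n" "(k, l) \<in> cactus_gens n" "{i..j} \<inter> {k..l} = {}"
  shows "cactus_s n i j \<otimes>\<^bsub>C\<^esub> cactus_s n k l = cactus_s n k l \<otimes>\<^bsub>C\<^esub> cactus_s n i j"
proof -
  have "([cactus_letter i j, cactus_letter k l], [cactus_letter k l, cactus_letter i j]) \<in> CR"
    unfolding CR_def cactus_rels_def using assms by blast
  from C.cls_rel[OF this] show ?thesis
    unfolding cactus_s_cls C_PM using assms by (simp add: C.mult_PM cactus_letter_def)
qed

lemma cactus_s_nested:
  assumes "(i, j) \<in> cactus_gens n" "(k, l) \<in> cactus_gens n" "{k..l} \<subseteq> {i..j}"
  shows "cactus_s n i j \<otimes>\<^bsub>C\<^esub> cactus_s n k l =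
    cactus_s n (interval_reversal i j l) (interval_reversal i j k) \<otimes>\<^bsub>C\<^esub> cactus_s n i j"
proof -
  have "([cactus_letter i j, cactus_letter k l],
      [cactus_letter (interval_reversal i j l) (interval_reversal i j k), cactus_letter i j]) \<in> CR"
    unfolding CR_def cactus_rels_def using assms by blast
  from C.cls_rel[OF this] show ?thesis
    unfolding cactus_s_cls C_PM using assms interval_reversal_gens[OF assms]
    by (simp add: C.mult_PM cactus_letter_def)
qed

lemma C_hom:
  assumes K: "group K" and r: "vc_relations n K s t"
  obtains \<Theta> where "\<Theta> \<in> hom C K" "\<And>i j. (i, j) \<in> cactus_gens n \<Longrightarrow> \<Theta> (cactus_s n i j) = s i j"
proof -
  interpret K: group K by (rule K)
  let ?h = "\<lambda>a. s (fst (fst a)) (snd (fst a))"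
  note vcr = vc_relationsD[OF r]
  have s: "s i j \<in> carrier K" "s i j \<otimes>\<^bsub>K\<^esub> s i j = \<one>\<^bsub>K\<^esub>" if "(i, j) \<in> cactus_gens n" for i j
    using vcr(1) that by auto
  have h: "?h \<in> cactus_gens n \<times> (UNIV :: bool set) \<rightarrow> carrier K" using s by auto
  have ev: "C.eval_word K ?h l = C.eval_word K ?h r" if "(l, r) \<in> CR" for l r
  proof -
    have "(l, r) \<in> cactus_rels n \<or> (\<exists>p b. l = [(p, b), (p, \<not> b)] \<and> r = [] \<and> p \<in> cactus_gens n)"
      using that unfolding CR_def by blast
    then show ?thesis
      unfolding cactus_rels_def Un_iff mem_Collect_eq prod.inject
    proof (elim disjE exE conjE)
      fix i j assume a: "l = [cactus_letter i j, cactus_letter i j]" "r = []" "(i, j) \<in> cactus_gens n"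
      show ?thesis unfolding a(1,2) using s[OF a(3)] by (simp add: C.eval_word_def cactus_letter_def)
    next
      fix i j k l' assume b: "l = [cactus_letter i j, cactus_letter k l']" "r = [cactus_letter k l', cactus_letter i j]"
        "(i, j) \<in> cactus_gens n" "(k, l') \<in> cactus_gens n" "{i..j} \<inter> {k..l'} = {}"
      have "s i j \<otimes>\<^bsub>K\<^esub> s k l' = s k l' \<otimes>\<^bsub>K\<^esub> s i j"
        using vcr(2) b(3-5) by metis
      then show ?thesis unfolding b(1,2) using s(1)[OF b(3)] s(1)[OF b(4)] by (simp add: C.eval_word_def cactus_letter_def)
    next
      fix i j k l' assume c: "l = [cactus_letter i j, cactus_letter k l']"
        "r = [cactus_letter (interval_reversal i j l') (interval_reversal i j k), cactus_letter i j]"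
        "(i, j) \<in> cactus_gens n" "(k, l') \<in> cactus_gens n" "{k..l'} \<subseteq> {i..j}"
      have "s i j \<otimes>\<^bsub>K\<^esub> s k l' = s (interval_reversal i j l') (interval_reversal i j k) \<otimes>\<^bsub>K\<^esub> s i j"
        using vcr(3) c(3-5) by metis
      then show ?thesis
        unfolding c(1,2) using s(1)[OF c(3)] s(1)[OF c(4)] s(1)[OF interval_reversal_gens[OF c(3-5)]]
        by (simp add: C.eval_word_def cactus_letter_def)
    next
      fix p b assume d: "l = [(p, b), (p, \<not> b)]" "r = []" "p \<in> cactus_gens n"
      show ?thesis unfolding d(1,2) using s[of "fst p" "snd p"] d(3) by (simp add: C.eval_word_def)
    qed
  qed
  obtain \<Theta> where \<Theta>0: "\<Theta> \<in> hom C.PM K \<and>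
      (\<forall>w. w \<in> lists (cactus_gens n \<times> UNIV) \<longrightarrow> \<Theta> (C.cls w) = C.eval_word K ?h w)"
    using C.presented_hom[OF K.is_monoid h ev] by (rule exE)
  note \<Theta> = conjunct1[OF \<Theta>0] mp[OF spec[OF conjunct2[OF \<Theta>0]]]
  show ?thesis
  proof (rule that[of \<Theta>])
    show "\<Theta> \<in> hom C K" using \<Theta>(1) by (simp only: C_PM)
    show "\<Theta> (cactus_s n i j) = s i j" if "(i, j) \<in> cactus_gens n" for i j
      unfolding cactus_s_cls using \<Theta>(2)[of "[((i, j), True)]"] that s(1)[OF that] by (simp add: C.eval_word_def)
  qed
qed

sublocale S: group S by (rule sym_group_is_group)

sublocale F: presentation "carrier C <+> carrier S" "free_product_rels C S"
proof
  interpret C: group C by (rule group_C)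
  fix l r assume "(l, r) \<in> free_product_rels C S"
  then show "l \<in> lists (carrier C <+> carrier S) \<and> r \<in> lists (carrier C <+> carrier S)"
    unfolding free_product_rels_def by auto
qed

lemma F_PM: "F = F.PM"
  by (simp add: cactus_free_sym_def free_product_def)

abbreviation inl where "inl \<equiv> free_product_inl C S"
abbreviation inr where "inr \<equiv> free_product_inr C S"

lemma inl_cls: "inl x = F.cls [Inl x]" and inr_cls: "inr w = F.cls [Inr w]"
  by (simp_all add: free_product_inl_def free_product_inr_def)

lemma inl_hom: "inl \<in> hom C F" and inr_hom: "inr \<in> hom S F"
  and inl_one: "inl \<one>\<^bsub>C\<^esub> = \<one>\<^bsub>F\<^esub>" and inr_one: "inr \<one>\<^bsub>S\<^esub> = \<one>\<^bsub>F\<^esub>"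
proof -
  show "inl \<in> hom C F"
  proof (rule homI)
    fix x y assume x: "x \<in> carrier C"
    then show "inl x \<in> carrier F" unfolding inl_cls F_PM by (intro F.cls_in) auto
    assume y: "y \<in> carrier C"
    have "([Inl x, Inl y], [Inl (x \<otimes>\<^bsub>C\<^esub> y)]) \<in> free_product_rels C S"
      using x y by (simp add: free_product_rels_def)
    from F.cls_rel[OF this] show "inl (x \<otimes>\<^bsub>C\<^esub> y) = inl x \<otimes>\<^bsub>F\<^esub> inl y"
      unfolding inl_cls F_PM using x y by (subst F.mult_PM) auto
  qed
  show "inr \<in> hom S F"
  proof (rule homI)
    fix x y assume x: "x \<in> carrier S"
    then show "inr x \<in> carrier F" unfolding inr_cls F_PM by (intro F.cls_in) auto
    assume y: "y \<in> carrier S"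
    have "([Inr x, Inr y], [Inr (x \<otimes>\<^bsub>S\<^esub> y)]) \<in> free_product_rels C S"
      using x y by (simp add: free_product_rels_def)
    from F.cls_rel[OF this] show "inr (x \<otimes>\<^bsub>S\<^esub> y) = inr x \<otimes>\<^bsub>F\<^esub> inr y"
      unfolding inr_cls F_PM using x y by (subst F.mult_PM) auto
  qed
  have r: "([Inl \<one>\<^bsub>C\<^esub>], []) \<in> free_product_rels C S" "([Inr \<one>\<^bsub>S\<^esub>], []) \<in> free_product_rels C S"
    by (auto simp: free_product_rels_def)
  show "inl \<one>\<^bsub>C\<^esub> = \<one>\<^bsub>F\<^esub>"
    unfolding inl_cls F_PM F.one_PM by (rule F.cls_rel[OF r(1)])
  show "inr \<one>\<^bsub>S\<^esub> = \<one>\<^bsub>F\<^esub>"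
    unfolding inr_cls F_PM F.one_PM by (rule F.cls_rel[OF r(2)])
qed

lemma group_F: "group F"
  unfolding F_PM
proof (rule F.group_PM)
  interpret C: group C by (rule group_C)
  fix a assume "a \<in> carrier C <+> carrier S"
  then consider x where "a = Inl x" "x \<in> carrier C" | y where "a = Inr y" "y \<in> carrier S" by auto
  then show "\<exists>w\<in>lists (carrier C <+> carrier S). F.cls (w @ [a]) = F.cls []"
  proof cases
    case (1 x)
    have "inl (inv\<^bsub>C\<^esub> x) \<otimes>\<^bsub>F\<^esub> inl x = \<one>\<^bsub>F\<^esub>"
      using hom_mult[OF inl_hom, of "inv\<^bsub>C\<^esub> x" x] 1 inl_one by simp
    moreover have "F.cls [Inl (inv\<^bsub>C\<^esub> x)] \<otimes>\<^bsub>F.PM\<^esub> F.cls [Inl x] = F.cls ([Inl (inv\<^bsub>C\<^esub> x)] @ [Inl x])"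
      by (rule F.mult_PM) (use 1 in auto)
    ultimately have "F.cls ([Inl (inv\<^bsub>C\<^esub> x)] @ [a]) = F.cls []"
      unfolding inl_cls F_PM F.one_PM using 1(1) by simp
    then show ?thesis using 1 by (intro bexI[of _ "[Inl (inv\<^bsub>C\<^esub> x)]"]) auto
  next
    case (2 x)
    have "inr (inv\<^bsub>S\<^esub> x) \<otimes>\<^bsub>F\<^esub> inr x = \<one>\<^bsub>F\<^esub>"
      using hom_mult[OF inr_hom S.inv_closed[OF 2(2)] 2(2)] unfolding S.l_inv[OF 2(2)] inr_one by (rule sym)
    moreover have "F.cls [Inr (inv\<^bsub>S\<^esub> x)] \<otimes>\<^bsub>F.PM\<^esub> F.cls [Inr x] = F.cls ([Inr (inv\<^bsub>S\<^esub> x)] @ [Inr x])"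
      by (rule F.mult_PM) (use 2 S.inv_closed[OF 2(2)] in auto)
    ultimately have "F.cls ([Inr (inv\<^bsub>S\<^esub> x)] @ [a]) = F.cls []"
      unfolding inr_cls F_PM F.one_PM using 2(1) by simp
    then show ?thesis using S.inv_closed[OF 2(2)] by (intro bexI[of _ "[Inr (inv\<^bsub>S\<^esub> x)]"]) auto
  qed
qed

sublocale C: group C by (rule group_C)
sublocale F: group F by (rule group_F)

lemma inl_in: "x \<in> carrier C \<Longrightarrow> inl x \<in> carrier F" and inr_in: "w \<in> carrier S \<Longrightarrow> inr w \<in> carrier F"
  using inl_hom inr_hom by (auto simp: hom_def)

lemma relators_iff: "x \<in> virtual_cactus_relators n \<longleftrightarrow>
   (\<exists>w i j. (i, j) \<in> cactus_gens n \<and> w \<in> carrier S \<and> (\<forall>k\<le>j - i. w (i + k) = w i + k) \<and>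
     x = (inr w \<otimes>\<^bsub>F\<^esub> inl (cactus_s n i j) \<otimes>\<^bsub>F\<^esub> inv\<^bsub>F\<^esub> (inr w)) \<otimes>\<^bsub>F\<^esub> inv\<^bsub>F\<^esub> (inl (cactus_s n (w i) (w j))))"
  unfolding virtual_cactus_relators_def Let_def cactus_gens_def by auto

lemma translation_s_in:
  "(i, j) \<in> cactus_gens n \<Longrightarrow> w \<in> carrier S \<Longrightarrow> \<forall>k\<le>j - i. w (i + k) = w i + k \<Longrightarrow> cactus_s n (w i) (w j) \<in> carrier C"
  using translation_gens cactus_s_in by (simp add: sym_group_carrier)

lemma relators_in: "virtual_cactus_relators n \<subseteq> carrier F"
  unfolding relators_iff subset_iff using translation_s_in cactus_s_in inl_in inr_in by auto

abbreviation conjugates where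
  "conjugates \<equiv> {g \<otimes>\<^bsub>F\<^esub> r \<otimes>\<^bsub>F\<^esub> inv\<^bsub>F\<^esub> g | g r. g \<in> carrier F \<and> r \<in> virtual_cactus_relators n}"

lemma conjugates_in: "conjugates \<subseteq> carrier F"
  using relators_in by auto

lemma normal_N: "N \<lhd> F"
  unfolding normal_closure_def
proof (rule F.normal_generateI[OF conjugates_in])
  fix h g assume "h \<in> conjugates" and g: "g \<in> carrier F"
  then obtain k r where k: "k \<in> carrier F" "r \<in> virtual_cactus_relators n" "h = k \<otimes>\<^bsub>F\<^esub> r \<otimes>\<^bsub>F\<^esub> inv\<^bsub>F\<^esub> k" by blast
  have r: "r \<in> carrier F" using relators_in k(2) by blast
  have "g \<otimes>\<^bsub>F\<^esub> h \<otimes>\<^bsub>F\<^esub> inv\<^bsub>F\<^esub> g = (g \<otimes>\<^bsub>F\<^esub> k) \<otimes>\<^bsub>F\<^esub> r \<otimes>\<^bsub>F\<^esub> inv\<^bsub>F\<^esub> (g \<otimes>\<^bsub>F\<^esub> k)"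
    unfolding k(3) using g k(1) r by (simp add: F.inv_mult_group F.m_assoc)
  then show "g \<otimes>\<^bsub>F\<^esub> h \<otimes>\<^bsub>F\<^esub> inv\<^bsub>F\<^esub> g \<in> conjugates" using g k by blast
qed

lemma relators_in_N: "r \<in> virtual_cactus_relators n \<Longrightarrow> r \<in> N"
proof -
  assume r: "r \<in> virtual_cactus_relators n"
  then have "r \<in> carrier F" using relators_in by blast
  then have "r = \<one>\<^bsub>F\<^esub> \<otimes>\<^bsub>F\<^esub> r \<otimes>\<^bsub>F\<^esub> inv\<^bsub>F\<^esub> \<one>\<^bsub>F\<^esub>" by simp
  then have "r \<in> conjugates" using r by blast
  then show ?thesis unfolding normal_closure_def by (rule generate.incl)
qed

lemma VC_Mod: "VC = F Mod N"
  by (simp add: virtual_cactus_group_def)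

sublocale N: normal N F by (rule normal_N)

sublocale VC: group VC
  unfolding VC_Mod by (rule N.factorgroup_is_group)

definition proj :: "cactus_free_elem \<Rightarrow> cactus_free_elem set" where
  "proj x = N #>\<^bsub>F\<^esub> x"

lemma proj_hom: "proj \<in> hom F VC"
  unfolding proj_def VC_Mod by (rule N.r_coset_hom_Mod)

lemma carrier_VC: "carrier VC = proj ` carrier F"
  unfolding VC_Mod FactGroup_def RCOSETS_def proj_def by auto

sublocale P: group_hom F VC proj
  by unfold_locales (rule proj_hom)

definition \<sigma> :: "nat \<Rightarrow> nat \<Rightarrow> cactus_free_elem set" where
  "\<sigma> i j = proj (inl (cactus_s n i j))"

definition \<tau> :: "(nat \<Rightarrow> nat) \<Rightarrow> cactus_free_elem set" where
  "\<tau> w = proj (inr w)"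

lemma \<sigma>_in: "(i, j) \<in> cactus_gens n \<Longrightarrow> \<sigma> i j \<in> carrier VC"
  unfolding \<sigma>_def using inl_in cactus_s_in by simp

lemma \<tau>_hom: "\<tau> \<in> hom S VC"
  using hom_compose[OF inr_hom proj_hom] by (simp add: \<tau>_def[abs_def] comp_def)

lemma vc_relations_VC: "vc_relations n VC \<sigma> \<tau>"
  unfolding vc_relations_def
proof (intro conjI allI impI)
  have m: "\<sigma> i j \<otimes>\<^bsub>VC\<^esub> \<sigma> k l = proj (inl (cactus_s n i j \<otimes>\<^bsub>C\<^esub> cactus_s n k l))"
    if "(i, j) \<in> cactus_gens n" "(k, l) \<in> cactus_gens n" for i j k l
    unfolding \<sigma>_def using that hom_mult[OF inl_hom] inl_in cactus_s_in by simp
  fix i j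
  show "\<sigma> i j \<in> carrier VC" if "(i, j) \<in> cactus_gens n" using \<sigma>_in that .
  show "\<sigma> i j \<otimes>\<^bsub>VC\<^esub> \<sigma> i j = \<one>\<^bsub>VC\<^esub>" if "(i, j) \<in> cactus_gens n"
    unfolding m[OF that that] cactus_s_square[OF that] inl_one by simp
  fix k l
  show "\<sigma> i j \<otimes>\<^bsub>VC\<^esub> \<sigma> k l = \<sigma> k l \<otimes>\<^bsub>VC\<^esub> \<sigma> i j"
    if "(i, j) \<in> cactus_gens n \<and> (k, l) \<in> cactus_gens n \<and> {i..j} \<inter> {k..l} = {}"
    using that m[of i j k l] m[of k l i j] cactus_s_commute[of i j k l] by simp
  show "\<sigma> i j \<otimes>\<^bsub>VC\<^esub> \<sigma> k l = \<sigma> (interval_reversal i j l) (interval_reversal i j k) \<otimes>\<^bsub>VC\<^esub> \<sigma> i j"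
    if "(i, j) \<in> cactus_gens n \<and> (k, l) \<in> cactus_gens n \<and> {k..l} \<subseteq> {i..j}"
    using that m[of i j k l] m[OF interval_reversal_gens[of i j n k l], of i j] cactus_s_nested[of i j k l] by simp
next
  show "\<tau> \<in> hom S VC" by (rule \<tau>_hom)
  fix w i j assume a: "(i, j) \<in> cactus_gens n \<and> w permutes {1..n} \<and> (\<forall>k\<le>j - i. w (i + k) = w i + k)"
  have w: "w \<in> carrier S" using a by (simp add: sym_group_carrier)
  let ?a = "inr w" and ?b = "inl (cactus_s n i j)" and ?c = "inl (cactus_s n (w i) (w j))"
  have c: "?a \<in> carrier F" "?b \<in> carrier F" "?c \<in> carrier F"
    using inl_in inr_in cactus_s_in translation_s_in w a by auto
  have "(?a \<otimes>\<^bsub>F\<^esub> ?b \<otimes>\<^bsub>F\<^esub> inv\<^bsub>F\<^esub> ?a) \<otimes>\<^bsub>F\<^esub> inv\<^bsub>F\<^esub> ?c \<in> N"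
    by (rule relators_in_N) (use a w in \<open>unfold relators_iff, blast\<close>)
  then have "proj ((?a \<otimes>\<^bsub>F\<^esub> ?b \<otimes>\<^bsub>F\<^esub> inv\<^bsub>F\<^esub> ?a) \<otimes>\<^bsub>F\<^esub> inv\<^bsub>F\<^esub> ?c) = \<one>\<^bsub>VC\<^esub>"
    unfolding proj_def VC_Mod FactGroup_def using N.rcos_const by simp
  then have "(proj ?a \<otimes>\<^bsub>VC\<^esub> proj ?b \<otimes>\<^bsub>VC\<^esub> inv\<^bsub>VC\<^esub> proj ?a) \<otimes>\<^bsub>VC\<^esub> inv\<^bsub>VC\<^esub> proj ?c = \<one>\<^bsub>VC\<^esub>"
    using c by simp
  then have "proj ?a \<otimes>\<^bsub>VC\<^esub> proj ?b \<otimes>\<^bsub>VC\<^esub> inv\<^bsub>VC\<^esub> proj ?a = proj ?c"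
    using c by (metis VC.inv_closed VC.inv_equality VC.inv_inv VC.m_closed P.hom_closed)
  then show "\<tau> w \<otimes>\<^bsub>VC\<^esub> \<sigma> i j = \<sigma> (w i) (w j) \<otimes>\<^bsub>VC\<^esub> \<tau> w"
    unfolding \<sigma>_def \<tau>_def using c by (metis VC.inv_closed VC.inv_solve_right' VC.m_closed P.hom_closed)
qed

text \<open>The universal property in three layers: the presentation of the cactus group, the free
  product, and the quotient. For the last one the relators lie in the kernel, which is normal and so
  contains their normal closure.\<close>

lemma VC_hom:
  assumes K: "group K" and r: "vc_relations n K s t"
  obtains \<Theta> where "\<Theta> \<in> hom VC K" "\<And>i j. (i, j) \<in> cactus_gens n \<Longrightarrow> \<Theta> (\<sigma> i j) = s i j"
    "\<And>w. w permutes {1..n} \<Longrightarrow> \<Theta> (\<tau> w) = t w"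
proof -
  interpret K: group K by (rule K)
  note vcr = vc_relationsD[OF r]
  have t: "t \<in> hom S K" by (rule vcr(4))
  have "\<exists>\<Theta>. \<Theta> \<in> hom C K \<and> (\<forall>i j. (i, j) \<in> cactus_gens n \<longrightarrow> \<Theta> (cactus_s n i j) = s i j)"
    by (rule C_hom[OF K r]) blast
  then obtain \<Theta> where \<Theta>0: "\<Theta> \<in> hom C K \<and> (\<forall>i j. (i, j) \<in> cactus_gens n \<longrightarrow> \<Theta> (cactus_s n i j) = s i j)"
    by (rule exE)
  note \<Theta> = conjunct1[OF \<Theta>0] mp[OF spec[OF spec[OF conjunct2[OF \<Theta>0]]]]
  interpret \<Theta>: group_hom C K \<Theta> by unfold_locales (rule \<Theta>(1))
  interpret t: group_hom S K t by unfold_locales (rule t)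
  let ?h = "case_sum \<Theta> t"
  have h: "?h \<in> carrier C <+> carrier S \<rightarrow> carrier K" by auto
  have ev: "F.eval_word K ?h l = F.eval_word K ?h r" if "(l, r) \<in> free_product_rels C S" for l r
    using that unfolding free_product_rels_def by (auto simp: F.eval_word_def)
  obtain \<Phi> where \<Phi>0: "\<Phi> \<in> hom F.PM K \<and>
      (\<forall>w. w \<in> lists (carrier C <+> carrier S) \<longrightarrow> \<Phi> (F.cls w) = F.eval_word K ?h w)"
    using F.presented_hom[OF K.is_monoid h ev] by (rule exE)
  note \<Phi> = conjunct1[OF \<Phi>0] mp[OF spec[OF conjunct2[OF \<Phi>0]]]
  have \<Phi>': "\<Phi> (inl x) = \<Theta> x" "\<Phi> (inr w) = t w" if "x \<in> carrier C" "w \<in> carrier S" for x w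
    unfolding inl_cls inr_cls using \<Phi>(2)[of "[Inl x]"] \<Phi>(2)[of "[Inr w]"] that by (auto simp: F.eval_word_def)
  interpret \<Phi>: group_hom F K \<Phi> by unfold_locales (use \<Phi>(1) F_PM in simp)
  have "virtual_cactus_relators n \<subseteq> kernel F K \<Phi>"
  proof
    fix x assume "x \<in> virtual_cactus_relators n"
    then obtain w i j where a: "(i, j) \<in> cactus_gens n" "w \<in> carrier S" "\<forall>k\<le>j - i. w (i + k) = w i + k"
      and x: "x = (inr w \<otimes>\<^bsub>F\<^esub> inl (cactus_s n i j) \<otimes>\<^bsub>F\<^esub> inv\<^bsub>F\<^esub> (inr w)) \<otimes>\<^bsub>F\<^esub> inv\<^bsub>F\<^esub> (inl (cactus_s n (w i) (w j)))"
      unfolding relators_iff by blast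
    have g: "(w i, w j) \<in> cactus_gens n" using translation_gens a by (simp add: sym_group_carrier)
    have c: "inr w \<in> carrier F" "inl (cactus_s n i j) \<in> carrier F" "inl (cactus_s n (w i) (w j)) \<in> carrier F"
      using inl_in inr_in cactus_s_in a g by auto
    have s: "s i j \<in> carrier K" "s (w i) (w j) \<in> carrier K" "t w \<in> carrier K"
      using vcr(1) a g by auto
    have "t w \<otimes>\<^bsub>K\<^esub> s i j = s (w i) (w j) \<otimes>\<^bsub>K\<^esub> t w"
      using vcr(5) a unfolding sym_group_carrier by metis
    then have "(t w \<otimes>\<^bsub>K\<^esub> s i j \<otimes>\<^bsub>K\<^esub> inv\<^bsub>K\<^esub> (t w)) \<otimes>\<^bsub>K\<^esub> inv\<^bsub>K\<^esub> (s (w i) (w j)) = \<one>\<^bsub>K\<^esub>"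
      using s by (simp add: K.m_assoc)
    then have "\<Phi> x = \<one>\<^bsub>K\<^esub>"
      unfolding x using c \<Phi>'(2)[OF C.one_closed a(2)] \<Phi>'(1)[OF cactus_s_in[OF a(1)] S.one_closed]
        \<Phi>'(1)[OF cactus_s_in[OF g] S.one_closed] \<Theta>(2)[OF a(1)] \<Theta>(2)[OF g] by simp
    then show "x \<in> kernel F K \<Phi>"
      using c x by (simp add: kernel_def)
  qed
  then have "conjugates \<subseteq> kernel F K \<Phi>"
    using \<Phi>.normal_kernel normal.inv_op_closed2[OF \<Phi>.normal_kernel] by blast
  then have Nk: "N \<subseteq> kernel F K \<Phi>"
    unfolding normal_closure_def by (rule F.generate_subgroup_incl[OF _ \<Phi>.subgroup_kernel])
  have "\<exists>\<Psi>. \<Psi> \<in> hom (F Mod N) K \<and> (\<forall>x. x \<in> carrier F \<longrightarrow> \<Psi> (N #>\<^bsub>F\<^esub> x) = \<Phi> x)"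
    by (rule \<Phi>.FactGroup_universal_kernel[OF normal_N Nk]) blast
  then obtain \<Psi> where \<Psi>0: "\<Psi> \<in> hom (F Mod N) K \<and> (\<forall>x. x \<in> carrier F \<longrightarrow> \<Psi> (N #>\<^bsub>F\<^esub> x) = \<Phi> x)"
    by (rule exE)
  note \<Psi> = conjunct1[OF \<Psi>0] mp[OF spec[OF conjunct2[OF \<Psi>0]]]
  show ?thesis
  proof (rule that[of \<Psi>])
    show "\<Psi> \<in> hom VC K" using \<Psi>(1) VC_Mod by simp
    show "\<Psi> (\<sigma> i j) = s i j" if "(i, j) \<in> cactus_gens n" for i j
      unfolding \<sigma>_def proj_def using \<Psi>(2) inl_in \<Phi>'(1)[OF _ S.one_closed] \<Theta>(2) cactus_s_in that by simp
    show "\<Psi> (\<tau> w) = t w" if "w permutes {1..n}" for w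
      unfolding \<tau>_def proj_def using \<Psi>(2) inr_in \<Phi>'(2)[OF C.one_closed] that by (simp add: sym_group_carrier)
  qed
qed

text \<open>The group is generated by the \<open>\<sigma> i j\<close> and \<open>\<tau> w\<close>
  even without inverses; elements are built by multiplication on the left, which suits an
  action.\<close>

lemma VC_induct [consumes 1, case_names one \<sigma> \<tau>]:
  assumes x: "x \<in> carrier VC" and one: "P \<one>\<^bsub>VC\<^esub>"
    and \<sigma>: "\<And>i j x. (i, j) \<in> cactus_gens n \<Longrightarrow> x \<in> carrier VC \<Longrightarrow> P x \<Longrightarrow> P (\<sigma> i j \<otimes>\<^bsub>VC\<^esub> x)"
    and \<tau>: "\<And>w x. w permutes {1..n} \<Longrightarrow> x \<in> carrier VC \<Longrightarrow> P x \<Longrightarrow> P (\<tau> w \<otimes>\<^bsub>VC\<^esub> x)"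
  shows "P x"
proof -
  have inlP: "P (proj (inl y) \<otimes>\<^bsub>VC\<^esub> x)" if y: "y \<in> carrier C" and x: "x \<in> carrier VC" "P x" for y x
  proof -
    have "P (proj (inl (C.cls l)) \<otimes>\<^bsub>VC\<^esub> x)" if "l \<in> lists (cactus_gens n \<times> UNIV)" for l
      using that
    proof (induction l)
      case Nil
      have "inl (C.cls []) = \<one>\<^bsub>F\<^esub>" using inl_one by (simp add: C_PM C.one_PM)
      then show ?case using x by simp
    next
      case (Cons a l)
      obtain i j b where a: "a = ((i, j), b)" "(i, j) \<in> cactus_gens n" using Cons.hyps by (cases a) auto
      have cl: "C.cls l \<in> carrier C" using C.cls_in Cons.hyps unfolding C_PM by simp
      have ca: "C.cls [a] \<in> carrier C" unfolding C_PM by (rule C.cls_in) (use a in simp)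
      \<comment> \<open>A formal inverse letter has the class of the generator, because the
        generator is an involution.\<close>
      have s: "C.cls [a] = cactus_s n i j"
      proof (cases b)
        case True then show ?thesis by (simp add: a cactus_s_cls)
      next
        case False
        have "([((i, j), False), ((i, j), \<not> False)], []) \<in> CR" unfolding CR_def using a(2) by blast
        from C.cls_rel[OF this] have "C.cls [a] \<otimes>\<^bsub>C\<^esub> cactus_s n i j = \<one>\<^bsub>C\<^esub>"
          unfolding a(1) cactus_s_cls C_PM C.one_PM using a(2) False by (simp add: C.mult_PM)
        then show ?thesis
          using cactus_s_square[OF a(2)] cactus_s_in[OF a(2)] ca by (metis C.inv_equality C.inv_inv)
      qed
      have "C.cls (a # l) = cactus_s n i j \<otimes>\<^bsub>C\<^esub> C.cls l"
        unfolding s[symmetric] C_PM using a(2) Cons.hyps by (simp add: C.mult_PM a(1))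
      then have "inl (C.cls (a # l)) = inl (cactus_s n i j) \<otimes>\<^bsub>F\<^esub> inl (C.cls l)"
        using hom_mult[OF inl_hom cactus_s_in[OF a(2)] cl] by simp
      then have "proj (inl (C.cls (a # l))) \<otimes>\<^bsub>VC\<^esub> x = \<sigma> i j \<otimes>\<^bsub>VC\<^esub> (proj (inl (C.cls l)) \<otimes>\<^bsub>VC\<^esub> x)"
        using inl_in[OF cl] inl_in[OF cactus_s_in[OF a(2)]] x by (simp add: \<sigma>_def VC.m_assoc)
      then show ?case using \<sigma>[OF a(2) _ Cons.IH] inl_in[OF cl] x by simp
    qed
    then show ?thesis using y unfolding C_PM C.carrier_PM by blast
  qed
  have "P (proj (F.cls l))" if "l \<in> lists (carrier C <+> carrier S)" for l
    using that
  proof (induction l)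
    case Nil
    have "F.cls [] = \<one>\<^bsub>F\<^esub>" by (simp add: F_PM F.one_PM)
    then show ?case using one by simp
  next
    case (Cons a l)
    have cl: "F.cls l \<in> carrier F" using F.cls_in Cons.hyps unfolding F_PM by simp
    have ca: "F.cls [a] \<in> carrier F" unfolding F_PM by (rule F.cls_in) (use Cons.hyps in simp)
    have "F.cls (a # l) = F.cls [a] \<otimes>\<^bsub>F\<^esub> F.cls l"
      unfolding F_PM using Cons.hyps by (simp add: F.mult_PM)
    then have e: "proj (F.cls (a # l)) = proj (F.cls [a]) \<otimes>\<^bsub>VC\<^esub> proj (F.cls l)"
      using ca cl by simp
    from Cons.hyps consider y where "a = Inl y" "y \<in> carrier C" | w where "a = Inr w" "w \<in> carrier S" by auto
    then show ?case
    proof cases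
      case (1 y)
      then show ?thesis unfolding e using inlP[OF 1(2) _ Cons.IH] cl by (simp add: inl_cls)
    next
      case (2 w)
      then show ?thesis unfolding e using \<tau>[OF _ _ Cons.IH, of w] cl by (simp add: \<tau>_def inr_cls sym_group_carrier)
    qed
  qed
  then show ?thesis using x unfolding carrier_VC F_PM F.carrier_PM by blast
qed

end

section \<open>Reversals of lists, segments and traces\<close>

definition revp :: "nat list \<Rightarrow> nat \<Rightarrow> nat" where
  "revp l k = (case map_of (zip l (rev l)) k of None \<Rightarrow> k | Some y \<Rightarrow> y)"

lemma revp_nth: "distinct l \<Longrightarrow> k < length l \<Longrightarrow> revp l (l ! k) = rev l ! k"
  by (simp add: revp_def map_of_zip_nth)

lemma revp_out: "k \<notin> set l \<Longrightarrow> revp l k = k"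
proof -
  assume "k \<notin> set l"
  then have "map_of (zip l (rev l)) k = None"
    unfolding map_of_eq_None_iff by (auto dest: set_zip_leftD)
  then show ?thesis unfolding revp_def by (simp only: option.case)
qed

lemma map_revp: "distinct l \<Longrightarrow> map (revp l) l = rev l"
  by (rule nth_equalityI) (auto simp: revp_nth)

lemma revp_in: "distinct l \<Longrightarrow> k \<in> set l \<Longrightarrow> revp l k \<in> set l"
  by (metis image_eqI list.set_map map_revp set_rev)

lemma revp_revp [simp]: "distinct l \<Longrightarrow> revp l (revp l k) = k"
proof (cases "k \<in> set l")
  case True
  assume d: "distinct l"
  obtain i where i: "i < length l" "k = l ! i" using True by (metis in_set_conv_nth)
  have "revp l k = l ! (length l - Suc i)" using revp_nth[OF d i(1)] i by (simp add: rev_nth)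
  then show ?thesis using revp_nth[OF d, of "length l - Suc i"] i by (simp add: rev_nth)
qed (simp add: revp_out)

lemma revp_comp: "distinct l \<Longrightarrow> revp l \<circ> revp l = id"
  by (auto simp: fun_eq_iff)

lemma inj_revp: "distinct l \<Longrightarrow> inj (revp l)"
  by (metis injI revp_revp)

lemma bij_revp: "distinct l \<Longrightarrow> bij (revp l)"
  using o_bij[OF revp_comp revp_comp] .

lemma revp_permutes: "distinct l \<Longrightarrow> revp l permutes set l"
  unfolding permutes_def using bij_revp[of l] by (simp add: revp_out bij_iff)

lemma inv_revp: "distinct l \<Longrightarrow> inv' (revp l) = revp l"
  by (rule inv_unique_comp) (auto simp: revp_comp)

lemma revp_rev: "distinct l \<Longrightarrow> revp (rev l) = revp l"
proof
  fix k assume d: "distinct l"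
  show "revp (rev l) k = revp l k"
  proof (cases "k \<in> set l")
    case True
    then obtain i where i: "i < length l" "k = rev l ! i" by (metis in_set_conv_nth set_rev length_rev)
    then have "revp (rev l) k = l ! i" using revp_nth[of "rev l" i] d by simp
    moreover have "revp l k = l ! i" using revp_nth[OF d, of "length l - Suc i"] i by (simp add: rev_nth)
    ultimately show ?thesis by simp
  qed (simp add: revp_out)
qed

text \<open>A reversal depends only on positions in the list, so an injective renaming conjugates
  it. Most commutation identities below are rearrangements of this one.\<close>

lemma revp_conj:
  assumes d: "distinct l" and f: "inj f" shows "revp (map f l) (f k) = f (revp l k)"
proof (cases "k \<in> set l")
  case True
  then obtain i where i: "i < length l" "k = l ! i" by (metis in_set_conv_nth)
  have dm: "distinct (map f l)" using d inj_on_subset[OF f subset_UNIV] by (simp add: distinct_map)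
  have "revp (map f l) (map f l ! i) = rev (map f l) ! i" by (rule revp_nth[OF dm]) (use i in simp)
  then show ?thesis using i revp_nth[OF d i(1)] by (simp add: rev_map)
next
  case False
  then have "f k \<notin> set (map f l)" using f by (auto simp: inj_eq)
  then show ?thesis using False by (simp add: revp_out)
qed

lemma revp_conj_comp: "distinct l \<Longrightarrow> inj f \<Longrightarrow> revp (map f l) \<circ> f = f \<circ> revp l"
  by (auto simp: fun_eq_iff revp_conj)

text \<open>Lets a flip act trivially on every set that meets the moving list in at most one
  point.\<close>

lemma revp_short: "length l \<le> 1 \<Longrightarrow> revp l = id"
proof -
  assume "length l \<le> 1"
  then consider "l = []" | a where "l = [a]" by (cases l) auto
  then show ?thesis by cases (auto simp: revp_def fun_eq_iff)
qed

lemma revp_map_other: "set l \<inter> set k = {} \<Longrightarrow> map (revp l) k = k"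
  by (rule map_idI) (auto intro!: revp_out)

lemma map_revp_segment:
  assumes "distinct (x @ b @ y)" shows "map (revp b) (x @ b @ y) = x @ rev b @ y"
proof -
  have "map (revp b) x = x" "map (revp b) y = y"
    using assms by (auto intro!: revp_map_other)
  then show ?thesis using assms map_revp[of b] by simp
qed

lemma revp_commute_disjoint:
  assumes "distinct a" "distinct b" "set a \<inter> set b = {}"
  shows "revp a \<circ> revp b = revp b \<circ> revp a"
proof
  fix k
  have 1: "revp b k \<notin> set a" if "k \<in> set b"
    using revp_in[OF assms(2) that] assms(3) by blast
  have 2: "revp a k \<notin> set b" if "k \<in> set a"
    using revp_in[OF assms(1) that] assms(3) by blast
  consider "k \<in> set a" "k \<notin> set b" | "k \<in> set b" "k \<notin> set a" | "k \<notin> set a" "k \<notin> set b"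
    using assms(3) by blast
  then show "(revp a \<circ> revp b) k = (revp b \<circ> revp a) k"
    by cases (use 1 2 in \<open>simp_all add: revp_out\<close>)
qed

definition seg :: "nat list \<Rightarrow> nat list \<Rightarrow> bool" where
  "seg b a \<longleftrightarrow> (\<exists>x y. a = x @ b @ y)"

lemma seg_refl: "seg a a"
  unfolding seg_def by (rule exI[of _ "[]"], rule exI[of _ "[]"]) simp

lemma seg_set: "seg b a \<Longrightarrow> set b \<subseteq> set a"
  by (auto simp: seg_def)

lemma filter_all_in: "set b \<subseteq> S \<Longrightarrow> filter (\<lambda>k. k \<in> S) b = b"
  by (rule filter_True) auto

lemma filter_none_in: "set b \<inter> S = {} \<Longrightarrow> filter (\<lambda>k. k \<in> S) b = []"
  by (rule filter_False) auto

lemma filter_seg: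
  assumes "seg b a" "distinct a" shows "filter (\<lambda>k. k \<in> set b) a = b"
proof -
  obtain x y where a: "a = x @ b @ y" using assms unfolding seg_def by blast
  have "filter (\<lambda>k. k \<in> set b) x = []" "filter (\<lambda>k. k \<in> set b) y = []"
    using assms(2) unfolding a by (auto intro!: filter_none_in)
  then show ?thesis unfolding a by (simp add: filter_all_in)
qed

text \<open>Reversing a contiguous part commutes with deleting points, since what is left of the
  segment is contiguous in what is left of the list.\<close>

lemma filter_revp_segment:
  assumes c: "seg c a" and d: "distinct a"
  shows "filter P (map (revp c) a) = map (revp (filter P c)) (filter P a)"
proof -
  obtain x y where a: "a = x @ c @ y" using c unfolding seg_def by blast
  have d': "distinct (x @ c @ y)" "distinct (filter P x @ filter P c @ filter P y)"
    using d unfolding a by auto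
  have "filter P (map (revp c) a) = filter P x @ rev (filter P c) @ filter P y"
    unfolding a map_revp_segment[OF d'(1)] by (simp add: rev_filter)
  also have "\<dots> = map (revp (filter P c)) (filter P a)"
    unfolding a using map_revp_segment[OF d'(2)] by simp
  finally show ?thesis .
qed

text \<open>The pairs of lists whose elements \<open>list_t\<close> satisfy a relation of length
  four, that is, bound a square. Equality is excluded so that a nonempty list does not cross
  itself.\<close>

definition adj :: "nat list \<Rightarrow> nat list \<Rightarrow> bool" where
  "adj a b \<longleftrightarrow> set a \<inter> set b = {} \<or> (a \<noteq> b \<and> (seg a b \<or> seg b a))"

lemma adj_sym: "adj a b \<Longrightarrow> adj b a"
  by (auto simp: adj_def)

text \<open>Contiguity of a subset \<open>B\<close> in a list is detected by collapsing \<open>B\<close> to any one of its points.\<close>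

lemma segment_by_collapse:
  assumes d: "distinct a" and B: "B \<subseteq> set a" "B \<noteq> {}"
    and eq: "\<And>b0 b1. b0 \<in> B \<Longrightarrow> b1 \<in> B \<Longrightarrow> filter (\<lambda>k. k \<in> insert b0 (set a - B)) a =
      map (Transposition.transpose b0 b1) (filter (\<lambda>k. k \<in> insert b1 (set a - B)) a)"
  shows "seg (filter (\<lambda>k. k \<in> B) a) a"
proof -
  have ex: "\<exists>k\<in>set a. k \<in> B" using B by blast
  \<comment> \<open>The first point of \<open>B\<close> in \<open>a\<close>; \<open>b1\<close> will
    be the last. Collapsing to \<open>b0\<close> puts the point before everything in between and
    collapsing to \<open>b1\<close> puts it behind, so the two results match only if nothing outside
    \<open>B\<close> lies in between.\<close>
  obtain x b0 r where a: "a = x @ b0 # r" "b0 \<in> B" "\<forall>k\<in>set x. k \<notin> B"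
    using split_list_first_prop[OF ex] by blast
  have ex': "\<exists>k\<in>set (b0 # r). k \<in> B" using a by auto
  obtain m b1 y where m: "b0 # r = m @ b1 # y" "b1 \<in> B" "\<forall>k\<in>set y. k \<notin> B"
    using split_list_last_prop[OF ex'] by blast
  let ?S = "set a - B"
  let ?f = "\<lambda>b l. filter (\<lambda>k. k \<in> insert b ?S) l"
  have aa: "a = x @ (m @ [b1]) @ y" using a m by simp
  have mB: "filter (\<lambda>k. k \<in> ?S) m = []"
  proof (cases m)
    case Nil then show ?thesis by simp
  next
    case (Cons b m')
    then have m': "m = b0 # m'" using m by simp
    have d': "distinct (x @ b0 # m' @ b1 # y)" using d aa m' by simp
    have S: "set x \<subseteq> ?S" "set y \<subseteq> ?S" using a m aa by auto
    have f0: "?f b0 x = x" "?f b0 y = y" "?f b1 x = x" "?f b1 y = y"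
      using S by (auto intro!: filter_True)
    have f0m: "?f b0 m' = filter (\<lambda>k. k \<in> ?S) m'" "?f b1 m' = filter (\<lambda>k. k \<in> ?S) m'"
      using d' by (auto intro!: filter_cong)
    have "?f b0 a = x @ b0 # filter (\<lambda>k. k \<in> ?S) m' @ y"
      using f0 f0m m(2) d' unfolding aa m' by (simp add: a(2))
    moreover have "?f b1 a = x @ filter (\<lambda>k. k \<in> ?S) m' @ b1 # y"
      using f0 f0m a(2) d' unfolding aa m' by (simp add: m(2))
    moreover have "map (Transposition.transpose b0 b1) (x @ filter (\<lambda>k. k \<in> ?S) m' @ b1 # y) = x @ filter (\<lambda>k. k \<in> ?S) m' @ b0 # y"
    proof -
      have "map (Transposition.transpose b0 b1) l = l" if "b0 \<notin> set l" "b1 \<notin> set l" for l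
        by (rule map_idI) (use that in \<open>auto simp: Transposition.transpose_def\<close>)
      then show ?thesis using d' by simp
    qed
    ultimately have "x @ b0 # filter (\<lambda>k. k \<in> ?S) m' @ y = x @ filter (\<lambda>k. k \<in> ?S) m' @ b0 # y"
      using eq[OF a(2) m(2)] by simp
    then have "b0 # filter (\<lambda>k. k \<in> ?S) m' @ y = filter (\<lambda>k. k \<in> ?S) m' @ b0 # y" by simp
    then have e: "b0 # filter (\<lambda>k. k \<in> ?S) m' @ y = filter (\<lambda>k. k \<in> ?S) m' @ b0 # y" .
    have nb: "b0 \<notin> set (filter (\<lambda>k. k \<in> ?S) m')" using a(2) by simp
    have "filter (\<lambda>k. k \<in> ?S) m' = []"
    proof (cases "filter (\<lambda>k. k \<in> ?S) m'")
      case (Cons c l)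
      then have "c = b0" using e by simp
      then show ?thesis using nb unfolding Cons by simp
    qed
    then show ?thesis unfolding m' using a(2) by simp
  qed
  have "filter (\<lambda>k. k \<in> B) m = m"
  proof (rule filter_True, rule ballI)
    fix k assume k: "k \<in> set m"
    then have "k \<notin> ?S" using mB by (auto simp: filter_empty_conv)
    then show "k \<in> B" using k aa by auto
  qed
  moreover have "filter (\<lambda>k. k \<in> B) x = []" "filter (\<lambda>k. k \<in> B) y = []"
    using a(3) m(3) by (auto intro!: filter_False)
  ultimately have e: "filter (\<lambda>k. k \<in> B) a = m @ [b1]" unfolding aa using m(2) by simp
  show ?thesis unfolding seg_def e using aa by blast
qed

section \<open>The flip system of the virtual cactus group\<close>

type_synonym vstate = "(nat set \<Rightarrow> nat \<Rightarrow> nat) \<times> nat list set"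

text \<open>The first component of a state attaches to each set \<open>S\<close> of points the permutation of \<open>S\<close> that the
  flips so far have produced, a flip reversing the part of the moving list that lies in \<open>S\<close>; the second is
  the mark. An axis \<open>\<alpha>\<close> names the list \<open>loc q \<alpha>\<close> by pulling it back to the initial state.\<close>

definition loc :: "vstate \<Rightarrow> nat list \<Rightarrow> nat list" where
  "loc q \<alpha> = map (fst q (set \<alpha>)) \<alpha>"

definition vflip :: "nat list \<Rightarrow> vstate \<Rightarrow> vstate" where
  "vflip \<alpha> q = (\<lambda>S. revp (filter (\<lambda>k. k \<in> S) (loc q \<alpha>)) \<circ> fst q S, sym_diff (snd q) {\<alpha>})"

definition good :: "vstate \<Rightarrow> bool" where
  "good q \<longleftrightarrow> (\<forall>S. fst q S permutes S)"

definition vort :: "vstate \<Rightarrow> nat list \<Rightarrow> nat list \<Rightarrow> bool" where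
  "vort q \<alpha> \<beta> \<longleftrightarrow> adj (loc q \<alpha>) (loc q \<beta>)"

text \<open>Besides the axis, the hyperplane knows the traces of its list on its subsets, pulled back to the
  initial state, and how the permutations of the sets \<open>insert b0 S\<close> and \<open>insert b1 S\<close> compare if \<open>S\<close> avoids
  the list and \<open>b0\<close>, \<open>b1\<close> lie on it: a flip of a larger list in which the list is contiguous acts
  on both sets in the same way.\<close>

definition vlab :: "vstate \<Rightarrow> nat list \<Rightarrow>
    nat list \<times> (nat set \<Rightarrow> nat list) \<times> (nat set \<Rightarrow> nat \<Rightarrow> nat \<Rightarrow> nat \<Rightarrow> nat)" where
  "vlab q \<alpha> = (\<alpha>,
     (\<lambda>S. if S \<subseteq> set \<alpha> then map (inv' (fst q S)) (filter (\<lambda>k. k \<in> S) (loc q \<alpha>)) else []),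
     (\<lambda>S b0 b1. if b0 \<in> set \<alpha> \<and> b1 \<in> set \<alpha> \<and> S \<inter> set \<alpha> = {}
        then inv' (fst q (insert b0 S)) \<circ> Transposition.transpose b0 b1 \<circ> fst q (insert b1 S) else id))"

lemma goodD: "good q \<Longrightarrow> fst q S permutes S"
  by (simp add: good_def)

lemma good_bij: "good q \<Longrightarrow> bij (fst q S)"
  using goodD permutes_bij by blast

lemma loc_props:
  assumes q: "good q" and d: "distinct \<alpha>"
  shows "distinct (loc q \<alpha>)" "set (loc q \<alpha>) = set \<alpha>" "length (loc q \<alpha>) = length \<alpha>"
proof -
  show "set (loc q \<alpha>) = set \<alpha>"
    using permutes_image[OF goodD[OF q, of "set \<alpha>"]] by (simp add: loc_def)
  show "distinct (loc q \<alpha>)"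
    using d permutes_inj_on[OF goodD[OF q, of "set \<alpha>"]] by (simp add: loc_def distinct_map)
qed (simp add: loc_def)

lemma good_vflip:
  assumes q: "good q" and d: "distinct \<alpha>" shows "good (vflip \<alpha> q)"
  unfolding good_def
proof
  fix S
  have "distinct (filter (\<lambda>k. k \<in> S) (loc q \<alpha>))" using loc_props[OF q d] by simp
  then have "revp (filter (\<lambda>k. k \<in> S) (loc q \<alpha>)) permutes S"
    by (rule permutes_subset[OF revp_permutes]) auto
  then show "fst (vflip \<alpha> q) S permutes S"
    unfolding vflip_def using permutes_compose[OF goodD[OF q]] by simp
qed

lemma loc_vflip: "loc (vflip \<gamma> q) \<alpha> = map (revp (filter (\<lambda>k. k \<in> set \<alpha>) (loc q \<gamma>))) (loc q \<alpha>)"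
  by (simp add: loc_def vflip_def)

lemma loc_vflip_same:
  assumes q: "good q" and d: "distinct \<alpha>" shows "loc (vflip \<alpha> q) \<alpha> = rev (loc q \<alpha>)"
  unfolding loc_vflip using loc_props[OF q d] by (simp add: filter_all_in map_revp)

lemma loc_vflip_disjoint:
  assumes q: "good q" and d: "distinct \<alpha>" "distinct \<gamma>" and dis: "set (loc q \<alpha>) \<inter> set (loc q \<gamma>) = {}"
  shows "loc (vflip \<gamma> q) \<alpha> = loc q \<alpha>"
proof -
  have "filter (\<lambda>k. k \<in> set \<alpha>) (loc q \<gamma>) = []"
    using dis loc_props[OF q d(1)] by (auto intro!: filter_none_in)
  then show ?thesis unfolding loc_vflip using revp_short[of "[]"] by simp
qed

lemma loc_vflip_inner:
  assumes q: "good q" and d: "distinct \<alpha>" "distinct \<gamma>" and s: "seg (loc q \<gamma>) (loc q \<alpha>)"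
  shows "loc (vflip \<gamma> q) \<alpha> = map (revp (loc q \<gamma>)) (loc q \<alpha>)"
proof -
  have "filter (\<lambda>k. k \<in> set \<alpha>) (loc q \<gamma>) = loc q \<gamma>"
    using seg_set[OF s] loc_props[OF q d(1)] by (intro filter_all_in) simp
  then show ?thesis unfolding loc_vflip by simp
qed

text \<open>The larger list runs through the points of \<alpha> in one stretch, so its trace on them
  is the list of \<alpha> itself, and this is what gets reversed.\<close>

lemma loc_vflip_outer:
  assumes q: "good q" and d: "distinct \<alpha>" "distinct \<gamma>" and s: "seg (loc q \<alpha>) (loc q \<gamma>)"
  shows "loc (vflip \<gamma> q) \<alpha> = rev (loc q \<alpha>)"
proof -
  have "filter (\<lambda>k. k \<in> set \<alpha>) (loc q \<gamma>) = loc q \<alpha>"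
    using filter_seg[OF s] loc_props[OF q d(1)] loc_props[OF q d(2)] by simp
  then show ?thesis unfolding loc_vflip using map_revp loc_props[OF q d(1)] by simp
qed

lemma vflip_vflip:
  assumes q: "good q" and d: "distinct \<alpha>" shows "vflip \<alpha> (vflip \<alpha> q) = q"
proof -
  have "revp (filter (\<lambda>k. k \<in> S) (rev (loc q \<alpha>))) \<circ> (revp (filter (\<lambda>k. k \<in> S) (loc q \<alpha>)) \<circ> fst q S) = fst q S" for S
    using loc_props[OF q d] by (auto simp: fun_eq_iff rev_filter[symmetric] revp_rev)
  moreover have "sym_diff (sym_diff (snd q) {\<alpha>}) {\<alpha>} = snd q" by blast
  ultimately show ?thesis
    unfolding vflip_def[of \<alpha> "vflip \<alpha> q"] loc_vflip_same[OF q d] by (simp add: vflip_def prod_eq_iff)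
qed

text \<open>On each set of points the outer flip done first leaves the inner list reversed, which
  has the same reversal permutation; the inner flip done first conjugates the outer reversal. Both
  orders give the same product by \<open>revp_conj_comp\<close>.\<close>

lemma vflip_comm_inner:
  assumes q: "good q" and d: "distinct \<alpha>" "distinct \<beta>" and s: "seg (loc q \<beta>) (loc q \<alpha>)"
  shows "vflip \<beta> (vflip \<alpha> q) = vflip \<alpha> (vflip \<beta> q)"
proof -
  let ?a = "loc q \<alpha>" and ?b = "loc q \<beta>"
  note a = loc_props[OF q d(1)] and b = loc_props[OF q d(2)]
  have "revp (filter (\<lambda>k. k \<in> S) (rev ?b)) \<circ> revp (filter (\<lambda>k. k \<in> S) ?a) =
      revp (filter (\<lambda>k. k \<in> S) (map (revp ?b) ?a)) \<circ> revp (filter (\<lambda>k. k \<in> S) ?b)" for S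
    unfolding filter_revp_segment[OF s a(1)] using a b
    by (subst revp_conj_comp) (auto simp: inj_revp rev_filter[symmetric] revp_rev)
  then have "revp (filter (\<lambda>k. k \<in> S) (rev ?b)) \<circ> (revp (filter (\<lambda>k. k \<in> S) ?a) \<circ> fst q S) =
      revp (filter (\<lambda>k. k \<in> S) (map (revp ?b) ?a)) \<circ> (revp (filter (\<lambda>k. k \<in> S) ?b) \<circ> fst q S)" for S
    by (metis comp_assoc)
  moreover have "sym_diff (sym_diff (snd q) {\<alpha>}) {\<beta>} = sym_diff (sym_diff (snd q) {\<beta>}) {\<alpha>}" by blast
  ultimately show ?thesis
    unfolding vflip_def[of \<beta> "vflip \<alpha> q"] vflip_def[of \<alpha> "vflip \<beta> q"]
      loc_vflip_outer[OF q d(2,1) s] loc_vflip_inner[OF q d s]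
    by (simp add: vflip_def prod_eq_iff)
qed

lemma vflip_comm_disjoint:
  assumes q: "good q" and d: "distinct \<alpha>" "distinct \<beta>" and s: "set (loc q \<alpha>) \<inter> set (loc q \<beta>) = {}"
  shows "vflip \<beta> (vflip \<alpha> q) = vflip \<alpha> (vflip \<beta> q)"
proof -
  let ?a = "loc q \<alpha>" and ?b = "loc q \<beta>"
  note a = loc_props[OF q d(1)] and b = loc_props[OF q d(2)]
  have "revp (filter (\<lambda>k. k \<in> S) ?b) \<circ> revp (filter (\<lambda>k. k \<in> S) ?a) =
      revp (filter (\<lambda>k. k \<in> S) ?a) \<circ> revp (filter (\<lambda>k. k \<in> S) ?b)" for S
    by (rule revp_commute_disjoint) (use a(1) b(1) s in auto)
  then have "revp (filter (\<lambda>k. k \<in> S) ?b) \<circ> (revp (filter (\<lambda>k. k \<in> S) ?a) \<circ> fst q S) =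
      revp (filter (\<lambda>k. k \<in> S) ?a) \<circ> (revp (filter (\<lambda>k. k \<in> S) ?b) \<circ> fst q S)" for S
    by (metis comp_assoc)
  moreover have "sym_diff (sym_diff (snd q) {\<alpha>}) {\<beta>} = sym_diff (sym_diff (snd q) {\<beta>}) {\<alpha>}" by blast
  moreover have "set (loc q \<beta>) \<inter> set (loc q \<alpha>) = {}" using s by blast
  ultimately show ?thesis
    unfolding vflip_def[of \<beta> "vflip \<alpha> q"] vflip_def[of \<alpha> "vflip \<beta> q"]
    using loc_vflip_disjoint[OF q d(1,2) s] loc_vflip_disjoint[OF q d(2,1)]
    by (simp add: vflip_def prod_eq_iff)
qed

lemma vflip_comm:
  assumes q: "good q" and d: "distinct \<alpha>" "distinct \<beta>" and o: "vort q \<alpha> \<beta>"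
  shows "vflip \<alpha> (vflip \<beta> q) = vflip \<beta> (vflip \<alpha> q)"
  using o vflip_comm_disjoint[OF q d] vflip_comm_inner[OF q d] vflip_comm_inner[OF q d(2,1)]
  unfolding vort_def adj_def by auto

lemma vlab_vflip:
  assumes q: "good q" and d: "distinct \<alpha>" "distinct \<gamma>"
    and adj: "set (loc q \<alpha>) \<inter> set (loc q \<gamma>) = {} \<or> seg (loc q \<gamma>) (loc q \<alpha>) \<or> seg (loc q \<alpha>) (loc q \<gamma>)"
  shows "vlab (vflip \<gamma> q) \<alpha> = vlab q \<alpha>"
proof -
  let ?a = "loc q \<alpha>" and ?c = "loc q \<gamma>" and ?a' = "loc (vflip \<gamma> q) \<alpha>"
  let ?f = "\<lambda>S l. filter (\<lambda>k. k \<in> S) l"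
  note a = loc_props[OF q d(1)] and c = loc_props[OF q d(2)]
  have inv: "inv' (fst (vflip \<gamma> q) S) = inv' (fst q S) \<circ> revp (?f S ?c)" for S
    unfolding vflip_def fst_conv using o_inv_distrib[OF bij_revp good_bij[OF q]] inv_revp c(1) by simp
  \<comment> \<open>In each of the three positions the trace on \<open>S\<close> is moved by the
    reversal of the trace of \<gamma>. The permutation of \<open>S\<close> acquires the same factor,
    so pulling back cancels it.\<close>
  have 1: "map (inv' (fst (vflip \<gamma> q) S)) (?f S ?a') = map (inv' (fst q S)) (?f S ?a)" if S: "S \<subseteq> set \<alpha>" for S
  proof -
    have "?f S ?a' = map (revp (?f S ?c)) (?f S ?a)"
      using adj
    proof (elim disjE)
      assume dis: "set ?a \<inter> set ?c = {}"
      then have "?f S ?c = []" using S a by (intro filter_none_in) auto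
      then show ?thesis using loc_vflip_disjoint[OF q d dis] revp_short[of "[]"] by simp
    next
      assume s: "seg ?c ?a"
      show ?thesis unfolding loc_vflip_inner[OF q d s] by (rule filter_revp_segment[OF s a(1)])
    next
      assume s: "seg ?a ?c"
      have "?f S ?c = ?f S (?f (set ?a) ?c)"
        using S a(2) by (auto simp: filter_filter intro!: filter_cong)
      then have "?f S ?c = ?f S ?a" using filter_seg[OF s c(1)] by simp
      then show ?thesis unfolding loc_vflip_outer[OF q d s] using a(1) by (simp add: map_revp rev_filter)
    qed
    then show ?thesis unfolding inv using c(1) by (simp add: o_def)
  qed
  \<comment> \<open>It suffices that the transposition conjugates the two reversals into each other.
    For disjoint lists both traces are the same part in \<open>S\<close>; for an inner \<gamma> both
    have at most one point and act trivially; for an outer \<gamma> the points \<open>b0\<close> and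
    \<open>b1\<close> occupy the same place among the points of \<open>S\<close>, because the list
    of \<alpha> is contiguous.\<close>
  have 2: "inv' (fst (vflip \<gamma> q) (insert b0 S)) \<circ> Transposition.transpose b0 b1 \<circ> fst (vflip \<gamma> q) (insert b1 S) =
      inv' (fst q (insert b0 S)) \<circ> Transposition.transpose b0 b1 \<circ> fst q (insert b1 S)"
    if b: "b0 \<in> set \<alpha>" "b1 \<in> set \<alpha>" "S \<inter> set \<alpha> = {}" for S b0 b1
  proof -
    let ?g = "?f (insert b0 S) ?c" and ?h = "?f (insert b1 S) ?c"
    have fx: "map (Transposition.transpose b0 b1) (?f S l) = ?f S l" for l
      by (rule map_idI) (use b in \<open>auto simp: Transposition.transpose_def\<close>)
    have "?g = map (Transposition.transpose b0 b1) ?h \<or> (length ?g \<le> 1 \<and> length ?h \<le> 1)"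
      using adj
    proof (elim disjE)
      assume dis: "set ?a \<inter> set ?c = {}"
      then have "?g = ?f S ?c" "?h = ?f S ?c" using b a by (auto intro!: filter_cong)
      then show ?thesis using fx by simp
    next
      assume s: "seg ?c ?a"
      have "?f (insert b0 S) ?c = filter (\<lambda>k. k = b0) ?c" for b0
        using seg_set[OF s] a b by (intro filter_cong) auto
      moreover have "length (filter (\<lambda>k. k = b) l) \<le> 1" if "distinct l" for b l
        using that by (induction l) (auto simp: filter_empty_conv)
      from this[OF c(1)] have "length (filter (\<lambda>k. k = b0) ?c) \<le> 1 \<and> length (filter (\<lambda>k. k = b1) ?c) \<le> 1"
        by blast
      ultimately show ?thesis by simp
    next
      assume s: "seg ?a ?c"
      then obtain x y where xy: "?c = x @ ?a @ y" unfolding seg_def by blast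
      have "?f (insert b S) ?c = ?f S x @ [b] @ ?f S y" if bA: "b \<in> set \<alpha>" for b
      proof -
        have dx: "distinct (x @ ?a @ y)" using c(1) xy by simp
        have "?f (insert b S) x = ?f S x" "?f (insert b S) y = ?f S y"
          using dx a(2) bA by (auto intro!: filter_cong)
        moreover have "?f (insert b S) ?a = filter (\<lambda>k. k = b) ?a"
          using a b(3) by (intro filter_cong) auto
        moreover have "filter (\<lambda>k. k = b) l = [b]" if "distinct l" "b \<in> set l" for l
          using that by (induction l) (auto simp: filter_empty_conv)
        ultimately show ?thesis unfolding xy using a bA by simp
      qed
      then show ?thesis using b fx by simp
    qed
    then have "revp ?g \<circ> Transposition.transpose b0 b1 \<circ> revp ?h = Transposition.transpose b0 b1"
    proof (elim disjE conjE)
      assume e: "?g = map (Transposition.transpose b0 b1) ?h"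
      have d1: "distinct ?h" using c(1) by simp
      have "revp ?g \<circ> Transposition.transpose b0 b1 = Transposition.transpose b0 b1 \<circ> revp ?h"
        unfolding e by (rule revp_conj_comp[OF d1]) (simp add: inj_transpose)
      then show ?thesis using revp_comp[OF d1] by (simp add: comp_assoc)
    next
      assume "length ?g \<le> 1" "length ?h \<le> 1"
      then show ?thesis using revp_short[of ?g] revp_short[of ?h] by simp
    qed
    then have "inv' (fst q (insert b0 S)) \<circ> (revp ?g \<circ> Transposition.transpose b0 b1 \<circ> revp ?h) \<circ> fst q (insert b1 S) =
        inv' (fst q (insert b0 S)) \<circ> Transposition.transpose b0 b1 \<circ> fst q (insert b1 S)"
      by simp
    then show ?thesis unfolding inv by (simp add: vflip_def comp_assoc)
  qed
  show ?thesis
    unfolding vlab_def using 1 2 by (auto simp: fun_eq_iff)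
qed

lemma Diff_disjoint2: "(A - B) \<inter> B = {}"
  by blast

text \<open>Contiguity is tested by collapsing \<open>set \<beta>\<close> to one of its points. The
  label of \<alpha> knows the traces on the two collapsed sets, each up to the permutation of that
  set, and the label of \<beta> compares these permutations; so the collapse identity carries over
  from \<open>q\<close> to \<open>q'\<close>.\<close>

lemma vlab_determines_seg:
  assumes q: "good q" "good q'" and d: "distinct \<alpha>" "distinct \<beta>" and ne: "\<beta> \<noteq> []"
    and lab: "vlab q \<alpha> = vlab q' \<alpha>" "vlab q \<beta> = vlab q' \<beta>"
    and s: "seg (loc q \<beta>) (loc q \<alpha>)"
  shows "seg (loc q' \<beta>) (loc q' \<alpha>)"
proof -
  let ?a = "loc q \<alpha>" and ?b = "loc q \<beta>" and ?a' = "loc q' \<alpha>" and ?b' = "loc q' \<beta>"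
  let ?f = "\<lambda>S l. filter (\<lambda>k. k \<in> S) l"
  note a = loc_props[OF q(1) d(1)] and b = loc_props[OF q(1) d(2)]
  note a' = loc_props[OF q(2) d(1)] and b' = loc_props[OF q(2) d(2)]
  have BA: "set \<beta> \<subseteq> set \<alpha>" using seg_set[OF s] a b by simp
  have l1: "map (inv' (fst q S)) (?f S (loc q \<gamma>)) = map (inv' (fst q' S)) (?f S (loc q' \<gamma>))"
    if "S \<subseteq> set \<gamma>" "vlab q \<gamma> = vlab q' \<gamma>" for S \<gamma>
    using that(2) that(1) unfolding vlab_def by (auto dest!: fun_cong[where x = S])
  have l2: "inv' (fst q (insert b0 S)) \<circ> Transposition.transpose b0 b1 \<circ> fst q (insert b1 S) =
      inv' (fst q' (insert b0 S)) \<circ> Transposition.transpose b0 b1 \<circ> fst q' (insert b1 S)"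
    if "b0 \<in> set \<beta>" "b1 \<in> set \<beta>" "S \<inter> set \<beta> = {}" for S b0 b1
  proof -
    have "snd (snd (vlab q \<beta>)) S b0 b1 = snd (snd (vlab q' \<beta>)) S b0 b1" using lab(2) by simp
    then show ?thesis using that by (simp add: vlab_def)
  qed
  have inj: "map (inv' (fst q' S)) x = map (inv' (fst q' S)) y \<Longrightarrow> x = y" for S x y
    by (rule injD[OF inj_mapI[OF bij_is_inj[OF bij_imp_bij_inv[OF good_bij[OF q(2)]]]]])
  \<comment> \<open>First the order of the points of \<beta>: in \<open>q\<close> the trace of
    \<alpha> on them is the list of \<beta>, and both labels pull it back by the same
    permutation.\<close>
  have "?f (set \<beta>) ?a = ?b" using filter_seg[OF s a(1)] b(2) by simp
  then have "map (inv' (fst q' (set \<beta>))) (?f (set \<beta>) ?a') = map (inv' (fst q' (set \<beta>))) ?b'"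
    using l1[OF BA lab(1)] l1[OF subset_refl lab(2)] b(2) b'(2) by (simp add: filter_all_in)
  then have fb: "?f (set \<beta>) ?a' = ?b'" by (rule inj)
  have "seg (?f (set \<beta>) ?a') ?a'"
  proof (rule segment_by_collapse[OF a'(1)])
    show "set \<beta> \<subseteq> set ?a'" "set \<beta> \<noteq> {}" using BA a' ne by auto
    fix b0 b1 assume b01: "b0 \<in> set \<beta>" "b1 \<in> set \<beta>"
    let ?S = "set ?a' - set \<beta>"
    let ?SA = "insert b0 ?S" and ?SB = "insert b1 ?S"
    have sub: "?SA \<subseteq> set \<alpha>" "?SB \<subseteq> set \<alpha>" using b01 BA a' by auto
    have base: "?f ?SA ?a = map (Transposition.transpose b0 b1) (?f ?SB ?a)"
    proof -
      obtain x y where xy: "?a = x @ ?b @ y" using s unfolding seg_def by blast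
      have dx: "distinct (x @ ?b @ y)" using a(1) xy by simp
      have "?f (insert c ?S) ?a = ?f ?S x @ [c] @ ?f ?S y" if c: "c \<in> set \<beta>" for c
      proof -
        have "?f (insert c ?S) x = ?f ?S x" "?f (insert c ?S) y = ?f ?S y"
          using dx b(2) c by (auto intro!: filter_cong)
        moreover have "?f (insert c ?S) ?b = filter (\<lambda>k. k = c) ?b"
          using b(2) by (intro filter_cong) auto
        moreover have "filter (\<lambda>k. k = c) l = [c]" if "distinct l" "c \<in> set l" for l
          using that by (induction l) (auto simp: filter_empty_conv)
        ultimately show ?thesis unfolding xy using b c by simp
      qed
      moreover have "map (Transposition.transpose b0 b1) (?f ?S l) = ?f ?S l" for l
        by (rule map_idI) (use b01 in \<open>auto simp: Transposition.transpose_def\<close>)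
      ultimately show ?thesis using b01 by simp
    qed
    have k: "map (fst q ?SB) (map (inv' (fst q ?SB)) l) = l" "map (fst q' ?SB) (map (inv' (fst q' ?SB)) l) = l" for l
      using permutes_inverses(1)[OF goodD[OF q(1)]] permutes_inverses(1)[OF goodD[OF q(2)]] by (simp_all add: map_idI)
    have "map (inv' (fst q' ?SA)) (?f ?SA ?a') = map (inv' (fst q ?SA)) (map (Transposition.transpose b0 b1) (?f ?SB ?a))"
      using l1[OF sub(1) lab(1)] base by simp
    \<comment> \<open>The permutation of \<open>?SB\<close> and its inverse are inserted to form the
      composite that the label of \<beta> records.\<close>
    also have "\<dots> = map (inv' (fst q ?SA) \<circ> Transposition.transpose b0 b1 \<circ> fst q ?SB) (map (inv' (fst q ?SB)) (?f ?SB ?a))"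
      using k(1)[of "?f ?SB ?a"] by (simp add: map_map[symmetric] del: map_map)
    also have "\<dots> = map (inv' (fst q' ?SA) \<circ> Transposition.transpose b0 b1 \<circ> fst q' ?SB) (map (inv' (fst q' ?SB)) (?f ?SB ?a'))"
      unfolding l1[OF sub(2) lab(1)] l2[OF b01 Diff_disjoint2] by (rule refl)
    also have "\<dots> = map (inv' (fst q' ?SA)) (map (Transposition.transpose b0 b1) (?f ?SB ?a'))"
      using k(2)[of "?f ?SB ?a'"] by (simp add: map_map[symmetric] del: map_map)
    finally show "?f ?SA ?a' = map (Transposition.transpose b0 b1) (?f ?SB ?a')" by (rule inj)
  qed
  then show ?thesis unfolding fb .
qed

text \<open>Besides nesting only properness needs care. On equal sets of points a segment has full
  length, so nested lists would be equal; on different sets the lists stay different, because a list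
  keeps its set of points in every state.\<close>

lemma vlab_determines:
  assumes q: "good q" "good q'" and d: "distinct \<alpha>" "distinct \<beta>" and ne: "\<alpha> \<noteq> []" "\<beta> \<noteq> []"
    and lab: "vlab q \<alpha> = vlab q' \<alpha>" "vlab q \<beta> = vlab q' \<beta>"
    and o: "vort q \<alpha> \<beta>"
  shows "vort q' \<alpha> \<beta>"
proof -
  note sets = loc_props(2)[OF q(1) d(1)] loc_props(2)[OF q(1) d(2)] loc_props(2)[OF q(2) d(1)] loc_props(2)[OF q(2) d(2)]
  have ne': "loc q' \<alpha> \<noteq> loc q' \<beta>" if "loc q \<alpha> \<noteq> loc q \<beta>" "set \<alpha> = set \<beta>"
    "seg (loc q \<alpha>) (loc q \<beta>) \<or> seg (loc q \<beta>) (loc q \<alpha>)"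
  proof -
    have "length \<alpha> = length \<beta>" using that(2) d by (metis distinct_card)
    then have "loc q \<alpha> = loc q \<beta>"
      using that(3) loc_props(3)[OF q(1) d(1)] loc_props(3)[OF q(1) d(2)] unfolding seg_def by auto
    then show ?thesis using that(1) by blast
  qed
  have "seg (loc q' \<beta>) (loc q' \<alpha>)" if "seg (loc q \<beta>) (loc q \<alpha>)"
    by (rule vlab_determines_seg[OF q d ne(2) lab that])
  moreover have "seg (loc q' \<alpha>) (loc q' \<beta>)" if "seg (loc q \<alpha>) (loc q \<beta>)"
    by (rule vlab_determines_seg[OF q d(2,1) ne(1) lab(2,1) that])
  moreover have "loc q' \<alpha> \<noteq> loc q' \<beta>" if "set \<alpha> \<noteq> set \<beta>"
    using that sets by metis
  ultimately show ?thesis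
    using o ne' sets unfolding vort_def adj_def by metis
qed

section \<open>Axes, reachable states and the special flip system\<close>

context virtual_cactus begin

definition I :: "nat list set" where
  "I = {a. distinct a \<and> 2 \<le> length a \<and> set a \<subseteq> {1..n}}"

definition q0 :: vstate where
  "q0 = (\<lambda>_. id, {})"

definition V :: "vstate set" where
  "V = {fold vflip l q0 | l. set l \<subseteq> I}"

lemma I_D: "\<alpha> \<in> I \<Longrightarrow> distinct \<alpha>" "\<alpha> \<in> I \<Longrightarrow> \<alpha> \<noteq> []" "\<alpha> \<in> I \<Longrightarrow> set \<alpha> \<subseteq> {1..n}" "\<alpha> \<in> I \<Longrightarrow> 2 \<le> length \<alpha>"
  by (auto simp: I_def)

lemma finite_I: "finite I"
proof (rule finite_subset)
  show "I \<subseteq> {a. set a \<subseteq> {1..n} \<and> length a \<le> n}"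
  proof (rule subsetI)
    fix a assume a: "a \<in> I"
    have "length a = card (set a)" using distinct_card[OF I_D(1)[OF a]] by simp
    also have "\<dots> \<le> card {1..n}" by (rule card_mono[OF _ I_D(3)[OF a]]) simp
    finally show "a \<in> {a. set a \<subseteq> {1..n} \<and> length a \<le> n}" using I_D(3)[OF a] by simp
  qed
qed (rule finite_lists_length_le, simp)

lemma q0_in: "q0 \<in> V"
  unfolding V_def by (intro CollectI exI[of _ "[]"]) simp

lemma V_flip: "\<alpha> \<in> I \<Longrightarrow> q \<in> V \<Longrightarrow> vflip \<alpha> q \<in> V"
proof -
  assume a: "\<alpha> \<in> I" and "q \<in> V"
  then obtain l where "set l \<subseteq> I" "q = fold vflip l q0" unfolding V_def by blast
  then have "set (l @ [\<alpha>]) \<subseteq> I" "vflip \<alpha> q = fold vflip (l @ [\<alpha>]) q0" using a by auto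
  then show ?thesis unfolding V_def by blast
qed

lemma V_induct [consumes 1, case_names q0 flip]:
  assumes "q \<in> V" "P q0" "\<And>\<alpha> q. \<alpha> \<in> I \<Longrightarrow> q \<in> V \<Longrightarrow> P q \<Longrightarrow> P (vflip \<alpha> q)"
  shows "P q"
proof -
  have "set l \<subseteq> I \<Longrightarrow> P (fold vflip l q0)" for l
  proof (induction l rule: rev_induct)
    case (snoc a l)
    then have "fold vflip l q0 \<in> V" unfolding V_def by auto
    then show ?case using snoc assms(3) by simp
  qed (simp add: assms(2))
  then show ?thesis using assms(1) unfolding V_def by blast
qed

lemma V_good: "q \<in> V \<Longrightarrow> good q"
proof (induction rule: V_induct)
  case q0 then show ?case by (simp add: q0_def good_def permutes_id)
qed (simp add: good_vflip I_D)

lemma V_sub: "q \<in> V \<Longrightarrow> snd q \<subseteq> I"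
  by (induction rule: V_induct) (auto simp: q0_def vflip_def)

text \<open>A state is a function on all sets of naturals, but only their points in
  \<open>{1..n}\<close> ever move. So a state is determined by finitely many permutations, and there
  are finitely many states.\<close>

lemma V_restrict: "q \<in> V \<Longrightarrow> fst q A = fst q (A \<inter> {1..n})"
proof (induction rule: V_induct)
  case (flip \<alpha> q)
  have "set (loc q \<alpha>) \<subseteq> {1..n}"
    using loc_props(2)[OF V_good[OF flip.hyps(2)] I_D(1)[OF flip.hyps(1)]] I_D(3)[OF flip.hyps(1)] by simp
  then have "filter (\<lambda>k. k \<in> A) (loc q \<alpha>) = filter (\<lambda>k. k \<in> A \<inter> {1..n}) (loc q \<alpha>)"
    by (intro filter_cong) auto
  then show ?case unfolding vflip_def fst_conv using flip.IH by simp
qed (simp add: q0_def)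

lemma finite_V: "finite V"
proof -
  let ?r = "\<lambda>q::vstate. (restrict (fst q) (Pow {1..n}), snd q)"
  have "finite ((PiE (Pow {1..n}) (\<lambda>A. {p. p permutes A})) \<times> Pow I)"
    by (intro finite_cartesian_product finite_PiE) (auto intro: finite_permutations finite_subset simp: finite_I)
  moreover have "?r ` V \<subseteq> (PiE (Pow {1..n}) (\<lambda>A. {p. p permutes A})) \<times> Pow I"
    using V_good V_sub goodD by fastforce
  ultimately have "finite (?r ` V)" by (rule finite_subset[rotated])
  moreover have "inj_on ?r V"
  proof (rule inj_onI)
    fix q q' assume q: "q \<in> V" "q' \<in> V" and eq: "?r q = ?r q'"
    have "fst q A = fst q' A" for A
      using fun_cong[OF arg_cong[OF eq, of fst], of "A \<inter> {1..n}"] V_restrict[OF q(1), of A] V_restrict[OF q(2), of A]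
      by simp
    then show "q = q'" using eq by (simp add: prod_eq_iff fun_eq_iff)
  qed
  ultimately show ?thesis by (rule finite_imageD)
qed

lemma vlab_move:
  assumes "q \<in> V" "\<alpha> \<in> I" "\<gamma> \<in> I" "vort q \<alpha> \<gamma>" shows "vlab (vflip \<gamma> q) \<alpha> = vlab q \<alpha>"
  by (rule vlab_vflip) (use assms V_good I_D in \<open>auto simp: vort_def adj_def\<close>)

lemma vlab_same:
  assumes "q \<in> V" "\<alpha> \<in> I" shows "vlab (vflip \<alpha> q) \<alpha> = vlab q \<alpha>"
  by (rule vlab_vflip) (use assms V_good I_D seg_refl in auto)

lemma vort_sym: "vort q \<alpha> \<beta> \<Longrightarrow> vort q \<beta> \<alpha>"
  unfolding vort_def by (rule adj_sym)

lemma vort_determines: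
  assumes "q \<in> V" "q' \<in> V" "\<alpha> \<in> I" "\<beta> \<in> I" "vlab q \<alpha> = vlab q' \<alpha>" "vlab q \<beta> = vlab q' \<beta>" "vort q \<alpha> \<beta>"
  shows "vort q' \<alpha> \<beta>"
  by (rule vlab_determines[of q q']) (use assms V_good I_D in auto)

lemma vort_in: "vort q \<alpha> \<alpha> \<Longrightarrow> loc q \<alpha> = []"
  by (auto simp: vort_def adj_def)

text \<open>The empty list is disjoint from itself and would cross itself, while
  \<open>flip_system\<close> asks for irreflexivity at all indices and not only at those in
  \<open>I\<close>.\<close>

definition ortI :: "vstate \<Rightarrow> nat list \<Rightarrow> nat list \<Rightarrow> bool" where
  "ortI q \<alpha> \<beta> \<longleftrightarrow> \<alpha> \<noteq> [] \<and> \<beta> \<noteq> [] \<and> vort q \<alpha> \<beta>"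

sublocale flip: special_flip_system V I vflip snd ortI vlab
proof
  show "finite V" by (rule finite_V)
  show "finite I" by (rule finite_I)
  fix \<alpha> q assume a: "\<alpha> \<in> I" and q: "q \<in> V"
  note g = V_good[OF q] I_D(1)[OF a]
  show "vflip \<alpha> q \<in> V" by (rule V_flip[OF a q])
  show "vflip \<alpha> (vflip \<alpha> q) = q" by (rule vflip_vflip[OF g])
  show "snd (vflip \<alpha> q) = sym_diff (snd q) {\<alpha>}" by (simp add: vflip_def)
  show "vlab (vflip \<alpha> q) \<alpha> = vlab q \<alpha>" by (rule vlab_same[OF q a])
next
  show "snd q \<subseteq> I" if "q \<in> V" for q using V_sub that .
next
  show "ortI q \<beta> \<alpha>" if "ortI q \<alpha> \<beta>" for q \<alpha> \<beta> using that vort_sym by (auto simp: ortI_def)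
next
  show "\<not> ortI q \<alpha> \<alpha>" for q \<alpha> using vort_in[of q \<alpha>] by (auto simp: ortI_def loc_def)
next
  fix q \<alpha> \<beta> assume a: "q \<in> V" "\<alpha> \<in> I" "\<beta> \<in> I" "ortI q \<alpha> \<beta>"
  then have o: "vort q \<alpha> \<beta>" by (simp add: ortI_def)
  show "vflip \<alpha> (vflip \<beta> q) = vflip \<beta> (vflip \<alpha> q)"
    by (rule vflip_comm[OF V_good[OF a(1)] I_D(1)[OF a(2)] I_D(1)[OF a(3)] o])
  show "vlab (vflip \<beta> q) \<alpha> = vlab q \<alpha>" by (rule vlab_move[OF a(1-3) o])
  \<comment> \<open>The flip changes neither label, and the labels decide crossing; so the
    persistence of crossing under flips is a consequence of specialness and is not computed
    separately.\<close>
  have "vort (vflip \<alpha> q) \<alpha> \<beta>"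
    by (rule vort_determines[OF a(1) V_flip[OF a(2,1)] a(2,3) vlab_same[OF a(1,2), symmetric]
          vlab_move[OF a(1,3,2) vort_sym[OF o], symmetric] o])
  then show "ortI (vflip \<alpha> q) \<alpha> \<beta>" using a(4) by (simp add: ortI_def)
  fix \<gamma> assume c: "\<gamma> \<in> I" "ortI q \<alpha> \<gamma>" "ortI q \<beta> \<gamma>"
  then have o': "vort q \<alpha> \<gamma>" "vort q \<beta> \<gamma>" by (auto simp: ortI_def)
  have "vort (vflip \<gamma> q) \<alpha> \<beta>"
    by (rule vort_determines[OF a(1) V_flip[OF c(1) a(1)] a(2,3) vlab_move[OF a(1,2) c(1) o'(1), symmetric]
          vlab_move[OF a(1,3) c(1) o'(2), symmetric] o])
  then show "ortI (vflip \<gamma> q) \<alpha> \<beta>" using a(4) by (simp add: ortI_def)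
next
  fix q q' \<alpha> \<beta> assume "q \<in> V" "q' \<in> V" "\<alpha> \<in> I" "\<beta> \<in> I" "vlab q \<alpha> = vlab q' \<alpha>" "vlab q \<beta> = vlab q' \<beta>" "ortI q \<alpha> \<beta>"
  then show "ortI q' \<alpha> \<beta>" using vort_determines[of q q' \<alpha> \<beta>] by (simp add: ortI_def)
qed

end

section \<open>The local system of the virtual cactus group\<close>

lemma extend_to_permutation:
  fixes xs ys :: "'a list"
  assumes fin: "finite A" and xs: "distinct xs" "set xs \<subseteq> A" and ys: "distinct ys" "set ys \<subseteq> A"
    and len: "length xs = length ys"
  obtains w where "w permutes A" "map w xs = ys"
proof -
  let ?f = "\<lambda>k. the (map_of (zip xs ys) k)"
  have f: "?f (xs ! m) = ys ! m" if "m < length xs" for m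
    using map_of_zip_nth[OF len xs(1)] that len by simp
  have mf: "map ?f xs = ys"
    by (rule nth_equalityI) (use f len in auto)
  have bf: "bij_betw ?f (set xs) (set ys)"
  proof (rule bij_betw_imageI)
    show im: "?f ` set xs = set ys" using mf by (metis list.set_map)
    have "card (?f ` set xs) = card (set xs)"
      unfolding im using distinct_card xs(1) ys(1) len by metis
    then show "inj_on ?f (set xs)" by (rule eq_card_imp_inj_on[rotated]) simp
  qed
  have "card (A - set xs) = card (A - set ys)"
    using xs ys len fin by (simp add: card_Diff_subset distinct_card)
  then obtain g where g: "bij_betw g (A - set xs) (A - set ys)"
    using finite_same_card_bij[of "A - set xs" "A - set ys"] fin by auto
  define w where "w k = (if k \<in> set xs then ?f k else if k \<in> A then g k else k)" for k
  have "bij_betw w (set xs) (set ys)"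
    using bf by (rule bij_betw_cong[THEN iffD1, rotated]) (simp add: w_def)
  moreover have "bij_betw w (A - set xs) (A - set ys)"
    using g by (rule bij_betw_cong[THEN iffD1, rotated]) (simp add: w_def)
  ultimately have "bij_betw w (set xs \<union> (A - set xs)) (set ys \<union> (A - set ys))"
    by (rule bij_betw_combine) auto
  moreover have "set xs \<union> (A - set xs) = A" "set ys \<union> (A - set ys) = A" using xs ys by auto
  ultimately have "bij_betw w A A" by simp
  then have "w permutes A"
    by (rule bij_imp_permutes) (use xs in \<open>auto simp: w_def\<close>)
  moreover have "map w xs = map ?f xs" by (simp add: w_def)
  ultimately show ?thesis using that mf by simp
qed

lemma nth_ivl: "m < j - i \<Longrightarrow> map w [i..<j] ! m = w (i + m)"
  by simp

context virtual_cactus begin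

lemma \<tau>_in: "w permutes {1..n} \<Longrightarrow> \<tau> w \<in> carrier VC"
  using \<tau>_hom by (auto simp: hom_def sym_group_carrier)

lemma \<tau>_comp: "v permutes {1..n} \<Longrightarrow> w permutes {1..n} \<Longrightarrow> \<tau> (v \<circ> w) = \<tau> v \<otimes>\<^bsub>VC\<^esub> \<tau> w"
  using hom_mult[OF \<tau>_hom, of v w] by (simp add: sym_group_carrier sym_group_mult)

lemma \<tau>_id: "\<tau> id = \<one>\<^bsub>VC\<^esub>"
  using hom_one[OF \<tau>_hom] VC.group_axioms sym_group_is_group[of n] by (simp add: sym_group_one)

lemma \<tau>_inv:
  assumes w: "w permutes {1..n}" shows "inv\<^bsub>VC\<^esub> (\<tau> w) = \<tau> (inv' w)"
proof (rule VC.inv_equality)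
  show "\<tau> (inv' w) \<otimes>\<^bsub>VC\<^esub> \<tau> w = \<one>\<^bsub>VC\<^esub>"
    unfolding \<tau>_comp[OF permutes_inv[OF w] w, symmetric] permutes_inv_o(2)[OF w] by (rule \<tau>_id)
qed (use \<tau>_in w permutes_inv[OF w] in auto)

lemmas VC_rel = vc_relationsD[OF vc_relations_VC]

text \<open>The choice of \<open>w\<close> does not matter, by lemma \<open>list_s_eq\<close>.\<close>

definition list_s :: "nat list \<Rightarrow> cactus_free_elem set" where
  "list_s a = (let w = (SOME w. w permutes {1..n} \<and> map w [1..<Suc (length a)] = a)
     in \<tau> w \<otimes>\<^bsub>VC\<^esub> \<sigma> 1 (length a) \<otimes>\<^bsub>VC\<^esub> inv\<^bsub>VC\<^esub> (\<tau> w))"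

lemma length_I: "a \<in> I \<Longrightarrow> length a \<le> n"
proof -
  assume a: "a \<in> I"
  have "length a = card (set a)" using distinct_card[OF I_D(1)[OF a]] by simp
  also have "\<dots> \<le> card {1..n}" by (rule card_mono[OF _ I_D(3)[OF a]]) simp
  finally show "length a \<le> n" by simp
qed

text \<open>Two admissible permutations differ by one that translates \<open>[i..j]\<close> to an
  initial interval, and the mixed relation of the virtual cactus group makes \<open>\<sigma>\<close>
  follow such translations.\<close>

lemma list_s_eq:
  assumes a: "a \<in> I" and w: "w permutes {1..n}" and ij: "(i, j) \<in> cactus_gens n" and wa: "map w [i..<Suc j] = a"
  shows "list_s a = \<tau> w \<otimes>\<^bsub>VC\<^esub> \<sigma> i j \<otimes>\<^bsub>VC\<^esub> inv\<^bsub>VC\<^esub> (\<tau> w)"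
proof -
  let ?k = "length a"
  let ?P = "\<lambda>w. w permutes {1..n} \<and> map w [1..<Suc ?k] = a"
  have "\<exists>w. ?P w"
    by (rule extend_to_permutation[of "{1..n}" "[1..<Suc ?k]" a])
      (use I_D[OF a] length_I[OF a] in \<open>auto simp del: upt_Suc\<close>)
  then have v: "?P (SOME w. ?P w)" by (rule someI_ex)
  define v where "v = (SOME w. ?P w)"
  have vp: "v permutes {1..n}" and va: "map v [1..<Suc ?k] = a"
    using v unfolding v_def by blast+
  have lenk: "?k = Suc j - i" "i < j" "1 \<le> i"
    using arg_cong[OF wa, of length] ij by (auto simp: cactus_gens_def)
  let ?u = "inv' v \<circ> w"
  have up: "?u permutes {1..n}" by (rule permutes_compose[OF w permutes_inv[OF vp]])
  have u: "?u (i + m) = 1 + m" if "m \<le> j - i" for m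
  proof -
    have "a ! m = w (i + m)" unfolding wa[symmetric] by (rule nth_ivl) (use that lenk in simp)
    moreover have "a ! m = v (1 + m)"
      by (subst va[symmetric], rule nth_ivl) (use that lenk in simp)
    ultimately show ?thesis using permutes_inverses(2)[OF vp] by (metis comp_apply)
  qed
  have ui: "?u i = 1" using u[of 0] by simp
  have uj: "?u j = ?k" using u[of "j - i"] lenk by simp
  have "\<forall>k\<le>j - i. ?u (i + k) = ?u i + k" using u ui by simp
  then have rel: "\<tau> ?u \<otimes>\<^bsub>VC\<^esub> \<sigma> i j = \<sigma> 1 ?k \<otimes>\<^bsub>VC\<^esub> \<tau> ?u"
    using VC_rel(5)[rule_format, of i j ?u] ij up unfolding ui uj by blast
  have g1: "(1, ?k) \<in> cactus_gens n" using I_D(4)[OF a] length_I[OF a] by (auto simp: cactus_gens_def)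
  note c = \<tau>_in[OF vp] \<tau>_in[OF up] \<sigma>_in[OF ij] \<sigma>_in[OF g1]
  have "v \<circ> ?u = w" using permutes_inv_o(1)[OF vp] by (metis comp_assoc comp_id id_comp)
  then have "\<tau> w = \<tau> v \<otimes>\<^bsub>VC\<^esub> \<tau> ?u" using \<tau>_comp[OF vp up] by simp
  then have "\<tau> w \<otimes>\<^bsub>VC\<^esub> \<sigma> i j \<otimes>\<^bsub>VC\<^esub> inv\<^bsub>VC\<^esub> (\<tau> w) =
      \<tau> v \<otimes>\<^bsub>VC\<^esub> (\<tau> ?u \<otimes>\<^bsub>VC\<^esub> \<sigma> i j) \<otimes>\<^bsub>VC\<^esub> (inv\<^bsub>VC\<^esub> (\<tau> ?u) \<otimes>\<^bsub>VC\<^esub> inv\<^bsub>VC\<^esub> (\<tau> v))"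
    using c by (simp add: VC.inv_mult_group VC.m_assoc)
  also have "\<dots> = \<tau> v \<otimes>\<^bsub>VC\<^esub> \<sigma> 1 ?k \<otimes>\<^bsub>VC\<^esub> (\<tau> ?u \<otimes>\<^bsub>VC\<^esub> inv\<^bsub>VC\<^esub> (\<tau> ?u)) \<otimes>\<^bsub>VC\<^esub> inv\<^bsub>VC\<^esub> (\<tau> v)"
    unfolding rel using c by (simp only: VC.m_assoc VC.m_closed VC.inv_closed)
  also have "\<dots> = \<tau> v \<otimes>\<^bsub>VC\<^esub> \<sigma> 1 ?k \<otimes>\<^bsub>VC\<^esub> inv\<^bsub>VC\<^esub> (\<tau> v)"
    using c by simp
  finally show ?thesis unfolding list_s_def Let_def v_def by (rule sym)
qed

lemma list_s_obtain:
  assumes a: "a \<in> I"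
  obtains w where "w permutes {1..n}" "map w [1..<Suc (length a)] = a" "(1, length a) \<in> cactus_gens n"
    "list_s a = \<tau> w \<otimes>\<^bsub>VC\<^esub> \<sigma> 1 (length a) \<otimes>\<^bsub>VC\<^esub> inv\<^bsub>VC\<^esub> (\<tau> w)"
proof -
  have g: "(1, length a) \<in> cactus_gens n" using I_D(4)[OF a] length_I[OF a] by (auto simp: cactus_gens_def)
  obtain w where w: "w permutes {1..n}" "map w [1..<Suc (length a)] = a"
    by (rule extend_to_permutation[of "{1..n}" "[1..<Suc (length a)]" a])
      (use I_D[OF a] length_I[OF a] in \<open>auto simp del: upt_Suc\<close>)
  show ?thesis by (rule that[OF w g list_s_eq[OF a w(1) g w(2)]])
qed

lemma list_s_in: "a \<in> I \<Longrightarrow> list_s a \<in> carrier VC"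
  using list_s_obtain[of a] \<tau>_in \<sigma>_in by (metis VC.inv_closed VC.m_closed)

lemma conj_mult:
  assumes "t \<in> carrier VC" "x \<in> carrier VC" "y \<in> carrier VC"
  shows "(t \<otimes>\<^bsub>VC\<^esub> x \<otimes>\<^bsub>VC\<^esub> inv\<^bsub>VC\<^esub> t) \<otimes>\<^bsub>VC\<^esub> (t \<otimes>\<^bsub>VC\<^esub> y \<otimes>\<^bsub>VC\<^esub> inv\<^bsub>VC\<^esub> t) = t \<otimes>\<^bsub>VC\<^esub> (x \<otimes>\<^bsub>VC\<^esub> y) \<otimes>\<^bsub>VC\<^esub> inv\<^bsub>VC\<^esub> t"
proof -
  have "inv\<^bsub>VC\<^esub> t \<otimes>\<^bsub>VC\<^esub> (t \<otimes>\<^bsub>VC\<^esub> z) = z" if "z \<in> carrier VC" for z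
    using assms that by (simp add: VC.m_assoc[symmetric])
  then show ?thesis using assms by (simp add: VC.m_assoc)
qed

lemma list_s_square: assumes a: "a \<in> I" shows "list_s a \<otimes>\<^bsub>VC\<^esub> list_s a = \<one>\<^bsub>VC\<^esub>"
proof -
  obtain w where w: "w permutes {1..n}" "(1, length a) \<in> cactus_gens n"
    "list_s a = \<tau> w \<otimes>\<^bsub>VC\<^esub> \<sigma> 1 (length a) \<otimes>\<^bsub>VC\<^esub> inv\<^bsub>VC\<^esub> (\<tau> w)"
    using list_s_obtain[OF a] by metis
  show ?thesis
    unfolding w(3) conj_mult[OF \<tau>_in[OF w(1)] \<sigma>_in[OF w(2)] \<sigma>_in[OF w(2)]]
    using VC_rel(1) w(2) \<tau>_in[OF w(1)] by simp
qed

lemma map_I: "a \<in> I \<Longrightarrow> v permutes {1..n} \<Longrightarrow> map v a \<in> I"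
  unfolding I_def using permutes_inj_on[of v "{1..n}"] permutes_in_image[of v "{1..n}"]
  by (auto simp: distinct_map intro: inj_on_subset)

lemma \<tau>_list_s:
  assumes a: "a \<in> I" and v: "v permutes {1..n}"
  shows "\<tau> v \<otimes>\<^bsub>VC\<^esub> list_s a = list_s (map v a) \<otimes>\<^bsub>VC\<^esub> \<tau> v"
proof -
  obtain w where w: "w permutes {1..n}" "map w [1..<Suc (length a)] = a" "(1, length a) \<in> cactus_gens n"
    "list_s a = \<tau> w \<otimes>\<^bsub>VC\<^esub> \<sigma> 1 (length a) \<otimes>\<^bsub>VC\<^esub> inv\<^bsub>VC\<^esub> (\<tau> w)"
    by (rule list_s_obtain[OF a])
  have "map (v \<circ> w) [1..<Suc (length a)] = map v a" using w(2) by (metis map_map)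
  from list_s_eq[OF map_I[OF a v] permutes_compose[OF w(1) v] w(3) this]
  have "list_s (map v a) = (\<tau> v \<otimes>\<^bsub>VC\<^esub> \<tau> w) \<otimes>\<^bsub>VC\<^esub> \<sigma> 1 (length a) \<otimes>\<^bsub>VC\<^esub> inv\<^bsub>VC\<^esub> (\<tau> v \<otimes>\<^bsub>VC\<^esub> \<tau> w)"
    unfolding \<tau>_comp[OF v w(1)] .
  then show ?thesis
    unfolding w(4) using \<tau>_in[OF v] \<tau>_in[OF w(1)] \<sigma>_in[OF w(3)]
    by (simp add: VC.inv_mult_group VC.m_assoc)
qed

lemma list_s_commute:
  assumes a: "a \<in> I" and b: "b \<in> I" and dis: "set a \<inter> set b = {}"
  shows "list_s a \<otimes>\<^bsub>VC\<^esub> list_s b = list_s b \<otimes>\<^bsub>VC\<^esub> list_s a"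
proof -
  let ?k = "length a" and ?l = "length b"
  have d: "distinct (a @ b)" using I_D a b dis by simp
  have sub: "set (a @ b) \<subseteq> {1..n}" using I_D a b by simp
  have "length (a @ b) = card (set (a @ b))" using distinct_card[OF d] by simp
  also have "\<dots> \<le> card {1..n}" by (rule card_mono[OF _ sub]) simp
  finally have len: "?k + ?l \<le> n" by simp
  \<comment> \<open>One permutation carries two adjacent intervals to \<open>a\<close> and
    \<open>b\<close>, so that the commutation for disjoint intervals can be conjugated as a
    whole.\<close>
  obtain w where w: "w permutes {1..n}" "map w [1..<Suc (?k + ?l)] = a @ b"
    by (rule extend_to_permutation[of "{1..n}" "[1..<Suc (?k + ?l)]" "a @ b"]) (use d sub len I_D(4)[OF a] in \<open>auto simp del: upt_Suc\<close>)
  have split: "[1..<Suc (?k + ?l)] = [1..<Suc ?k] @ [Suc ?k..<Suc (?k + ?l)]"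
    using upt_add_eq_append[of 1 "Suc ?k" ?l] by simp
  have wa: "map w [1..<Suc ?k] = a" and wb: "map w [Suc ?k..<Suc (?k + ?l)] = b"
    using w(2) unfolding split map_append by (simp_all add: append_eq_append_conv del: upt_Suc)
  have g: "(1, ?k) \<in> cactus_gens n" "(Suc ?k, ?k + ?l) \<in> cactus_gens n"
    using I_D(4)[OF a] I_D(4)[OF b] len by (auto simp: cactus_gens_def)
  have "\<sigma> 1 ?k \<otimes>\<^bsub>VC\<^esub> \<sigma> (Suc ?k) (?k + ?l) = \<sigma> (Suc ?k) (?k + ?l) \<otimes>\<^bsub>VC\<^esub> \<sigma> 1 ?k"
    using VC_rel(2) g by simp
  then show ?thesis
    unfolding list_s_eq[OF a w(1) g(1) wa] list_s_eq[OF b w(1) g(2) wb]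
    using conj_mult[OF \<tau>_in[OF w(1)]] \<sigma>_in[OF g(1)] \<sigma>_in[OF g(2)] by simp
qed

lemma revp_I: "a \<in> I \<Longrightarrow> revp a permutes {1..n}"
  by (rule permutes_subset[OF revp_permutes[OF I_D(1)] I_D(3)])

lemma rev_I: "a \<in> I \<Longrightarrow> rev a \<in> I"
  by (simp add: I_def)

text \<open>The nested cactus relation, conjugated by a permutation that carries an initial interval
  to \<open>a\<close>. If \<open>a = x @ b @ y\<close>, the interval of \<open>b\<close> is reversed
  to the one that starts after \<open>length y\<close> points, and the list there is
  \<open>map (revp a) (rev b)\<close>.\<close>

lemma list_s_nested:
  assumes a: "a \<in> I" and b: "b \<in> I" and s: "seg b a"
  shows "list_s a \<otimes>\<^bsub>VC\<^esub> list_s b = list_s (map (revp a) (rev b)) \<otimes>\<^bsub>VC\<^esub> list_s a"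
proof -
  let ?k = "length a"
  obtain x y where xy: "a = x @ b @ y" using s unfolding seg_def by blast
  let ?i = "Suc (length x)" and ?j = "length x + length b"
  obtain w where w: "w permutes {1..n}" "map w [1..<Suc ?k] = a" "(1, ?k) \<in> cactus_gens n"
    "list_s a = \<tau> w \<otimes>\<^bsub>VC\<^esub> \<sigma> 1 ?k \<otimes>\<^bsub>VC\<^esub> inv\<^bsub>VC\<^esub> (\<tau> w)"
    by (rule list_s_obtain[OF a])
  have lk: "?k = length x + length b + length y" using xy by simp
  have b2: "2 \<le> length b" by (rule I_D(4)[OF b])
  have kn: "?k \<le> n" by (rule length_I[OF a])
  have g: "(?i, ?j) \<in> cactus_gens n" using b2 kn lk by (auto simp: cactus_gens_def)
  have wn: "w (Suc m) = a ! m" if "m < ?k" for m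
    using nth_ivl[of m "Suc ?k" 1 w] w(2) that by simp
  have wb: "map w [?i..<Suc ?j] = b"
  proof (rule nth_equalityI)
    fix m assume "m < length (map w [?i..<Suc ?j])"
    then have m: "m < length b" by (simp del: upt_Suc)
    have "map w [?i..<Suc ?j] ! m = w (Suc (length x + m))" using m by (simp del: upt_Suc)
    also have "\<dots> = a ! (length x + m)" by (rule wn) (use m lk in simp)
    also have "\<dots> = b ! m" unfolding xy using m by (simp add: nth_append)
    finally show "map w [?i..<Suc ?j] ! m = b ! m" .
  qed (simp del: upt_Suc)
  let ?i' = "interval_reversal 1 ?k ?j" and ?j' = "interval_reversal 1 ?k ?i"
  have ij': "?i' = Suc (length y)" "?j' = length y + length b"
    using b2 lk by (auto simp: interval_reversal_def)
  have sub: "{?i..?j} \<subseteq> {1..?k}" using lk by auto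
  have g': "(?i', ?j') \<in> cactus_gens n" by (rule interval_reversal_gens[OF w(3) g sub])
  let ?b' = "map (revp a) (rev b)"
  have wb': "map w [?i'..<Suc ?j'] = ?b'"
  proof (rule nth_equalityI)
    show "length (map w [?i'..<Suc ?j']) = length ?b'" unfolding ij' by (simp del: upt_Suc)
    fix m assume "m < length (map w [?i'..<Suc ?j'])"
    then have m: "m < length b" unfolding ij' by (simp del: upt_Suc)
    have "map w [?i'..<Suc ?j'] ! m = w (Suc (length y + m))" using m unfolding ij' by (simp del: upt_Suc)
    also have "\<dots> = a ! (length y + m)" by (rule wn) (use m lk in simp)
    finally have L: "map w [?i'..<Suc ?j'] ! m = a ! (length y + m)" .
    let ?p = "length x + (length b - Suc m)"
    have p: "?p < ?k" using m lk by simp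
    have ax: "a ! (length x + k) = b ! k" if "k < length b" for k
      unfolding xy using that by (simp add: nth_append)
    have "rev b ! m = a ! ?p"
      unfolding rev_nth[OF m] by (rule ax[symmetric]) (use m in simp)
    then have "?b' ! m = revp a (a ! ?p)" using m by simp
    also have "\<dots> = rev a ! ?p" by (rule revp_nth[OF I_D(1)[OF a] p])
    also have "\<dots> = a ! (?k - Suc ?p)" by (rule rev_nth[OF p])
    also have "?k - Suc ?p = length y + m" using m lk by simp
    finally show "map w [?i'..<Suc ?j'] ! m = ?b' ! m" using L by simp
  qed
  have b'I: "?b' \<in> I" by (rule map_I[OF rev_I[OF b] revp_I[OF a]])
  have rel: "\<sigma> 1 ?k \<otimes>\<^bsub>VC\<^esub> \<sigma> ?i ?j = \<sigma> ?i' ?j' \<otimes>\<^bsub>VC\<^esub> \<sigma> 1 ?k"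
    using VC_rel(3) w(3) g sub by metis
  show ?thesis
    unfolding w(4) list_s_eq[OF b w(1) g wb] list_s_eq[OF b'I w(1) g' wb']
      conj_mult[OF \<tau>_in[OF w(1)] \<sigma>_in[OF w(3)] \<sigma>_in[OF g]]
      conj_mult[OF \<tau>_in[OF w(1)] \<sigma>_in[OF g'] \<sigma>_in[OF w(3)]] rel ..
qed

definition list_t :: "nat list \<Rightarrow> cactus_free_elem set" where
  "list_t a = list_s a \<otimes>\<^bsub>VC\<^esub> \<tau> (revp a)"

lemma list_t_in: "a \<in> I \<Longrightarrow> list_t a \<in> carrier VC"
  unfolding list_t_def using list_s_in \<tau>_in revp_I by simp

text \<open>The permutation of the first factor moves to the right and renames the list of the
  second. Relations between the \<open>list_t\<close> then split into one between
  \<open>list_s\<close> and one between permutations.\<close>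

lemma list_t_mult:
  assumes a: "a \<in> I" and b: "b \<in> I"
  shows "list_t a \<otimes>\<^bsub>VC\<^esub> list_t b = (list_s a \<otimes>\<^bsub>VC\<^esub> list_s (map (revp a) b)) \<otimes>\<^bsub>VC\<^esub> \<tau> (revp a \<circ> revp b)"
proof -
  note ra = revp_I[OF a] and rb = revp_I[OF b]
  note c = list_s_in[OF a] list_s_in[OF b] \<tau>_in[OF ra] \<tau>_in[OF rb] list_s_in[OF map_I[OF b ra]]
  have "list_t a \<otimes>\<^bsub>VC\<^esub> list_t b = list_s a \<otimes>\<^bsub>VC\<^esub> (\<tau> (revp a) \<otimes>\<^bsub>VC\<^esub> list_s b) \<otimes>\<^bsub>VC\<^esub> \<tau> (revp b)"
    unfolding list_t_def using c by (simp add: VC.m_assoc)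
  then show ?thesis
    unfolding \<tau>_list_s[OF b ra] \<tau>_comp[OF ra rb] using c by (simp add: VC.m_assoc)
qed

lemma list_t_rev: assumes a: "a \<in> I" shows "list_t a \<otimes>\<^bsub>VC\<^esub> list_t (rev a) = \<one>\<^bsub>VC\<^esub>"
proof -
  have "map (revp a) (rev a) = a" using map_revp[OF I_D(1)[OF a]] by (metis rev_map rev_rev_ident)
  then show ?thesis
    unfolding list_t_mult[OF a rev_I[OF a]] revp_rev[OF I_D(1)[OF a]] revp_comp[OF I_D(1)[OF a]] \<tau>_id
    using list_s_square[OF a] by simp
qed

lemma list_t_commute:
  assumes a: "a \<in> I" and b: "b \<in> I" and dis: "set a \<inter> set b = {}"
  shows "list_t a \<otimes>\<^bsub>VC\<^esub> list_t b = list_t b \<otimes>\<^bsub>VC\<^esub> list_t a"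
proof -
  have dis': "set b \<inter> set a = {}" using dis by blast
  show ?thesis
    unfolding list_t_mult[OF a b] list_t_mult[OF b a] revp_map_other[OF dis] revp_map_other[OF dis']
      revp_commute_disjoint[OF I_D(1)[OF a] I_D(1)[OF b] dis] list_s_commute[OF a b dis] ..
qed

lemma list_t_nested:
  assumes a: "a \<in> I" and b: "b \<in> I" and s: "seg b a"
  shows "list_t a \<otimes>\<^bsub>VC\<^esub> list_t (rev b) = list_t b \<otimes>\<^bsub>VC\<^esub> list_t (map (revp b) a)"
proof -
  note da = I_D(1)[OF a] and db = I_D(1)[OF b]
  have aI: "map (revp b) a \<in> I" by (rule map_I[OF a revp_I[OF b]])
  have bb: "map (revp b) (map (revp b) a) = a" using revp_revp[OF db] by (simp add: map_idI)
  \<comment> \<open>The mirror image of \<open>b\<close> in \<open>a\<close>. It is again a segment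
    of \<open>a\<close>, and the nested relation for it has \<open>b\<close> on the other side,
    since mirroring twice gives \<open>b\<close> back.\<close>
  let ?b' = "map (revp a) (rev b)"
  have b'I: "?b' \<in> I" by (rule map_I[OF rev_I[OF b] revp_I[OF a]])
  obtain x y where xy: "a = x @ b @ y" using s unfolding seg_def by blast
  have "rev a = map (revp a) x @ map (revp a) b @ map (revp a) y"
    using map_revp[OF da] xy by (metis map_append)
  then have "a = rev (map (revp a) y) @ ?b' @ rev (map (revp a) x)"
    by (metis append_assoc rev_append rev_map rev_rev_ident)
  then have s': "seg ?b' a" unfolding seg_def by blast
  have "map (revp a) (rev ?b') = b" using revp_revp[OF da] by (simp add: rev_map map_idI)
  then have comm: "list_s a \<otimes>\<^bsub>VC\<^esub> list_s ?b' = list_s b \<otimes>\<^bsub>VC\<^esub> list_s a"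
    using list_s_nested[OF a b'I s'] by simp
  have "revp (map (revp b) a) \<circ> revp b = revp b \<circ> revp a"
    by (rule revp_conj_comp[OF da inj_revp[OF db]])
  then have "revp b \<circ> (revp (map (revp b) a) \<circ> revp b) \<circ> revp b = revp b \<circ> (revp b \<circ> revp a) \<circ> revp b" by simp
  then have "revp b \<circ> revp (map (revp b) a) \<circ> (revp b \<circ> revp b) = (revp b \<circ> revp b) \<circ> revp a \<circ> revp b"
    by (simp only: comp_assoc)
  then have rr: "revp b \<circ> revp (map (revp b) a) = revp a \<circ> revp b"
    unfolding revp_comp[OF db] by simp
  show ?thesis
    unfolding list_t_mult[OF a rev_I[OF b]] list_t_mult[OF b aI] bb revp_rev[OF db] rr comm ..
qed

lemma loc_I: "q \<in> V \<Longrightarrow> \<alpha> \<in> I \<Longrightarrow> loc q \<alpha> \<in> I"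
  using loc_props[OF V_good] by (simp add: I_def)

text \<open>Multiplication on the right, so that transport commutes with multiplication on the left;
  this makes the holonomy of loops multiplicative.\<close>

definition transition :: "nat list \<Rightarrow> vstate \<Rightarrow> cactus_free_elem set \<Rightarrow> cactus_free_elem set" where
  "transition \<alpha> q x = x \<otimes>\<^bsub>VC\<^esub> list_t (loc q \<alpha>)"

lemma transition_comm_inner:
  assumes a: "\<alpha> \<in> I" "\<beta> \<in> I" "q \<in> V" and x: "x \<in> carrier VC" and s: "seg (loc q \<beta>) (loc q \<alpha>)"
  shows "transition \<alpha> (vflip \<beta> q) (transition \<beta> q x) = transition \<beta> (vflip \<alpha> q) (transition \<alpha> q x)"
proof -
  note g = V_good[OF a(3)] and l = loc_I[OF a(3,1)] loc_I[OF a(3,2)]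
  have b': "map (revp (loc q \<beta>)) (loc q \<alpha>) \<in> I" by (rule map_I[OF l(1) revp_I[OF l(2)]])
  show ?thesis
    unfolding transition_def loc_vflip_inner[OF g I_D(1)[OF a(1)] I_D(1)[OF a(2)] s]
      loc_vflip_outer[OF g I_D(1)[OF a(2)] I_D(1)[OF a(1)] s]
    using x list_t_in[OF l(1)] list_t_in[OF l(2)] list_t_in[OF b'] list_t_in[OF rev_I[OF l(2)]] list_t_nested[OF l s]
    by (simp add: VC.m_assoc)
qed

lemma transition_comm_disjoint:
  assumes a: "\<alpha> \<in> I" "\<beta> \<in> I" "q \<in> V" and x: "x \<in> carrier VC" and s: "set (loc q \<alpha>) \<inter> set (loc q \<beta>) = {}"
  shows "transition \<alpha> (vflip \<beta> q) (transition \<beta> q x) = transition \<beta> (vflip \<alpha> q) (transition \<alpha> q x)"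
proof -
  note g = V_good[OF a(3)] and l = loc_I[OF a(3,1)] loc_I[OF a(3,2)]
  have s': "set (loc q \<beta>) \<inter> set (loc q \<alpha>) = {}" using s by blast
  show ?thesis
    unfolding transition_def loc_vflip_disjoint[OF g I_D(1)[OF a(1)] I_D(1)[OF a(2)] s]
      loc_vflip_disjoint[OF g I_D(1)[OF a(2)] I_D(1)[OF a(1)] s']
    using x list_t_in[OF l(1)] list_t_in[OF l(2)] list_t_commute[OF l s] by (simp add: VC.m_assoc)
qed

sublocale L: flip_local_system V I vflip snd ortI "carrier VC" transition
proof
  fix \<alpha> q x assume a: "\<alpha> \<in> I" "q \<in> V" "x \<in> carrier VC"
  note l = loc_I[OF a(2,1)]
  show "transition \<alpha> q x \<in> carrier VC" using a list_t_in[OF l] by (simp add: transition_def)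
  show "transition \<alpha> (vflip \<alpha> q) (transition \<alpha> q x) = x"
    unfolding transition_def loc_vflip_same[OF V_good[OF a(2)] I_D(1)[OF a(1)]]
    using a list_t_in[OF l] list_t_in[OF rev_I[OF l]] list_t_rev[OF l] by (simp add: VC.m_assoc)
next
  fix \<alpha> \<beta> q x assume a: "\<alpha> \<in> I" "\<beta> \<in> I" "q \<in> V" "x \<in> carrier VC" and o: "ortI q \<alpha> \<beta>"
  have "set (loc q \<alpha>) \<inter> set (loc q \<beta>) = {} \<or> seg (loc q \<beta>) (loc q \<alpha>) \<or> seg (loc q \<alpha>) (loc q \<beta>)"
    using o unfolding ortI_def vort_def adj_def by blast
  then show "transition \<alpha> (vflip \<beta> q) (transition \<beta> q x) = transition \<beta> (vflip \<alpha> q) (transition \<alpha> q x)"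
    using transition_comm_disjoint[OF a] transition_comm_inner[OF a] transition_comm_inner[OF a(2,1,3,4)] by metis
qed

end

context flip_system begin

lemma edge_path_pair:
  assumes v: "v \<in> V" "i \<in> I" "j \<in> I"
  shows "homotopic_paths model (edge_path v [i, j]) (edge v i +++ edge (flip i v) j)"
proof -
  have w: "flip i v \<in> V" by (rule flip_in[OF v(2,1)])
  note e = edge_between[OF v(1,2)] and e' = edge_between[OF w v(3)]
  have "homotopic_paths model (edge (flip i v) j +++ (\<lambda>_. vertex (flip j (flip i v)))) (edge (flip i v) j)"
    by (rule homotopic_join_const_right[OF e'])
  moreover have "path_between model (vertex (flip i v)) (vertex (flip j (flip i v)))
      (edge (flip i v) j +++ (\<lambda>_. vertex (flip j (flip i v))))"
    by (rule path_between_join[OF e']) (use vertex_in_model flip_in w v in simp)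
  ultimately show ?thesis
    using homotopic_join_cong[OF path_between_refl[OF e] _ e] by simp
qed

lemma edge_path_backtrack:
  assumes "v \<in> V" "i \<in> I" shows "homotopic_paths model (edge_path v [i, i]) (edge_path v [])"
  using homotopic_paths_trans[OF edge_path_pair[OF assms assms(2)] edge_backtrack[OF assms]] by simp

lemma edge_path_square:
  assumes "v \<in> V" "i \<in> I" "j \<in> I" "ort v i j"
  shows "homotopic_paths model (edge_path v [i, j]) (edge_path v [j, i])"
  by (rule homotopic_paths_trans[OF edge_path_pair[OF assms(1-3)]
      homotopic_paths_trans[OF edge_square[OF assms] homotopic_paths_sym[OF edge_path_pair[OF assms(1,3,2)]]]])

lemma edge_path_append_cong:
  assumes v: "v \<in> V" and l: "set l \<subseteq> I" "set l' \<subseteq> I" and k: "set k \<subseteq> I" "set k' \<subseteq> I"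
    and w: "walk l v = walk l' v"
    and hl: "homotopic_paths model (edge_path v l) (edge_path v l')"
    and hk: "homotopic_paths model (edge_path (walk l v) k) (edge_path (walk l v) k')"
  shows "homotopic_paths model (edge_path v (l @ k)) (edge_path v (l' @ k'))"
proof -
  have wl: "walk l v \<in> V" by (rule walk_in[OF l(1) v])
  have "homotopic_paths model (edge_path v l +++ edge_path (walk l v) k) (edge_path v l' +++ edge_path (walk l v) k')"
    by (rule homotopic_join_cong[OF hl hk edge_path_between[OF v l(1)] edge_path_between[OF wl k(1)]])
  moreover have "homotopic_paths model (edge_path v (l' @ k')) (edge_path v l' +++ edge_path (walk l v) k')"
    using edge_path_append[OF v l(2) k(2)] unfolding w .
  ultimately show ?thesis
    using edge_path_append[OF v l(1) k(1)] by (meson homotopic_paths_sym homotopic_paths_trans)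
qed

end

definition ivl :: "nat \<Rightarrow> nat \<Rightarrow> nat list" where
  "ivl i j = [i..<Suc j]"

lemma ivl: "distinct (ivl i j)" "set (ivl i j) = {i..j}" "length (ivl i j) = Suc j - i"
  by (auto simp: ivl_def)

lemma ivl_nth: "m < Suc j - i \<Longrightarrow> ivl i j ! m = i + m"
  unfolding ivl_def by (simp del: upt_Suc)

lemma revp_ivl:
  assumes k: "i \<le> k" "k \<le> j" shows "revp (ivl i j) k = i + j - k"
proof -
  have m: "k - i < length (ivl i j)" using k by (simp add: ivl)
  have "revp (ivl i j) (ivl i j ! (k - i)) = ivl i j ! (length (ivl i j) - Suc (k - i))"
    using revp_nth[OF ivl(1) m] rev_nth[OF m] by simp
  then show ?thesis using k by (simp add: ivl ivl_nth)
qed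

lemma ivl_reversal:
  assumes k: "i \<le> k" "k \<le> l" "l \<le> j"
  shows "map (revp (ivl i j)) (rev (ivl k l)) = ivl (interval_reversal i j l) (interval_reversal i j k)"
proof (rule nth_equalityI)
  have r: "interval_reversal i j l = i + j - l" "interval_reversal i j k = i + j - k"
    using k by (auto simp: interval_reversal_def)
  show "length (map (revp (ivl i j)) (rev (ivl k l))) =
      length (ivl (interval_reversal i j l) (interval_reversal i j k))"
    unfolding r using k by (simp add: ivl)
  fix m assume "m < length (map (revp (ivl i j)) (rev (ivl k l)))"
  then have m: "m < length (ivl k l)" by simp
  then have m': "m < Suc l - k" by (simp add: ivl)
  have "rev (ivl k l) ! m = l - m"
    unfolding rev_nth[OF m] using m' k by (simp add: ivl ivl_nth)
  then show "map (revp (ivl i j)) (rev (ivl k l)) ! m =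
      ivl (interval_reversal i j l) (interval_reversal i j k) ! m"
    unfolding r using m m' k by (simp add: revp_ivl ivl_nth)
qed

lemma seg_ivl: "i \<le> k \<Longrightarrow> k \<le> l \<Longrightarrow> l \<le> j \<Longrightarrow> seg (ivl k l) (ivl i j)"
proof -
  assume k: "i \<le> k" "k \<le> l" "l \<le> j"
  have app: "[a..<c] = [a..<b] @ [b..<c]" if "a \<le> b" "b \<le> c" for a b c :: nat
    using upt_add_eq_append[OF that(1), of "c - b"] that by simp
  show ?thesis unfolding seg_def ivl_def
    by (rule exI[of _ "[i..<k]"], rule exI[of _ "[Suc l..<Suc j]"])
      (use k app[of i k "Suc j"] app[of k "Suc l" "Suc j"] in \<open>simp del: upt_Suc\<close>)
qed

lemma map_ivl:
  assumes "\<forall>k\<le>j - i. w (i + k) = w i + k" "i < j"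
  shows "map w (ivl i j) = ivl (w i) (w j)"
proof (rule nth_equalityI)
  have wj: "w j = w i + (j - i)" using assms by (auto dest: spec[of _ "j - i"])
  show "length (map w (ivl i j)) = length (ivl (w i) (w j))" using wj assms(2) by (simp add: ivl)
  fix m assume m: "m < length (map w (ivl i j))"
  then show "map w (ivl i j) ! m = ivl (w i) (w j) ! m"
    using wj assms by (simp add: ivl ivl_nth)
qed

section \<open>Words of axes as edge paths from the initial state\<close>

context virtual_cactus begin

lemma ivl_I: "(i, j) \<in> cactus_gens n \<Longrightarrow> ivl i j \<in> I"
  by (auto simp: I_def ivl cactus_gens_def)

text \<open>Inverse to \<open>loc q\<close>: the axis that lies at the list \<open>a\<close> in the
  state \<open>q\<close>. Both lists have the same points, so \<open>a\<close> already tells which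
  permutation to invert.\<close>

definition label_of :: "vstate \<Rightarrow> nat list \<Rightarrow> nat list" where
  "label_of q a = map (inv' (fst q (set a))) a"

lemma label_of_props:
  assumes q: "q \<in> V" and a: "a \<in> I"
  shows "label_of q a \<in> I" and "loc q (label_of q a) = a"
proof -
  have p: "fst q (set a) permutes set a" using goodD[OF V_good[OF q]] .
  have pi: "inv' (fst q (set a)) permutes set a" by (rule permutes_inv[OF p])
  have s: "set (label_of q a) = set a" using permutes_image[OF pi] by (simp add: label_of_def)
  show "label_of q a \<in> I" using a s permutes_inj_on[OF pi, of "set a"] by (simp add: I_def label_of_def distinct_map)
  show "loc q (label_of q a) = a" unfolding loc_def s unfolding label_of_def
    using permutes_inverses(1)[OF p] by (simp add: map_idI)
qed

lemma label_of_loc: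
  assumes q: "q \<in> V" and a: "\<alpha> \<in> I"
  shows "label_of q (loc q \<alpha>) = \<alpha>"
  unfolding label_of_def loc_props(2)[OF V_good[OF q] I_D(1)[OF a]] unfolding loc_def
  using permutes_inverses(2)[OF goodD[OF V_good[OF q]]] by (simp add: map_idI)

abbreviation walk0 :: "nat list list \<Rightarrow> vstate" where
  "walk0 W \<equiv> fold vflip W q0"

text \<open>Group elements refer to the list where an axis lies at present, edge paths to its name.
  \<open>label_of\<close> at the end state of the word translates between the two.\<close>

definition extend_word :: "nat list list \<Rightarrow> nat list \<Rightarrow> nat list list" where
  "extend_word W a = W @ [label_of (walk0 W) a]"

definition homotopic_words :: "nat list list \<Rightarrow> nat list list \<Rightarrow> bool" where
  "homotopic_words W W' \<longleftrightarrow> homotopic_paths flip.model (flip.edge_path q0 W) (flip.edge_path q0 W')"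

lemma walk0_in: "set W \<subseteq> I \<Longrightarrow> walk0 W \<in> V"
  by (rule flip.walk_in[OF _ q0_in])

lemma extend_word_in: "set W \<subseteq> I \<Longrightarrow> a \<in> I \<Longrightarrow> set (extend_word W a) \<subseteq> I"
  using label_of_props(1)[OF walk0_in] by (simp add: extend_word_def)

lemma homotopic_words_refl: "set W \<subseteq> I \<Longrightarrow> homotopic_words W W"
  unfolding homotopic_words_def by (rule path_between_refl[OF flip.edge_path_between[OF q0_in]])

lemma homotopic_words_sym: "homotopic_words W W' \<Longrightarrow> homotopic_words W' W"
  unfolding homotopic_words_def by (rule homotopic_paths_sym)

lemma homotopic_words_trans: "homotopic_words W W' \<Longrightarrow> homotopic_words W' W'' \<Longrightarrow> homotopic_words W W''"
  unfolding homotopic_words_def by (rule homotopic_paths_trans)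

lemma homotopic_words_walk: "set W \<subseteq> I \<Longrightarrow> set W' \<subseteq> I \<Longrightarrow> homotopic_words W W' \<Longrightarrow> walk0 W = walk0 W'"
  unfolding homotopic_words_def using L.edge_path_homotopic_along(1)[OF q0_in _ _ VC.one_closed] by blast

lemma homotopic_words_append:
  assumes "set W \<subseteq> I" "set W' \<subseteq> I" "set K \<subseteq> I" "set K' \<subseteq> I" "homotopic_words W W'"
    "homotopic_paths flip.model (flip.edge_path (walk0 W) K) (flip.edge_path (walk0 W) K')"
  shows "homotopic_words (W @ K) (W' @ K')"
  using flip.edge_path_append_cong[OF q0_in assms(1-4) homotopic_words_walk[OF assms(1,2,5)] assms(5)[unfolded homotopic_words_def] assms(6)]
  unfolding homotopic_words_def .

lemma homotopic_words_extend:
  assumes "set W \<subseteq> I" "set W' \<subseteq> I" "a \<in> I" "homotopic_words W W'"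
  shows "homotopic_words (extend_word W a) (extend_word W' a)"
proof -
  have i: "set [label_of (walk0 W) a] \<subseteq> I" using label_of_props(1)[OF walk0_in[OF assms(1)] assms(3)] by simp
  have "homotopic_words (W @ [label_of (walk0 W) a]) (W' @ [label_of (walk0 W) a])"
    by (rule homotopic_words_append[OF assms(1,2) i i assms(4) path_between_refl[OF flip.edge_path_between[OF walk0_in[OF assms(1)] i]]])
  then show ?thesis unfolding extend_word_def homotopic_words_walk[OF assms(1,2,4)] .
qed

text \<open>The second list is read after the first flip, when the axis of \<open>b\<close> lies at
  \<open>c\<close>. In terms of names the two flips are those of the axes at \<open>a\<close> and
  \<open>b\<close> in the old state, as needed for a square.\<close>

lemma extend_word_twice:
  assumes W: "set W \<subseteq> I" and ab: "a \<in> I" "b \<in> I" and c: "c = loc (vflip (label_of (walk0 W) a) (walk0 W)) (label_of (walk0 W) b)"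
  shows "extend_word (extend_word W a) c = W @ [label_of (walk0 W) a, label_of (walk0 W) b]"
proof -
  let ?q = "walk0 W"
  note q = walk0_in[OF W]
  have q': "vflip (label_of ?q a) ?q \<in> V" by (rule V_flip[OF label_of_props(1)[OF q ab(1)] q])
  show ?thesis unfolding extend_word_def c using label_of_loc[OF q' label_of_props(1)[OF q ab(2)]] by simp
qed

lemma homotopic_words_extend_rev:
  assumes W: "set W \<subseteq> I" and a: "a \<in> I" shows "homotopic_words (extend_word (extend_word W a) (rev a)) W"
proof -
  note q = walk0_in[OF W] and g = label_of_props[OF walk0_in[OF W] a]
  have "rev a = loc (vflip (label_of (walk0 W) a) (walk0 W)) (label_of (walk0 W) a)"
    unfolding loc_vflip_same[OF V_good[OF q] I_D(1)[OF g(1)]] g(2) ..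
  from extend_word_twice[OF W a a this] have e: "extend_word (extend_word W a) (rev a) = W @ [label_of (walk0 W) a, label_of (walk0 W) a]" .
  have "homotopic_words (W @ [label_of (walk0 W) a, label_of (walk0 W) a]) (W @ [])"
    by (rule homotopic_words_append[OF W W _ _ homotopic_words_refl[OF W] flip.edge_path_backtrack[OF q g(1)]]) (use g in auto)
  then show ?thesis unfolding e by simp
qed

lemma homotopic_words_square:
  assumes W: "set W \<subseteq> I" and a: "a \<in> I" "b \<in> I" and ab: "adj a b"
  shows "homotopic_words (W @ [label_of (walk0 W) a, label_of (walk0 W) b]) (W @ [label_of (walk0 W) b, label_of (walk0 W) a])"
proof -
  note q = walk0_in[OF W] and g = label_of_props[OF walk0_in[OF W] a(1)] and h = label_of_props[OF walk0_in[OF W] a(2)]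
  have o: "ortI (walk0 W) (label_of (walk0 W) a) (label_of (walk0 W) b)"
    unfolding ortI_def vort_def g(2) h(2) using ab I_D(2) g(1) h(1) by blast
  show ?thesis
    by (rule homotopic_words_append[OF W W _ _ homotopic_words_refl[OF W] flip.edge_path_square[OF q g(1) h(1) o]]) (use g h in auto)
qed

lemma homotopic_words_extend_disjoint:
  assumes W: "set W \<subseteq> I" and a: "a \<in> I" "b \<in> I" and dis: "set a \<inter> set b = {}"
  shows "homotopic_words (extend_word (extend_word W a) b) (extend_word (extend_word W b) a)"
proof -
  note q = V_good[OF walk0_in[OF W]]
    and g = label_of_props[OF walk0_in[OF W] a(1)] and h = label_of_props[OF walk0_in[OF W] a(2)]
  have d: "set (loc (walk0 W) (label_of (walk0 W) b)) \<inter> set (loc (walk0 W) (label_of (walk0 W) a)) = {}"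
    "set (loc (walk0 W) (label_of (walk0 W) a)) \<inter> set (loc (walk0 W) (label_of (walk0 W) b)) = {}"
    unfolding g(2) h(2) using dis by blast+
  have "b = loc (vflip (label_of (walk0 W) a) (walk0 W)) (label_of (walk0 W) b)"
    unfolding loc_vflip_disjoint[OF q I_D(1)[OF h(1)] I_D(1)[OF g(1)] d(1)] h(2) ..
  note e1 = extend_word_twice[OF W a this]
  have "a = loc (vflip (label_of (walk0 W) b) (walk0 W)) (label_of (walk0 W) a)"
    unfolding loc_vflip_disjoint[OF q I_D(1)[OF g(1)] I_D(1)[OF h(1)] d(2)] g(2) ..
  note e2 = extend_word_twice[OF W a(2,1) this]
  show ?thesis unfolding e1 e2 by (rule homotopic_words_square[OF W a]) (use dis in \<open>simp add: adj_def\<close>)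
qed

text \<open>After the flip of \<open>a\<close> the axis of \<open>b\<close> lies at
  \<open>rev b\<close>; after the flip of \<open>b\<close> the axis of \<open>a\<close> lies at
  \<open>a\<close> with this segment reversed. These are the lists in \<open>list_t_nested\<close>,
  now as the sides of a square.\<close>

lemma homotopic_words_extend_nested:
  assumes W: "set W \<subseteq> I" and a: "a \<in> I" "b \<in> I" and s: "seg b a" and ne: "a \<noteq> b"
  shows "homotopic_words (extend_word (extend_word W a) (rev b)) (extend_word (extend_word W b) (map (revp b) a))"
proof -
  note q = V_good[OF walk0_in[OF W]]
    and g = label_of_props[OF walk0_in[OF W] a(1)] and h = label_of_props[OF walk0_in[OF W] a(2)]
  have s': "seg (loc (walk0 W) (label_of (walk0 W) b)) (loc (walk0 W) (label_of (walk0 W) a))"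
    unfolding g(2) h(2) by (rule s)
  have "rev b = loc (vflip (label_of (walk0 W) a) (walk0 W)) (label_of (walk0 W) b)"
    unfolding loc_vflip_outer[OF q I_D(1)[OF h(1)] I_D(1)[OF g(1)] s'] h(2) ..
  note e1 = extend_word_twice[OF W a this]
  have "map (revp b) a = loc (vflip (label_of (walk0 W) b) (walk0 W)) (label_of (walk0 W) a)"
    unfolding loc_vflip_inner[OF q I_D(1)[OF g(1)] I_D(1)[OF h(1)] s'] g(2) h(2) ..
  note e2 = extend_word_twice[OF W a(2,1) this]
  show ?thesis unfolding e1 e2 by (rule homotopic_words_square[OF W a]) (use s ne in \<open>simp add: adj_def\<close>)
qed

definition word_class :: "nat list list \<Rightarrow> nat list list set" where
  "word_class W = {W'. set W' \<subseteq> I \<and> homotopic_words W W'}"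

lemma word_class_eq:
  assumes "set W \<subseteq> I" "set W' \<subseteq> I" shows "word_class W = word_class W' \<longleftrightarrow> homotopic_words W W'"
proof
  assume "word_class W = word_class W'"
  then have "W' \<in> word_class W" using assms homotopic_words_refl by (simp add: word_class_def)
  then show "homotopic_words W W'" by (simp add: word_class_def)
next
  assume "homotopic_words W W'"
  then show "word_class W = word_class W'" unfolding word_class_def using homotopic_words_trans homotopic_words_sym by blast
qed

definition extend_class :: "nat list list set \<Rightarrow> nat list \<Rightarrow> nat list list set" where
  "extend_class X a = (\<Union>W\<in>X. word_class (extend_word W a))"

lemma extend_class_word_class:
  assumes W: "set W \<subseteq> I" and a: "a \<in> I" shows "extend_class (word_class W) a = word_class (extend_word W a)"
proof -
  have "word_class (extend_word W' a) = word_class (extend_word W a)" if "W' \<in> word_class W" for W'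
    using that word_class_eq[OF extend_word_in[OF W a] extend_word_in[of W' a]] homotopic_words_extend[OF W _ a, of W'] a unfolding word_class_def by blast
  moreover have "W \<in> word_class W" using W homotopic_words_refl by (simp add: word_class_def)
  ultimately show ?thesis unfolding extend_class_def by blast
qed

section \<open>The action on framed homotopy classes\<close>


text \<open>Generators are named by intervals and edges by lists. The framing \<open>u\<close> says
  which list an interval stands for at the end of the path.\<close>

definition framed_classes :: "(nat list list set \<times> (nat \<Rightarrow> nat)) set" where
  "framed_classes = {(word_class W, u) | W u. set W \<subseteq> I \<and> u permutes {1..n}}"

text \<open>A step along the list that the framing assigns to the interval. The framing is reversed
  on the interval because \<open>list_s\<close> differs from \<open>list_t\<close> by a reversal.
  Functions are restricted since \<open>Bij\<close> asks for extensional ones.\<close>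

definition act_s :: "nat \<Rightarrow> nat \<Rightarrow> nat list list set \<times> (nat \<Rightarrow> nat) \<Rightarrow> nat list list set \<times> (nat \<Rightarrow> nat)" where
  "act_s i j = (\<lambda>p\<in>framed_classes. (extend_class (fst p) (map (snd p) (ivl i j)), snd p \<circ> revp (ivl i j)))"

text \<open>Composing with the inverse on the right gives an action from the left.\<close>

definition act_t :: "(nat \<Rightarrow> nat) \<Rightarrow> nat list list set \<times> (nat \<Rightarrow> nat) \<Rightarrow> nat list list set \<times> (nat \<Rightarrow> nat)" where
  "act_t w = (\<lambda>p\<in>framed_classes. (fst p, snd p \<circ> inv' w))"

lemma framed_classes_in: "set W \<subseteq> I \<Longrightarrow> u permutes {1..n} \<Longrightarrow> (word_class W, u) \<in> framed_classes"
  unfolding framed_classes_def by blast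

lemma framed_classes_cases:
  assumes "p \<in> framed_classes" obtains W u where "p = (word_class W, u)" "set W \<subseteq> I" "u permutes {1..n}"
  using assms unfolding framed_classes_def by blast

lemma u_ivl: "(i, j) \<in> cactus_gens n \<Longrightarrow> u permutes {1..n} \<Longrightarrow> map u (ivl i j) \<in> I"
  and u_revp: "(i, j) \<in> cactus_gens n \<Longrightarrow> u permutes {1..n} \<Longrightarrow> u \<circ> revp (ivl i j) permutes {1..n}"
  using map_I[OF ivl_I] permutes_compose[OF revp_I[OF ivl_I]] by blast+

lemma act_s_apply:
  "set W \<subseteq> I \<Longrightarrow> u permutes {1..n} \<Longrightarrow> (i, j) \<in> cactus_gens n \<Longrightarrow>
    act_s i j (word_class W, u) = (word_class (extend_word W (map u (ivl i j))), u \<circ> revp (ivl i j))"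
  unfolding act_s_def using framed_classes_in extend_class_word_class u_ivl by simp

lemma act_t_apply:
  "set W \<subseteq> I \<Longrightarrow> u permutes {1..n} \<Longrightarrow> act_t w (word_class W, u) = (word_class W, u \<circ> inv' w)"
  unfolding act_t_def using framed_classes_in by simp

lemma act_s_in: "p \<in> framed_classes \<Longrightarrow> (i, j) \<in> cactus_gens n \<Longrightarrow> act_s i j p \<in> framed_classes"
  by (erule framed_classes_cases, simp only: act_s_apply, rule framed_classes_in[OF extend_word_in[OF _ u_ivl] u_revp])

lemma act_t_in: "p \<in> framed_classes \<Longrightarrow> w permutes {1..n} \<Longrightarrow> act_t w p \<in> framed_classes"
  by (erule framed_classes_cases) (simp add: act_t_apply framed_classes_in permutes_compose permutes_inv)

lemma act_s_act_s:
  assumes p: "p \<in> framed_classes" and ij: "(i, j) \<in> cactus_gens n" shows "act_s i j (act_s i j p) = p"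
proof -
  obtain W u where p: "p = (word_class W, u)" and W: "set W \<subseteq> I" and u: "u permutes {1..n}" by (rule framed_classes_cases[OF p])
  note a = u_ivl[OF ij u] and r = u_revp[OF ij u]
  let ?a = "map u (ivl i j)"
  have m: "map (u \<circ> revp (ivl i j)) (ivl i j) = rev ?a"
    using map_revp[OF ivl(1), of i j] by (metis map_map rev_map)
  have ar: "rev ?a \<in> I" by (rule rev_I[OF a])
  have "act_s i j (act_s i j p) = (word_class (extend_word (extend_word W ?a) (rev ?a)), u \<circ> revp (ivl i j) \<circ> revp (ivl i j))"
    unfolding p act_s_apply[OF W u ij] act_s_apply[OF extend_word_in[OF W a] r ij] m ..
  moreover have "word_class (extend_word (extend_word W ?a) (rev ?a)) = word_class W"
    unfolding word_class_eq[OF extend_word_in[OF extend_word_in[OF W a] ar] W] by (rule homotopic_words_extend_rev[OF W a])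
  moreover have "u \<circ> revp (ivl i j) \<circ> revp (ivl i j) = u"
    unfolding comp_assoc revp_comp[OF ivl(1)] by simp
  ultimately show ?thesis unfolding p by simp
qed

lemma act_t_act_t:
  assumes p: "p \<in> framed_classes" and v: "v permutes {1..n}" "w permutes {1..n}"
  shows "act_t v (act_t w p) = act_t (v \<circ> w) p"
proof -
  obtain W u where p: "p = (word_class W, u)" and W: "set W \<subseteq> I" and u: "u permutes {1..n}" by (rule framed_classes_cases[OF p])
  have "inv' (v \<circ> w) = inv' w \<circ> inv' v"
    using o_inv_distrib[OF permutes_bij[OF v(1)] permutes_bij[OF v(2)]] .
  then show ?thesis unfolding p act_t_apply[OF W u]
      act_t_apply[OF W permutes_compose[OF permutes_inv[OF v(2)] u]] by (simp add: comp_assoc)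
qed

lemma act_t_id: "p \<in> framed_classes \<Longrightarrow> act_t id p = p"
  by (erule framed_classes_cases) (simp add: act_t_apply)

lemma Bij_by_inverse:
  assumes "f \<in> extensional A" "\<And>p. p \<in> A \<Longrightarrow> f p \<in> A" "\<And>p. p \<in> A \<Longrightarrow> g p \<in> A"
    "\<And>p. p \<in> A \<Longrightarrow> g (f p) = p" "\<And>p. p \<in> A \<Longrightarrow> f (g p) = p"
  shows "f \<in> Bij A"
  unfolding Bij_def using assms bij_betw_byWitness[of A g f A] by blast

lemma act_s_Bij: assumes ij: "(i, j) \<in> cactus_gens n" shows "act_s i j \<in> Bij framed_classes"
proof -
  have "act_s i j \<in> extensional framed_classes" unfolding act_s_def by simp
  then show ?thesis
    by (rule Bij_by_inverse[of _ _ "act_s i j"]) (use ij act_s_in act_s_act_s in auto)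
qed

lemma act_t_Bij:
  assumes w: "w permutes {1..n}" shows "act_t w \<in> Bij framed_classes"
proof -
  note wi = permutes_inv[OF w]
  have "act_t w \<in> extensional framed_classes" unfolding act_t_def by simp
  then show ?thesis
  proof (rule Bij_by_inverse[of _ _ "act_t (inv' w)"])
    fix p assume p: "p \<in> framed_classes"
    show "act_t (inv' w) (act_t w p) = p" "act_t w (act_t (inv' w) p) = p"
      unfolding act_t_act_t[OF p wi w] act_t_act_t[OF p w wi] permutes_inv_o[OF w] by (rule act_t_id[OF p])+
  qed (use act_t_in w wi in auto)
qed

lemma BijGroup_mult: "f \<in> Bij A \<Longrightarrow> g \<in> Bij A \<Longrightarrow> f \<otimes>\<^bsub>BijGroup A\<^esub> g = compose A f g"
  by (simp add: BijGroup_def)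

lemma compose_eqI: "(\<And>p. p \<in> A \<Longrightarrow> f (g p) = f' (g' p)) \<Longrightarrow> compose A f g = compose A f' g'"
  unfolding compose_def by (rule restrict_ext)

lemma act_s_commute:
  assumes p: "p \<in> framed_classes" and ij: "(i, j) \<in> cactus_gens n" and kl: "(k, l) \<in> cactus_gens n" and dis: "{i..j} \<inter> {k..l} = {}"
  shows "act_s i j (act_s k l p) = act_s k l (act_s i j p)"
proof -
  obtain W u where p: "p = (word_class W, u)" and W: "set W \<subseteq> I" and u: "u permutes {1..n}" by (rule framed_classes_cases[OF p])
  note a = u_ivl[OF ij u] and b = u_ivl[OF kl u] and ra = u_revp[OF ij u] and rb = u_revp[OF kl u]
  have d: "set (ivl i j) \<inter> set (ivl k l) = {}" "set (ivl k l) \<inter> set (ivl i j) = {}" using dis by (auto simp: ivl)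
  have m: "map (u \<circ> revp (ivl k l)) (ivl i j) = map u (ivl i j)" "map (u \<circ> revp (ivl i j)) (ivl k l) = map u (ivl k l)"
    using revp_map_other[OF d(1)] revp_map_other[OF d(2)] by (metis map_map)+
  have dd: "set (map u (ivl k l)) \<inter> set (map u (ivl i j)) = {}"
    using d(2) permutes_inj[OF u] by (auto simp: inj_eq)
  have "word_class (extend_word (extend_word W (map u (ivl k l))) (map u (ivl i j))) = word_class (extend_word (extend_word W (map u (ivl i j))) (map u (ivl k l)))"
    unfolding word_class_eq[OF extend_word_in[OF extend_word_in[OF W b] a] extend_word_in[OF extend_word_in[OF W a] b]]
    by (rule homotopic_words_extend_disjoint[OF W b a dd])
  moreover have "u \<circ> revp (ivl k l) \<circ> revp (ivl i j) = u \<circ> revp (ivl i j) \<circ> revp (ivl k l)"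
    unfolding comp_assoc revp_commute_disjoint[OF ivl(1) ivl(1) d(1)] ..
  ultimately show ?thesis
    unfolding p act_s_apply[OF W u ij] act_s_apply[OF W u kl] act_s_apply[OF extend_word_in[OF W a] ra kl]
      act_s_apply[OF extend_word_in[OF W b] rb ij] m by simp
qed

lemma act_s_nested:
  assumes p: "p \<in> framed_classes" and ij: "(i, j) \<in> cactus_gens n" and kl: "(k, l) \<in> cactus_gens n" and sub: "{k..l} \<subseteq> {i..j}"
  shows "act_s i j (act_s k l p) = act_s (interval_reversal i j l) (interval_reversal i j k) (act_s i j p)"
\<comment> \<open>For equal intervals there is only one axis and no square; the reversed interval is
  then the interval itself and both sides coincide.\<close>
proof (cases "(k, l) = (i, j)")
  case True
  then show ?thesis using ij by (auto simp: interval_reversal_def cactus_gens_def)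
next
  case False
  obtain W u where p: "p = (word_class W, u)" and W: "set W \<subseteq> I" and u: "u permutes {1..n}" by (rule framed_classes_cases[OF p])
  note a = u_ivl[OF ij u] and b = u_ivl[OF kl u] and ra = u_revp[OF ij u] and rb = u_revp[OF kl u]
  have kl': "i \<le> k" "k \<le> l" "l \<le> j" using sub kl by (auto simp: cactus_gens_def)
  let ?k = "interval_reversal i j l" and ?l = "interval_reversal i j k"
  let ?a = "map u (ivl i j)" and ?b = "map u (ivl k l)"
  have g: "(?k, ?l) \<in> cactus_gens n" by (rule interval_reversal_gens[OF ij kl sub])
  note iv = ivl_reversal[OF kl', symmetric]
  obtain x y where xy: "ivl i j = x @ ivl k l @ y" using seg_ivl[OF kl'] unfolding seg_def by blast
  have s: "seg ?b ?a" unfolding xy seg_def by auto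
  have ne: "?a \<noteq> ?b"
  proof
    assume "?a = ?b"
    then have "set ?a = set ?b" by simp
    then have "{i..j} = {k..l}" using permutes_inj[OF u] by (simp add: ivl inj_image_eq_iff)
    then show False using False kl' by simp
  qed
  have m1: "map (u \<circ> revp (ivl k l)) (ivl i j) = map (revp ?b) ?a"
    using revp_conj_comp[OF ivl(1) permutes_inj[OF u], of k l] by (metis map_map)
  have "revp (ivl i j) \<circ> revp (ivl i j) = id" by (rule revp_comp[OF ivl(1)])
  then have m2: "map (u \<circ> revp (ivl i j)) (ivl ?k ?l) = rev ?b"
    unfolding iv by (metis map_map comp_assoc comp_id rev_map)
  have "revp (ivl ?k ?l) = revp (map (revp (ivl i j)) (ivl k l))"
    unfolding iv rev_map[symmetric] by (rule revp_rev) (use inj_on_subset[OF inj_revp[OF ivl(1)]] in \<open>simp add: distinct_map ivl\<close>)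
  then have "revp (ivl ?k ?l) \<circ> revp (ivl i j) = revp (ivl i j) \<circ> revp (ivl k l)"
    using revp_conj_comp[OF ivl(1) inj_revp[OF ivl(1)]] by simp
  then have "revp (ivl i j) \<circ> (revp (ivl ?k ?l) \<circ> revp (ivl i j)) \<circ> revp (ivl i j) =
      revp (ivl i j) \<circ> (revp (ivl i j) \<circ> revp (ivl k l)) \<circ> revp (ivl i j)" by simp
  then have "revp (ivl i j) \<circ> revp (ivl ?k ?l) \<circ> (revp (ivl i j) \<circ> revp (ivl i j)) =
      (revp (ivl i j) \<circ> revp (ivl i j)) \<circ> revp (ivl k l) \<circ> revp (ivl i j)" by (simp only: comp_assoc)
  then have "revp (ivl i j) \<circ> revp (ivl ?k ?l) = revp (ivl k l) \<circ> revp (ivl i j)"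
    unfolding revp_comp[OF ivl(1)] by simp
  then have pe: "u \<circ> revp (ivl i j) \<circ> revp (ivl ?k ?l) = u \<circ> revp (ivl k l) \<circ> revp (ivl i j)"
    by (simp only: comp_assoc)
  have i1: "rev ?b \<in> I" by (rule rev_I[OF b])
  have i2: "map (revp ?b) ?a \<in> I" by (rule map_I[OF a revp_I[OF b]])
  have "word_class (extend_word (extend_word W ?a) (rev ?b)) = word_class (extend_word (extend_word W ?b) (map (revp ?b) ?a))"
    unfolding word_class_eq[OF extend_word_in[OF extend_word_in[OF W a] i1] extend_word_in[OF extend_word_in[OF W b] i2]]
    by (rule homotopic_words_extend_nested[OF W a b s ne])
  then show ?thesis
    unfolding p act_s_apply[OF W u ij] act_s_apply[OF W u kl] act_s_apply[OF extend_word_in[OF W a] ra g]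
      act_s_apply[OF extend_word_in[OF W b] rb ij] m1 m2 pe by simp
qed

text \<open>A translation moves the interval by \<open>w\<close> and the framing by its inverse, so
  both sides step along the same list.\<close>

lemma act_t_act_s:
  assumes p: "p \<in> framed_classes" and ij: "(i, j) \<in> cactus_gens n" and w: "w permutes {1..n}" and t: "\<forall>k\<le>j - i. w (i + k) = w i + k"
  shows "act_t w (act_s i j p) = act_s (w i) (w j) (act_t w p)"
proof -
  obtain W u where p: "p = (word_class W, u)" and W: "set W \<subseteq> I" and u: "u permutes {1..n}" by (rule framed_classes_cases[OF p])
  note a = u_ivl[OF ij u] and ra = u_revp[OF ij u]
  have g: "(w i, w j) \<in> cactus_gens n" by (rule translation_gens[OF ij w t])
  have "i < j" using ij by (simp add: cactus_gens_def)
  note iv = map_ivl[OF t this, symmetric]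
  have uw: "u \<circ> inv' w permutes {1..n}" by (rule permutes_compose[OF permutes_inv[OF w] u])
  have "u \<circ> inv' w \<circ> w = u" unfolding comp_assoc permutes_inv_o[OF w] by simp
  then have m: "map (u \<circ> inv' w) (ivl (w i) (w j)) = map u (ivl i j)" unfolding iv map_map by simp
  have "revp (ivl (w i) (w j)) \<circ> w = w \<circ> revp (ivl i j)"
    unfolding iv by (rule revp_conj_comp[OF ivl(1) permutes_inj[OF w]])
  then have "u \<circ> inv' w \<circ> (revp (ivl (w i) (w j)) \<circ> w) \<circ> inv' w = u \<circ> inv' w \<circ> (w \<circ> revp (ivl i j)) \<circ> inv' w" by simp
  then have "u \<circ> inv' w \<circ> revp (ivl (w i) (w j)) \<circ> (w \<circ> inv' w) = u \<circ> (inv' w \<circ> w) \<circ> revp (ivl i j) \<circ> inv' w"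
    by (simp only: comp_assoc)
  then have e: "u \<circ> inv' w \<circ> revp (ivl (w i) (w j)) = u \<circ> revp (ivl i j) \<circ> inv' w"
    unfolding permutes_inv_o[OF w] by simp
  show ?thesis
    unfolding p act_t_apply[OF W u] act_s_apply[OF W u ij] act_t_apply[OF extend_word_in[OF W a] ra] act_s_apply[OF W uw g] m e ..
qed

lemma vc_relations_Bij: "vc_relations n (BijGroup framed_classes) act_s act_t"
  unfolding vc_relations_def
proof (intro conjI allI impI)
  fix i j assume ij: "(i, j) \<in> cactus_gens n"
  show "act_s i j \<in> carrier (BijGroup framed_classes)" using act_s_Bij[OF ij] by (simp add: BijGroup_def)
  show "act_s i j \<otimes>\<^bsub>BijGroup framed_classes\<^esub> act_s i j = \<one>\<^bsub>BijGroup framed_classes\<^esub>"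
    unfolding BijGroup_mult[OF act_s_Bij[OF ij] act_s_Bij[OF ij]]
    by (simp add: BijGroup_def compose_def) (rule restrict_ext, rule act_s_act_s[OF _ ij])
next
  fix i j k l assume a: "(i, j) \<in> cactus_gens n \<and> (k, l) \<in> cactus_gens n \<and> {i..j} \<inter> {k..l} = {}"
  then have ij: "(i, j) \<in> cactus_gens n" and kl: "(k, l) \<in> cactus_gens n" and d: "{i..j} \<inter> {k..l} = {}" by blast+
  show "act_s i j \<otimes>\<^bsub>BijGroup framed_classes\<^esub> act_s k l = act_s k l \<otimes>\<^bsub>BijGroup framed_classes\<^esub> act_s i j"
    unfolding BijGroup_mult[OF act_s_Bij[OF ij] act_s_Bij[OF kl]] BijGroup_mult[OF act_s_Bij[OF kl] act_s_Bij[OF ij]]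
    by (rule compose_eqI, rule act_s_commute[OF _ ij kl d])
next
  fix i j k l assume a: "(i, j) \<in> cactus_gens n \<and> (k, l) \<in> cactus_gens n \<and> {k..l} \<subseteq> {i..j}"
  then have ij: "(i, j) \<in> cactus_gens n" and kl: "(k, l) \<in> cactus_gens n" and d: "{k..l} \<subseteq> {i..j}" by blast+
  note g = interval_reversal_gens[OF ij kl d]
  show "act_s i j \<otimes>\<^bsub>BijGroup framed_classes\<^esub> act_s k l = act_s (interval_reversal i j l) (interval_reversal i j k) \<otimes>\<^bsub>BijGroup framed_classes\<^esub> act_s i j"
    unfolding BijGroup_mult[OF act_s_Bij[OF ij] act_s_Bij[OF kl]] BijGroup_mult[OF act_s_Bij[OF g] act_s_Bij[OF ij]]
    by (rule compose_eqI, rule act_s_nested[OF _ ij kl d])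
next
  show "act_t \<in> hom S (BijGroup framed_classes)"
  proof (rule homI)
    fix v w assume "v \<in> carrier S" "w \<in> carrier S"
    then have v: "v permutes {1..n}" "w permutes {1..n}" by (simp_all add: sym_group_carrier)
    note vw = permutes_compose[OF v(2,1)]
    have "act_t v \<otimes>\<^bsub>BijGroup framed_classes\<^esub> act_t w = (\<lambda>p\<in>framed_classes. act_t (v \<circ> w) p)"
      unfolding BijGroup_mult[OF act_t_Bij[OF v(1)] act_t_Bij[OF v(2)]] compose_def
      by (rule restrict_ext, rule act_t_act_t[OF _ v])
    also have "\<dots> = act_t (v \<circ> w)" unfolding act_t_def by (auto simp: restrict_def)
    finally show "act_t (v \<otimes>\<^bsub>S\<^esub> w) = act_t v \<otimes>\<^bsub>BijGroup framed_classes\<^esub> act_t w" by (simp add: sym_group_mult)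
  qed (use act_t_Bij in \<open>simp add: sym_group_carrier BijGroup_def\<close>)
next
  fix w i j assume a: "(i, j) \<in> cactus_gens n \<and> w permutes {1..n} \<and> (\<forall>k\<le>j - i. w (i + k) = w i + k)"
  then have ij: "(i, j) \<in> cactus_gens n" and w: "w permutes {1..n}" and t: "\<forall>k\<le>j - i. w (i + k) = w i + k" by blast+
  note g = translation_gens[OF ij w t]
  show "act_t w \<otimes>\<^bsub>BijGroup framed_classes\<^esub> act_s i j = act_s (w i) (w j) \<otimes>\<^bsub>BijGroup framed_classes\<^esub> act_t w"
    unfolding BijGroup_mult[OF act_t_Bij[OF w] act_s_Bij[OF ij]] BijGroup_mult[OF act_s_Bij[OF g] act_t_Bij[OF w]]
    by (rule compose_eqI, rule act_t_act_s[OF _ ij w t])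
qed

text \<open>The group element that carries the trivial framed path to the framed path \<open>(W, u)\<close> is the inverse of
  \<open>hol W u\<close>.\<close>

definition hol :: "nat list list \<Rightarrow> (nat \<Rightarrow> nat) \<Rightarrow> cactus_free_elem set" where
  "hol W u = L.along q0 W \<one>\<^bsub>VC\<^esub> \<otimes>\<^bsub>VC\<^esub> \<tau> u"

lemma along_q0_in: "set W \<subseteq> I \<Longrightarrow> L.along q0 W \<one>\<^bsub>VC\<^esub> \<in> carrier VC"
  by (rule L.along_in[OF _ q0_in VC.one_closed])

lemma hol_in: "set W \<subseteq> I \<Longrightarrow> u permutes {1..n} \<Longrightarrow> hol W u \<in> carrier VC"
  unfolding hol_def using along_q0_in \<tau>_in by simp

text \<open>The changed framing absorbs the reversal inside \<open>list_t\<close>, and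
  \<open>\<tau> u\<close> turns the conjugate of \<open>\<sigma> i j\<close> into plain
  multiplication on the right.\<close>

lemma hol_extend:
  assumes W: "set W \<subseteq> I" and u: "u permutes {1..n}" and ij: "(i, j) \<in> cactus_gens n"
  shows "hol (extend_word W (map u (ivl i j))) (u \<circ> revp (ivl i j)) = hol W u \<otimes>\<^bsub>VC\<^esub> \<sigma> i j"
proof -
  note a = u_ivl[OF ij u] and r = u_revp[OF ij u]
  let ?a = "map u (ivl i j)"
  have al: "L.along q0 (extend_word W ?a) \<one>\<^bsub>VC\<^esub> = L.along q0 W \<one>\<^bsub>VC\<^esub> \<otimes>\<^bsub>VC\<^esub> list_t ?a"
    unfolding extend_word_def L.along_append by (simp add: transition_def label_of_props(2)[OF walk0_in[OF W] a])
  have c: "revp ?a \<circ> (u \<circ> revp (ivl i j)) = u"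
  proof -
    have "revp ?a \<circ> u \<circ> revp (ivl i j) = u \<circ> (revp (ivl i j) \<circ> revp (ivl i j))"
      unfolding revp_conj_comp[OF ivl(1) permutes_inj[OF u]] comp_assoc ..
    then show ?thesis unfolding revp_comp[OF ivl(1)] by (simp add: comp_assoc)
  qed
  note cl = list_s_in[OF a] \<tau>_in[OF r] \<tau>_in[OF u] \<sigma>_in[OF ij] \<tau>_in[OF revp_I[OF a]] along_q0_in[OF W]
  have list_s: "list_s ?a = \<tau> u \<otimes>\<^bsub>VC\<^esub> \<sigma> i j \<otimes>\<^bsub>VC\<^esub> inv\<^bsub>VC\<^esub> (\<tau> u)"
    by (rule list_s_eq[OF a u ij]) (simp add: ivl_def del: upt_Suc)
  have "list_t ?a \<otimes>\<^bsub>VC\<^esub> \<tau> (u \<circ> revp (ivl i j)) = list_s ?a \<otimes>\<^bsub>VC\<^esub> (\<tau> (revp ?a) \<otimes>\<^bsub>VC\<^esub> \<tau> (u \<circ> revp (ivl i j)))"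
    unfolding list_t_def using cl by (simp add: VC.m_assoc)
  also have "\<dots> = list_s ?a \<otimes>\<^bsub>VC\<^esub> \<tau> u"
    unfolding \<tau>_comp[OF revp_I[OF a] r, symmetric] c ..
  also have "\<dots> = \<tau> u \<otimes>\<^bsub>VC\<^esub> \<sigma> i j" unfolding list_s using cl by (simp add: VC.m_assoc)
  finally have "list_t ?a \<otimes>\<^bsub>VC\<^esub> \<tau> (u \<circ> revp (ivl i j)) = \<tau> u \<otimes>\<^bsub>VC\<^esub> \<sigma> i j" .
  then show ?thesis unfolding hol_def al using cl list_t_in[OF a] by (simp add: VC.m_assoc)
qed

lemma hol_inv:
  assumes W: "set W \<subseteq> I" and u: "u permutes {1..n}" and w: "w permutes {1..n}"
  shows "hol W (u \<circ> inv' w) = hol W u \<otimes>\<^bsub>VC\<^esub> inv\<^bsub>VC\<^esub> (\<tau> w)"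
  unfolding hol_def \<tau>_comp[OF u permutes_inv[OF w]] \<tau>_inv[OF w]
  using along_q0_in[OF W] \<tau>_in[OF u] \<tau>_in[OF permutes_inv[OF w]] by (simp add: VC.m_assoc)

lemma \<sigma>_inv: "(i, j) \<in> cactus_gens n \<Longrightarrow> inv\<^bsub>VC\<^esub> (\<sigma> i j) = \<sigma> i j"
  using VC_rel(1) \<sigma>_in by (intro VC.inv_equality) auto

text \<open>Extending the path and changing the frame multiply \<open>hol\<close> on the right by
  generators, that is, they multiply its inverse on the left. So the inverses of the attained values
  are closed under the generators.\<close>

theorem hol_surj:
  assumes g: "g \<in> carrier VC"
  shows "\<exists>W u. set W \<subseteq> I \<and> u permutes {1..n} \<and> hol W u = inv\<^bsub>VC\<^esub> g"
  using g
proof (induction rule: VC_induct)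
  case one
  have "hol [] id = \<one>\<^bsub>VC\<^esub>" by (simp add: hol_def \<tau>_id)
  then have "set [] \<subseteq> I \<and> id permutes {1..n} \<and> hol [] id = inv\<^bsub>VC\<^esub> \<one>\<^bsub>VC\<^esub>"
    using permutes_id[of "{1..n}"] by (simp only: VC.inv_one list.set empty_subsetI)
  then show ?case by blast
next
  case (\<sigma> i j x)
  then obtain W u where W: "set W \<subseteq> I" and u: "u permutes {1..n}" and h: "hol W u = inv\<^bsub>VC\<^esub> x" by blast
  have "hol (extend_word W (map u (ivl i j))) (u \<circ> revp (ivl i j)) = inv\<^bsub>VC\<^esub> (\<sigma> i j \<otimes>\<^bsub>VC\<^esub> x)"
    unfolding hol_extend[OF W u \<sigma>(1)] h using \<sigma>(1,2) \<sigma>_in \<sigma>_inv by (simp add: VC.inv_mult_group)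
  then show ?case using extend_word_in[OF W u_ivl[OF \<sigma>(1) u]] u_revp[OF \<sigma>(1) u] by blast
next
  case (\<tau> w x)
  then obtain W u where W: "set W \<subseteq> I" and u: "u permutes {1..n}" and h: "hol W u = inv\<^bsub>VC\<^esub> x" by blast
  have "hol W (u \<circ> inv' w) = inv\<^bsub>VC\<^esub> (\<tau> w \<otimes>\<^bsub>VC\<^esub> x)"
    unfolding hol_inv[OF W u \<tau>(1)] h using \<tau>(1,2) \<tau>_in by (simp add: VC.inv_mult_group)
  then show ?case using W permutes_compose[OF permutes_inv[OF \<tau>(1)] u] by blast
qed

text \<open>Acting on the trivial framed class, the inverse of \<open>hol W u\<close> yields the
  class of \<open>W\<close> with framing \<open>u\<close>. Path class and framing can therefore be
  read off the group element.\<close>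

theorem hol_inj:
  assumes W: "set W \<subseteq> I" "u permutes {1..n}" and W': "set W' \<subseteq> I" "u' permutes {1..n}"
    and eq: "hol W u = hol W' u'"
  shows "homotopic_words W W'" "u = u'"
proof -
  let ?B = "BijGroup framed_classes"
  interpret B: group ?B by (rule group_BijGroup)
  obtain \<Theta> where hom: "\<Theta> \<in> hom VC ?B" and \<Theta>s: "\<And>i j. (i, j) \<in> cactus_gens n \<Longrightarrow> \<Theta> (\<sigma> i j) = act_s i j"
    and \<Theta>t: "\<And>w. w permutes {1..n} \<Longrightarrow> \<Theta> (\<tau> w) = act_t w"
    using VC_hom[OF B.group_axioms vc_relations_Bij] by blast
  have \<Theta>c: "\<Theta> x \<in> Bij framed_classes" if "x \<in> carrier VC" for x
    using hom that by (auto simp: hom_def BijGroup_def)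
  let ?p = "(word_class [], id)"
  have p: "?p \<in> framed_classes" by (rule framed_classes_in) (simp_all add: permutes_id)
  have app: "\<Theta> (x \<otimes>\<^bsub>VC\<^esub> y) ?p = \<Theta> x (\<Theta> y ?p)" if "x \<in> carrier VC" "y \<in> carrier VC" for x y
    unfolding hom_mult[OF hom that] BijGroup_mult[OF \<Theta>c[OF that(1)] \<Theta>c[OF that(2)]]
    using p by (simp add: compose_def)
  have step_b: "\<Theta> (inv\<^bsub>VC\<^esub> (hol W (u \<circ> inv' w))) ?p = (word_class W, u \<circ> inv' w)"
    if "set W \<subseteq> I" "u permutes {1..n}" "w permutes {1..n}" "\<Theta> (inv\<^bsub>VC\<^esub> (hol W u)) ?p = (word_class W, u)" for W u w
  proof -
    have "inv\<^bsub>VC\<^esub> (hol W (u \<circ> inv' w)) = \<tau> w \<otimes>\<^bsub>VC\<^esub> inv\<^bsub>VC\<^esub> (hol W u)"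
      unfolding hol_inv[OF that(1-3)] using hol_in[OF that(1,2)] \<tau>_in[OF that(3)] by (simp add: VC.inv_mult_group)
    then show ?thesis
      using app[OF \<tau>_in[OF that(3)] VC.inv_closed[OF hol_in[OF that(1,2)]]] \<Theta>t[OF that(3)]
        act_t_apply[OF that(1,2)] that(4) by simp
  qed
  have step_a: "\<Theta> (inv\<^bsub>VC\<^esub> (hol (extend_word W (map u (ivl i j))) (u \<circ> revp (ivl i j)))) ?p =
      (word_class (extend_word W (map u (ivl i j))), u \<circ> revp (ivl i j))"
    if "set W \<subseteq> I" "u permutes {1..n}" "(i, j) \<in> cactus_gens n" "\<Theta> (inv\<^bsub>VC\<^esub> (hol W u)) ?p = (word_class W, u)" for W u i j
  proof -
    have "inv\<^bsub>VC\<^esub> (hol (extend_word W (map u (ivl i j))) (u \<circ> revp (ivl i j))) = \<sigma> i j \<otimes>\<^bsub>VC\<^esub> inv\<^bsub>VC\<^esub> (hol W u)"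
      unfolding hol_extend[OF that(1-3)] using hol_in[OF that(1,2)] \<sigma>_in[OF that(3)] \<sigma>_inv[OF that(3)]
      by (simp add: VC.inv_mult_group)
    then show ?thesis
      using app[OF \<sigma>_in[OF that(3)] VC.inv_closed[OF hol_in[OF that(1,2)]]] \<Theta>s[OF that(3)]
        act_s_apply[OF that(1-3)] that(4) by simp
  qed
  \<comment> \<open>Before the last letter \<alpha> the framing is taken to be some \<open>w\<close>
    that carries an initial interval to the current list of \<alpha>. The generator of this interval
    appends \<alpha>, and a permutation then restores the wanted framing.\<close>
  have reach: "\<Theta> (inv\<^bsub>VC\<^esub> (hol W u)) ?p = (word_class W, u)" if "set W \<subseteq> I" "u permutes {1..n}" for W u
    using that
  proof (induction W arbitrary: u rule: rev_induct)
    case Nil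
    have "hol [] id = \<one>\<^bsub>VC\<^esub>" by (simp add: hol_def \<tau>_id)
    moreover have "\<Theta> \<one>\<^bsub>VC\<^esub> = \<one>\<^bsub>?B\<^esub>" by (rule hom_one[OF hom VC.group_axioms B.group_axioms])
    ultimately have "\<Theta> (inv\<^bsub>VC\<^esub> (hol [] id)) ?p = (word_class [], id)" using p by (simp add: BijGroup_def)
    from step_b[OF Nil(1) permutes_id permutes_inv[OF Nil(2)] this]
    show ?case unfolding inv_inv_eq[OF permutes_bij[OF Nil(2)]] id_comp .
  next
    case (snoc \<alpha> W)
    then have W: "set W \<subseteq> I" and \<alpha>: "\<alpha> \<in> I" by auto
    note q = walk0_in[OF W]
    let ?a = "loc (walk0 W) \<alpha>"
    have a: "?a \<in> I" by (rule loc_I[OF q \<alpha>])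
    obtain w where w: "w permutes {1..n}" "map w (ivl 1 (length ?a)) = ?a" and g: "(1, length ?a) \<in> cactus_gens n"
      using list_s_obtain[OF a] unfolding ivl_def by metis
    have e: "extend_word W (map w (ivl 1 (length ?a))) = W @ [\<alpha>]"
      unfolding w(2) extend_word_def label_of_loc[OF q \<alpha>] ..
    let ?v = "w \<circ> revp (ivl 1 (length ?a))"
    have v: "?v permutes {1..n}" by (rule u_revp[OF g w(1)])
    have "\<Theta> (inv\<^bsub>VC\<^esub> (hol (W @ [\<alpha>]) ?v)) ?p = (word_class (W @ [\<alpha>]), ?v)"
      using step_a[OF W w(1) g snoc.IH[OF W w(1)]] unfolding e .
    from step_b[OF snoc.prems(1) v permutes_compose[OF v permutes_inv[OF snoc.prems(2)]] this]
    have "\<Theta> (inv\<^bsub>VC\<^esub> (hol (W @ [\<alpha>]) (?v \<circ> inv' (inv' u \<circ> ?v)))) ?p = (word_class (W @ [\<alpha>]), ?v \<circ> inv' (inv' u \<circ> ?v))" .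
    moreover have "?v \<circ> inv' (inv' u \<circ> ?v) = u"
    proof -
      have "inv' (inv' u \<circ> ?v) = inv' ?v \<circ> inv' (inv' u)"
        by (rule o_inv_distrib[OF permutes_bij[OF permutes_inv[OF snoc.prems(2)]] permutes_bij[OF v]])
      also have "inv' (inv' u) = u" by (rule inv_inv_eq[OF permutes_bij[OF snoc.prems(2)]])
      finally have "?v \<circ> inv' (inv' u \<circ> ?v) = (?v \<circ> inv' ?v) \<circ> u" by (simp only: comp_assoc)
      then show ?thesis unfolding permutes_inv_o(1)[OF v] by simp
    qed
    ultimately show ?case by (simp only:)
  qed
  have "(word_class W, u) = (word_class W', u')" using reach[OF W] reach[OF W'] eq by simp
  then show "homotopic_words W W'" "u = u'" using word_class_eq[OF W(1) W'(1)] by simp_all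
qed

lemma along_inj:
  assumes "set W \<subseteq> I" "set W' \<subseteq> I" "L.along q0 W \<one>\<^bsub>VC\<^esub> = L.along q0 W' \<one>\<^bsub>VC\<^esub>"
  shows "homotopic_words W W'"
  by (rule hol_inj(1)[OF assms(1) permutes_id assms(2) permutes_id]) (simp add: hol_def assms(3))

end

section \<open>The fundamental group of the realization\<close>

lemma loop_homotopy_in:
  assumes "(p, q) \<in> loop_homotopy T x" shows "p \<in> loops_at T x" "q \<in> loops_at T x"
proof -
  have h: "homotopic_with (\<lambda>r. r 0 = x \<and> r 1 = x) (top_of_set {0..1}) T p q"
    using assms by (simp add: loop_homotopy_def)
  show "p \<in> loops_at T x" "q \<in> loops_at T x"
    using homotopic_with_imp_continuous_maps[OF h] homotopic_with_imp_property[OF h]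
    by (simp_all add: loops_at_def pathin_def)
qed

text \<open>The fibres of \<open>h\<close> are exactly the homotopy classes of loops, so the
  isomorphism sends an element of \<open>K\<close> to its fibre.\<close>

lemma fundamental_group_iso:
  assumes h: "\<And>p. p \<in> loops_at T x \<Longrightarrow> h p \<in> carrier K"
    and surj: "\<And>k. k \<in> carrier K \<Longrightarrow> \<exists>p\<in>loops_at T x. h p = k"
    and eq: "\<And>p q. p \<in> loops_at T x \<Longrightarrow> q \<in> loops_at T x \<Longrightarrow> (p, q) \<in> loop_homotopy T x \<longleftrightarrow> h p = h q"
    and conc: "\<And>p q. p \<in> loops_at T x \<Longrightarrow> q \<in> loops_at T x \<Longrightarrow> path_concat p q \<in> loops_at T x"
    and mult: "\<And>p q. p \<in> loops_at T x \<Longrightarrow> q \<in> loops_at T x \<Longrightarrow> h (path_concat p q) = h p \<otimes>\<^bsub>K\<^esub> h q"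
  shows "K \<cong> fundamental_group T x"
proof -
  let ?L = "loops_at T x" and ?G = "fundamental_group T x"
  define \<Psi> where "\<Psi> k = {p \<in> ?L. h p = k}" for k
  have cls: "loop_homotopy T x `` {p} = \<Psi> (h p)" if "p \<in> ?L" for p
  proof (rule Set.set_eqI)
    fix q show "q \<in> loop_homotopy T x `` {p} \<longleftrightarrow> q \<in> \<Psi> (h p)"
      by (cases "q \<in> ?L") (use eq[OF that, of q] loop_homotopy_in(2)[of p q T x] in \<open>auto simp: \<Psi>_def\<close>)
  qed
  have c: "carrier ?G = \<Psi> ` carrier K"
  proof (intro equalityI subsetI)
    fix P assume "P \<in> carrier ?G"
    then obtain p where "p \<in> ?L" "P = loop_homotopy T x `` {p}"
      by (auto simp: fundamental_group_def elim!: quotientE)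
    then show "P \<in> \<Psi> ` carrier K" using cls h by blast
  next
    fix P assume "P \<in> \<Psi> ` carrier K"
    then obtain p where "p \<in> ?L" "P = \<Psi> (h p)" using surj by blast
    then show "P \<in> carrier ?G" using cls quotientI[of p ?L "loop_homotopy T x"] by (simp add: fundamental_group_def)
  qed
  have m: "\<Psi> k \<otimes>\<^bsub>?G\<^esub> \<Psi> l = \<Psi> (k \<otimes>\<^bsub>K\<^esub> l)" if kl: "k \<in> carrier K" "l \<in> carrier K" for k l
  proof -
    have "loop_homotopy T x `` {path_concat p q} = \<Psi> (k \<otimes>\<^bsub>K\<^esub> l)" if "p \<in> \<Psi> k" "q \<in> \<Psi> l" for p q
    proof -
      have pq: "p \<in> ?L" "q \<in> ?L" "h p = k" "h q = l" using that by (auto simp: \<Psi>_def)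
      show ?thesis unfolding cls[OF conc[OF pq(1,2)]] mult[OF pq(1,2)] pq(3,4) ..
    qed
    moreover obtain p q where "p \<in> \<Psi> k" "q \<in> \<Psi> l" using surj kl unfolding \<Psi>_def by blast
    ultimately show ?thesis unfolding fundamental_group_def by auto
  qed
  have "inj_on \<Psi> (carrier K)"
  proof (rule inj_onI)
    fix k l assume kl: "k \<in> carrier K" "l \<in> carrier K" "\<Psi> k = \<Psi> l"
    obtain p where "p \<in> ?L" "h p = k" using surj kl(1) by blast
    then show "k = l" using kl(3) unfolding \<Psi>_def by blast
  qed
  then have "bij_betw \<Psi> (carrier K) (carrier ?G)" unfolding c by (rule inj_on_imp_bij_betw)
  moreover have "\<Psi> \<in> hom K ?G" by (rule homI) (use c m in auto)
  ultimately show ?thesis unfolding is_iso_def iso_def by blast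
qed

section \<open>Transfer of paths and loops along a homeomorphism\<close>

locale modelled_space =
  fixes T :: "'a topology" and M :: "'b::topological_space set" and f :: "'a \<Rightarrow> 'b" and g :: "'b \<Rightarrow> 'a"
  assumes maps: "homeomorphic_maps T (top_of_set M) f g"
begin

lemma cont_f: "continuous_map T (top_of_set M) f" and cont_g: "continuous_map (top_of_set M) T g"
  and gf: "x \<in> topspace T \<Longrightarrow> g (f x) = x" and fg: "y \<in> M \<Longrightarrow> f (g y) = y"
  using maps unfolding homeomorphic_maps_def by simp_all

lemma pathin_in: "pathin T p \<Longrightarrow> t \<in> {0..1} \<Longrightarrow> p t \<in> topspace T"
  using continuous_map_image_subset_topspace[of "top_of_set {0..1}" T p] unfolding pathin_def
  by (simp add: image_subset_iff)

lemma path_between_map: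
  assumes "pathin T p" shows "path_between M (f (p 0)) (f (p 1)) (f \<circ> p)"
proof -
  have "continuous_map (top_of_set {0..1}) (top_of_set M) (f \<circ> p)"
    using continuous_map_compose[OF assms[unfolded pathin_def] cont_f] .
  then show ?thesis
    by (auto simp: continuous_map_in_subtopology path_between_def path_def path_image_def pathstart_def pathfinish_def)
qed

lemma pathin_back:
  assumes "path_between M y z r" shows "pathin T (g \<circ> r)"
proof -
  have "continuous_map (top_of_set {0..1}) (top_of_set M) r"
    using assms by (auto simp: continuous_map_in_subtopology path_between_def path_def path_image_def)
  then show ?thesis unfolding pathin_def by (rule continuous_map_compose[OF _ cont_g])
qed

lemma loop_between: "p \<in> loops_at T x \<Longrightarrow> path_between M (f x) (f x) (f \<circ> p)"
  using path_between_map[of p] by (auto simp: loops_at_def)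

lemma loop_back:
  assumes x: "x \<in> topspace T" and r: "path_between M (f x) (f x) r"
  obtains p where "p \<in> loops_at T x" "homotopic_paths M (f \<circ> p) r"
proof -
  have "r 0 = f x" "r 1 = f x" using r by (auto simp: path_between_def pathstart_def pathfinish_def)
  then have p: "g \<circ> r \<in> loops_at T x" using pathin_back[OF r] gf[OF x] by (simp add: loops_at_def)
  have b: "path_between M (f x) (f x) (f \<circ> (g \<circ> r))" by (rule loop_between[OF p])
  have rM: "r t \<in> M" if "t \<in> {0..1}" for t using r that by (auto simp: path_between_def path_image_def)
  have "homotopic_paths M (f \<circ> (g \<circ> r)) r"
    by (rule homotopic_paths_eq) (use b fg[OF rM] in \<open>simp_all add: path_between_def\<close>)
  then show ?thesis using that p by blast
qed

lemma loop_homotopy_iff: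
  assumes x: "x \<in> topspace T" and p: "p \<in> loops_at T x" and q: "q \<in> loops_at T x"
  shows "(p, q) \<in> loop_homotopy T x \<longleftrightarrow> homotopic_paths M (f \<circ> p) (f \<circ> q)"
proof
  assume "(p, q) \<in> loop_homotopy T x"
  then have "homotopic_with (\<lambda>r. r 0 = x \<and> r 1 = x) (top_of_set {0..1}) T p q"
    by (simp add: loop_homotopy_def)
  then show "homotopic_paths M (f \<circ> p) (f \<circ> q)"
    unfolding homotopic_paths_def
    by (rule homotopic_with_compose_continuous_map_left[OF _ cont_f])
      (use p in \<open>auto simp: loops_at_def pathstart_def pathfinish_def\<close>)
next
  assume "homotopic_paths M (f \<circ> p) (f \<circ> q)"
  then have "homotopic_with (\<lambda>r. r 0 = x \<and> r 1 = x) (top_of_set {0..1}) T (g \<circ> (f \<circ> p)) (g \<circ> (f \<circ> q))"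
    unfolding homotopic_paths_def
    by (rule homotopic_with_compose_continuous_map_left[OF _ cont_g])
      (use p gf[OF x] in \<open>auto simp: loops_at_def pathstart_def pathfinish_def\<close>)
  moreover have "p t \<in> topspace T" "q t \<in> topspace T" if "t \<in> {0..1}" for t
    using p q that pathin_in by (auto simp only: loops_at_def mem_Collect_eq)
  ultimately have "homotopic_with (\<lambda>r. r 0 = x \<and> r 1 = x) (top_of_set {0..1}) T p q"
    by (rule_tac homotopic_with_eq[of _ _ _ "g \<circ> (f \<circ> p)" "g \<circ> (f \<circ> q)"]) (auto simp: gf)
  then show "(p, q) \<in> loop_homotopy T x" by (simp add: loop_homotopy_def)
qed

lemma path_connected_space_transfer:
  assumes M: "\<And>y z. y \<in> M \<Longrightarrow> z \<in> M \<Longrightarrow> \<exists>r. path_between M y z r"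
  shows "path_connected_space T"
  unfolding path_connected_space_def
proof (intro ballI)
  fix x y assume xy: "x \<in> topspace T" "y \<in> topspace T"
  have "f x \<in> M" "f y \<in> M" using continuous_map_image_subset_topspace[OF cont_f] xy by auto
  then obtain r where r: "path_between M (f x) (f y) r" using M by blast
  then have "r 0 = f x" "r 1 = f y" by (auto simp: path_between_def pathstart_def pathfinish_def)
  then show "\<exists>p. pathin T p \<and> p 0 = x \<and> p 1 = y"
    using pathin_back[OF r] gf xy by (intro exI[of _ "g \<circ> r"]) simp
qed

lemma loop_concat:
  assumes "p \<in> loops_at T x" "q \<in> loops_at T x"
  shows "path_concat p q \<in> loops_at T x" "f \<circ> path_concat p q = (f \<circ> p) +++ (f \<circ> q)"
proof -
  show e: "f \<circ> path_concat p q = (f \<circ> p) +++ (f \<circ> q)" by (auto simp: path_concat_def joinpaths_def fun_eq_iff)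
  have pq: "pathin T p" "pathin T q" "p 0 = x" "p 1 = x" "q 0 = x" "q 1 = x" using assms by (auto simp: loops_at_def)
  have "path_between M (f x) (f x) (f \<circ> path_concat p q)"
    unfolding e by (rule path_between_join[OF loop_between[OF assms(1)] loop_between[OF assms(2)]])
  then have 1: "pathin T (g \<circ> (f \<circ> path_concat p q))" by (rule pathin_back)
  have "path_concat p q t \<in> topspace T" if "t \<in> {0..1}" for t
  proof -
    show ?thesis using that pathin_in[OF pq(1), of "2 * t"] pathin_in[OF pq(2), of "2 * t - 1"]
      by (auto simp: path_concat_def)
  qed
  then have "continuous_map (top_of_set {0..1}) T (path_concat p q)"
    using 1 gf unfolding pathin_def by (rule_tac continuous_map_eq[of _ _ "g \<circ> (f \<circ> path_concat p q)"]) auto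
  then show "path_concat p q \<in> loops_at T x"
    using pq by (simp add: loops_at_def pathin_def path_concat_def)
qed

end

context flip_local_system begin

lemma walk_rev: "set l \<subseteq> I \<Longrightarrow> v \<in> V \<Longrightarrow> walk (rev l) (walk l v) = v"
  by (induction l arbitrary: v) (auto simp: flip_in flip_flip)

lemma along_rev: "set l \<subseteq> I \<Longrightarrow> v \<in> V \<Longrightarrow> x \<in> F \<Longrightarrow> along (walk l v) (rev l) (along v l x) = x"
  by (induction l arbitrary: v x) (auto simp: flip_in along_append walk_rev st_st st_in)

end

section \<open>The holonomy subgroup, its index, and the fundamental group\<close>

context virtual_cactus begin

text \<open>Every step multiplies on the right, so a factor on the left passes through the whole
  word. Transport is thereby known from its value at the identity.\<close>

lemma along_left:
  "set W \<subseteq> I \<Longrightarrow> q \<in> V \<Longrightarrow> x \<in> carrier VC \<Longrightarrow> L.along q W x = x \<otimes>\<^bsub>VC\<^esub> L.along q W \<one>\<^bsub>VC\<^esub>"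
proof (induction W arbitrary: q x)
  case (Cons \<alpha> W)
  then have W: "set W \<subseteq> I" "\<alpha> \<in> I" by auto
  note q' = V_flip[OF W(2) Cons.prems(2)] and t = list_t_in[OF loc_I[OF Cons.prems(2) W(2)]]
  have s: "transition \<alpha> q y = y \<otimes>\<^bsub>VC\<^esub> list_t (loc q \<alpha>)" for y by (simp add: transition_def)
  show ?case
    using Cons.IH[OF W(1) q', of "x \<otimes>\<^bsub>VC\<^esub> list_t (loc q \<alpha>)"] Cons.IH[OF W(1) q' t]
      L.along_in[OF W(1) q' VC.one_closed] Cons.prems(3) t
    by (simp add: s VC.m_assoc)
qed simp

definition H :: "cactus_free_elem set set" where
  "H = {L.along q0 W \<one>\<^bsub>VC\<^esub> | W. set W \<subseteq> I \<and> walk0 W = q0}"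

text \<open>\<open>W'\<close> followed by \<open>W\<close> backwards is a closed word, and transport
  backwards is the inverse. With an empty \<open>W'\<close> this gives inverses in \<open>H\<close>;
  in general it places words with a common end in one coset.\<close>

lemma along_back:
  assumes "set W \<subseteq> I" "set W' \<subseteq> I" "walk0 W = walk0 W'"
  shows "L.along q0 W' \<one>\<^bsub>VC\<^esub> \<otimes>\<^bsub>VC\<^esub> inv\<^bsub>VC\<^esub> (L.along q0 W \<one>\<^bsub>VC\<^esub>) \<in> H"
proof -
  have r: "set (rev W) \<subseteq> I" using assms(1) by simp
  note q = walk0_in[OF assms(1)]
  let ?b = "L.along (walk0 W) (rev W) \<one>\<^bsub>VC\<^esub>"
  have b: "?b \<in> carrier VC" by (rule L.along_in[OF r q VC.one_closed])
  have "L.along q0 W \<one>\<^bsub>VC\<^esub> \<otimes>\<^bsub>VC\<^esub> ?b = \<one>\<^bsub>VC\<^esub>"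
    using along_left[OF r q along_q0_in[OF assms(1)]] L.along_rev[OF assms(1) q0_in VC.one_closed] by simp
  then have "?b = inv\<^bsub>VC\<^esub> (L.along q0 W \<one>\<^bsub>VC\<^esub>)"
    using VC.inv_equality[OF VC.inv_comm] b along_q0_in[OF assms(1)] by metis
  then have "L.along q0 W' \<one>\<^bsub>VC\<^esub> \<otimes>\<^bsub>VC\<^esub> inv\<^bsub>VC\<^esub> (L.along q0 W \<one>\<^bsub>VC\<^esub>) = L.along q0 (W' @ rev W) \<one>\<^bsub>VC\<^esub>"
    unfolding L.along_append using along_left[OF r q along_q0_in[OF assms(2)]] assms(3) by simp
  moreover have "walk0 (W' @ rev W) = q0"
    using L.walk_rev[OF assms(1) q0_in] assms(3) by simp
  moreover have "set (W' @ rev W) \<subseteq> I" using assms(1,2) by simp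
  ultimately show ?thesis unfolding H_def by blast
qed

lemma subgroup_H: "subgroup H VC"
proof (rule VC.subgroupI)
  show "H \<subseteq> carrier VC" unfolding H_def using along_q0_in by blast
  have n: "set [] \<subseteq> I" "walk0 [] = q0" by simp_all
  then have "L.along q0 [] \<one>\<^bsub>VC\<^esub> \<in> H" unfolding H_def by blast
  then show "H \<noteq> {}" by blast
  fix a assume "a \<in> H"
  then obtain W where W: "set W \<subseteq> I" "walk0 W = q0" "a = L.along q0 W \<one>\<^bsub>VC\<^esub>" unfolding H_def by blast
  have ac: "a \<in> carrier VC" unfolding W(3) by (rule along_q0_in[OF W(1)])
  have "L.along q0 [] \<one>\<^bsub>VC\<^esub> \<otimes>\<^bsub>VC\<^esub> inv\<^bsub>VC\<^esub> a \<in> H" unfolding W(3)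
    by (rule along_back[OF W(1) n(1)]) (use W in simp)
  then show "inv\<^bsub>VC\<^esub> a \<in> H" using ac by simp
  fix b assume "b \<in> H"
  then obtain W' where W': "set W' \<subseteq> I" "walk0 W' = q0" "b = L.along q0 W' \<one>\<^bsub>VC\<^esub>" unfolding H_def by blast
  have "L.along q0 (W @ W') \<one>\<^bsub>VC\<^esub> = a \<otimes>\<^bsub>VC\<^esub> b"
    unfolding L.along_append W(2) W(3)[symmetric] W'(3) by (rule along_left[OF W'(1) q0_in ac])
  moreover have "set (W @ W') \<subseteq> I \<and> walk0 (W @ W') = q0" using W W' by simp
  ultimately show "a \<otimes>\<^bsub>VC\<^esub> b \<in> H" unfolding H_def by (metis (mono_tags, lifting) mem_Collect_eq)
qed

text \<open>Every element is some \<open>hol W u\<close>, and its coset depends only on the end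
  state of \<open>W\<close> and on \<open>u\<close>: replacing \<open>W\<close> by a fixed word with
  the same end changes it by a left factor in \<open>H\<close>.\<close>

lemma finite_rcosets_H: "finite (rcosets\<^bsub>VC\<^esub> H)"
proof -
  let ?P = "\<lambda>q W. set W \<subseteq> I \<and> walk0 W = q"
  let ?f = "\<lambda>(q, u). H #>\<^bsub>VC\<^esub> hol (SOME W. ?P q W) u"
  have "rcosets\<^bsub>VC\<^esub> H \<subseteq> ?f ` (V \<times> {u. u permutes {1..n}})"
  proof
    fix X assume "X \<in> rcosets\<^bsub>VC\<^esub> H"
    then obtain x where x: "x \<in> carrier VC" "X = H #>\<^bsub>VC\<^esub> x" unfolding RCOSETS_def by blast
    obtain W u where W: "set W \<subseteq> I" and u: "u permutes {1..n}" and h: "hol W u = x"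
      using hol_surj[OF VC.inv_closed[OF x(1)]] VC.inv_inv[OF x(1)] by metis
    define W1 where "W1 = (SOME W'. ?P (walk0 W) W')"
    have "\<exists>W'. ?P (walk0 W) W'" using W by blast
    then have "?P (walk0 W) W1" unfolding W1_def by (rule someI_ex)
    then have W1: "set W1 \<subseteq> I" "walk0 W1 = walk0 W" by blast+
    note c = along_q0_in[OF W] along_q0_in[OF W1(1)] \<tau>_in[OF u]
    let ?k = "L.along q0 W \<one>\<^bsub>VC\<^esub> \<otimes>\<^bsub>VC\<^esub> inv\<^bsub>VC\<^esub> (L.along q0 W1 \<one>\<^bsub>VC\<^esub>)"
    have "?k \<in> H" by (rule along_back[OF W1(1) W W1(2)])
    moreover have "inv\<^bsub>VC\<^esub> (L.along q0 W1 \<one>\<^bsub>VC\<^esub>) \<otimes>\<^bsub>VC\<^esub> (L.along q0 W1 \<one>\<^bsub>VC\<^esub> \<otimes>\<^bsub>VC\<^esub> \<tau> u) = \<tau> u"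
      using c by (simp add: VC.m_assoc[symmetric])
    then have "x = ?k \<otimes>\<^bsub>VC\<^esub> hol W1 u"
      unfolding h[symmetric] hol_def using c by (simp add: VC.m_assoc)
    ultimately have "x \<in> H #>\<^bsub>VC\<^esub> hol W1 u" unfolding r_coset_def by blast
    then have "X = H #>\<^bsub>VC\<^esub> hol W1 u"
      using VC.repr_independence[OF _ hol_in[OF W1(1) u] subgroup_H] x(2) by simp
    then show "X \<in> ?f ` (V \<times> {u. u permutes {1..n}})"
      using walk0_in[OF W] u unfolding W1_def by (intro image_eqI[of _ _ "(walk0 W, u)"]) auto
  qed
  moreover have "finite (?f ` (V \<times> {u. u permutes {1..n}}))"
    by (intro finite_imageI finite_cartesian_product finite_V finite_permutations) simp
  ultimately show ?thesis by (rule finite_subset)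
qed

text \<open>A ray joins each point to a vertex of its support, and every vertex is reachable from
  \<open>q0\<close> by the definition of \<open>V\<close>.\<close>

lemma model_path_connected:
  assumes "y \<in> flip.model" "z \<in> flip.model" shows "\<exists>r. path_between flip.model y z r"
proof -
  have from_q0: "\<exists>r. path_between flip.model (flip.vertex q0) y r" if y: "y \<in> flip.model" for y
  proof -
    obtain v where v: "y v \<noteq> 0" using flip.model_support_nonempty[OF y] .
    have "v \<in> V" by (rule flip.model_chart(1)[OF y v])
    then obtain W where W: "set W \<subseteq> I" "v = walk0 W" unfolding V_def by blast
    show ?thesis
      using path_between_join[OF flip.edge_path_between[OF q0_in W(1)] flip.ray_between[OF y v[unfolded W(2)]]] by blast
  qed
  obtain r s where "path_between flip.model (flip.vertex q0) y r" "path_between flip.model (flip.vertex q0) z s"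
    using from_q0 assms by blast
  then show ?thesis using path_between_join path_between_reverse by blast
qed

definition base :: "(nat \<times> (nat \<Rightarrow> real)) set" where
  "base = glue_rel flip.cubing `` {(flip.code (q0, {}), \<lambda>_. 0)}"

lemma base_in: "base \<in> topspace (realization flip.cubing)"
  and base_vertex: "flip.to_model base = flip.vertex q0"
proof -
  have c: "(q0, {}) \<in> flip.cells" using q0_in by (simp add: flip.cells_def flip.clique_def)
  have "(flip.code (q0, {}), \<lambda>_. 0) \<in> flip.points"
    using c by (auto simp: flip.points_def flip.cubes_cubing std_cube_def topspace_Euclidean_space)
  then show "base \<in> topspace (realization flip.cubing)"
    unfolding flip.topspace_realization base_def by (rule quotientI)
  have "flip.cell_coord {} (\<lambda>_. 0) = (\<lambda>_. 0)" by (simp add: fun_eq_iff flip.cell_coord_def)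
  then show "flip.to_model base = flip.vertex q0"
    unfolding base_def flip.to_model_class flip.cell_point[OF c] by simp
qed

text \<open>Every loop at the base point is homotopic to a closed word, and its holonomy is the
  product along this word. Homotopic loops have equal holonomy by lifting; equal holonomy gives
  homotopic words by the action on framed classes.\<close>

theorem virtually_special_compact_VC: "virtually_special_compact VC"
proof -
  let ?T = "realization flip.cubing" and ?M = "flip.model" and ?f = "flip.to_model"
  obtain g where "homeomorphic_maps ?T (top_of_set ?M) ?f g"
    using flip.homeomorphic_realization unfolding homeomorphic_map_maps by blast
  then interpret Z: modelled_space ?T ?M ?f g by unfold_locales
  let ?v = "flip.vertex q0"
  \<comment> \<open>The holonomy of a loop: the end of its lift that starts at the identity.\<close>
  define h where "h p = L.lift_end (?f \<circ> p) q0 q0 \<one>\<^bsub>VC\<^esub>" for p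
  have v: "?v q0 \<noteq> 0" using flip.vertex_apply[OF q0_in] by simp
  have between: "path_between ?M ?v ?v (?f \<circ> p)" if "p \<in> loops_at ?T base" for p
    using Z.loop_between[OF that] unfolding base_vertex .
  have lift: "L.lift_end r q0 q0 x = L.along q0 W x"
    if "set W \<subseteq> I" "walk0 W = q0" "homotopic_paths ?M r (flip.edge_path q0 W)" "path_between ?M ?v ?v r" "x \<in> carrier VC" for r W x
    using L.lift_end_homotopic[OF that(3,4) v v that(5)] L.lift_end_edge_path[OF q0_in that(1,5)] that(2) by simp
  have word: "\<exists>W. set W \<subseteq> I \<and> walk0 W = q0 \<and> homotopic_paths ?M (?f \<circ> p) (flip.edge_path q0 W)"
    if "p \<in> loops_at ?T base" for p
    using flip.path_homotopic_edge_path[OF between[OF that] q0_in q0_in] by metis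
  have "VC\<lparr>carrier := H\<rparr> \<cong> fundamental_group ?T base"
  proof (rule fundamental_group_iso[where h = h])
    fix p assume p: "p \<in> loops_at ?T base"
    obtain W where W: "set W \<subseteq> I" "walk0 W = q0" "homotopic_paths ?M (?f \<circ> p) (flip.edge_path q0 W)"
      using word[OF p] by blast
    have homotopic_words: "h p = L.along q0 W \<one>\<^bsub>VC\<^esub>"
      unfolding h_def by (rule lift[OF W between[OF p] VC.one_closed])
    then show "h p \<in> carrier (VC\<lparr>carrier := H\<rparr>)" using W unfolding H_def by auto
    have hc: "h p \<in> carrier VC" unfolding homotopic_words by (rule along_q0_in[OF W(1)])
    fix q assume q: "q \<in> loops_at ?T base"
    obtain W' where W': "set W' \<subseteq> I" "walk0 W' = q0" "homotopic_paths ?M (?f \<circ> q) (flip.edge_path q0 W')"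
      using word[OF q] by blast
    have hq: "h q = L.along q0 W' \<one>\<^bsub>VC\<^esub>"
      unfolding h_def by (rule lift[OF W' between[OF q] VC.one_closed])
    show "(p, q) \<in> loop_homotopy ?T base \<longleftrightarrow> h p = h q"
      unfolding Z.loop_homotopy_iff[OF base_in p q]
    proof
      assume "homotopic_paths ?M (?f \<circ> p) (?f \<circ> q)"
      from L.lift_end_homotopic[OF this between[OF p] v v VC.one_closed] show "h p = h q" by (simp add: h_def)
    next
      assume "h p = h q"
      then have "homotopic_words W W'" unfolding homotopic_words hq by (rule along_inj[OF W(1) W'(1)])
      then show "homotopic_paths ?M (?f \<circ> p) (?f \<circ> q)"
        unfolding homotopic_words_def using W(3) W'(3) by (meson homotopic_paths_sym homotopic_paths_trans)
    qed
    show "path_concat p q \<in> loops_at ?T base" by (rule Z.loop_concat(1)[OF p q])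
    have "h (path_concat p q) = L.lift_end (?f \<circ> q) q0 q0 (h p)"
      unfolding h_def Z.loop_concat(2)[OF p q] by (rule L.lift_end_join[OF between[OF p] between[OF q] v v v VC.one_closed])
    also have "\<dots> = L.along q0 W' (h p)" by (rule lift[OF W' between[OF q] hc])
    also have "\<dots> = h p \<otimes>\<^bsub>VC\<^esub> h q" unfolding hq by (rule along_left[OF W'(1) q0_in hc])
    finally show "h (path_concat p q) = h p \<otimes>\<^bsub>VC\<lparr>carrier := H\<rparr>\<^esub> h q" by simp
  next
    fix k assume "k \<in> carrier (VC\<lparr>carrier := H\<rparr>)"
    then obtain W where W: "set W \<subseteq> I" "walk0 W = q0" "k = L.along q0 W \<one>\<^bsub>VC\<^esub>" unfolding H_def by auto
    have "path_between ?M (?f base) (?f base) (flip.edge_path q0 W)"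
      using flip.edge_path_between[OF q0_in W(1)] W(2) unfolding base_vertex by simp
    from Z.loop_back[OF base_in this] obtain p
      where p: "p \<in> loops_at ?T base" "homotopic_paths ?M (?f \<circ> p) (flip.edge_path q0 W)" .
    have "h p = k" unfolding h_def W(3) by (rule lift[OF W(1,2) p(2) between[OF p(1)] VC.one_closed])
    then show "\<exists>p\<in>loops_at ?T base. h p = k" using p(1) by blast
  qed
  then show ?thesis
    unfolding virtually_special_compact_def
    using subgroup_H finite_rcosets_H flip.special_cubing flip.compact_realization
      Z.path_connected_space_transfer[OF model_path_connected] base_in by blast
qed

end

theorem corollary1p2:
  fixes n :: nat
  assumes "n \<ge> 1"
  shows "virtually_special_compact (virtual_cactus_group n)"
  by (rule virtual_cactus.virtually_special_compact_VC)

end
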